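(* Let $X$ be a Hausdorff sequentially complete locally convex space over $\mathbb{C}$. Assume that $\mathcal{A}$ is a closed MLO in $X$, $C\in L(X)$, $C\mathcal{A}\subseteq\mathcal{A}C$, $\alpha\in(0,\pi/2]$, $\mathrm{abs}(k)<\infty$, $\mathrm{abs}(|a|)<\infty$ and $\omega\geq\max(0,\mathrm{abs}(k),\mathrm{abs}(|a|))$. Assume, further, that for every $\lambda\in\mathbb{C}$ with $\Re\lambda>\omega$ and $\tilde{a}(\lambda)\neq 0$ we have $R(C)\subseteq R(\tilde{a}(\lambda)-\mathcal{A})$, and that there exist a function $\Upsilon:\omega+\Sigma_{\frac{\pi}{2}+\alpha}\to L(X)$ and an operator $D'\in L(X)$ such that, for every $x\in X$, the mapping $\lambda\mapsto\Upsilon(\lambda)x$, $\lambda\in\omega+\Sigma_{\frac{\pi}{2}+\alpha}$, is analytic, and such that: (i) there exists a function $\mathbf{k}:\Sigma_{\alpha}\cup\{0\}\to\mathbb{C}$ which is analytic on $\Sigma_{\alpha}$, continuous on any closed subsector $\overline{\Sigma_{\gamma}}$ ($0<\gamma<\alpha$), and which satisfies $\sup_{z\in\Sigma_{\gamma}}|e^{-\omega z}\mathbf{k}(z)|<\infty$ ($0<\gamma<\alpha$) and $\mathbf{k}(t)=k(t)$ for all $t\geq 0$; (ii) $\Upsilon(\lambda)x\in\tilde{a}(\lambda)(\tilde{a}(\lambda)-\mathcal{A})^{-1}Cx$ for every $x\in X$ and $\lambda\in\mathbb{C}$ with $\Re\lambda>\omega$, $\tilde{a}(\lambda)\neq 0$;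 (iii) $\Upsilon(\lambda)Cx=C\Upsilon(\lambda)x$ for $\Re\lambda>\omega$, $x\in X$; (iv) $\tilde{a}(\lambda)\Upsilon(\lambda)x-\Upsilon(\lambda)y=\tilde{a}(\lambda)Cx$, provided $\Re\lambda>\omega$ and $(x,y)\in\mathcal{A}$; (v) $\lim_{\lambda\to+\infty}\Upsilon(\lambda)x=D'x$ for all $x\in X$, if $\overline{R(\mathcal{A})}\neq X$. Then the function $\lambda\mapsto\tilde{k}(\lambda)$, $\Re\lambda>\omega$, has an analytic extension $\lambda\mapsto\hat{k}(\lambda)$, $\lambda\in\omega+\Sigma_{(\pi/2)+\alpha}$, satisfying $\sup_{\lambda\in\omega+\Sigma_{(\pi/2)+\gamma}}|(\lambda-\omega)\hat{k}(\lambda)|<\infty$ for $0<\gamma<\alpha$ and $\lim_{\lambda\to+\infty}\lambda\hat{k}(\lambda)=k(0)$. If, additionally, (vi) the family $\{(\lambda-\omega)\hat{k}(\lambda)\Upsilon(\lambda):\lambda\in\omega+\Sigma_{\frac{\pi}{2}+\gamma}\}\subseteq L(X)$ is equicontinuous for all $\gamma\in(0,\alpha)$, then $\mathcal{A}^{-1}$ is a subgenerator of an exponentially equicontinuous, analytic $(a,k)$-regularized $C$-resolvent family $(R(t))_{t\geq 0}$ of angle $\alpha$ such that $R(z)\mathcal{A}^{-1}\subseteq\mathcal{A}^{-1}R(z)$ for $z\in\Sigma_{\alpha}$, the family $\{e^{-\omega z}R(z):z\in\Sigma_{\gamma}\}\subseteq L(X)$ is equicontinuous for all $\gamma\in(0,\alpha)$,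 and $$ \Bigl(\int_{0}^{t}a(t-s)R(s)x\,ds,\ R(t)x-k(t)Cx\Bigr)\in\mathcal{A}^{-1},\quad t\geq 0,\ x\in X. $$
   Context: MLOs: a map $\mathcal{A}:X\to P(X)$ is a multivalued linear operator (MLO) in $X$ if $D(\mathcal{A}):=\{x:\mathcal{A}x\neq\emptyset\}$ is a linear subspace, $\mathcal{A}x+\mathcal{A}y\subseteq\mathcal{A}(x+y)$ and $\lambda\mathcal{A}x\subseteq\mathcal{A}(\lambda x)$ for $x,y\in D(\mathcal{A})$, $\lambda\in\mathbb{C}$; it is identified with its graph in $X\times X$ (a linear subspace), is closed if the graph is closed, and inclusions are inclusions of graphs. $\mathcal{A}^{-1}=\{(y,x):(x,y)\in\mathcal{A}\}$. $R(C)$, $R(\mathcal{A})$ etc. denote ranges. $\Sigma_{\theta}:=\{z\in\mathbb{C}\setminus\{0\}:|\arg z|<\theta\}$. The tilde denotes the Laplace transform, $\tilde{k}(\lambda)=\lim_{b\to\infty}\int_0^b e^{-\lambda t}k(t)\,dt$, and $\mathrm{abs}(k):=\inf\{\Re\lambda:\tilde{k}(\lambda)\text{ exists}\}$ for locally integrable $k$ on $[0,\infty)$. Families: throughout $k\in C([0,\infty))$, $k\neq 0$, $a\in L^{1}_{loc}([0,\infty))$, $a\neq 0$. For an MLO $\mathcal{M}$ in $X$ and $C\in L(X)$ (not necessarily injective) with $C\mathcal{M}\subseteq\mathcal{M}C$, a strongly continuous family $(R(t))_{t\geq 0}\subseteq L(X)$ is an $(a,k)$-regularized $C$-resolvent family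 with a subgenerator $\mathcal{M}$ if: $\int_{0}^{t}a(t-s)R(s)y\,ds=R(t)x-k(t)Cx$ for all $t\geq 0$ and $(x,y)\in\mathcal{M}$; $R(t)C=CR(t)$; and $R(t)\mathcal{M}\subseteq\mathcal{M}R(t)$ for all $t\geq 0$. It is analytic of angle $\alpha$ if there is $\mathbf{R}:\Sigma_{\alpha}\to L(X)$ with $z\mapsto\mathbf{R}(z)x$ analytic on $\Sigma_\alpha$ for each $x\in X$, $\mathbf{R}(t)=R(t)$ for $t>0$, and $\lim_{z\to 0,z\in\Sigma_{\gamma}}\mathbf{R}(z)x=R(0)x$ for all $\gamma\in(0,\alpha)$, $x\in X$; one writes $R(z)$ for $\mathbf{R}(z)$. It is exponentially equicontinuous, analytic of angle $\alpha$ if moreover for every $\gamma\in(0,\alpha)$ there is $\omega_{\gamma}\geq 0$ such that $\{e^{-\omega_{\gamma}\Re z}R(z):z\in\Sigma_{\gamma}\}$ is equicontinuous. *)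

theory Defs
  imports "HOL-Analysis.Analysis"
begin

section \<open>Complex locally convex spaces\<close>

class complex_vector = real_vector +
  fixes scaleC :: "complex \<Rightarrow> 'a \<Rightarrow> 'a"  (infixr \<open>*\<^sub>C\<close> 75)
  assumes scaleC_add_right: "c *\<^sub>C (x + y) = c *\<^sub>C x + c *\<^sub>C y"
    and scaleC_add_left: "(c + d) *\<^sub>C x = c *\<^sub>C x + d *\<^sub>C x"
    and scaleC_scaleC: "c *\<^sub>C d *\<^sub>C x = (c * d) *\<^sub>C x"
    and scaleC_of_real: "complex_of_real r *\<^sub>C x = r *\<^sub>R x"

definition (in complex_vector) seminorm :: "('a \<Rightarrow> real) \<Rightarrow> bool" where
  "seminorm p \<longleftrightarrow> (\<forall>x y. p (x + y) \<le> p x + p y) \<and> (\<forall>c x. p (c *\<^sub>C x) = cmod c * p x)"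

class locally_convex = complex_vector + topological_space +
  assumes topology_generated_by_seminorms:
    "\<exists>P. (\<forall>p\<in>P. seminorm p) \<and>
      (\<forall>U. open U \<longleftrightarrow>
        (\<forall>x\<in>U. \<exists>F e. finite F \<and> F \<subseteq> P \<and> 0 < e \<and> {y. \<forall>p\<in>F. p (y - x) < e} \<subseteq> U))"

class sequentially_complete_lcs = locally_convex +
  assumes Cauchy_sequences_converge:
    "(\<And>U. open U \<Longrightarrow> 0 \<in> U \<Longrightarrow> \<exists>N. \<forall>m\<ge>N. \<forall>n\<ge>N. f m - f n \<in> U)
      \<Longrightarrow> \<exists>x. filterlim f (nhds x) sequentially"

text \<open>The space \<open>L(X)\<close>.\<close>

definition continuous_operators :: "('a::locally_convex \<Rightarrow> 'a) set" where
  "continuous_operators = {T. Vector_Spaces.linear (*\<^sub>C) (*\<^sub>C) T \<and> continuous_on UNIV T}"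

text \<open>For families of linear maps, equicontinuity at \<open>0\<close> is equicontinuity.\<close>

definition equicontinuous :: "('a::locally_convex \<Rightarrow> 'a) set \<Rightarrow> bool" where
  "equicontinuous \<F> \<longleftrightarrow>
    (\<forall>V. open V \<and> 0 \<in> V \<longrightarrow> (\<exists>U. open U \<and> 0 \<in> U \<and> (\<forall>T\<in>\<F>. T ` U \<subseteq> V)))"

text \<open>Used for open \<open>S\<close> only: a function with values in a sequentially complete locally convex
  space is analytic on an open set iff it is complex differentiable at each point.\<close>

definition vector_analytic_on :: "(complex \<Rightarrow> 'a::locally_convex) \<Rightarrow> complex set \<Rightarrow> bool" where
  "vector_analytic_on f S \<longleftrightarrow>
    (\<forall>z\<in>S. \<exists>d. ((\<lambda>w. inverse (w - z) *\<^sub>C (f w - f z)) \<longlongrightarrow> d) (at z within S))"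

text \<open>Strong (Bochner) integral: one sequence of simple functions approximates \<open>f\<close> almost
  everywhere and in \<open>L\<^sup>1\<close> with respect to every continuous seminorm. The measure \<open>M\<close> is meant to
  be complete, so that the functions \<open>p (f x - s i x)\<close> are measurable.\<close>

definition has_strong_integral ::
  "'b measure \<Rightarrow> ('b \<Rightarrow> 'a::locally_convex) \<Rightarrow> 'a \<Rightarrow> bool" where
  "has_strong_integral M f v \<longleftrightarrow>
    (\<exists>s. (\<forall>i::nat. Bochner_Integration.simple_bochner_integrable M (s i)) \<and>
      (AE x in M. (\<lambda>i. s i x) \<longlonglongrightarrow> f x) \<and>
      (\<forall>p. seminorm p \<and> continuous_on UNIV p \<longrightarrow>
        (\<lambda>i. \<integral>\<^sup>+ x. ennreal (p (f x - s i x)) \<partial>M) \<longlonglongrightarrow> 0) \<and>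
      (\<lambda>i. Bochner_Integration.simple_bochner_integral M (s i)) \<longlonglongrightarrow> v)"


section \<open>Multivalued linear operators\<close>

text \<open>Multivalued operators are given by their graphs. Thus the inverse of \<open>A\<close> is \<open>A\<inverse>\<close>, the range is
  \<open>Range A\<close>, \<open>A x\<close> is \<open>A `` {x}\<close>, and the product \<open>B A\<close> is the relational composition \<open>A O B\<close>.\<close>

definition mlo :: "('a::complex_vector \<times> 'a) set \<Rightarrow> bool" where
  "mlo A \<longleftrightarrow> module.subspace (*\<^sub>C) (Domain A) \<and>
    (\<forall>x u y v. (x, u) \<in> A \<and> (y, v) \<in> A \<longrightarrow> (x + y, u + v) \<in> A) \<and>
    (\<forall>c x u. (x, u) \<in> A \<longrightarrow> (c *\<^sub>C x, c *\<^sub>C u) \<in> A)"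

definition graph_of :: "('a \<Rightarrow> 'a) \<Rightarrow> ('a \<times> 'a) set" where
  "graph_of T = {(x, T x) | x. True}"

text \<open>The inclusion \<open>T A \<subseteq> A T\<close>.\<close>

definition commutes_with_mlo :: "('a \<Rightarrow> 'a) \<Rightarrow> ('a \<times> 'a) set \<Rightarrow> bool" where
  "commutes_with_mlo T A \<longleftrightarrow> A O graph_of T \<subseteq> graph_of T O A"

definition scalar_minus :: "complex \<Rightarrow> ('a::complex_vector \<times> 'a) set \<Rightarrow> ('a \<times> 'a) set" where
  "scalar_minus c A = {(x, c *\<^sub>C x - y) | x y. (x, y) \<in> A}"


section \<open>Sectors and the Laplace transform\<close>

definition sector :: "real \<Rightarrow> complex set" where
  "sector \<theta> = {z. z \<noteq> 0 \<and> \<bar>Arg z\<bar> < \<theta>}"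

definition shifted_sector :: "real \<Rightarrow> real \<Rightarrow> complex set" where
  "shifted_sector \<omega> \<theta> = (\<lambda>z. of_real \<omega> + z) ` sector \<theta>"

text \<open>Functions on \<open>[0,\<infinity>)\<close> are functions on the reals whose values at negative arguments are
  irrelevant.\<close>

definition locally_integrable :: "(real \<Rightarrow> complex) \<Rightarrow> bool" where
  "locally_integrable f \<longleftrightarrow> (\<forall>T\<ge>0. f absolutely_integrable_on {0..T})"

definition truncated_laplace :: "(real \<Rightarrow> complex) \<Rightarrow> complex \<Rightarrow> real \<Rightarrow> complex" where
  "truncated_laplace f z b = integral {0..b} (\<lambda>t. exp (- z * of_real t) * f t)"

definition laplace_exists :: "(real \<Rightarrow> complex) \<Rightarrow> complex \<Rightarrow> bool" where
  "laplace_exists f z \<longleftrightarrow> (\<exists>L. (truncated_laplace f z \<longlongrightarrow> L) at_top)"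

definition laplace :: "(real \<Rightarrow> complex) \<Rightarrow> complex \<Rightarrow> complex" where
  "laplace f z = Lim at_top (truncated_laplace f z)"

definition laplace_abscissa :: "(real \<Rightarrow> complex) \<Rightarrow> ereal" where
  "laplace_abscissa f = (INF z\<in>{z. laplace_exists f z}. ereal (Re z))"


section \<open>Regularized resolvent families\<close>

definition resolvent_family_with_subgenerator ::
  "(real \<Rightarrow> complex) \<Rightarrow> (real \<Rightarrow> complex) \<Rightarrow> ('a::locally_convex \<Rightarrow> 'a) \<Rightarrow> ('a \<times> 'a) set
    \<Rightarrow> (real \<Rightarrow> 'a \<Rightarrow> 'a) \<Rightarrow> bool" where
  "resolvent_family_with_subgenerator a k C M R \<longleftrightarrow>
    mlo M \<and> C \<in> continuous_operators \<and> commutes_with_mlo C M \<and>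
    (\<forall>t\<ge>0. R t \<in> continuous_operators) \<and>
    (\<forall>x. continuous_on {0..} (\<lambda>t. R t x)) \<and>
    (\<forall>t\<ge>0. \<forall>(x, y)\<in>M. has_strong_integral (lebesgue_on {0..t})
        (\<lambda>s. a (t - s) *\<^sub>C R s y) (R t x - k t *\<^sub>C C x)) \<and>
    (\<forall>t\<ge>0. R t \<circ> C = C \<circ> R t) \<and>
    (\<forall>t\<ge>0. commutes_with_mlo (R t) M)"

text \<open>The analytic extension to the sector of angle \<open>\<alpha>\<close> is the separate argument \<open>RR\<close>.\<close>

definition analytic_family ::
  "real \<Rightarrow> (real \<Rightarrow> 'a::locally_convex \<Rightarrow> 'a) \<Rightarrow> (complex \<Rightarrow> 'a \<Rightarrow> 'a) \<Rightarrow> bool" where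
  "analytic_family \<alpha> R RR \<longleftrightarrow>
    (\<forall>z\<in>sector \<alpha>. RR z \<in> continuous_operators) \<and>
    (\<forall>x. vector_analytic_on (\<lambda>z. RR z x) (sector \<alpha>)) \<and>
    (\<forall>t>0. RR (of_real t) = R t) \<and>
    (\<forall>\<gamma>\<in>{0<..<\<alpha>}. \<forall>x. ((\<lambda>z. RR z x) \<longlongrightarrow> R 0 x) (at 0 within sector \<gamma>))"

definition exponentially_equicontinuous_analytic_family ::
  "real \<Rightarrow> (real \<Rightarrow> 'a::locally_convex \<Rightarrow> 'a) \<Rightarrow> (complex \<Rightarrow> 'a \<Rightarrow> 'a) \<Rightarrow> bool" where
  "exponentially_equicontinuous_analytic_family \<alpha> R RR \<longleftrightarrow>
    analytic_family \<alpha> R RR \<and>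
    (\<forall>\<gamma>\<in>{0<..<\<alpha>}. \<exists>w\<ge>0.
      equicontinuous ((\<lambda>z x. exp (- (of_real w * of_real (Re z))) *\<^sub>C RR z x) ` sector \<gamma>))"

end

theory Submission
  imports Defs "HOL-Complex_Analysis.Complex_Analysis" "HOL-Probability.Sinc_Integral" "HOL-Real_Asymp.Real_Asymp"
begin

text \<open>Put \<open>k\<^sub>0(z) = exp (- \<omega> z) k(z)\<close>. Rotating the ray of integration extends the Laplace transform \<open>K\<close> of
  \<open>k\<^sub>0\<close> to the sector of half-angle \<open>\<pi>/2 + \<alpha>\<close>. The function \<open>Q(\<mu>) = K(\<mu>) \<Upsilon>(\<omega> + \<mu>)\<close> is analytic there and
  \<open>\<mu> Q(\<mu>)\<close> is equicontinuous on smaller sectors, so its inverse Laplace transform \<open>S(z)\<close> is given by an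
  absolutely convergent integral over the boundary of a wedge, and \<open>R(z) = k(z) C - exp (\<omega> z) S(z)\<close>.
  The limit of \<open>S(z)\<close> at \<open>0\<close> comes from the limit of \<open>\<mu> Q(\<mu>)\<close> along the positive reals by Montel's theorem,
  uniformly on the polar of a seminorm; if the range of \<open>A\<close> is dense, that limit is \<open>0\<close> because \<open>\<Upsilon>(\<mu>) y\<close> for
  \<open>(x, y) \<in> A\<close> carries the factor \<open>a~(\<mu>) \<rightarrow> 0\<close>.

  By Hahn--Banach, vector integrals, analyticity and membership in the closed graph \<open>A\<close> can all be tested with
  continuous functionals. Each identity for \<open>R\<close> thus becomes a scalar one, which uniqueness of the
  Laplace transform reduces to an algebraic relation for \<open>\<Upsilon>\<close>; zeros of \<open>a~\<close> are isolated and do no harm.\<close>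

section \<open>Hahn--Banach\<close>

text \<open>Condition (vi) bounds \<open>Q(\<mu>)\<close> only by a multiple of
  \<open>1 / \<mu>\<close>, too weak for an absolutely convergent inversion integral on a vertical
  line; on edges that lean into the left half-plane the exponential supplies the decay. The
  relations for \<open>\<Upsilon>\<close>, in contrast, are given only for
  \<open>Re \<mu> > \<omega>\<close>; they are transferred to \<open>R(t)\<close> on the real axis
  and from there to the sector by the identity theorem.

  The form of \<open>R\<close> is forced. If \<open>C x = a~ u - y\<close> with
  \<open>(u, y)\<close> in \<open>A\<close>, then \<open>w = - y\<close> satisfies
  \<open>C x = w - a~ (- u)\<close> with \<open>(w, - u)\<close> in \<open>A\<inverse>\<close>, so
  the resolvent of \<open>A\<inverse>\<close> applied to \<open>C x\<close> is
  \<open>C x - a~ u = C x - \<Upsilon> x\<close>, and \<open>R\<close> must have the transform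
  \<open>k~ (C - \<Upsilon>)\<close>.

  Scalar estimates return to vectors only if they are uniform over the polar of a seminorm. Because
  completeness is sequential, each integral and derivative is built as the limit of a sequence.
  Uniqueness of transforms says nothing at \<open>t = 0\<close>; there the identities come from the
  limit of \<open>\<mu> Q(\<mu>)\<close> and the decay of \<open>a~\<close>.\<close>

definition sublinear :: "('a::real_vector \<Rightarrow> real) \<Rightarrow> bool" where
  "sublinear p \<longleftrightarrow> (\<forall>x y. p (x + y) \<le> p x + p y) \<and> (\<forall>c\<ge>0. \<forall>x. p (c *\<^sub>R x) = c * p x)"

text \<open>One inequality for \<open>c > 0\<close> is enough, because applying it to
  \<open>inverse c\<close> and the scaled vector gives the converse. This form suits functionals
  defined as infima.\<close>

lemma sublinearI:
  assumes "\<And>x y. p (x + y) \<le> p x + p y" "p 0 = 0" "\<And>c x. c > 0 \<Longrightarrow> p (c *\<^sub>R x) \<le> c * p x"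
  shows "sublinear p"
  unfolding sublinear_def
proof (intro conjI allI impI)
  fix c :: real and x :: 'a assume "c \<ge> 0"
  show "p (c *\<^sub>R x) = c * p x"
  proof (cases "c = 0")
    case False
    then have "c > 0" using \<open>c \<ge> 0\<close> by simp
    have "p x = p (inverse c *\<^sub>R (c *\<^sub>R x))" using False by simp
    also have "\<dots> \<le> inverse c * p (c *\<^sub>R x)"
      using assms(3)[of "inverse c" "c *\<^sub>R x"] \<open>c > 0\<close> by simp
    finally have "c * p x \<le> p (c *\<^sub>R x)" using \<open>c > 0\<close> by (simp add: field_simps)
    with assms(3)[OF \<open>c > 0\<close>, of x] show ?thesis by simp
  qed (simp add: assms)
qed (use assms in auto)

lemma sublinear_add: "sublinear p \<Longrightarrow> p (x + y) \<le> p x + p y"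
  and sublinear_scale: "sublinear p \<Longrightarrow> c \<ge> 0 \<Longrightarrow> p (c *\<^sub>R x) = c * p x"
  by (auto simp: sublinear_def)

lemma sublinear_0: "sublinear p \<Longrightarrow> p 0 = 0"
  using sublinear_scale[of p 0 0] by simp

lemma sublinear_lower: "sublinear p \<Longrightarrow> - p (- x) \<le> p x"
  using sublinear_add[of p x "- x"] sublinear_0[of p] by simp

text \<open>Lowers \<open>p\<close> just enough to be linear along \<open>w\<close>: the result
  stays below \<open>p\<close> and its value at \<open>- w\<close> drops to at most
  \<open>- p w\<close>.\<close>

definition sublinear_descent :: "('a::real_vector \<Rightarrow> real) \<Rightarrow> 'a \<Rightarrow> 'a \<Rightarrow> real" where
  "sublinear_descent p w z = (INF t\<in>{0..}. p (z + t *\<^sub>R w) - t * p w)"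

lemma sublinear_descent:
  fixes p :: "'a::real_vector \<Rightarrow> real" and w :: 'a
  assumes "sublinear p"
  shows "sublinear (sublinear_descent p w)" "sublinear_descent p w z \<le> p z"
    "sublinear_descent p w (- w) \<le> - p w"
proof -
  define q where "q = sublinear_descent p w"
  note q_def = q_def sublinear_descent_def
  have bdd: "bdd_below ((\<lambda>t. p (z + t *\<^sub>R w) - t * p w) ` {0..})" for z
  proof (rule bdd_belowI2[of _ "- p (- z)"])
    fix t :: real assume "t \<in> {0..}"
    then have "t * p w = p ((z + t *\<^sub>R w) + (- z))" using sublinear_scale[OF assms(1)] by simp
    also have "\<dots> \<le> p (z + t *\<^sub>R w) + p (- z)" by (rule sublinear_add[OF assms(1)])
    finally show "- p (- z) \<le> p (z + t *\<^sub>R w) - t * p w" by simp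
  qed
  have qle: "q z \<le> p (z + t *\<^sub>R w) - t * p w" if "t \<ge> 0" for z t
    unfolding q_def by (rule cINF_lower[OF bdd]) (use that in auto)
  have leq: "m \<le> q z" if "\<And>t. t \<ge> 0 \<Longrightarrow> m \<le> p (z + t *\<^sub>R w) - t * p w" for m z
    unfolding q_def by (rule cINF_greatest) (use that in auto)
  show "sublinear_descent p w z \<le> p z" using qle[of 0 z] by (simp add: q_def(1))
  show "sublinear_descent p w (- w) \<le> - p w"
    using qle[of 1 "- w"] sublinear_0[OF assms(1)] by (simp add: q_def(1))
  have "sublinear q"
  proof (rule sublinearI)
    have "0 \<le> q 0" by (rule leq) (simp add: sublinear_scale[OF assms(1)])
    then show "q 0 = 0" using qle[of 0 0] sublinear_0[OF assms(1)] by simp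
    show "q (c *\<^sub>R z) \<le> c * q z" if c: "c > 0" for c z
    proof -
      have "q (c *\<^sub>R z) / c \<le> q z"
      proof (rule leq)
        fix t :: real assume "t \<ge> 0"
        then have "q (c *\<^sub>R z) \<le> p (c *\<^sub>R z + (c * t) *\<^sub>R w) - (c * t) * p w"
          using c by (intro qle) auto
        also have "c *\<^sub>R z + (c * t) *\<^sub>R w = c *\<^sub>R (z + t *\<^sub>R w)" by (simp add: scaleR_add_right)
        also have "p (c *\<^sub>R (z + t *\<^sub>R w)) - (c * t) * p w = c * (p (z + t *\<^sub>R w) - t * p w)"
          using c sublinear_scale[OF assms(1), of c "z + t *\<^sub>R w"]
          by (simp add: right_diff_distrib del: scaleR_add_right)
        finally show "q (c *\<^sub>R z) / c \<le> p (z + t *\<^sub>R w) - t * p w"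
          using c by (simp add: field_simps)
      qed
      then show ?thesis using c by (simp add: field_simps)
    qed
    show "q (x + y) \<le> q x + q y" for x y
    proof -
      have "q (x + y) - (p (y + t' *\<^sub>R w) - t' * p w) \<le> q x" if t': "t' \<ge> 0" for t'
      proof (rule leq)
        fix t :: real assume t: "t \<ge> 0"
        have "q (x + y) \<le> p ((x + t *\<^sub>R w) + (y + t' *\<^sub>R w)) - (t + t') * p w"
          using qle[of "t + t'" "x + y"] t t' by (simp add: algebra_simps)
        also have "\<dots> \<le> p (x + t *\<^sub>R w) + p (y + t' *\<^sub>R w) - (t + t') * p w"
          using sublinear_add[OF assms(1)] by simp
        finally show "q (x + y) - (p (y + t' *\<^sub>R w) - t' * p w) \<le> p (x + t *\<^sub>R w) - t * p w"
          by (simp add: algebra_simps)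
      qed
      then have "q (x + y) - q x \<le> q y" by (intro leq) (simp add: algebra_simps)
      then show ?thesis by simp
    qed
  qed
  then show "sublinear (sublinear_descent p w)" by (simp add: q_def(1))
qed

text \<open>By Zorn, there is a minimal sublinear functional below \<open>p\<close>; it is linear.\<close>

lemma sublinear_dominates_linear:
  fixes p :: "'a::real_vector \<Rightarrow> real"
  assumes p: "sublinear p"
  shows "\<exists>f. linear f \<and> (\<forall>x. f x \<le> p x)"
proof -
  define S where "S = {q. sublinear q \<and> q \<le> p}"
  define P where "P = (\<lambda>f g :: 'a \<Rightarrow> real. g \<le> f)"
  have "\<exists>m\<in>S. \<forall>q\<in>S. P m q \<longrightarrow> q = m"
  proof (rule predicate_Zorn)
    show "partial_order_on S (relation_of P S)"
      by (rule partial_order_on_relation_ofI) (auto simp: P_def)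
    fix K assume "K \<in> Chains (relation_of P S)"
    then have KS: "K \<subseteq> S" and chain: "\<And>f g. f \<in> K \<Longrightarrow> g \<in> K \<Longrightarrow> f \<le> g \<or> g \<le> f"
      by (auto simp: Chains_def relation_of_def P_def)
    show "\<exists>u\<in>S. \<forall>q\<in>K. P q u"
    proof (cases "K = {}")
      case True then show ?thesis using p by (auto simp: S_def)
    next
      case False
      define u where "u = (\<lambda>z. INF f\<in>K. f z)"
      have bdd: "bdd_below ((\<lambda>f. f z) ` K)" for z
      proof (rule bdd_belowI2[of _ "- p (- z)"])
        fix f assume "f \<in> K"
        with KS have "sublinear f" "f (- z) \<le> p (- z)" by (auto simp: S_def le_fun_def)
        then show "- p (- z) \<le> f z" using sublinear_lower[of f z] by linarith
      qed
      have ule: "u z \<le> f z" if "f \<in> K" for f z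
        unfolding u_def by (rule cINF_lower[OF bdd that])
      have leu: "m \<le> u z" if "\<And>f. f \<in> K \<Longrightarrow> m \<le> f z" for m z
        unfolding u_def by (rule cINF_greatest[OF False]) (use that in auto)
      have "sublinear u"
      proof (rule sublinearI)
        obtain f0 where "f0 \<in> K" using False by auto
        then have "f0 0 = 0" using KS sublinear_0 by (auto simp: S_def)
        then show "u 0 = 0"
          using ule[OF \<open>f0 \<in> K\<close>, of 0] leu[of 0 0] KS sublinear_0 by (force simp: S_def)
        show "u (c *\<^sub>R z) \<le> c * u z" if c: "c > 0" for c z
        proof -
          have "u (c *\<^sub>R z) / c \<le> u z"
          proof (rule leu)
            fix f assume f: "f \<in> K"
            then have "f (c *\<^sub>R z) = c * f z" using KS c by (auto simp: S_def sublinear_scale)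
            with ule[OF f, of "c *\<^sub>R z"] show "u (c *\<^sub>R z) / c \<le> f z"
              using c by (simp add: field_simps)
          qed
          then show ?thesis using c by (simp add: field_simps)
        qed
        show "u (x + y) \<le> u x + u y" for x y
        proof -
          have "u (x + y) - g y \<le> u x" if g: "g \<in> K" for g
          proof (rule leu)
            fix f assume f: "f \<in> K"
            obtain h where h: "h \<in> K" "h \<le> f" "h \<le> g"
              using chain[OF f g] f g by auto
            have "u (x + y) \<le> h (x + y)" by (rule ule[OF h(1)])
            also have "\<dots> \<le> h x + h y" using h KS by (auto simp: S_def sublinear_add)
            also have "\<dots> \<le> f x + g y" using h by (auto simp: le_fun_def intro: add_mono)
            finally show "u (x + y) - g y \<le> f x" by simp
          qed
          then have "u (x + y) - u x \<le> u y" by (intro leu) (simp add: algebra_simps)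
          then show ?thesis by simp
        qed
      qed
      moreover have "u \<le> p"
      proof -
        obtain f0 where "f0 \<in> K" using False by auto
        then have "u \<le> f0" "f0 \<le> p" using ule KS by (auto simp: le_fun_def S_def)
        then show ?thesis by simp
      qed
      ultimately show ?thesis using ule by (intro bexI[of _ u]) (auto simp: S_def P_def le_fun_def)
    qed
  qed
  then obtain m where m: "sublinear m" "m \<le> p" and
    min: "\<And>q. sublinear q \<Longrightarrow> q \<le> p \<Longrightarrow> q \<le> m \<Longrightarrow> q = m"
    by (auto simp: S_def P_def)
  \<comment> \<open>The descent of \<open>m\<close> along \<open>w\<close> lies below
    \<open>m\<close>, so minimality makes the two equal, and the descent inequality at
    \<open>- w\<close> becomes oddness. For an odd functional subadditivity is additivity.\<close>
  have neg: "m (- w) = - m w" for w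
  proof -
    define q where "q = sublinear_descent m w"
    note q = sublinear_descent[OF m(1), of w, folded q_def]
    have "q \<le> m" using q(2) by (simp add: le_fun_def)
    then have "q = m" using min[OF q(1)] m(2) by simp
    then show ?thesis using q(3) sublinear_lower[OF m(1), of w] by simp
  qed
  have "linear m"
  proof (rule linearI)
    show "m (x + y) = m x + m y" for x y
      using sublinear_add[OF m(1), of x y] sublinear_add[OF m(1), of "x + y" "- y"] neg[of y]
      by simp
    show "m (c *\<^sub>R x) = c *\<^sub>R m x" for c x
    proof (cases "c \<ge> 0")
      case True then show ?thesis using sublinear_scale[OF m(1)] by simp
    next
      case False
      then have "m ((- c) *\<^sub>R x) = (- c) * m x" using sublinear_scale[OF m(1), of "- c" x] by simp
      then show ?thesis using neg[of "c *\<^sub>R x"] by simp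
    qed
  qed
  then show ?thesis using m(2) by (auto simp: le_fun_def)
qed

text \<open>Descending along \<open>x0\<close> first forces every linear minorant to attain
  \<open>p x0\<close>, since its value at \<open>- x0\<close> is at most
  \<open>- p x0\<close>.\<close>

theorem hahn_banach:
  fixes p :: "'a::real_vector \<Rightarrow> real"
  assumes p: "sublinear p"
  shows "\<exists>f. linear f \<and> (\<forall>x. f x \<le> p x) \<and> f x0 = p x0"
proof -
  define q where "q = sublinear_descent p x0"
  note q = sublinear_descent[OF p, of x0, folded q_def]
  obtain f where f: "linear f" "\<And>x. f x \<le> q x"
    using sublinear_dominates_linear[OF q(1)] by auto
  have "f x \<le> p x" for x using f(2)[of x] q(2)[of x] by simp
  moreover have "f x0 \<ge> p x0"
    using f(2)[of "- x0"] q(3) linear_neg[OF f(1), of x0] by simp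
  ultimately show ?thesis using f(1) by (intro exI[of _ f]) (auto intro: antisym)
qed

section \<open>Complex functionals\<close>

lemma vector_space_scaleC: "vector_space ((*\<^sub>C) :: complex \<Rightarrow> 'a::complex_vector \<Rightarrow> 'a)"
  by unfold_locales
    (use scaleC_of_real[of 1] in \<open>auto simp: scaleC_add_right scaleC_add_left scaleC_scaleC\<close>)

lemma scaleC_one [simp]: "1 *\<^sub>C x = x"
  using scaleC_of_real[of 1 x] by simp

lemma scaleC_zero_left [simp]: "0 *\<^sub>C x = 0"
  using scaleC_of_real[of 0 x] by simp

lemma scaleC_zero_right [simp]: "c *\<^sub>C 0 = 0"
  using scaleC_add_right[of c 0 0] by simp

lemma scaleC_minus_one: "(-1) *\<^sub>C x = - x"
  using scaleC_of_real[of "-1" x] by simp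

lemma scaleC_minus_left: "(- c) *\<^sub>C x = - (c *\<^sub>C x)"
  using scaleC_add_left[of c "- c" x] by (simp add: minus_unique)

lemma scaleC_minus_right: "c *\<^sub>C (- x) = - (c *\<^sub>C x)"
  using scaleC_add_right[of c x "- x"] by (simp add: minus_unique)

lemma scaleC_diff_right: "c *\<^sub>C (x - y) = c *\<^sub>C x - c *\<^sub>C y"
  using scaleC_add_right[of c x "- y"] by (simp add: scaleC_minus_right)

lemma scaleC_diff_left: "(c - d) *\<^sub>C x = c *\<^sub>C x - d *\<^sub>C x"
  using scaleC_add_left[of c "- d" x] by (simp add: scaleC_minus_left)

lemma scaleC_decompose: "c *\<^sub>C x = Re c *\<^sub>R x + Im c *\<^sub>R (\<i> *\<^sub>C x)"
proof -
  have "c *\<^sub>C x = (of_real (Re c) + of_real (Im c) * \<i>) *\<^sub>C x"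
    by (metis complex_eq mult.commute)
  then show ?thesis by (simp only: scaleC_add_left flip: scaleC_scaleC) (simp add: scaleC_of_real)
qed

lemma seminorm_add: "seminorm p \<Longrightarrow> p (x + y) \<le> p x + p y"
  and seminorm_scale: "seminorm p \<Longrightarrow> p (c *\<^sub>C x) = cmod c * p x"
  by (auto simp: seminorm_def)

lemma seminorm_scaleR: "seminorm p \<Longrightarrow> p (c *\<^sub>R x) = \<bar>c\<bar> * p x"
  using seminorm_scale[of p "of_real c" x] by (simp add: scaleC_of_real)

lemma seminorm_0: "seminorm p \<Longrightarrow> p 0 = 0"
  using seminorm_scaleR[of p 0 0] by simp

lemma seminorm_minus: "seminorm p \<Longrightarrow> p (- x) = p x"
  using seminorm_scaleR[of p "-1" x] by simp

lemma seminorm_nonneg: "seminorm p \<Longrightarrow> 0 \<le> p x"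
  using seminorm_add[of p x "- x"] seminorm_minus[of p x] seminorm_0[of p] by simp

lemma seminorm_diff: "seminorm p \<Longrightarrow> p (x - y) \<le> p x + p y"
  using seminorm_add[of p x "- y"] seminorm_minus[of p y] by simp

lemma seminorm_commute: "seminorm p \<Longrightarrow> p (x - y) = p (y - x)"
  using seminorm_minus[of p "x - y"] by simp

lemma seminorm_triangle: "seminorm p \<Longrightarrow> p (x - z) \<le> p (x - y) + p (y - z)"
  using seminorm_add[of p "x - y" "y - z"] by simp

lemma seminorm_abs_diff: "seminorm p \<Longrightarrow> \<bar>p x - p y\<bar> \<le> p (x - y)"
  using seminorm_add[of p "x - y" y] seminorm_add[of p "y - x" x] seminorm_commute[of p x y]
  by (simp add: abs_le_iff)

lemma seminorm_add_seminorm: "seminorm p \<Longrightarrow> seminorm q \<Longrightarrow> seminorm (\<lambda>x. p x + q x)"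
  unfolding seminorm_def by (auto simp: algebra_simps) (metis add_mono add.assoc add.left_commute)

lemma seminorm_scaled: "seminorm p \<Longrightarrow> c \<ge> 0 \<Longrightarrow> seminorm (\<lambda>x. c * p x)"
  unfolding seminorm_def by (auto simp: algebra_simps) (metis distrib_left mult_left_mono)

lemma seminorm_sublinear: "seminorm p \<Longrightarrow> sublinear p"
  by (auto simp: sublinear_def seminorm_add seminorm_scaleR)

definition functional :: "('a::complex_vector \<Rightarrow> complex) \<Rightarrow> bool" where
  "functional \<phi> \<longleftrightarrow> (\<forall>x y. \<phi> (x + y) = \<phi> x + \<phi> y) \<and> (\<forall>c x. \<phi> (c *\<^sub>C x) = c * \<phi> x)"

text \<open>The polar of the unit ball of \<open>p\<close>. Bounds uniform over this set are the
  scalar form of bounds in the seminorm.\<close>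

definition polar :: "('a::complex_vector \<Rightarrow> real) \<Rightarrow> ('a \<Rightarrow> complex) set" where
  "polar p = {\<phi>. functional \<phi> \<and> (\<forall>x. cmod (\<phi> x) \<le> p x)}"

lemma functional_add: "functional \<phi> \<Longrightarrow> \<phi> (x + y) = \<phi> x + \<phi> y"
  and functional_scale: "functional \<phi> \<Longrightarrow> \<phi> (c *\<^sub>C x) = c * \<phi> x"
  by (auto simp: functional_def)

lemma functional_0: "functional \<phi> \<Longrightarrow> \<phi> 0 = 0"
  using functional_scale[of \<phi> 0 0] by simp

lemma functional_minus: "functional \<phi> \<Longrightarrow> \<phi> (- x) = - \<phi> x"
  using functional_scale[of \<phi> "-1" x] by (simp add: scaleC_minus_one)

lemma functional_diff: "functional \<phi> \<Longrightarrow> \<phi> (x - y) = \<phi> x - \<phi> y"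
  using functional_add[of \<phi> x "- y"] functional_minus[of \<phi> y] by simp

lemma functional_scaleR: "functional \<phi> \<Longrightarrow> \<phi> (c *\<^sub>R x) = of_real c * \<phi> x"
  using functional_scale[of \<phi> "of_real c" x] by (simp add: scaleC_of_real)

lemma functional_sum: "functional \<phi> \<Longrightarrow> \<phi> (\<Sum>i\<in>I. f i) = (\<Sum>i\<in>I. \<phi> (f i))"
  by (induction I rule: infinite_finite_induct) (auto simp: functional_0 functional_add)

lemma polar_functional: "\<phi> \<in> polar p \<Longrightarrow> functional \<phi>"
  and polar_bound: "\<phi> \<in> polar p \<Longrightarrow> cmod (\<phi> x) \<le> p x"
  by (auto simp: polar_def)

text \<open>This is the complex linear functional with real part \<open>f\<close>. At a suitable
  unimodular multiple of \<open>x\<close> its value is real, hence equal to \<open>f\<close>, and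
  \<open>p\<close> does not see the unimodular factor.\<close>

lemma complexification:
  fixes f :: "'a::complex_vector \<Rightarrow> real"
  assumes f: "linear f" and le: "\<And>x. f x \<le> p x" and p: "seminorm p"
  shows "(\<lambda>x. Complex (f x) (- f (\<i> *\<^sub>C x))) \<in> polar p"
proof -
  define \<phi> where "\<phi> = (\<lambda>x. Complex (f x) (- f (\<i> *\<^sub>C x)))"
  have "functional \<phi>"
    unfolding functional_def
  proof (intro conjI allI)
    show "\<phi> (x + y) = \<phi> x + \<phi> y" for x y
      by (simp add: \<phi>_def scaleC_add_right linear_add[OF f] complex_eq_iff)
    show "\<phi> (c *\<^sub>C x) = c * \<phi> x" for c x
    proof -
      have "f (c *\<^sub>C x) = Re c * f x + Im c * f (\<i> *\<^sub>C x)"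
        by (subst scaleC_decompose) (simp add: linear_add[OF f] linear_scale[OF f])
      moreover have "f (\<i> *\<^sub>C c *\<^sub>C x) = - Im c * f x + Re c * f (\<i> *\<^sub>C x)"
        unfolding scaleC_scaleC
        by (subst scaleC_decompose) (simp add: linear_add[OF f] linear_scale[OF f] linear_diff[OF f])
      ultimately show ?thesis by (simp add: \<phi>_def complex_eq_iff)
    qed
  qed
  moreover have "cmod (\<phi> x) \<le> p x" for x
  proof (cases "\<phi> x = 0")
    case False
    define c where "c = cnj (\<phi> x) / cmod (\<phi> x)"
    have c: "cmod c = 1" using False by (simp add: c_def norm_divide)
    have "\<phi> (c *\<^sub>C x) = c * \<phi> x" using \<open>functional \<phi>\<close> by (rule functional_scale)
    also have "\<dots> = of_real (cmod (\<phi> x))"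
      using False by (simp add: c_def mult.commute[of "cnj _"] complex_norm_square[symmetric] power2_eq_square)
    finally have "cmod (\<phi> x) = Re (\<phi> (c *\<^sub>C x))" by simp
    also have "\<dots> = f (c *\<^sub>C x)" by (simp add: \<phi>_def)
    also have "\<dots> \<le> p x" using le[of "c *\<^sub>C x"] seminorm_scale[OF p, of c x] c by simp
    finally show ?thesis .
  qed (simp add: seminorm_nonneg[OF p])
  ultimately show ?thesis by (simp add: polar_def \<phi>_def)
qed

lemma norming_functional:
  assumes p: "seminorm p"
  obtains \<phi> where "\<phi> \<in> polar p" "\<phi> x = of_real (p x)"
proof -
  obtain f where f: "linear f" "\<And>y. f y \<le> p y" "f x = p x"
    using hahn_banach[OF seminorm_sublinear[OF p]] by blast
  define \<phi> where "\<phi> = (\<lambda>x. Complex (f x) (- f (\<i> *\<^sub>C x)))"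
  have \<phi>: "\<phi> \<in> polar p" unfolding \<phi>_def by (rule complexification[OF f(1,2) p])
  have "Re (\<phi> x) = p x" using f(3) by (simp add: \<phi>_def)
  moreover have "cmod (\<phi> x) \<le> p x" using \<phi> by (rule polar_bound)
  ultimately have "(cmod (\<phi> x))\<^sup>2 \<le> (Re (\<phi> x))\<^sup>2" by (simp add: power_mono)
  then have "Im (\<phi> x) = 0" by (simp add: cmod_power2)
  with \<open>Re (\<phi> x) = p x\<close> have "\<phi> x = of_real (p x)" by (simp add: complex_eq_iff)
  with \<phi> show ?thesis by (rule that)
qed

text \<open>The bridge back from scalars to vectors: some functional in the polar attains
  \<open>p x\<close>, so a bound valid on the whole polar bounds the seminorm.\<close>

lemma seminorm_le_polar:
  assumes p: "seminorm p" and "\<And>\<phi>. \<phi> \<in> polar p \<Longrightarrow> cmod (\<phi> x) \<le> B"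
  shows "p x \<le> B"
proof -
  obtain \<phi> where "\<phi> \<in> polar p" "\<phi> x = of_real (p x)" by (rule norming_functional[OF p])
  with assms(2)[of \<phi>] show ?thesis by simp
qed

section \<open>Continuous seminorms\<close>

lemma tendsto_0_dominated:
  fixes f h :: "'b \<Rightarrow> real"
  assumes "(h \<longlongrightarrow> 0) F" "\<And>x. 0 \<le> f x" "\<And>x. f x \<le> h x"
  shows "(f \<longlongrightarrow> 0) F"
  by (rule tendsto_sandwich[of "\<lambda>_. 0" f F h]) (use assms in auto)

definition cseminorm :: "('a::locally_convex \<Rightarrow> real) \<Rightarrow> bool" where
  "cseminorm p \<longleftrightarrow> seminorm p \<and> continuous_on UNIV p"

lemma cseminorm_seminorm: "cseminorm p \<Longrightarrow> seminorm p"
  by (simp add: cseminorm_def)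

lemma seminorm_continuousI:
  fixes p :: "'a::locally_convex \<Rightarrow> real"
  assumes p: "seminorm p" and "\<And>x e. e > 0 \<Longrightarrow> open {y. p (y - x) < e}"
  shows "continuous_on UNIV p"
proof -
  have "(p \<longlongrightarrow> p x) (at x)" for x
  proof (rule tendstoI)
    fix e :: real assume "e > 0"
    then have "\<forall>\<^sub>F y in nhds x. y \<in> {y. p (y - x) < e}"
      using assms(2)[of e x] by (intro eventually_nhds_in_open) (auto simp: seminorm_0[OF p])
    then have "\<forall>\<^sub>F y in nhds x. dist (p y) (p x) < e"
    proof eventually_elim
      case (elim y)
      then show ?case using seminorm_abs_diff[OF p, of y x] by (simp add: dist_real_def)
    qed
    then show "\<forall>\<^sub>F y in at x. dist (p y) (p x) < e"
      by (simp add: eventually_at_filter eventually_mono)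
  qed
  then show ?thesis by (simp add: continuous_on_def)
qed

text \<open>A finite set of generating seminorms with radius \<open>e\<close> collapses to
  \<open>1 / e\<close> times their sum. From here on a neighbourhood is described by one continuous
  seminorm and radius 1.\<close>

lemma open_iff_cseminorm:
  fixes U :: "'a::locally_convex set"
  shows "open U \<longleftrightarrow> (\<forall>x\<in>U. \<exists>p. cseminorm p \<and> {y. p (y - x) < 1} \<subseteq> U)"
proof -
  obtain P :: "('a \<Rightarrow> real) set" where P_top: "(\<forall>p\<in>P. seminorm p) \<and> (\<forall>U. open U \<longleftrightarrow>
      (\<forall>x\<in>U. \<exists>F e. finite F \<and> F \<subseteq> P \<and> 0 < e \<and> {y. \<forall>p\<in>F. p (y - x) < e} \<subseteq> U))"
    using topology_generated_by_seminorms[where 'a='a] by (rule exE)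
  have P: "\<And>p. p \<in> P \<Longrightarrow> seminorm p" using P_top by simp
  have top: "open U \<longleftrightarrow> (\<forall>x\<in>U. \<exists>F e. finite F \<and> F \<subseteq> P \<and> 0 < e \<and> {y. \<forall>p\<in>F. p (y - x) < e} \<subseteq> U)" for U
    using P_top by simp
  have ball: "open {y. p (y - x) < e}" if p: "p \<in> P" for p x e
    unfolding top
  proof
    fix y assume y: "y \<in> {y. p (y - x) < e}"
    have "{z. \<forall>q\<in>{p}. q (z - y) < e - p (y - x)} \<subseteq> {y. p (y - x) < e}"
    proof
      fix z assume "z \<in> {z. \<forall>q\<in>{p}. q (z - y) < e - p (y - x)}"
      then show "z \<in> {y. p (y - x) < e}" using seminorm_triangle[OF P[OF p], of z x y] by simp
    qed
    then show "\<exists>F e'. finite F \<and> F \<subseteq> P \<and> 0 < e' \<and> {z. \<forall>p\<in>F. p (z - y) < e'} \<subseteq> {y. p (y - x) < e}"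
      using p y by (intro exI[of _ "{p}"] exI[of _ "e - p (y - x)"]) auto
  qed
  have cont: "continuous_on UNIV p" if "p \<in> P" for p
    by (rule seminorm_continuousI) (use that P ball in auto)
  show ?thesis
  proof
    assume U: "open U"
    show "\<forall>x\<in>U. \<exists>p. cseminorm p \<and> {y. p (y - x) < 1} \<subseteq> U"
    proof
      fix x assume "x \<in> U"
      then obtain F e where F: "finite F" "F \<subseteq> P" "0 < e" "{y. \<forall>p\<in>F. p (y - x) < e} \<subseteq> U"
        using top[of U] U by blast
      define p where "p = (\<lambda>z. (1 / e) * (\<Sum>q\<in>F. q z))"
      have "seminorm (\<lambda>z. \<Sum>q\<in>F. q z)"
        using F(2) P unfolding seminorm_def
        by (auto simp: sum_distrib_left simp flip: sum.distrib intro!: sum_mono sum.cong)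
      then have "seminorm p" unfolding p_def using F(3) by (intro seminorm_scaled) auto
      moreover have "continuous_on UNIV p"
        unfolding p_def using F(2) cont by (intro continuous_intros) auto
      moreover have "{y. p (y - x) < 1} \<subseteq> U"
      proof
        fix y assume "y \<in> {y. p (y - x) < 1}"
        then have le: "(\<Sum>q\<in>F. q (y - x)) < e" using F(3) by (simp add: p_def field_simps)
        have "q (y - x) \<le> (\<Sum>q\<in>F. q (y - x))" if "q \<in> F" for q
        proof (rule member_le_sum[OF that])
          show "0 \<le> r (y - x)" if "r \<in> F - {q}" for r
            by (intro seminorm_nonneg P) (use that F in blast)
        qed (rule F(1))
        then show "y \<in> U" using F(4) le by force
      qed
      ultimately show "\<exists>p. cseminorm p \<and> {y. p (y - x) < 1} \<subseteq> U" by (auto simp: cseminorm_def)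
    qed
  next
    assume R: "\<forall>x\<in>U. \<exists>p. cseminorm p \<and> {y. p (y - x) < 1} \<subseteq> U"
    have "\<exists>T. open T \<and> x \<in> T \<and> T \<subseteq> U" if x: "x \<in> U" for x
    proof -
      obtain p where p: "cseminorm p" "{y. p (y - x) < 1} \<subseteq> U" using R x by auto
      txt \<open>Continuity of translations is not at hand yet: the ball is covered by basic open sets.\<close>
      have sp: "seminorm p" using p(1) by (rule cseminorm_seminorm)
      have o: "open {z. p z < 1}"
        using p(1) unfolding cseminorm_def by (intro open_Collect_less) auto
      have tr: "open {y. y - x \<in> V}" if V: "open V" for V
        unfolding top
      proof
        fix y assume "y \<in> {y. y - x \<in> V}"
        then obtain F e where F: "finite F" "F \<subseteq> P" "0 < e" "{z. \<forall>p\<in>F. p (z - (y - x)) < e} \<subseteq> V"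
          using top[of V] V by blast
        have "{z. \<forall>p\<in>F. p (z - y) < e} \<subseteq> {y. y - x \<in> V}"
        proof
          fix z assume "z \<in> {z. \<forall>p\<in>F. p (z - y) < e}"
          then have "z - x \<in> {z. \<forall>p\<in>F. p (z - (y - x)) < e}" by simp
          then show "z \<in> {y. y - x \<in> V}" using F(4) by auto
        qed
        then show "\<exists>F e. finite F \<and> F \<subseteq> P \<and> 0 < e \<and> {z. \<forall>p\<in>F. p (z - y) < e} \<subseteq> {y. y - x \<in> V}"
          using F by blast
      qed
      have "open {y. p (y - x) < 1}" using tr[OF o] by simp
      then show ?thesis using p(2) by (intro exI[of _ "{y. p (y - x) < 1}"]) (auto simp: seminorm_0[OF sp])
    qed
    then show "open U" by (meson open_subopen)
  qed
qed

lemma cseminorm_scaled: "cseminorm p \<Longrightarrow> c \<ge> 0 \<Longrightarrow> cseminorm (\<lambda>x. c * p x)"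
  by (auto simp: cseminorm_def seminorm_scaled intro!: continuous_intros)

lemma cseminorm_add: "cseminorm p \<Longrightarrow> cseminorm q \<Longrightarrow> cseminorm (\<lambda>x. p x + q x)"
  by (auto simp: cseminorm_def seminorm_add_seminorm intro!: continuous_intros)

lemma open_cseminorm_ball:
  assumes "cseminorm p"
  shows "open {y. p (y - x) < e}"
  unfolding open_iff_cseminorm
proof
  fix y assume y: "y \<in> {y. p (y - x) < e}"
  define d where "d = e - p (y - x)"
  have d: "d > 0" using y by (simp add: d_def)
  have p: "seminorm p" using assms by (rule cseminorm_seminorm)
  have "{z. (1 / d) * p (z - y) < 1} \<subseteq> {y. p (y - x) < e}"
  proof
    fix z assume "z \<in> {z. (1 / d) * p (z - y) < 1}"
    then have "p (z - y) < d" using d by (simp add: field_simps)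
    then show "z \<in> {y. p (y - x) < e}" using seminorm_triangle[OF p, of z x y] by (simp add: d_def)
  qed
  then show "\<exists>q. cseminorm q \<and> {z. q (z - y) < 1} \<subseteq> {y. p (y - x) < e}"
    using cseminorm_scaled[OF assms, of "1 / d"] d by (intro exI[of _ "\<lambda>z. (1 / d) * p z"]) auto
qed

lemma tendsto_cseminorm_iff:
  fixes f :: "'b \<Rightarrow> 'a::locally_convex"
  shows "(f \<longlongrightarrow> l) F \<longleftrightarrow> (\<forall>p. cseminorm p \<longrightarrow> ((\<lambda>x. p (f x - l)) \<longlongrightarrow> 0) F)"
proof (intro iffI allI impI)
  fix p :: "'a \<Rightarrow> real" assume f: "(f \<longlongrightarrow> l) F" and p: "cseminorm p"
  show "((\<lambda>x. p (f x - l)) \<longlongrightarrow> 0) F"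
  proof (rule tendstoI)
    fix e :: real assume "e > 0"
    then have "\<forall>\<^sub>F x in F. f x \<in> {y. p (y - l) < e}"
      using p by (intro topological_tendstoD[OF f] open_cseminorm_ball)
        (auto simp: seminorm_0 cseminorm_seminorm)
    then show "\<forall>\<^sub>F x in F. dist (p (f x - l)) 0 < e"
      by eventually_elim (use seminorm_nonneg[OF cseminorm_seminorm[OF p]] in \<open>auto simp: dist_real_def\<close>)
  qed
next
  assume R: "\<forall>p. cseminorm p \<longrightarrow> ((\<lambda>x. p (f x - l)) \<longlongrightarrow> 0) F"
  show "(f \<longlongrightarrow> l) F"
  proof (rule topological_tendstoI)
    fix U assume "open U" "l \<in> U"
    then obtain p where p: "cseminorm p" "{y. p (y - l) < 1} \<subseteq> U" using open_iff_cseminorm by blast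
    then have "((\<lambda>x. p (f x - l)) \<longlongrightarrow> 0) F" using R by blast
    then have "\<forall>\<^sub>F x in F. dist (p (f x - l)) 0 < 1" by (rule tendstoD) simp
    then show "\<forall>\<^sub>F x in F. f x \<in> U"
      by eventually_elim (use p(2) in \<open>auto simp: dist_real_def\<close>)
  qed
qed

lemma tendsto_cseminormI:
  fixes f :: "'b \<Rightarrow> 'a::locally_convex"
  assumes "\<And>p e. cseminorm p \<Longrightarrow> e > 0 \<Longrightarrow> \<forall>\<^sub>F x in F. p (f x - l) \<le> e"
  shows "(f \<longlongrightarrow> l) F"
  unfolding tendsto_cseminorm_iff
proof (intro allI impI tendstoI)
  fix p :: "'a \<Rightarrow> real" and e :: real assume p: "cseminorm p" and e: "e > 0"
  have "\<forall>\<^sub>F x in F. p (f x - l) \<le> e / 2" using assms[OF p, of "e / 2"] e by simp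
  then show "\<forall>\<^sub>F x in F. dist (p (f x - l)) 0 < e"
    by eventually_elim (use e seminorm_nonneg[OF cseminorm_seminorm[OF p]] in \<open>auto simp: dist_real_def\<close>)
qed

lemma tendsto_add_lcs:
  fixes f g :: "'b \<Rightarrow> 'a::locally_convex"
  assumes "(f \<longlongrightarrow> a) F" "(g \<longlongrightarrow> b) F"
  shows "((\<lambda>x. f x + g x) \<longlongrightarrow> a + b) F"
  unfolding tendsto_cseminorm_iff
proof (intro allI impI)
  fix p :: "'a \<Rightarrow> real" assume p: "cseminorm p"
  note sp = cseminorm_seminorm[OF p]
  have "((\<lambda>x. p (f x - a) + p (g x - b)) \<longlongrightarrow> 0 + 0) F"
    using assms p unfolding tendsto_cseminorm_iff by (intro tendsto_add) auto
  moreover have "p (f x + g x - (a + b)) \<le> p (f x - a) + p (g x - b)" for x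
    using seminorm_add[OF sp, of "f x - a" "g x - b"] by (simp add: algebra_simps)
  ultimately show "((\<lambda>x. p (f x + g x - (a + b))) \<longlongrightarrow> 0) F"
    using seminorm_nonneg[OF sp] by (auto intro: tendsto_0_dominated)
qed

lemma tendsto_scaleC:
  fixes f :: "'b \<Rightarrow> 'a::locally_convex"
  assumes "(c \<longlongrightarrow> c0) F" "(f \<longlongrightarrow> a) F"
  shows "((\<lambda>x. c x *\<^sub>C f x) \<longlongrightarrow> c0 *\<^sub>C a) F"
  unfolding tendsto_cseminorm_iff
proof (intro allI impI)
  fix p :: "'a \<Rightarrow> real" assume p: "cseminorm p"
  note sp = cseminorm_seminorm[OF p]
  have "((\<lambda>x. cmod (c x) * p (f x - a) + cmod (c x - c0) * p a) \<longlongrightarrow> cmod c0 * 0 + cmod (c0 - c0) * p a) F"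
    using assms p unfolding tendsto_cseminorm_iff by (intro tendsto_intros) auto
  moreover have "p (c x *\<^sub>C f x - c0 *\<^sub>C a) \<le> cmod (c x) * p (f x - a) + cmod (c x - c0) * p a" for x
  proof -
    have "c x *\<^sub>C f x - c0 *\<^sub>C a = c x *\<^sub>C (f x - a) + (c x - c0) *\<^sub>C a"
      by (simp add: scaleC_diff_right scaleC_diff_left)
    then show ?thesis using seminorm_add[OF sp, of "c x *\<^sub>C (f x - a)" "(c x - c0) *\<^sub>C a"]
      by (simp add: seminorm_scale[OF sp])
  qed
  ultimately show "((\<lambda>x. p (c x *\<^sub>C f x - c0 *\<^sub>C a)) \<longlongrightarrow> 0) F"
    using seminorm_nonneg[OF sp] by (auto intro: tendsto_0_dominated)
qed

lemma tendsto_diff_lcs: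
  fixes f g :: "'b \<Rightarrow> 'a::locally_convex"
  assumes "(f \<longlongrightarrow> a) F" "(g \<longlongrightarrow> b) F"
  shows "((\<lambda>x. f x - g x) \<longlongrightarrow> a - b) F"
  using tendsto_add_lcs[OF assms(1) tendsto_scaleC[OF tendsto_const[of "-1"] assms(2)]]
  by (simp add: scaleC_minus_one)

lemma Cauchy_cseminorm_convergent:
  fixes f :: "nat \<Rightarrow> 'a::sequentially_complete_lcs"
  assumes "\<And>p e. cseminorm p \<Longrightarrow> e > 0 \<Longrightarrow> \<exists>N. \<forall>m\<ge>N. \<forall>n\<ge>N. p (f m - f n) < e"
  shows "\<exists>l. f \<longlonglongrightarrow> l"
proof (rule Cauchy_sequences_converge)
  fix U :: "'a set" assume "open U" "0 \<in> U"
  then obtain p where "cseminorm p" "{y. p (y - 0) < 1} \<subseteq> U" using open_iff_cseminorm by blast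
  then show "\<exists>N. \<forall>m\<ge>N. \<forall>n\<ge>N. f m - f n \<in> U" using assms[of p 1] by fastforce
qed

lemma cseminorm_separates:
  fixes x :: "'a::{locally_convex,t2_space}"
  assumes "\<And>p. cseminorm p \<Longrightarrow> p x = 0"
  shows "x = 0"
proof (rule ccontr)
  assume "x \<noteq> 0"
  then obtain U where U: "open U" "0 \<in> U" "x \<notin> U" using hausdorff[of x 0] by fastforce
  then obtain p where "cseminorm p" "{y. p (y - 0) < 1} \<subseteq> U" using open_iff_cseminorm by blast
  then have "x \<in> U" using assms[of p] by auto
  with U(3) show False by simp
qed

text \<open>Continuity is encoded as domination by a continuous seminorm, so that every functional
  brings along the polar in which estimates are carried out.\<close>

definition dual :: "('a::locally_convex \<Rightarrow> complex) set" where
  "dual = {\<phi>. \<exists>p. cseminorm p \<and> \<phi> \<in> polar p}"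

lemma dualI: "cseminorm p \<Longrightarrow> \<phi> \<in> polar p \<Longrightarrow> \<phi> \<in> dual"
  by (auto simp: dual_def)

lemma dual_functional: "\<phi> \<in> dual \<Longrightarrow> functional \<phi>"
  by (auto simp: dual_def polar_functional)

lemma dual_separates:
  fixes x y :: "'a::{locally_convex,t2_space}"
  assumes "\<And>\<phi>. \<phi> \<in> dual \<Longrightarrow> \<phi> x = \<phi> y"
  shows "x = y"
proof -
  have "p (x - y) = 0" if p: "cseminorm p" for p
  proof -
    have "p (x - y) \<le> 0"
      by (rule seminorm_le_polar) (use p assms dualI in \<open>auto simp: cseminorm_seminorm functional_diff polar_functional\<close>)
    then show ?thesis using seminorm_nonneg[OF cseminorm_seminorm[OF p], of "x - y"] by simp
  qed
  then show ?thesis using cseminorm_separates[of "x - y"] by simp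
qed

lemma tendsto_dual:
  fixes f :: "'b \<Rightarrow> 'a::locally_convex"
  assumes "\<phi> \<in> dual" "(f \<longlongrightarrow> l) F"
  shows "((\<lambda>x. \<phi> (f x)) \<longlongrightarrow> \<phi> l) F"
proof -
  obtain p where p: "cseminorm p" "\<phi> \<in> polar p" using assms(1) by (auto simp: dual_def)
  have "((\<lambda>x. p (f x - l)) \<longlongrightarrow> 0) F" using assms(2) p(1) by (simp add: tendsto_cseminorm_iff)
  then have "((\<lambda>x. \<phi> (f x) - \<phi> l) \<longlongrightarrow> 0) F"
    by (rule Lim_null_comparison[rotated])
      (use polar_bound[OF p(2)] in \<open>simp flip: functional_diff[OF polar_functional[OF p(2)]]\<close>)
  then show ?thesis by (simp add: LIM_zero_iff)
qed

text \<open>Hahn--Banach in the product, applied to the distance \<open>N\<close> from the graph: a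
  linear minorant of \<open>N\<close> vanishes on \<open>A\<close>, and \<open>N\<close> is at least
  1 at \<open>(x0, y0)\<close>. A functional on the product splits into one for each coordinate, so
  membership in \<open>A\<close> becomes a family of scalar equations.\<close>

lemma closed_graph_separation:
  fixes A :: "('a::locally_convex \<times> 'a) set"
  assumes A: "mlo A" "closed A" and z: "(x0, y0) \<notin> A"
  obtains \<phi> \<psi> where "\<phi> \<in> dual" "\<psi> \<in> dual" "\<And>x y. (x, y) \<in> A \<Longrightarrow> \<phi> x + \<psi> y = 0" "\<phi> x0 + \<psi> y0 \<noteq> 0"
proof -
  have add: "\<And>u v. u \<in> A \<Longrightarrow> v \<in> A \<Longrightarrow> u + v \<in> A"
    and scale: "\<And>c x y. (x, y) \<in> A \<Longrightarrow> (c *\<^sub>C x, c *\<^sub>C y) \<in> A"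
    using A(1) by (auto simp: mlo_def)
  have scaleR: "\<And>c u. u \<in> A \<Longrightarrow> c *\<^sub>R u \<in> A"
    using scale by (metis scaleC_of_real scaleR_prod_def prod.collapse)
  have zero: "0 \<in> A"
  proof -
    have "0 \<in> Domain A"
      using A(1) module.subspace_0[OF vector_space_scaleC[folded module_iff_vector_space]]
      unfolding mlo_def by blast
    then obtain y where "(0, y) \<in> A" by auto
    then show ?thesis using scaleR[of "(0, y)" 0] by (simp add: zero_prod_def)
  qed
  obtain U V where UV: "open U" "open V" "x0 \<in> U" "y0 \<in> V" "U \<times> V \<subseteq> - A"
    using A(2) z open_prod_elim[of "- A" "(x0, y0)"] unfolding closed_def by (metis ComplI mem_Sigma_iff)
  obtain p1 where p1: "cseminorm p1" "{y. p1 (y - x0) < 1} \<subseteq> U" using UV open_iff_cseminorm by blast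
  obtain p2 where p2: "cseminorm p2" "{y. p2 (y - y0) < 1} \<subseteq> V" using UV open_iff_cseminorm by blast
  define p where "p = (\<lambda>x. p1 x + p2 x)"
  have p: "cseminorm p" unfolding p_def by (rule cseminorm_add[OF p1(1) p2(1)])
  note sp = cseminorm_seminorm[OF p]
  define q where "q = (\<lambda>u::'a\<times>'a. p (fst u) + p (snd u))"
  have q_add: "q (u + v) \<le> q u + q v" for u v
    unfolding q_def using seminorm_add[OF sp, of "fst u" "fst v"] seminorm_add[OF sp, of "snd u" "snd v"] by simp
  have q_scale: "q (c *\<^sub>R u) = c * q u" if "c \<ge> 0" for c u
    using that by (simp add: q_def seminorm_scaleR[OF sp] algebra_simps)
  have q_nonneg: "q u \<ge> 0" for u unfolding q_def using seminorm_nonneg[OF sp] by simp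
  \<comment> \<open>Otherwise \<open>- u\<close>, which again belongs to the subspace
    \<open>A\<close>, would lie in the neighbourhood \<open>U \<times> V\<close> that misses
    \<open>A\<close>.\<close>
  have q_z: "q ((x0, y0) + u) \<ge> 1" if "u \<in> A" for u
  proof (rule ccontr)
    assume neg: "\<not> ?thesis"
    have nn: "p1 x \<ge> 0" "p2 x \<ge> 0" for x using p1 p2 by (auto simp: seminorm_nonneg cseminorm_seminorm)
    have "p1 (x0 + fst u) < 1" "p2 (y0 + snd u) < 1"
      using neg nn[of "x0 + fst u"] nn[of "y0 + snd u"] by (auto simp: q_def p_def)
    then have "p1 (- fst u - x0) < 1" "p2 (- snd u - y0) < 1"
      using seminorm_minus[OF cseminorm_seminorm[OF p1(1)], of "x0 + fst u"]
        seminorm_minus[OF cseminorm_seminorm[OF p2(1)], of "y0 + snd u"]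
      by (auto simp: minus_diff_commute)
    then have "- u \<in> U \<times> V" using p1 p2 by (cases u) auto
    then show False using UV(5) scaleR[OF that, of "-1"] by auto
  qed
  define N where "N = (\<lambda>u. INF v\<in>A. q (u + v))"
  have bdd: "bdd_below ((\<lambda>v. q (u + v)) ` A)" for u
    by (rule bdd_belowI2[of _ 0]) (use q_nonneg in auto)
  have Nle: "N u \<le> q (u + v)" if "v \<in> A" for u v unfolding N_def by (rule cINF_lower[OF bdd that])
  have leN: "m \<le> N u" if "\<And>v. v \<in> A \<Longrightarrow> m \<le> q (u + v)" for m u
    unfolding N_def by (rule cINF_greatest) (use that zero in auto)
  have N: "sublinear N"
  proof (rule sublinearI)
    have "q 0 = 0" using q_scale[of 0 0] by simp
    then show "N 0 = 0" using Nle[OF zero, of 0] leN[of 0 0] q_nonneg by force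
    show "N (c *\<^sub>R u) \<le> c * N u" if c: "c > 0" for c u
    proof -
      have "N (c *\<^sub>R u) / c \<le> N u"
      proof (rule leN)
        fix v assume "v \<in> A"
        then have "N (c *\<^sub>R u) \<le> q (c *\<^sub>R u + c *\<^sub>R v)" by (intro Nle scaleR)
        then show "N (c *\<^sub>R u) / c \<le> q (u + v)"
          using c q_scale[of c "u + v"] by (simp add: field_simps scaleR_add_right)
      qed
      then show ?thesis using c by (simp add: field_simps)
    qed
    show "N (x + y) \<le> N x + N y" for x y
    proof -
      have "N (x + y) - q (y + w) \<le> N x" if w: "w \<in> A" for w
      proof (rule leN)
        fix v assume "v \<in> A"
        then have "N (x + y) \<le> q ((x + y) + (v + w))" using w by (intro Nle add)
        also have "(x + y) + (v + w) = (x + v) + (y + w)" by (simp add: algebra_simps)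
        finally show "N (x + y) - q (y + w) \<le> q (x + v)" using q_add[of "x + v" "y + w"] by simp
      qed
      then have "N (x + y) - N x \<le> N y" by (intro leN) (simp add: algebra_simps)
      then show ?thesis by simp
    qed
  qed
  obtain f where f: "linear f" "\<And>u. f u \<le> N u" "f (x0, y0) = N (x0, y0)"
    using hahn_banach[OF N] by blast
  have f0: "f u = 0" if "u \<in> A" for u
  proof -
    have *: "f v \<le> 0" if "v \<in> A" for v
    proof -
      have "- v \<in> A" using scaleR[OF that, of "-1"] by simp
      then have "N v \<le> q (v + - v)" by (rule Nle)
      also have "q (v + - v) = 0" using q_scale[of 0 0] by simp
      finally show ?thesis using f(2)[of v] by simp
    qed
    show ?thesis
      using *[OF that] *[of "- u"] scaleR[OF that, of "-1"] linear_neg[OF f(1), of u] by simp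
  qed
  define f1 where "f1 = (\<lambda>x. f (x, 0))"
  define f2 where "f2 = (\<lambda>y. f (0, y))"
  have split: "f (x, y) = f1 x + f2 y" for x y
    using linear_add[OF f(1), of "(x, 0)" "(0, y)"] by (simp add: f1_def f2_def)
  have fq: "f u \<le> q u" for u using f(2)[of u] Nle[OF zero, of u] by simp
  have lin: "linear f1" "linear f2"
    unfolding f1_def f2_def
    using linear_add[OF f(1), of "(_, 0)" "(_, 0)"] linear_add[OF f(1), of "(0, _)" "(0, _)"]
      linear_scale[OF f(1), of _ "(_, 0)"] linear_scale[OF f(1), of _ "(0, _)"]
    by (auto intro!: linearI)
  have le: "f1 x \<le> p x" "f2 x \<le> p x" for x
    using fq[of "(x, 0)"] fq[of "(0, x)"] by (auto simp: f1_def f2_def q_def seminorm_0[OF sp])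
  define \<phi> where "\<phi> = (\<lambda>x. Complex (f1 x) (- f1 (\<i> *\<^sub>C x)))"
  define \<psi> where "\<psi> = (\<lambda>x. Complex (f2 x) (- f2 (\<i> *\<^sub>C x)))"
  show ?thesis
  proof
    show "\<phi> \<in> dual" unfolding \<phi>_def by (rule dualI[OF p complexification[OF lin(1) le(1) sp]])
    show "\<psi> \<in> dual" unfolding \<psi>_def by (rule dualI[OF p complexification[OF lin(2) le(2) sp]])
    \<comment> \<open>The real functional \<open>f\<close> also vanishes at \<open>\<i>\<close>
      times the point, because \<open>A\<close> is complex linear; this is the imaginary part of the
      equation.\<close>
    show "\<phi> x + \<psi> y = 0" if "(x, y) \<in> A" for x y
      using f0[OF that] f0[OF scale[OF that, of \<i>]]
      by (simp add: split \<phi>_def \<psi>_def complex_eq_iff)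
    have "Re (\<phi> x0 + \<psi> y0) = N (x0, y0)" using f(3) by (simp add: \<phi>_def \<psi>_def split)
    moreover have "N (x0, y0) \<ge> 1" by (rule leN) (rule q_z)
    ultimately show "\<phi> x0 + \<psi> y0 \<noteq> 0" by (metis zero_complex.sel(1) not_one_le_zero)
  qed
qed

section \<open>Continuous operators\<close>

lemma operatorI:
  fixes T :: "'a::locally_convex \<Rightarrow> 'a"
  assumes add: "\<And>x y. T (x + y) = T x + T y" and scale: "\<And>c x. T (c *\<^sub>C x) = c *\<^sub>C T x"
    and bound: "\<And>p. cseminorm p \<Longrightarrow> \<exists>q. cseminorm q \<and> (\<forall>x. p (T x) \<le> q x)"
  shows "T \<in> continuous_operators"
proof -
  have diff: "T x - T y = T (x - y)" for x y
    using add[of "x - y" y] by simp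
  have "(T \<longlongrightarrow> T x) (at x)" for x
    unfolding tendsto_cseminorm_iff
  proof (intro allI impI)
    fix p :: "'a \<Rightarrow> real" assume p: "cseminorm p"
    then obtain q where q: "cseminorm q" "\<And>x. p (T x) \<le> q x" using bound by blast
    have "((\<lambda>y. y) \<longlongrightarrow> x) (at x)" by (rule tendsto_ident_at)
    then have "((\<lambda>y. q (y - x)) \<longlongrightarrow> 0) (at x)" using q(1) by (simp add: tendsto_cseminorm_iff)
    then show "((\<lambda>y. p (T y - T x)) \<longlongrightarrow> 0) (at x)"
      by (rule tendsto_sandwich[OF _ _ tendsto_const, rotated 2])
        (use q seminorm_nonneg[OF cseminorm_seminorm[OF p]] in \<open>auto simp: diff\<close>)
  qed
  then have "continuous_on UNIV T" by (simp add: continuous_on_def)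
  moreover have "Vector_Spaces.linear (*\<^sub>C) (*\<^sub>C) T"
    using add scale vector_space_scaleC by (simp add: Vector_Spaces.linear_iff)
  ultimately show ?thesis by (simp add: continuous_operators_def)
qed

lemma operator_add: "T \<in> continuous_operators \<Longrightarrow> T (x + y) = T x + T y"
  and operator_scale: "T \<in> continuous_operators \<Longrightarrow> T (c *\<^sub>C x) = c *\<^sub>C T x"
  and operator_continuous: "T \<in> continuous_operators \<Longrightarrow> continuous_on UNIV T"
  by (auto simp: continuous_operators_def Vector_Spaces.linear_iff)

lemma operator_diff: "T \<in> continuous_operators \<Longrightarrow> T (x - y) = T x - T y"
  using operator_add[of T "x - y" y] by simp

lemma operator_seminorm:
  assumes "T \<in> continuous_operators" "cseminorm p"
  shows "cseminorm (\<lambda>x. p (T x))"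
proof -
  have "continuous_on UNIV (p \<circ> T)"
    using assms by (intro continuous_on_compose operator_continuous)
      (auto simp: cseminorm_def intro: continuous_on_subset)
  moreover have "seminorm (\<lambda>x. p (T x))"
    using assms cseminorm_seminorm[OF assms(2)]
    by (auto simp: seminorm_def operator_add operator_scale)
  ultimately show ?thesis by (simp add: cseminorm_def o_def)
qed

lemma operator_dual:
  assumes "T \<in> continuous_operators" "\<phi> \<in> dual"
  shows "(\<lambda>x. \<phi> (T x)) \<in> dual"
proof -
  obtain p where p: "cseminorm p" "\<phi> \<in> polar p" using assms(2) by (auto simp: dual_def)
  have "(\<lambda>x. \<phi> (T x)) \<in> polar (\<lambda>x. p (T x))"
    using p(2) assms(1) by (auto simp: polar_def functional_def operator_add operator_scale)
  then show ?thesis using operator_seminorm[OF assms(1) p(1)] by (auto intro: dualI)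
qed

lemma operator_tendsto:
  assumes "T \<in> continuous_operators" "(f \<longlongrightarrow> l) F"
  shows "((\<lambda>x. T (f x)) \<longlongrightarrow> T l) F"
  using assms operator_seminorm[OF assms(1)]
  by (auto simp: tendsto_cseminorm_iff simp flip: operator_diff)

text \<open>Homogeneity lets a vector be rescaled into the unit ball of \<open>q\<close>, so that a
  statement about neighbourhoods becomes one inequality between seminorms for the whole
  family.\<close>

lemma equicontinuous_iff:
  fixes \<F> :: "('a::locally_convex \<Rightarrow> 'a) set"
  assumes scale: "\<And>T c x. T \<in> \<F> \<Longrightarrow> T (c *\<^sub>C x) = c *\<^sub>C T x"
  shows "equicontinuous \<F> \<longleftrightarrow>
    (\<forall>p. cseminorm p \<longrightarrow> (\<exists>q. cseminorm q \<and> (\<forall>T\<in>\<F>. \<forall>x. p (T x) \<le> q x)))"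
proof (intro iffI allI impI)
  fix p :: "'a \<Rightarrow> real" assume eq: "equicontinuous \<F>" and p: "cseminorm p"
  note sp = cseminorm_seminorm[OF p]
  have "open {y. p (y - 0) < 1}" by (rule open_cseminorm_ball[OF p])
  then obtain U where U: "open U" "0 \<in> U" "\<And>T. T \<in> \<F> \<Longrightarrow> T ` U \<subseteq> {y. p y < 1}"
    using eq seminorm_0[OF sp] unfolding equicontinuous_def
    by (elim allE[of _ "{y. p (y - 0) < 1}"]) auto
  then obtain q where q: "cseminorm q" "{y. q (y - 0) < 1} \<subseteq> U" using open_iff_cseminorm by blast
  note sq = cseminorm_seminorm[OF q(1)]
  have "p (T x) \<le> q x" if T: "T \<in> \<F>" for T x
  proof (rule field_le_epsilon)
    fix e :: real assume e: "e > 0"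
    \<comment> \<open>The added \<open>e\<close> keeps the divisor positive where
      \<open>q x = 0\<close>.\<close>
    define r where "r = q x + e"
    have r: "r > 0" using seminorm_nonneg[OF sq, of x] e by (simp add: r_def)
    have "q (of_real (1 / r) *\<^sub>C x) = q x / r"
      using r by (simp add: seminorm_scale[OF sq] norm_divide)
    also have "\<dots> < 1" using r e by (simp add: r_def)
    finally have "of_real (1 / r) *\<^sub>C x \<in> U" using q(2) by auto
    then have "p (T (of_real (1 / r) *\<^sub>C x)) < 1" using U(3)[OF T] by auto
    then have "(1 / r) * p (T x) < 1"
      unfolding scale[OF T] seminorm_scale[OF sp] using r by (simp add: norm_divide)
    then show "p (T x) \<le> q x + e" using r by (simp add: r_def field_simps)
  qed
  then show "\<exists>q. cseminorm q \<and> (\<forall>T\<in>\<F>. \<forall>x. p (T x) \<le> q x)" using q(1) by blast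
next
  assume R: "\<forall>p. cseminorm p \<longrightarrow> (\<exists>q. cseminorm q \<and> (\<forall>T\<in>\<F>. \<forall>x. p (T x) \<le> q x))"
  show "equicontinuous \<F>"
    unfolding equicontinuous_def
  proof (intro allI impI)
    fix V :: "'a set" assume "open V \<and> 0 \<in> V"
    then obtain p where p: "cseminorm p" "{y. p (y - 0) < 1} \<subseteq> V" using open_iff_cseminorm by blast
    then obtain q where q: "cseminorm q" "\<And>T x. T \<in> \<F> \<Longrightarrow> p (T x) \<le> q x" using R by blast
    have "open {y. q (y - 0) < 1}" by (rule open_cseminorm_ball[OF q(1)])
    then show "\<exists>U. open U \<and> 0 \<in> U \<and> (\<forall>T\<in>\<F>. T ` U \<subseteq> V)"
      using p q seminorm_0[OF cseminorm_seminorm[OF q(1)]]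
      by (intro exI[of _ "{y. q (y - 0) < 1}"]) (fastforce intro: le_less_trans)
  qed
qed

section \<open>Integration over the half-line\<close>

text \<open>Open at 0, because inverse transforms are continuous only for \<open>t > 0\<close>.
  Borel sets are used rather than their completion, so that jointly measurable integrands are
  available for Fubini's theorem.\<close>

definition half_line :: "real measure" where
  "half_line = restrict_space lborel {0<..}"

lemma space_half_line [simp]: "space half_line = {0<..}"
  by (simp add: half_line_def space_restrict_space)

lemma sets_half_line: "sets half_line = sets (restrict_space borel {0<..})"
  by (simp add: half_line_def sets_restrict_space)

lemma sigma_finite_half_line: "sigma_finite_measure half_line"
  unfolding half_line_def by (rule sigma_finite_measure_restrict_space) (auto intro: lborel.sigma_finite_measure_axioms)

interpretation half_line: sigma_finite_measure half_line
  by (rule sigma_finite_half_line)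

interpretation half_line_pair: pair_sigma_finite half_line half_line ..

lemma AE_half_line_iff: "(AE t in half_line. P t) \<longleftrightarrow> (AE t in lborel. t > 0 \<longrightarrow> P t)"
  unfolding half_line_def by (subst AE_restrict_space_iff) auto

lemma AE_half_lineI: "(\<And>t. t > 0 \<Longrightarrow> P t) \<Longrightarrow> AE t in half_line. P t"
  by (simp add: AE_half_line_iff)

lemma half_line_measurable_id [measurable]: "(\<lambda>t. t) \<in> borel_measurable half_line"
  by (simp add: half_line_def measurable_restrict_space1)

lemma borel_measurable_half_line: "f \<in> borel_measurable borel \<Longrightarrow> f \<in> borel_measurable half_line"
  by (simp add: half_line_def measurable_restrict_space1)

lemma continuous_half_line_measurable:
  fixes f :: "real \<Rightarrow> 'b::topological_space"
  shows "continuous_on {0<..} f \<Longrightarrow> f \<in> borel_measurable half_line"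
  using borel_measurable_continuous_on_restrict[of "{0<..}" f]
  by (simp add: measurable_cong_sets[OF sets_half_line refl])

lemma half_line_integrable_iff:
  fixes f :: "real \<Rightarrow> 'b::{banach, second_countable_topology}"
  shows "integrable half_line f \<longleftrightarrow> set_integrable lborel {0<..} f"
  unfolding half_line_def set_integrable_def by (rule integrable_restrict_space) simp

lemma half_line_integral:
  fixes f :: "real \<Rightarrow> 'b::{banach, second_countable_topology}"
  shows "(LINT t|half_line. f t) = (LINT t:{0<..}|lborel. f t)"
  unfolding half_line_def set_lebesgue_integral_def by (rule integral_restrict_space) simp

lemma half_line_scale:
  fixes f :: "real \<Rightarrow> 'b::{banach, second_countable_topology}"
  assumes "c > 0"
  shows "(LINT t|half_line. f t) = c *\<^sub>R (LINT t|half_line. f (c * t))"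
  unfolding half_line_integral set_lebesgue_integral_def
  by (subst lborel_integral_real_affine[of c _ 0])
    (use assms in \<open>auto intro!: Bochner_Integration.integral_cong simp: indicator_def zero_less_mult_iff\<close>)

lemma half_line_exp:
  assumes "c > 0"
  shows "integrable half_line (\<lambda>t. exp (- (c * t)))" "(LINT t|half_line. exp (- (c * t))) = 1 / c"
  using integrable_I0i_exp_mscale[OF assms] LBINT_I0i_exp_mscale[OF assms]
  by (simp_all add: half_line_integrable_iff half_line_integral mult.commute interval_lebesgue_integral_0_infty)

lemma half_line_inverse_square: "integrable half_line (\<lambda>t. 1 / (1 + t\<^sup>2))"
proof -
  have "set_integrable lborel {0<..} (\<lambda>x. inverse (1 + x\<^sup>2 :: real))"
    by (rule set_integrable_subset[OF integrable_inverse_1_plus_square]) auto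
  then show ?thesis by (simp add: half_line_integrable_iff inverse_eq_divide)
qed

lemma half_line_dominated:
  fixes f :: "real \<Rightarrow> 'b::{banach, second_countable_topology}"
  assumes "integrable half_line g" "f \<in> borel_measurable half_line" "\<And>t. t > 0 \<Longrightarrow> norm (f t) \<le> g t"
  shows "integrable half_line f"
  by (rule Bochner_Integration.integrable_bound[OF assms(1,2)])
    (rule AE_half_lineI, use assms(3) in fastforce)

lemma half_line_norm_le:
  fixes f :: "real \<Rightarrow> 'b::{banach, second_countable_topology}"
  assumes "integrable half_line g" "\<And>t. t > 0 \<Longrightarrow> norm (f t) \<le> g t"
  shows "norm (LINT t|half_line. f t) \<le> (LINT t|half_line. g t)"
proof (cases "integrable half_line f")
  case True
  show ?thesis by (rule Bochner_Integration.integral_norm_bound_integral[OF True assms(1)]) (use assms(2) in auto)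
next
  case False
  \<comment> \<open>The integral of a non-integrable function is 0 by convention, so the bound only
    has to be nonnegative.\<close>
  have "0 \<le> (LINT t|half_line. g t)"
    by (rule Bochner_Integration.integral_nonneg)
      (use assms(2) in \<open>auto intro: order_trans[OF norm_ge_zero]\<close>)
  then show ?thesis using False by (simp add: not_integrable_integral_eq)
qed

section \<open>Holomorphic parameter integrals\<close>

text \<open>The constant depends only on the radius and on the bound for \<open>f\<close>. The
  estimate can therefore be integrated over a parameter, and it holds uniformly for all functionals
  in a polar.\<close>

lemma holomorphic_remainder_bound:
  assumes f: "f holomorphic_on ball z r" and B: "\<And>w. w \<in> ball z r \<Longrightarrow> cmod (f w) \<le> B"
    and r: "r > 0" and h: "cmod h < r / 2"
  shows "cmod (f (z + h) - f z - h * deriv f z) \<le> 32 * B / r\<^sup>2 * (cmod h)\<^sup>2"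
proof -
  have der: "((deriv ^^ i) f has_field_derivative (deriv ^^ (Suc i)) f w) (at w within ball z (r / 2))"
    if "w \<in> ball z (r / 2)" for w i
  proof -
    have "(deriv ^^ i) f holomorphic_on ball z r" by (rule holomorphic_higher_deriv[OF f open_ball])
    moreover have "w \<in> ball z r" using that r by auto
    ultimately have "((deriv ^^ i) f has_field_derivative deriv ((deriv ^^ i) f) w) (at w)"
      by (rule holomorphic_derivI[OF _ open_ball])
    then show ?thesis by (simp add: has_field_derivative_at_within)
  qed
  \<comment> \<open>Circles of radius \<open>r / 4\<close> about points of
    \<open>ball z (r / 2)\<close> stay inside \<open>ball z r\<close>. Cauchy's inequality for the
    second derivative gives \<open>2 * B / (r / 4)\<^sup>2\<close>, whence the 32.\<close>
  have B2: "cmod ((deriv ^^ Suc 1) f w) \<le> 32 * B / r\<^sup>2" if "w \<in> ball z (r / 2)" for w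
  proof -
    have sub: "cball w (r / 4) \<subseteq> ball z r"
    proof
      fix v assume "v \<in> cball w (r / 4)"
      then show "v \<in> ball z r" using that dist_triangle[of z v w] r by auto
    qed
    have "cmod ((deriv ^^ 2) f w) \<le> fact 2 * B / (r / 4) ^ 2"
    proof (rule Cauchy_inequality)
      show "f holomorphic_on ball w (r / 4)"
        using f by (rule holomorphic_on_subset) (use sub ball_subset_cball in blast)
      show "continuous_on (cball w (r / 4)) f"
        by (rule holomorphic_on_imp_continuous_on[OF holomorphic_on_subset[OF f sub]])
      show "cmod (f x) \<le> B" if "cmod (w - x) = r / 4" for x
        by (rule B) (use sub that in \<open>auto simp: dist_norm\<close>)
    qed (use r in auto)
    then show ?thesis by (simp add: power_divide numeral_2_eq_2)
  qed
  have "cmod ((deriv ^^ 0) f (z + h) - (\<Sum>i\<le>1. (deriv ^^ i) f z * (z + h - z) ^ i / fact i))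
      \<le> 32 * B / r\<^sup>2 * cmod (z + h - z) ^ Suc 1 / fact 1"
    by (rule complex_Taylor[of "ball z (r/2)"]) (use der B2 h r in \<open>auto simp: dist_norm\<close>)
  then show ?thesis by (simp add: power2_eq_square algebra_simps)
qed

lemma has_field_derivative_quadratic:
  fixes F :: "complex \<Rightarrow> complex"
  assumes r: "r > 0" and le: "\<And>h. cmod h < r \<Longrightarrow> cmod (F (z + h) - F z - h * D) \<le> K * (cmod h)\<^sup>2"
  shows "(F has_field_derivative D) (at z)"
  unfolding has_field_derivative_def has_derivative_at
proof
  have "((\<lambda>h. K * cmod h) \<longlongrightarrow> 0) (at 0)" by (rule tendsto_eq_intros | simp)+
  moreover have "\<forall>\<^sub>F h in at 0. norm (norm (F (z + h) - F z - D * h) / norm h) \<le> K * cmod h"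
    unfolding eventually_at
  proof (intro exI[of _ r] conjI ballI impI r)
    fix h :: complex assume h: "h \<noteq> 0 \<and> dist h 0 < r"
    then have "cmod (F (z + h) - F z - D * h) \<le> K * (cmod h)\<^sup>2"
      using le[of h] by (simp add: mult.commute)
    then show "norm (norm (F (z + h) - F z - D * h) / norm h) \<le> K * cmod h"
      using h by (simp add: divide_le_eq power2_eq_square mult.assoc)
  qed
  ultimately show "((\<lambda>h. norm (F (z + h) - F z - D * h) / norm h) \<longlongrightarrow> 0) (at 0)"
    by (rule Lim_null_comparison[rotated])
qed (rule bounded_linear_mult_right)

text \<open>The Taylor remainder is bounded by a multiple of the dominating function, so integrating
  it over the parameter leaves a quadratic error for the integral itself. The candidate derivative
  is the integral of the derivatives, whose measurability and integrability come from difference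
  quotients.\<close>

lemma holomorphic_integral:
  fixes f :: "'b \<Rightarrow> complex \<Rightarrow> complex"
  assumes S: "open S" and meas: "\<And>z. z \<in> S \<Longrightarrow> (\<lambda>x. f x z) \<in> borel_measurable M"
    and hol: "\<And>x. x \<in> space M \<Longrightarrow> f x holomorphic_on S"
    and bound: "\<And>z. z \<in> S \<Longrightarrow> \<exists>r g. r > 0 \<and> ball z r \<subseteq> S \<and> integrable M g \<and>
      (\<forall>x\<in>space M. \<forall>w\<in>ball z r. cmod (f x w) \<le> g x)"
  shows "(\<lambda>z. LINT x|M. f x z) holomorphic_on S"
proof (rule holomorphic_onI)
  fix z assume z: "z \<in> S"
  obtain r g where r: "r > 0" "ball z r \<subseteq> S" and g: "integrable M g"
    and le: "\<And>x w. x \<in> space M \<Longrightarrow> w \<in> ball z r \<Longrightarrow> cmod (f x w) \<le> g x"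
    using bound[OF z] by blast
  have int: "integrable M (\<lambda>x. f x w)" if "w \<in> ball z r" for w
  proof (rule Bochner_Integration.integrable_bound[OF g meas])
    show "AE x in M. norm (f x w) \<le> norm (g x)"
      using le[OF _ that] by (intro AE_I2) fastforce
  qed (use that r in auto)
  have rem: "cmod (f x (z + h) - f x z - h * deriv (f x) z) \<le> 32 * g x / r\<^sup>2 * (cmod h)\<^sup>2"
    if "x \<in> space M" "cmod h < r / 2" for x h
    by (rule holomorphic_remainder_bound)
      (use that r le holomorphic_on_subset[OF hol[OF that(1)] r(2)] in auto)
  have hn: "cmod (of_real (r / (real n + 3))) < r / 2" for n
    unfolding norm_of_real using r by (simp add: field_simps add_pos_nonneg)
  \<comment> \<open>The increments \<open>r / (n + 3)\<close> stay below \<open>r / 2\<close>, the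
    range of the remainder bound, and tend to 0 without vanishing.\<close>
  define hh where "hh = (\<lambda>n. complex_of_real (r / (real n + 3)))"
  have hh0: "hh n \<noteq> 0" and hhr: "cmod (hh n) < r / 2" for n
    using r hn[of n] unfolding hh_def by (auto simp del: of_real_divide simp: of_real_eq_0_iff)
  have hhlim: "hh \<longlonglongrightarrow> 0"
  proof -
    have "(\<lambda>n. r / (real n + 3)) \<longlonglongrightarrow> 0"
      by real_asymp
    then have "(\<lambda>n. complex_of_real (r / (real n + 3))) \<longlonglongrightarrow> of_real 0" by (rule tendsto_of_real)
    then show ?thesis unfolding hh_def by simp
  qed
  have meas_d: "(\<lambda>x. deriv (f x) z) \<in> borel_measurable M"
  proof (rule borel_measurable_LIMSEQ_metric)
    have "z + hh n \<in> S" for n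
      using r hhr[of n] by (intro subsetD[OF r(2)]) (auto simp: dist_norm)
    then show "(\<lambda>x. (f x (z + hh n) - f x z) / hh n) \<in> borel_measurable M" for n
      using meas z by measurable
    fix x assume x: "x \<in> space M"
    have "(f x has_field_derivative deriv (f x) z) (at z)"
      by (rule holomorphic_derivI[OF hol[OF x] S z])
    then have "((\<lambda>h. (f x (z + h) - f x z) / h) \<longlongrightarrow> deriv (f x) z) (at 0)"
      by (simp add: DERIV_def)
    moreover have "filterlim hh (at 0) sequentially"
      using hhlim hh0 by (simp add: filterlim_at)
    ultimately show "(\<lambda>n. (f x (z + hh n) - f x z) / hh n) \<longlonglongrightarrow> deriv (f x) z"
      by (rule filterlim_compose)
  qed
  \<comment> \<open>A single fixed increment suffices to dominate the derivative: \<open>n0\<close>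
    times it is a combination of two values of \<open>f x\<close> and the remainder, all bounded by
    multiples of \<open>g x\<close>.\<close>
  define n0 where "n0 = hh 0"
  have n0: "n0 \<noteq> 0" "cmod n0 < r / 2" using hh0 hhr by (auto simp: n0_def)
  have int_d: "integrable M (\<lambda>x. deriv (f x) z)"
  proof (rule Bochner_Integration.integrable_bound[OF _ meas_d])
    define G where "G = (\<lambda>x. (g x + g x + 32 * g x / r\<^sup>2 * (cmod n0)\<^sup>2) / cmod n0)"
    show "integrable M G" unfolding G_def using g by simp
    show "AE x in M. norm (deriv (f x) z) \<le> norm (G x)"
    proof (rule AE_I2)
      fix x assume x: "x \<in> space M"
      have a: "cmod (f x (z + n0)) \<le> g x" "cmod (f x z) \<le> g x"
        using le[OF x, of "z + n0"] le[OF x, of z] n0 r by (auto simp: dist_norm)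
      have "cmod (n0 * deriv (f x) z) = cmod (f x (z + n0) - f x z - (f x (z + n0) - f x z - n0 * deriv (f x) z))"
        by simp
      also have "\<dots> \<le> cmod (f x (z + n0)) + cmod (f x z) + cmod (f x (z + n0) - f x z - n0 * deriv (f x) z)"
        by (smt (verit) norm_triangle_ineq4)
      also have "\<dots> \<le> g x + g x + 32 * g x / r\<^sup>2 * (cmod n0)\<^sup>2"
        using a rem[OF x n0(2)] by (intro add_mono)
      finally have "cmod (deriv (f x) z) \<le> G x"
        using n0 by (simp add: norm_mult G_def field_simps)
      then show "norm (deriv (f x) z) \<le> norm (G x)" by simp
    qed
  qed
  have "((\<lambda>z. LINT x|M. f x z) has_field_derivative (LINT x|M. deriv (f x) z)) (at z)"
  proof (rule has_field_derivative_quadratic)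
    show "r / 2 > 0" using r by simp
    fix h assume h: "cmod h < r / 2"
    have zh: "z + h \<in> ball z r" "z \<in> ball z r" using h r by (auto simp: dist_norm)
    have "(LINT x|M. f x (z + h)) - (LINT x|M. f x z) - h * (LINT x|M. deriv (f x) z)
        = (LINT x|M. f x (z + h) - f x z - h * deriv (f x) z)"
      using int[OF zh(1)] int[OF zh(2)] int_d by simp
    also have "cmod \<dots> \<le> (LINT x|M. 32 * g x / r\<^sup>2 * (cmod h)\<^sup>2)"
      by (rule order_trans[OF integral_norm_bound integral_mono])
        (use int[OF zh(1)] int[OF zh(2)] int_d g rem[OF _ h] in auto)
    also have "\<dots> = 32 * (LINT x|M. g x) / r\<^sup>2 * (cmod h)\<^sup>2" by simp
    finally show "cmod ((LINT x|M. f x (z + h)) - (LINT x|M. f x z) - h * (LINT x|M. deriv (f x) z))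
        \<le> 32 * (LINT x|M. g x) / r\<^sup>2 * (cmod h)\<^sup>2" .
  qed
  then show "(\<lambda>z. LINT x|M. f x z) field_differentiable at z within S"
    by (meson field_differentiable_at_within field_differentiable_def)
qed

section \<open>Absolutely convergent Laplace integrals\<close>

definition laplace_integrable :: "(real \<Rightarrow> complex) \<Rightarrow> real \<Rightarrow> bool" where
  "laplace_integrable f \<sigma> \<longleftrightarrow> f \<in> borel_measurable half_line \<and>
    integrable half_line (\<lambda>t. exp (- (\<sigma> * t)) * cmod (f t))"

definition laplace_integral :: "(real \<Rightarrow> complex) \<Rightarrow> complex \<Rightarrow> complex" where
  "laplace_integral f \<mu> = (LINT t|half_line. exp (- (\<mu> * of_real t)) * f t)"

lemma laplace_integrable_measurable: "laplace_integrable f \<sigma> \<Longrightarrow> f \<in> borel_measurable half_line"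
  by (simp add: laplace_integrable_def)

lemma cmod_exp_mult_real: "cmod (exp (- (\<mu> * of_real t))) = exp (- (Re \<mu> * t))"
  by simp

lemma measurable_exp_half_line [measurable]:
  "(\<lambda>t. exp (- (\<mu> * complex_of_real t))) \<in> borel_measurable half_line"
  by (intro continuous_half_line_measurable continuous_intros)

lemma laplace_integrableD:
  assumes "laplace_integrable f \<sigma>" "Re \<mu> \<ge> \<sigma>"
  shows "integrable half_line (\<lambda>t. exp (- (\<mu> * of_real t)) * f t)"
proof (rule half_line_dominated)
  have [measurable]: "f \<in> borel_measurable half_line"
    using assms(1) by (rule laplace_integrable_measurable)
  show "integrable half_line (\<lambda>t. exp (- (\<sigma> * t)) * cmod (f t))"
    using assms(1) by (simp add: laplace_integrable_def)
  show "(\<lambda>t. exp (- (\<mu> * of_real t)) * f t) \<in> borel_measurable half_line" by measurable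
  fix t :: real assume "t > 0"
  then have "exp (- (Re \<mu> * t)) \<le> exp (- (\<sigma> * t))" using assms(2) by simp
  then show "cmod (exp (- (\<mu> * of_real t)) * f t) \<le> exp (- (\<sigma> * t)) * cmod (f t)"
    by (simp add: norm_mult mult_right_mono)
qed

lemma laplace_integrableI:
  assumes "f \<in> borel_measurable half_line" "integrable half_line g"
    "\<And>t. t > 0 \<Longrightarrow> exp (- (\<sigma> * t)) * cmod (f t) \<le> g t"
  shows "laplace_integrable f \<sigma>"
  unfolding laplace_integrable_def
proof
  show "integrable half_line (\<lambda>t. exp (- (\<sigma> * t)) * cmod (f t))"
  proof (rule half_line_dominated[OF assms(2)])
    have "(\<lambda>t. exp (- (\<sigma> * t))) \<in> borel_measurable half_line"
      by (intro continuous_half_line_measurable continuous_intros)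
    then show "(\<lambda>t. exp (- (\<sigma> * t)) * cmod (f t)) \<in> borel_measurable half_line"
      using assms(1) by measurable
  qed (use assms(3) in auto)
qed (rule assms(1))

lemma laplace_integrable_bounded:
  assumes "f \<in> borel_measurable half_line" "\<And>t. t > 0 \<Longrightarrow> cmod (f t) \<le> K * exp (w * t)" "w < \<sigma>"
  shows "laplace_integrable f \<sigma>"
proof (rule laplace_integrableI[OF assms(1)])
  show "integrable half_line (\<lambda>t. K * exp (- ((\<sigma> - w) * t)))"
    using half_line_exp(1)[of "\<sigma> - w"] assms(3) by simp
  fix t :: real assume "t > 0"
  from mult_left_mono[OF assms(2)[OF this], of "exp (- (\<sigma> * t))"]
  show "exp (- (\<sigma> * t)) * cmod (f t) \<le> K * exp (- ((\<sigma> - w) * t))"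
    by (simp add: algebra_simps exp_diff exp_minus field_simps)
qed

lemma laplace_integrable_add:
  assumes "laplace_integrable f \<sigma>" "laplace_integrable g \<sigma>"
  shows "laplace_integrable (\<lambda>t. f t + g t) \<sigma>"
proof (rule laplace_integrableI)
  show "integrable half_line (\<lambda>t. exp (- (\<sigma> * t)) * cmod (f t) + exp (- (\<sigma> * t)) * cmod (g t))"
    using assms unfolding laplace_integrable_def by (intro Bochner_Integration.integrable_add) auto
  show "exp (- (\<sigma> * t)) * cmod (f t + g t) \<le> exp (- (\<sigma> * t)) * cmod (f t) + exp (- (\<sigma> * t)) * cmod (g t)" for t
    by (simp add: norm_triangle_ineq flip: distrib_left)
qed (use assms in \<open>auto simp: laplace_integrable_def\<close>)

lemma laplace_integrable_cmult:
  assumes "laplace_integrable f \<sigma>"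
  shows "laplace_integrable (\<lambda>t. c * f t) \<sigma>"
  using assms by (auto simp: laplace_integrable_def norm_mult mult.left_commute[of _ "cmod c"])

lemma laplace_integral_add:
  assumes "laplace_integrable f \<sigma>" "laplace_integrable g \<sigma>" "Re \<mu> \<ge> \<sigma>"
  shows "laplace_integral (\<lambda>t. f t + g t) \<mu> = laplace_integral f \<mu> + laplace_integral g \<mu>"
  using laplace_integrableD[OF assms(1,3)] laplace_integrableD[OF assms(2,3)]
  by (simp add: laplace_integral_def distrib_left)

lemma laplace_integral_cmult: "laplace_integral (\<lambda>t. c * f t) \<mu> = c * laplace_integral f \<mu>"
  by (simp add: laplace_integral_def mult.left_commute[of _ c])

lemma laplace_integral_cong: "(\<And>t. t > 0 \<Longrightarrow> f t = g t) \<Longrightarrow> laplace_integral f \<mu> = laplace_integral g \<mu>"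
  unfolding laplace_integral_def by (intro Bochner_Integration.integral_cong) auto

lemma laplace_integrable_cong:
  "(\<And>t. t > 0 \<Longrightarrow> f t = g t) \<Longrightarrow> laplace_integrable f \<sigma> \<longleftrightarrow> laplace_integrable g \<sigma>"
  unfolding laplace_integrable_def
  by (intro conj_cong measurable_cong Bochner_Integration.integrable_cong) auto

lemma laplace_integral_shift:
  "laplace_integral (\<lambda>t. exp (w * of_real t) * f t) \<mu> = laplace_integral f (\<mu> - w)"
  unfolding laplace_integral_def
  by (intro Bochner_Integration.integral_cong) (auto simp: algebra_simps simp flip: exp_add mult.assoc)

lemma laplace_integral_holomorphic:
  assumes "laplace_integrable f \<sigma>"
  shows "laplace_integral f holomorphic_on {\<mu>. Re \<mu> > \<sigma>}"
proof -
  have [measurable]: "f \<in> borel_measurable half_line" using assms by (rule laplace_integrable_measurable)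
  have "(\<lambda>\<mu>. LINT t|half_line. exp (- (\<mu> * of_real t)) * f t) holomorphic_on {\<mu>. Re \<mu> > \<sigma>}"
  proof (rule holomorphic_integral)
    show "open {\<mu>. Re \<mu> > \<sigma>}" by (rule open_halfspace_Re_gt)
    show "(\<lambda>t. exp (- (\<mu> * of_real t)) * f t) \<in> borel_measurable half_line" for \<mu> by measurable
    show "(\<lambda>\<mu>. exp (- (\<mu> * of_real t)) * f t) holomorphic_on {\<mu>. Re \<mu> > \<sigma>}" for t
      by (intro holomorphic_intros)
    fix \<mu> assume "\<mu> \<in> {\<mu>. Re \<mu> > \<sigma>}"
    define r where "r = Re \<mu> - \<sigma>"
    have r: "r > 0" using \<open>\<mu> \<in> _\<close> by (simp add: r_def)
    have sub: "Re w > \<sigma>" if "w \<in> ball \<mu> r" for w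
      using that abs_Re_le_cmod[of "\<mu> - w"] by (auto simp: r_def dist_norm)
    show "\<exists>r g. r > 0 \<and> ball \<mu> r \<subseteq> {\<mu>. Re \<mu> > \<sigma>} \<and> integrable half_line g \<and>
      (\<forall>t\<in>space half_line. \<forall>w\<in>ball \<mu> r. cmod (exp (- (w * of_real t)) * f t) \<le> g t)"
    proof (intro exI conjI ballI)
      show "integrable half_line (\<lambda>t. exp (- (\<sigma> * t)) * cmod (f t))"
        using assms by (simp add: laplace_integrable_def)
      fix t w assume "t \<in> space half_line" "w \<in> ball \<mu> r"
      with sub[of w] have "exp (- (Re w * t)) \<le> exp (- (\<sigma> * t))" by simp
      then show "cmod (exp (- (w * of_real t)) * f t) \<le> exp (- (\<sigma> * t)) * cmod (f t)"
        by (simp add: norm_mult mult_right_mono)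
    qed (use r sub in auto)
  qed
  then show ?thesis by (simp add: laplace_integral_def[abs_def])
qed

lemma laplace_integral_at_top:
  assumes "laplace_integrable f \<sigma>"
  shows "((\<lambda>r. laplace_integral f (of_real r)) \<longlongrightarrow> 0) at_top"
proof -
  have [measurable]: "f \<in> borel_measurable half_line" using assms by (rule laplace_integrable_measurable)
  have "((\<lambda>r. LINT t|half_line. exp (- (of_real r * of_real t)) * f t) \<longlongrightarrow> (LINT t|half_line. 0)) at_top"
  proof (rule integral_dominated_convergence_at_top)
    show "integrable half_line (\<lambda>t. exp (- (\<sigma> * t)) * cmod (f t))"
      using assms by (simp add: laplace_integrable_def)
    show "(\<lambda>t. exp (- (of_real r * of_real t)) * f t) \<in> borel_measurable half_line" for r :: real
      by measurable
    show "AE t in half_line. ((\<lambda>r. exp (- (of_real r * of_real t)) * f t) \<longlongrightarrow> 0) at_top"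
    proof (rule AE_half_lineI)
      fix t :: real assume t: "t > 0"
      have "((\<lambda>r. exp (- (r * t))) \<longlongrightarrow> 0) at_top" using t by real_asymp
      then have "((\<lambda>r. complex_of_real (exp (- (r * t))) * f t) \<longlongrightarrow> of_real 0 * f t) at_top"
        by (intro tendsto_intros)
      then show "((\<lambda>r. exp (- (of_real r * of_real t)) * f t) \<longlongrightarrow> 0) at_top"
        by (simp flip: of_real_mult of_real_minus exp_of_real)
    qed
    show "\<forall>\<^sub>F r in at_top. AE t in half_line. cmod (exp (- (of_real r * of_real t)) * f t) \<le> exp (- (\<sigma> * t)) * cmod (f t)"
      using eventually_ge_at_top[of \<sigma>]
    proof eventually_elim
      case (elim r)
      show ?case by (rule AE_half_lineI) (use elim in \<open>auto simp: norm_mult intro!: mult_right_mono\<close>)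
    qed
  qed simp
  then show ?thesis by (simp add: laplace_integral_def)
qed

subsection \<open>Uniqueness\<close>

text \<open>The positive and negative parts of \<open>g\<close> are densities of finite measures.
  The hypothesis says that these agree on all upper half-lines, hence everywhere, and equal measures
  have almost everywhere equal densities.\<close>

lemma AE_zero_of_upper_integrals:
  fixes g :: "real \<Rightarrow> real"
  assumes g: "integrable lborel g" and zero: "\<And>b. (LINT t:{b<..}|lborel. g t) = 0"
  shows "AE t in lborel. g t = 0"
proof -
  have [measurable]: "g \<in> borel_measurable lborel" using g by simp
  define P where "P = (\<lambda>t. ennreal (g t))"
  define N where "N = (\<lambda>t. ennreal (- g t))"
  have [measurable]: "P \<in> borel_measurable lborel" "N \<in> borel_measurable lborel"
    unfolding P_def N_def by measurable
  have em: "emeasure (density lborel (\<lambda>t. ennreal (f t))) {b<..} = ennreal (LINT t|lborel. max 0 (f t) * indicator {b<..} t)"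
    if f: "integrable lborel f" for f :: "real \<Rightarrow> real" and b
  proof -
    have [measurable]: "f \<in> borel_measurable lborel" using f by simp
    have i: "integrable lborel (\<lambda>t. max 0 (f t) * indicator {b<..} t)"
      by (rule Bochner_Integration.integrable_bound[OF f]) (measurable, auto simp: indicator_def)
    have "emeasure (density lborel (\<lambda>t. ennreal (f t))) {b<..} = (\<integral>\<^sup>+ t. ennreal (f t) * indicator {b<..} t \<partial>lborel)"
      by (rule emeasure_density) measurable
    also have "\<dots> = (\<integral>\<^sup>+ t. ennreal (max 0 (f t) * indicator {b<..} t) \<partial>lborel)"
      by (intro nn_integral_cong) (auto simp: indicator_def max_def ennreal_neg)
    also have "\<dots> = ennreal (LINT t|lborel. max 0 (f t) * indicator {b<..} t)"
      by (rule nn_integral_eq_integral[OF i]) (auto intro!: AE_I2 simp: indicator_def)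
    finally show ?thesis .
  qed
  have "density lborel P = density lborel N"
  proof (rule measure_eqI_lessThan)
    show "sets (density lborel P) = sets borel" "sets (density lborel N) = sets borel" by auto
    fix b
    show "emeasure (density lborel P) {b<..} < \<infinity>" unfolding P_def em[OF g] by simp
    have i: "integrable lborel (\<lambda>t. max 0 (g t) * indicator {b<..} t)"
      "integrable lborel (\<lambda>t. max 0 (- g t) * indicator {b<..} t)"
      by (rule Bochner_Integration.integrable_bound[OF g], measurable, auto simp: indicator_def)+
    have "0 = (LINT t|lborel. indicator {b<..} t * g t)"
      using zero[of b] by (simp add: set_lebesgue_integral_def)
    also have "\<dots> = (LINT t|lborel. max 0 (g t) * indicator {b<..} t - max 0 (- g t) * indicator {b<..} t)"
      by (intro Bochner_Integration.integral_cong) (auto simp: indicator_def max_def)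
    also have "\<dots> = (LINT t|lborel. max 0 (g t) * indicator {b<..} t) - (LINT t|lborel. max 0 (- g t) * indicator {b<..} t)"
      by (rule Bochner_Integration.integral_diff[OF i])
    finally show "emeasure (density lborel P) {b<..} = emeasure (density lborel N) {b<..}"
      unfolding P_def N_def using em[OF g, of b] em[of "\<lambda>t. - g t" b] g by simp
  qed
  then have "AE t in lborel. P t = N t"
    by (intro sigma_finite_measure.density_unique[OF lborel.sigma_finite_measure_axioms]) auto
  then show ?thesis
  proof eventually_elim
    case (elim t)
    then show ?case unfolding P_def N_def
      by (smt (verit) ennreal_neg ennreal_eq_0_iff)
  qed
qed

text \<open>The substitution \<open>x = exp (-t)\<close> turns vanishing of the transform at \<open>\<sigma> + n\<close> into vanishing of
  all moments of a density on \<open>[0, 1]\<close>.\<close>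

lemma laplace_moments_zero:
  fixes h :: "real \<Rightarrow> real"
  assumes h: "integrable half_line h" and zero: "\<And>n::nat. (LINT t|half_line. exp (- t) ^ n * h t) = 0"
  shows "AE t in half_line. h t = 0"
proof -
  have hm [measurable]: "h \<in> borel_measurable half_line" using h by simp
  have meas: "(\<lambda>t. u (exp (- t)) * h t) \<in> borel_measurable half_line" if "continuous_on UNIV u" for u :: "real \<Rightarrow> real"
  proof -
    have "(\<lambda>t. u (exp (- t))) \<in> borel_measurable half_line"
      by (intro continuous_half_line_measurable continuous_on_compose2[OF that] continuous_intros) auto
    then show ?thesis by measurable
  qed
  have bd: "integrable half_line (\<lambda>t. u (exp (- t)) * h t)"
    if u: "continuous_on UNIV u" "\<And>x. x \<in> {0..1} \<Longrightarrow> \<bar>u x\<bar> \<le> B" for u :: "real \<Rightarrow> real" and B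
  proof (rule half_line_dominated[OF _ meas[OF u(1)]])
    show "integrable half_line (\<lambda>t. B * \<bar>h t\<bar>)" using h by simp
    show "norm (u (exp (- t)) * h t) \<le> B * \<bar>h t\<bar>" if "t > 0" for t
      using u(2)[of "exp (- t)"] that by (simp add: abs_mult mult_right_mono)
  qed
  have poly: "(LINT t|half_line. g (exp (- t)) * h t) = 0" if g: "real_polynomial_function g" for g
  proof -
    obtain a n where "g = (\<lambda>x. \<Sum>i\<le>n. a i * x ^ i)" using g by (auto simp: real_polynomial_function_iff_sum)
    moreover have "integrable half_line (\<lambda>t. exp (- t) ^ i * h t)" for i
      by (rule bd[where B=1]) (auto intro!: continuous_intros power_le_one simp: abs_le_iff)
    ultimately show ?thesis
      using zero by (simp add: sum_distrib_right mult.assoc)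
  qed
  have cont: "(LINT t|half_line. u (exp (- t)) * h t) = 0"
    if u: "continuous_on UNIV u" for u :: "real \<Rightarrow> real"
  proof -
    define I where "I = (LINT t|half_line. \<bar>h t\<bar>)"
    have I: "I \<ge> 0" unfolding I_def by (rule integral_nonneg_AE) simp
    have "bounded (u ` {0..1})"
      by (intro compact_imp_bounded compact_continuous_image continuous_on_subset[OF u]) auto
    then obtain B where B: "\<And>x. x \<in> {0..1} \<Longrightarrow> \<bar>u x\<bar> \<le> B" unfolding bounded_iff by fastforce
    have "\<bar>LINT t|half_line. u (exp (- t)) * h t\<bar> \<le> e" if e: "e > 0" for e
    proof -
      define d where "d = e / (I + 1)"
      have d: "d > 0" using e I by (simp add: d_def)
      obtain g where g: "real_polynomial_function g" "\<And>x. x \<in> {0..1} \<Longrightarrow> \<bar>u x - g x\<bar> < d"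
        using Stone_Weierstrass_real_polynomial_function[of "{0..1::real}" u d] d
          continuous_on_subset[OF u, of "{0..1}"] by auto
      have gc: "continuous_on UNIV g"
        using g(1) continuous_on_polymonial_function real_polynomial_function_eq by blast
      have "bounded (g ` {0..1})"
        by (intro compact_imp_bounded compact_continuous_image continuous_on_subset[OF gc]) auto
      then obtain B' where B': "\<And>x. x \<in> {0..1} \<Longrightarrow> \<bar>g x\<bar> \<le> B'" unfolding bounded_iff by fastforce
      have "(LINT t|half_line. u (exp (- t)) * h t) = (LINT t|half_line. u (exp (- t)) * h t - g (exp (- t)) * h t)"
        using poly[OF g(1)] bd[OF u B] bd[OF gc B'] by simp
      also have "\<bar>\<dots>\<bar> \<le> (LINT t|half_line. d * \<bar>h t\<bar>)"
      proof (rule half_line_norm_le[where 'b=real, unfolded real_norm_def])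
        fix t :: real assume "t > 0"
        then have "\<bar>u (exp (- t)) - g (exp (- t))\<bar> \<le> d" using g(2)[of "exp (- t)"] by simp
        then show "\<bar>u (exp (- t)) * h t - g (exp (- t)) * h t\<bar> \<le> d * \<bar>h t\<bar>"
          by (simp add: abs_mult mult_right_mono flip: left_diff_distrib)
      qed (use h in simp)
      also have "\<dots> = d * I" by (simp add: I_def)
      also have "\<dots> \<le> e" using e I by (simp add: d_def field_simps)
      finally show ?thesis .
    qed
    then have "\<bar>LINT t|half_line. u (exp (- t)) * h t\<bar> \<le> 0" by (rule field_le_epsilon) auto
    then show ?thesis by simp
  qed
  define g where "g = (\<lambda>t. indicator {0<..} t * h t)"
  have g: "integrable lborel g" using h by (simp add: half_line_integrable_iff set_integrable_def g_def)
  have "(LINT t:{b<..}|lborel. g t) = 0" for b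
  proof -
    \<comment> \<open>Clipped ramps in the variable \<open>x = exp (- t)\<close>: they converge to
      the indicator of \<open>x < exp (- b)\<close>, which is that of \<open>t > b\<close>.\<close>
    define u where "u = (\<lambda>m::nat. \<lambda>x. min 1 (max 0 (real m * (exp (- b) - x))))"
    have u: "continuous_on UNIV (u m)" "\<And>x. \<bar>u m x\<bar> \<le> 1" for m
      unfolding u_def by (auto intro!: continuous_intros)
    have lim: "(\<lambda>m. u m (exp (- t))) \<longlonglongrightarrow> indicator {b<..} t" for t
    proof (cases "t > b")
      case True
      have "filterlim (\<lambda>m. real m * (exp (- b) - exp (- t))) at_top sequentially"
        using True by (intro filterlim_tendsto_pos_mult_at_top[OF tendsto_const, of "exp (- b) - exp (- t)", unfolded mult.commute[of "exp (- b) - exp (- t)"]] filterlim_real_sequentially) auto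
      then have "\<forall>\<^sub>F m in sequentially. real m * (exp (- b) - exp (- t)) \<ge> 1"
        by (simp add: filterlim_at_top)
      then have "\<forall>\<^sub>F m in sequentially. u m (exp (- t)) = 1" by eventually_elim (simp add: u_def)
      then show ?thesis using True by (simp add: tendsto_eventually)
    next
      case False
      then have "real m * (exp (- b) - exp (- t)) \<le> 0" for m by (simp add: mult_nonneg_nonpos)
      then have "u m (exp (- t)) = 0" for m by (simp add: u_def max_absorb1)
      then show ?thesis using False by simp
    qed
    have "(\<lambda>m. LINT t|half_line. u m (exp (- t)) * h t) \<longlonglongrightarrow> (LINT t|half_line. indicator {b<..} t * h t)"
    proof (rule integral_dominated_convergence)
      show "integrable half_line (\<lambda>t. \<bar>h t\<bar>)" using h by simp
      show "(\<lambda>t. indicator {b<..} t * h t) \<in> borel_measurable half_line"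
        by (intro borel_measurable_times hm borel_measurable_half_line) simp
      show "AE t in half_line. (\<lambda>m. u m (exp (- t)) * h t) \<longlonglongrightarrow> indicator {b<..} t * h t"
        using lim by (intro AE_I2 tendsto_mult tendsto_const) auto
      show "AE t in half_line. norm (u m (exp (- t)) * h t) \<le> \<bar>h t\<bar>" for m
        using mult_right_mono[OF u(2)] by (intro AE_I2) (simp add: abs_mult)
    qed (rule meas[OF u(1)])
    then have "(LINT t|half_line. indicator {b<..} t * h t) = 0"
      using cont[OF u(1)] LIMSEQ_const_iff[of 0] by (simp add: LIMSEQ_const_iff)
    moreover have "(LINT t|half_line. indicator {b<..} t * h t) = (LINT t:{b<..}|lborel. g t)"
      unfolding half_line_integral set_lebesgue_integral_def g_def
      by (intro Bochner_Integration.integral_cong) auto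
    ultimately show ?thesis by simp
  qed
  then have "AE t in lborel. g t = 0" by (rule AE_zero_of_upper_integrals[OF g])
  then show ?thesis unfolding AE_half_line_iff by eventually_elim (auto simp: g_def)
qed

text \<open>After weighting with the exponential of rate \<open>\<sigma> + 1\<close>, the moments in
  \<open>exp (- t)\<close> are the values of the transform at \<open>\<sigma> + 1 + n\<close>. The
  extra 1 keeps all these points strictly to the right of \<open>\<sigma>\<close>.\<close>

lemma laplace_unique_AE:
  assumes f: "laplace_integrable f \<sigma>" and zero: "\<And>r::real. r > \<sigma> \<Longrightarrow> laplace_integral f (of_real r) = 0"
  shows "AE t in half_line. f t = 0"
proof -
  define h where "h = (\<lambda>t. exp (- (of_real (\<sigma> + 1) * of_real t)) * f t)"
  have h: "integrable half_line h" unfolding h_def by (rule laplace_integrableD[OF f]) simp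
  have [measurable]: "h \<in> borel_measurable half_line" using h by simp
  have ib: "integrable half_line (\<lambda>t. complex_of_real (exp (- t) ^ n) * h t)" for n
  proof (rule half_line_dominated[of "\<lambda>t. cmod (h t)"])
    show "(\<lambda>t. complex_of_real (exp (- t) ^ n) * h t) \<in> borel_measurable half_line"
      by (intro borel_measurable_times borel_measurable_integrable[OF h] continuous_half_line_measurable continuous_intros)
    show "norm (complex_of_real (exp (- t) ^ n) * h t) \<le> cmod (h t)" if "t > 0" for t
      using that by (simp add: norm_mult norm_power mult_left_le_one_le power_le_one)
  qed (use h in simp)
  have z: "(LINT t|half_line. complex_of_real (exp (- t) ^ n) * h t) = 0" for n
  proof -
    have "(LINT t|half_line. complex_of_real (exp (- t) ^ n) * h t) = laplace_integral f (of_real (\<sigma> + 1 + real n))"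
      unfolding laplace_integral_def h_def
      by (intro Bochner_Integration.integral_cong refl)
        (auto simp: exp_of_real[symmetric] exp_of_nat_mult[symmetric] algebra_simps simp flip: exp_add mult.assoc)
    then show ?thesis using zero[of "\<sigma> + 1 + real n"] by simp
  qed
  have "AE t in half_line. Re (h t) = 0"
  proof (rule laplace_moments_zero)
    show "(LINT t|half_line. exp (- t) ^ n * Re (h t)) = 0" for n
      using integral_Re[OF ib[of n]] z[of n] by simp
  qed (use h in simp)
  moreover have "AE t in half_line. Im (h t) = 0"
  proof (rule laplace_moments_zero)
    show "(LINT t|half_line. exp (- t) ^ n * Im (h t)) = 0" for n
      using integral_Im[OF ib[of n]] z[of n] by simp
  qed (use h in simp)
  ultimately show ?thesis
  proof eventually_elim
    case (elim t)
    then have "h t = 0" by (simp add: complex_eq_iff)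
    then show ?case by (simp add: h_def)
  qed
qed

lemma AE_zero_continuous:
  fixes f :: "real \<Rightarrow> complex"
  assumes f: "continuous_on {0<..} f" and ae: "AE t in half_line. f t = 0" and t: "t > 0"
  shows "f t = 0"
proof (rule ccontr)
  assume ft: "f t \<noteq> 0"
  have "isCont f t" using f t by (simp add: continuous_on_eq_continuous_at)
  then have "\<forall>\<^sub>F s in nhds t. f s \<noteq> 0"
    using ft tendsto_imp_eventually_ne by (metis isCont_def tendsto_at_iff_tendsto_nhds)
  then obtain d where d: "d > 0" "\<And>s. dist s t < d \<Longrightarrow> f s \<noteq> 0"
    unfolding eventually_nhds_metric by auto
  define e where "e = min d t"
  have e: "e > 0" using d t by (simp add: e_def)
  have "AE s in lborel. s \<notin> {t - e<..<t + e}"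
    using ae unfolding AE_half_line_iff
  proof eventually_elim
    case (elim s)
    show ?case
    proof
      assume "s \<in> {t - e<..<t + e}"
      then have "dist s t < d" "s > 0" by (auto simp: e_def dist_real_def)
      then show False using elim d(2) by simp
    qed
  qed
  then have "{t - e<..<t + e} \<in> null_sets lborel" by (simp add: AE_iff_null_sets)
  then have "emeasure lborel {t - e<..<t + e} = 0" by auto
  then show False using e by simp
qed

lemma laplace_unique:
  assumes "laplace_integrable f \<sigma>" "laplace_integrable g \<sigma>" "continuous_on {0<..} f" "continuous_on {0<..} g"
    and eq: "\<And>r::real. r > \<sigma> \<Longrightarrow> laplace_integral f (of_real r) = laplace_integral g (of_real r)"
    and t: "t > 0"
  shows "f t = g t"
proof -
  have g': "laplace_integrable (\<lambda>t. (-1) * g t) \<sigma>" by (rule laplace_integrable_cmult[OF assms(2)])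
  have "f t + (-1) * g t = 0"
  proof (rule AE_zero_continuous[OF _ laplace_unique_AE[where \<sigma>=\<sigma>] t])
    show "laplace_integrable (\<lambda>t. f t + (-1) * g t) \<sigma>" by (rule laplace_integrable_add[OF assms(1) g'])
    show "laplace_integral (\<lambda>t. f t + (-1) * g t) (of_real r) = 0" if "r > \<sigma>" for r
      using that eq[OF that] laplace_integral_cmult[of "-1" g]
      by (subst laplace_integral_add[OF assms(1) g']) auto
  qed (intro continuous_intros assms)
  then show ?thesis by simp
qed

section \<open>Sectors\<close>

lemma sector_polarI:
  assumes "r > 0" "\<bar>\<phi>\<bar> < \<theta>" "\<theta> \<le> pi"
  shows "of_real r * cis \<phi> \<in> sector \<theta>"
proof -
  have "Arg (of_real r * cis \<phi>) = \<phi>"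
    by (rule Arg_unique'[of r]) (use assms in \<open>auto simp: cis_conv_exp rcis_def\<close>)
  then show ?thesis using assms by (auto simp: sector_def)
qed

lemma sector_polarE:
  assumes "z \<in> sector \<theta>"
  obtains r \<phi> where "r > 0" "\<bar>\<phi>\<bar> < \<theta>" "z = of_real r * cis \<phi>"
proof
  show "cmod z > 0" "\<bar>Arg z\<bar> < \<theta>" using assms by (auto simp: sector_def)
  show "z = of_real (cmod z) * cis (Arg z)" using rcis_cmod_Arg[of z] by (simp add: rcis_def)
qed

lemma sector_nonzero: "z \<in> sector \<theta> \<Longrightarrow> z \<noteq> 0"
  by (simp add: sector_def)

lemma sector_mono: "\<theta> \<le> \<theta>' \<Longrightarrow> sector \<theta> \<subseteq> sector \<theta>'"
  by (auto simp: sector_def)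

lemma sector_scale: "z \<in> sector \<theta> \<Longrightarrow> r > 0 \<Longrightarrow> of_real r * z \<in> sector \<theta>"
  by (simp add: sector_def Arg_times_of_real)

lemma of_real_in_sector: "r > 0 \<Longrightarrow> \<theta> > 0 \<Longrightarrow> of_real r \<in> sector \<theta>"
  by (simp add: sector_def Arg_of_real)

lemma sector_divide:
  assumes "z \<in> sector a" "w \<in> sector b" "a + b \<le> pi"
  shows "z / w \<in> sector (a + b)"
proof -
  obtain r \<phi> where z: "r > 0" "\<bar>\<phi>\<bar> < a" "z = of_real r * cis \<phi>" using assms(1) by (rule sector_polarE)
  obtain s \<psi> where w: "s > 0" "\<bar>\<psi>\<bar> < b" "w = of_real s * cis \<psi>" using assms(2) by (rule sector_polarE)
  have "of_real (r / s) * cis (\<phi> - \<psi>) \<in> sector (a + b)"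
    by (rule sector_polarI) (use z w assms(3) in auto)
  also have "of_real (r / s) * cis (\<phi> - \<psi>) = z / w" using z w by (simp add: cis_divide[symmetric])
  finally show ?thesis .
qed

lemma open_sector:
  assumes "\<theta> \<le> pi"
  shows "open (sector \<theta>)"
proof -
  have "sector \<theta> = (- \<real>\<^sub>\<le>\<^sub>0) \<inter> Arg -` {- \<theta><..<\<theta>}"
  proof (intro equalityI subsetI)
    fix z assume z: "z \<in> sector \<theta>"
    have "z \<notin> \<real>\<^sub>\<le>\<^sub>0"
    proof
      assume "z \<in> \<real>\<^sub>\<le>\<^sub>0"
      then have "Re z < 0 \<and> Im z = 0"
        using sector_nonzero[OF z] by (auto simp: complex_nonpos_Reals_iff complex_eq_iff)
      then have "Arg z = pi" by (simp add: Arg_eq_pi)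
      then show False using z assms by (simp add: sector_def)
    qed
    then show "z \<in> (- \<real>\<^sub>\<le>\<^sub>0) \<inter> Arg -` {- \<theta><..<\<theta>}" using z by (auto simp: sector_def)
  qed (auto simp: sector_def)
  moreover have "open ((- \<real>\<^sub>\<le>\<^sub>0) \<inter> Arg -` {- \<theta><..<\<theta>})"
    by (intro continuous_open_preimage continuous_at_imp_continuous_on ballI continuous_at_Arg) auto
  ultimately show ?thesis by simp
qed

lemma connected_sector:
  assumes "\<theta> \<le> pi"
  shows "connected (sector \<theta>)"
proof -
  have "sector \<theta> = (\<lambda>(r, \<phi>). of_real r * cis \<phi>) ` ({0<..} \<times> {- \<theta><..<\<theta>})"
  proof (intro equalityI subsetI)
    fix z assume "z \<in> sector \<theta>"
    then obtain r \<phi> where "r > 0" "\<bar>\<phi>\<bar> < \<theta>" "z = of_real r * cis \<phi>" by (rule sector_polarE)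
    then show "z \<in> (\<lambda>(r, \<phi>). of_real r * cis \<phi>) ` ({0<..} \<times> {- \<theta><..<\<theta>})"
      by (intro image_eqI[of _ _ "(r, \<phi>)"]) auto
  qed (use assms in \<open>auto intro!: sector_polarI\<close>)
  moreover have "connected ((\<lambda>(r, \<phi>). complex_of_real r * cis \<phi>) ` ({0<..} \<times> {- \<theta><..<\<theta>}))"
    unfolding case_prod_unfold
    by (intro connected_continuous_image continuous_intros convex_connected convex_Times) auto
  ultimately show ?thesis by simp
qed

lemma Arg_halfplane:
  assumes "Re (z * cis \<psi>) > 0" "\<bar>\<psi>\<bar> \<le> pi / 2"
  shows "\<bar>Arg z\<bar> < pi / 2 + \<bar>\<psi>\<bar>"
proof (rule ccontr)
  assume neg: "\<not> ?thesis"
  define \<phi> where "\<phi> = Arg z"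
  have z: "z = of_real (cmod z) * cis \<phi>" using rcis_cmod_Arg[of z] by (simp add: rcis_def \<phi>_def)
  have "z * cis \<psi> = of_real (cmod z) * cis (\<phi> + \<psi>)" by (subst z) (simp add: cis_mult mult.assoc)
  then have "cmod z * cos (\<phi> + \<psi>) > 0" using assms(1) by simp
  then have pos: "cos (\<phi> + \<psi>) > 0" by (simp add: zero_less_mult_iff)
  have bd: "- pi < \<phi>" "\<phi> \<le> pi" using Arg_bounded[of z] by (auto simp: \<phi>_def)
  have *: "cos x \<le> 0" if "pi / 2 \<le> x" "x \<le> 3 * pi / 2" for x
  proof -
    have "0 \<le> cos (x - pi)" by (rule cos_ge_zero) (use that in auto)
    then show ?thesis by (simp add: cos_diff)
  qed
  show False
  proof (cases "\<phi> \<ge> 0")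
    case True
    then have "pi / 2 \<le> \<phi> + \<psi>" "\<phi> + \<psi> \<le> 3 * pi / 2"
      using neg bd assms(2) unfolding \<phi>_def[symmetric] by linarith+
    then show False using * pos by (meson not_le)
  next
    case False
    then have "pi / 2 \<le> - (\<phi> + \<psi>)" "- (\<phi> + \<psi>) \<le> 3 * pi / 2"
      using neg bd assms(2) unfolding \<phi>_def[symmetric] by linarith+
    then have "cos (- (\<phi> + \<psi>)) \<le> 0" by (rule *)
    then show False using pos by (metis cos_minus not_le)
  qed
qed

text \<open>Replaces a condition on arguments by the sign of a real part, which is linear in
  \<open>z\<close> and thus easily checked along rays and cones.\<close>

lemma halfplane_in_sector:
  assumes "Re (z * cis \<psi>) > 0" "\<bar>\<psi>\<bar> \<le> \<delta>" "\<delta> \<le> pi / 2"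
  shows "z \<in> sector (pi / 2 + \<delta>)"
  using Arg_halfplane[OF assms(1)] assms by (auto simp: sector_def)

lemma cos_add_pi_half: "cos (pi / 2 + x) = - sin x" for x :: real
  by (simp add: cos_add)

lemma sin_add_pi_half: "sin (pi / 2 + x) = cos x" for x :: real
  by (simp add: sin_add)

section \<open>Rotation of rays\<close>

lemma half_line_set_integrable:
  fixes f :: "real \<Rightarrow> 'b::{banach, second_countable_topology}"
  shows "integrable half_line f \<longleftrightarrow> set_integrable lborel {0..} f"
    and "(LINT t|half_line. f t) = (LINT t:{0..}|lborel. f t)"
  unfolding half_line_integrable_iff half_line_integral
  by (rule set_integrable_discrete_difference[of "{0}"] set_integral_discrete_difference[of "{0}"]; auto)+

lemma half_line_integral_limit:
  fixes f :: "real \<Rightarrow> complex"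
  assumes "integrable half_line f"
  shows "((\<lambda>R. integral {0..R} f) \<longlongrightarrow> (LINT t|half_line. f t)) at_top"
proof -
  have i: "set_integrable lborel {0..} f" using assms by (simp add: half_line_set_integrable)
  have "((\<lambda>R. LINT t:{0..R}|lborel. f t) \<longlongrightarrow> (LINT t:{0..}|lborel. f t)) at_top"
    by (rule tendsto_set_lebesgue_integral_at_top[OF _ i]) auto
  moreover have "(LINT t:{0..R}|lborel. f t) = integral {0..R} f" for R
    by (rule set_borel_integral_eq_integral(2)[OF set_integrable_subset[OF i]]) auto
  ultimately show ?thesis by (simp add: half_line_set_integrable)
qed

lemma has_contour_integral_ray:
  assumes R: "R > 0" and f: "continuous_on {0..R} (\<lambda>t. f (c + of_real t * u))"
  shows "(f has_contour_integral u * integral {0..R} (\<lambda>t. f (c + of_real t * u))) (linepath c (c + of_real R * u))"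
proof -
  define I where "I = integral {0..R} (\<lambda>t. f (c + of_real t * u))"
  have "((\<lambda>t. f (c + of_real t * u)) has_integral I) {0..R}"
    unfolding I_def by (intro integrable_integral integrable_continuous_interval f)
  then have "((\<lambda>t. f (c + of_real (R * t) * u)) has_integral (1 / \<bar>R\<bar>) *\<^sub>R I) ((\<lambda>t. t / R) ` {0..R})"
    using R by (intro has_integral_stretch_real) auto
  moreover have "(\<lambda>t. t / R) ` {0..R} = {0..1}"
    using R by (auto simp: image_iff field_simps intro!: bexI[of _ "_ * R"])
  ultimately have "((\<lambda>t. f (c + of_real (R * t) * u) * (of_real R * u)) has_integral ((1 / \<bar>R\<bar>) *\<^sub>R I) * (of_real R * u)) {0..1}"
    by (intro has_integral_mult_left) simp
  then show ?thesis
    unfolding has_contour_integral_linepath I_def[symmetric] using R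
    by (simp add: linepath_def algebra_simps scaleR_conv_of_real)
qed

text \<open>Cauchy's theorem on the triangle with vertices \<open>0\<close>, \<open>R u\<close> and
  \<open>R v\<close>. The hypothesis on \<open>d\<close> keeps the third side at distance at least
  \<open>R d\<close> from the origin; its length is at most \<open>2 * R\<close> and the integrand
  decays quadratically, so its contribution vanishes as \<open>R\<close> grows.\<close>

lemma ray_rotation:
  fixes f :: "complex \<Rightarrow> complex"
  defines "K u v \<equiv> {of_real a * u + of_real b * v | a b. a \<ge> 0 \<and> b \<ge> (0::real)}"
  assumes u: "cmod u = 1" and v: "cmod v = 1" and d: "d > 0"
    and chord: "\<And>s. 0 \<le> s \<Longrightarrow> s \<le> 1 \<Longrightarrow> d \<le> cmod (of_real (1 - s) * u + of_real s * v)"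
    and cont: "continuous_on (K u v) f" and hol: "f holomorphic_on U" "open U" "K u v - {0} \<subseteq> U"
    and bound: "\<And>z. z \<in> K u v \<Longrightarrow> cmod (f z) \<le> B / (1 + (cmod z)\<^sup>2)"
  shows "integrable half_line (\<lambda>t. f (of_real t * u))"
    and "integrable half_line (\<lambda>t. f (of_real t * v))"
    and "u * (LINT t|half_line. f (of_real t * u)) = v * (LINT t|half_line. f (of_real t * v))"
proof -
  have uK: "of_real t * u \<in> K u v" and vK: "of_real t * v \<in> K u v" if "t \<ge> 0" for t
  proof -
    show "of_real t * u \<in> K u v" unfolding K_def
      by (rule CollectI, rule exI[of _ t], rule exI[of _ 0]) (use that in simp)
    show "of_real t * v \<in> K u v" unfolding K_def
      by (rule CollectI, rule exI[of _ 0], rule exI[of _ t]) (use that in simp)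
  qed
  have cont_u: "continuous_on {0..} (\<lambda>t. f (of_real t * u))" and cont_v: "continuous_on {0..} (\<lambda>t. f (of_real t * v))"
    by (rule continuous_on_compose2[OF cont]; use uK vK in \<open>auto intro!: continuous_intros\<close>)+
  have sq: "integrable half_line (\<lambda>t. B * (1 / (1 + t\<^sup>2)))"
    by (rule integrable_mult_right[OF half_line_inverse_square])
  show iu: "integrable half_line (\<lambda>t. f (of_real t * u))"
    by (rule half_line_dominated[OF sq])
      (use bound[OF uK] u in \<open>auto intro!: continuous_half_line_measurable continuous_on_subset[OF cont_u] simp: norm_mult\<close>)
  show iv: "integrable half_line (\<lambda>t. f (of_real t * v))"
    by (rule half_line_dominated[OF sq])
      (use bound[OF vK] v in \<open>auto intro!: continuous_half_line_measurable continuous_on_subset[OF cont_v] simp: norm_mult\<close>)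
  have B: "B \<ge> 0" using order_trans[OF norm_ge_zero bound[OF uK[of 0]]] by simp
  define D where "D = (\<lambda>R. u * integral {0..R} (\<lambda>t. f (of_real t * u)) - v * integral {0..R} (\<lambda>t. f (of_real t * v)))"
  have Dle: "cmod (D R) \<le> B / (1 + (R * d)\<^sup>2) * (2 * R)" if R: "R > 0" for R
  proof -
    define p q where "p = of_real R * u" and "q = of_real R * v"
    have hull: "convex hull {0, p, q} \<subseteq> K u v"
      unfolding convex_hull_3 K_def p_def q_def using R
      by (auto simp: scaleR_conv_of_real) (metis (no_types, lifting) less_le mult.assoc mult_nonneg_nonneg of_real_mult)
    have seg: "closed_segment p q \<subseteq> K u v"
      using hull by (meson convex_hull_subset hull_subset insert_subset order_trans closed_segment_subset_convex_hull in_mono insertCI hull_inc)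
    \<comment> \<open>The vertex \<open>0\<close> is an exceptional point, since \<open>f\<close> is
      assumed merely continuous there.\<close>
    have "(f has_contour_integral 0) (linepath 0 p +++ linepath p q +++ linepath q 0)"
    proof (rule Cauchy_theorem_triangle_cofinite)
      show "continuous_on (convex hull {0, p, q}) f" by (rule continuous_on_subset[OF cont hull])
      show "f field_differentiable (at z)" if "z \<in> interior (convex hull {0, p, q}) - {0}" for z
        using that hull interior_subset hol
        by (meson DiffD1 DiffD2 DiffI holomorphic_on_imp_differentiable_at subsetD)
    qed simp
    moreover have 1: "(f has_contour_integral u * integral {0..R} (\<lambda>t. f (of_real t * u))) (linepath 0 p)"
      using has_contour_integral_ray[of R f 0 u] R continuous_on_subset[OF cont_u, of "{0..R}"]
      by (auto simp: p_def)
    moreover have 2: "(f has_contour_integral v * integral {0..R} (\<lambda>t. f (of_real t * v))) (linepath 0 q)"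
      using has_contour_integral_ray[of R f 0 v] R continuous_on_subset[OF cont_v, of "{0..R}"]
      by (auto simp: q_def)
    moreover have 3: "(f has_contour_integral - (v * integral {0..R} (\<lambda>t. f (of_real t * v)))) (linepath q 0)"
      using has_contour_integral_reversepath[OF valid_path_linepath 2] by simp
    moreover have 4: "f contour_integrable_on linepath p q"
      by (rule contour_integrable_continuous_linepath[OF continuous_on_subset[OF cont seg]])
    moreover have "(f has_contour_integral (u * integral {0..R} (\<lambda>t. f (of_real t * u)) +
        (contour_integral (linepath p q) f + - (v * integral {0..R} (\<lambda>t. f (of_real t * v))))))
        (linepath 0 p +++ linepath p q +++ linepath q 0)"
      by (intro has_contour_integral_join 1 3 has_contour_integral_integral 4 valid_path_join) auto
    ultimately have "D R + contour_integral (linepath p q) f = 0"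
      unfolding D_def by (metis (no_types, lifting) ab_group_add_class.ab_diff_conv_add_uminus add.commute add.left_commute contour_integral_unique)
    then have "cmod (D R) = cmod (contour_integral (linepath p q) f)"
      by (metis add_eq_0_iff norm_minus_cancel)
    also have "\<dots> \<le> B / (1 + (R * d)\<^sup>2) * cmod (q - p)"
    proof (rule contour_integral_bound_linepath[OF 4])
      show "0 \<le> B / (1 + (R * d)\<^sup>2)" using B by simp
      fix z assume z: "z \<in> closed_segment p q"
      then obtain s where s: "0 \<le> s" "s \<le> 1" "z = (1 - s) *\<^sub>R p + s *\<^sub>R q" by (auto simp: closed_segment_def)
      have "z = of_real R * (of_real (1 - s) * u + of_real s * v)"
        unfolding s(3) p_def q_def by (simp add: scaleR_conv_of_real algebra_simps)
      then have "R * d \<le> cmod z" using chord[OF s(1,2)] R by (simp add: norm_mult)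
      then have "(R * d)\<^sup>2 \<le> (cmod z)\<^sup>2" using R d by (intro power_mono) auto
      then have "B / (1 + (cmod z)\<^sup>2) \<le> B / (1 + (R * d)\<^sup>2)"
        using B by (intro divide_left_mono) (auto intro!: add_pos_nonneg mult_pos_pos)
      then show "cmod (f z) \<le> B / (1 + (R * d)\<^sup>2)" using bound[of z] seg z by force
    qed
    finally have bd: "cmod (D R) \<le> B / (1 + (R * d)\<^sup>2) * cmod (q - p)" .
    have "cmod (q - p) \<le> 2 * R"
      using norm_triangle_ineq4[of q p] R u v by (simp add: p_def q_def norm_mult)
    then have "B / (1 + (R * d)\<^sup>2) * cmod (q - p) \<le> B / (1 + (R * d)\<^sup>2) * (2 * R)"
      using B by (intro mult_left_mono) auto
    with bd show ?thesis by linarith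
  qed
  have "((\<lambda>R. B / (1 + (R * d)\<^sup>2) * (2 * R)) \<longlongrightarrow> 0) at_top"
    using d by real_asymp
  then have "(D \<longlongrightarrow> 0) at_top"
    by (rule Lim_null_comparison[rotated]) (use Dle in \<open>auto intro: eventually_mono[OF eventually_gt_at_top[of 0]]\<close>)
  moreover have "(D \<longlongrightarrow> u * (LINT t|half_line. f (of_real t * u)) - v * (LINT t|half_line. f (of_real t * v))) at_top"
    unfolding D_def by (intro tendsto_intros half_line_integral_limit iu iv)
  ultimately have "u * (LINT t|half_line. f (of_real t * u)) - v * (LINT t|half_line. f (of_real t * v)) = 0"
    using tendsto_unique[OF trivial_limit_at_top_linorder] by blast
  then show "u * (LINT t|half_line. f (of_real t * u)) = v * (LINT t|half_line. f (of_real t * v))" by simp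
qed

section \<open>Cauchy's formula on wedges\<close>

text \<open>Cauchy's formula on a triangle with one side on the vertical line and its apex far to
  the right. The slanted sides have length of order \<open>R\<close> and the integrand is of order
  \<open>1 / R\<^sup>2\<close>. Writing the denominator as \<open>m - z\<close> absorbs the sign
  from traversing the vertical side upwards.\<close>

lemma cauchy_vertical_line:
  fixes F :: "complex \<Rightarrow> complex"
  assumes F: "F holomorphic_on {z. Re z > 0}" and bound: "\<And>z. Re z > 0 \<Longrightarrow> cmod (F z) \<le> M / cmod z"
    and c: "0 < c" "c < m"
    and int: "integrable half_line (\<lambda>t. F (of_real c + of_real t * \<i>) / (of_real m - (of_real c + of_real t * \<i>)))"
      "integrable half_line (\<lambda>t. F (of_real c + of_real t * (- \<i>)) / (of_real m - (of_real c + of_real t * (- \<i>))))"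
  shows "\<i> * (LINT t|half_line. F (of_real c + of_real t * \<i>) / (of_real m - (of_real c + of_real t * \<i>)))
    - (- \<i>) * (LINT t|half_line. F (of_real c + of_real t * (- \<i>)) / (of_real m - (of_real c + of_real t * (- \<i>))))
    = 2 * of_real pi * \<i> * F (of_real m)"
proof -
  define f where "f = (\<lambda>z. F z / (of_real m - z))"
  have fc: "continuous_on ({z. Re z > 0} - {of_real m}) f"
    unfolding f_def
    by (intro continuous_intros continuous_on_subset[OF holomorphic_on_imp_continuous_on[OF F]]) auto
  have M: "M \<ge> 0" using bound[of 1] norm_ge_zero[of "F 1"] by (metis div_by_1 dual_order.trans norm_one one_complex.sel(1) zero_less_one)
  define J where "J = (\<lambda>u R. u * integral {0..R} (\<lambda>t. f (of_real c + of_real t * u)))"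
  have key: "cmod (J \<i> R - J (- \<i>) R - 2 * of_real pi * \<i> * F (of_real m)) \<le>
      2 * (4 * M / (R - (m - c))\<^sup>2 * (2 * R))" if R: "R > 2 * m" for R
  proof -
    define p q w where "p = Complex c (- R)" and "q = Complex (c + R) 0" and "w = Complex c R"
    have Rpos: "R > 0" "R > m" using R c by auto
    have seg1: "closed_segment p q \<subseteq> {z. Re z > 0} - {of_real m}"
      and seg2: "closed_segment q w \<subseteq> {z. Re z > 0} - {of_real m}"
      and seg3: "closed_segment w p \<subseteq> {z. Re z > 0} - {of_real m}"
      and far1: "\<And>z. z \<in> closed_segment p q \<Longrightarrow> R - (m - c) \<le> 2 * cmod (of_real m - z) \<and> R - (m - c) \<le> 2 * cmod z"
      and far2: "\<And>z. z \<in> closed_segment q w \<Longrightarrow> R - (m - c) \<le> 2 * cmod (of_real m - z) \<and> R - (m - c) \<le> 2 * cmod z"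
    proof -
      have pq: "Re z - c = R + Im z \<and> Im z \<le> 0 \<and> Re z \<ge> c" if "z \<in> closed_segment p q" for z
      proof -
        obtain t where t: "0 \<le> t" "t \<le> 1" "z = (1 - t) *\<^sub>R p + t *\<^sub>R q" using \<open>z \<in> _\<close> by (auto simp: closed_segment_def)
        have "Re z = c + t * R" "Im z = t * R - R" unfolding t(3) by (simp_all add: p_def q_def algebra_simps)
        moreover have "0 \<le> t * R" "t * R \<le> R" using t Rpos by (auto simp: mult_left_le_one_le)
        ultimately show ?thesis by simp
      qed
      have qw: "Re z - c = R - Im z \<and> Im z \<ge> 0 \<and> Re z \<ge> c" if "z \<in> closed_segment q w" for z
      proof -
        obtain t where t: "0 \<le> t" "t \<le> 1" "z = (1 - t) *\<^sub>R q + t *\<^sub>R w" using \<open>z \<in> _\<close> by (auto simp: closed_segment_def)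
        have "Re z = c + R - t * R" "Im z = t * R" unfolding t(3) by (simp_all add: w_def q_def algebra_simps)
        moreover have "0 \<le> t * R" "t * R \<le> R" using t Rpos by (auto simp: mult_left_le_one_le)
        ultimately show ?thesis by simp
      qed
      have wp: "Re z = c" if "z \<in> closed_segment w p" for z
      proof -
        obtain t where t: "z = (1 - t) *\<^sub>R w + t *\<^sub>R p" using \<open>z \<in> _\<close> by (auto simp: closed_segment_def)
        show ?thesis unfolding t by (simp add: p_def w_def algebra_simps)
      qed
      \<comment> \<open>On the slanted sides \<open>Re z + \<bar>Im z\<bar> = R + c\<close>. Real
        and imaginary part are each at most the modulus, so their sum costs the factor 2.\<close>
      have far: "R - (m - c) \<le> 2 * cmod (of_real m - z) \<and> R - (m - c) \<le> 2 * cmod z"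
        if "Re z - c = R - \<bar>Im z\<bar>" "Re z \<ge> c" for z
      proof
        have "\<bar>Re (of_real m - z)\<bar> \<le> cmod (of_real m - z)" "\<bar>Im (of_real m - z)\<bar> \<le> cmod (of_real m - z)"
          "\<bar>Re z\<bar> \<le> cmod z" "\<bar>Im z\<bar> \<le> cmod z"
          by (rule abs_Re_le_cmod abs_Im_le_cmod)+
        then have "\<bar>m - Re z\<bar> \<le> cmod (of_real m - z)" "\<bar>Im z\<bar> \<le> cmod (of_real m - z)"
          "\<bar>Re z\<bar> \<le> cmod z" "\<bar>Im z\<bar> \<le> cmod z" by auto
        then show "R - (m - c) \<le> 2 * cmod (of_real m - z)" "R - (m - c) \<le> 2 * cmod z"
          using that c by linarith+
      qed
      show "closed_segment p q \<subseteq> {z. Re z > 0} - {of_real m}"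
        using pq c Rpos by fastforce
      show "closed_segment q w \<subseteq> {z. Re z > 0} - {of_real m}"
        using qw c Rpos by fastforce
      show "closed_segment w p \<subseteq> {z. Re z > 0} - {of_real m}"
        using wp c by fastforce
      show "R - (m - c) \<le> 2 * cmod (of_real m - z) \<and> R - (m - c) \<le> 2 * cmod z" if "z \<in> closed_segment p q" for z
        using pq[OF that] by (intro far) auto
      show "R - (m - c) \<le> 2 * cmod (of_real m - z) \<and> R - (m - c) \<le> 2 * cmod z" if "z \<in> closed_segment q w" for z
        using qw[OF that] by (intro far) auto
    qed
    have inhull: "of_real m \<in> convex hull {p, q, w}"
    proof -
      \<comment> \<open>The weight \<open>l\<close> of the apex is fixed by the real part
        \<open>m\<close>; the two vertices on the line share the remainder equally, so the imaginary
        parts cancel.\<close>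
      define l where "l = (m - c) / R"
      have l: "0 \<le> l" "l \<le> 1" "l * R = m - c" using Rpos c by (auto simp: l_def)
      have "of_real m = ((1 - l) / 2) *\<^sub>R p + l *\<^sub>R q + ((1 - l) / 2) *\<^sub>R w"
        using l by (auto simp: complex_eq_iff p_def q_def w_def field_simps)
      then show ?thesis unfolding convex_hull_3 using l
        by (intro CollectI exI[of _ "(1 - l) / 2"] exI[of _ l] exI[of _ "(1 - l) / 2"]) auto
    qed
    have "of_real m \<in> interior (convex hull {p, q, w})"
      using inhull seg1 seg2 seg3 by (auto simp: interior_of_triangle)
    then have wn: "winding_number (linepath p q +++ linepath q w +++ linepath w p) (of_real m) = 1"
      using Rpos c by (auto simp: winding_number_triangle p_def q_def)
    have "((\<lambda>z. F z / (z - of_real m)) has_contour_integral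
        (of_real (2 * pi) * \<i> * winding_number (linepath p q +++ linepath q w +++ linepath w p) (of_real m) * F (of_real m)))
        (linepath p q +++ linepath q w +++ linepath w p)"
    proof (rule Cauchy_integral_formula_convex_simple[OF _ F])
      show "convex {z. Re z > 0}" by (rule convex_halfspace_Re_gt)
      show "of_real m \<in> interior {z. Re z > 0}"
        using c by (simp add: interior_open open_halfspace_Re_gt)
      show "path_image (linepath p q +++ linepath q w +++ linepath w p) \<subseteq> {z. Re z > 0} - {of_real m}"
        using seg1 seg2 seg3 by (simp add: path_image_join)
    qed auto
    then have "((\<lambda>z. - (F z / (z - of_real m))) has_contour_integral
        - (2 * of_real pi * \<i> * F (of_real m))) (linepath p q +++ linepath q w +++ linepath w p)"
      unfolding wn by (intro has_contour_integral_neg) simp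
    moreover have "(\<lambda>z. - (F z / (z - of_real m))) = f"
      unfolding f_def by (auto simp: fun_eq_iff minus_divide_right)
    ultimately have tot: "(f has_contour_integral - (2 * of_real pi * \<i> * F (of_real m)))
        (linepath p q +++ linepath q w +++ linepath w p)" by simp
    have i1: "f contour_integrable_on linepath p q" and i2: "f contour_integrable_on linepath q w"
      and i3: "f contour_integrable_on linepath w p"
      by (rule contour_integrable_continuous_linepath continuous_on_subset[OF fc] seg1 seg2 seg3)+
    have "(f has_contour_integral (contour_integral (linepath p q) f + (contour_integral (linepath q w) f + contour_integral (linepath w p) f)))
        (linepath p q +++ linepath q w +++ linepath w p)"
      by (intro has_contour_integral_join has_contour_integral_integral i1 i2 i3 valid_path_join) auto
    with tot have sum: "contour_integral (linepath p q) f + (contour_integral (linepath q w) f + contour_integral (linepath w p) f)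
        = - (2 * of_real pi * \<i> * F (of_real m))"
      by (metis contour_integral_unique)
    have mid: "of_real c \<in> closed_segment p w"
      unfolding closed_segment_def p_def w_def by (auto intro!: exI[of _ "1/2"] simp: complex_eq_iff)
    have split: "contour_integral (linepath p w) f = contour_integral (linepath p (of_real c)) f + contour_integral (linepath (of_real c) w) f"
    proof (rule contour_integral_split_linepath[OF _ mid])
      show "continuous_on (closed_segment p w) f"
        by (rule continuous_on_subset[OF fc]) (use seg3 in \<open>simp add: closed_segment_commute\<close>)
    qed
    have ray: "contour_integral (linepath (of_real c) (of_real c + of_real R * u)) f = J u R"
      if "u = \<i> \<or> u = - \<i>" for u
      unfolding J_def
      by (intro contour_integral_unique has_contour_integral_ray Rpos continuous_on_compose2[OF fc] continuous_intros)
        (use that c in \<open>auto simp: complex_eq_iff\<close>)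
    have pw: "p = of_real c + of_real R * (- \<i>)" "w = of_real c + of_real R * \<i>"
      by (auto simp: p_def w_def complex_eq_iff)
    have ext: "contour_integral (linepath w p) f = - (J \<i> R - J (- \<i>) R)"
    proof -
      have "contour_integral (linepath w p) f = - contour_integral (linepath p w) f"
        by (metis contour_integral_reversepath reversepath_linepath valid_path_linepath)
      moreover have "contour_integral (linepath p (of_real c)) f = - contour_integral (linepath (of_real c) p) f"
        by (metis contour_integral_reversepath reversepath_linepath valid_path_linepath)
      ultimately show ?thesis using split ray[of \<i>] ray[of "- \<i>"] unfolding pw by simp
    qed
    have eq: "J \<i> R - J (- \<i>) R - 2 * of_real pi * \<i> * F (of_real m)
        = contour_integral (linepath p q) f + contour_integral (linepath q w) f"
      using sum unfolding ext by (simp add: algebra_simps)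
    define E where "E = 4 * M / (R - (m - c))\<^sup>2"
    have gap: "R - (m - c) > 0" using R c by simp
    have E: "E \<ge> 0" using M by (simp add: E_def)
    have fb: "cmod (f z) \<le> E"
      if far: "R - (m - c) \<le> 2 * cmod (of_real m - z) \<and> R - (m - c) \<le> 2 * cmod z" and "Re z > 0" for z
    proof -
      have p1: "cmod z > 0" "cmod (of_real m - z) > 0" using far gap by linarith+
      have "(R - (m - c)) * (R - (m - c)) \<le> (2 * cmod z) * (2 * cmod (of_real m - z))"
        using far gap by (intro mult_mono) auto
      then have *: "(R - (m - c))\<^sup>2 \<le> 4 * (cmod z * cmod (of_real m - z))" by (simp add: power2_eq_square)
      have "cmod (f z) \<le> M / cmod z / cmod (of_real m - z)"
        unfolding f_def norm_divide using bound[OF that(2)] by (intro divide_right_mono) auto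
      also have "\<dots> = 4 * M / (4 * (cmod z * cmod (of_real m - z)))" by simp
      also have "\<dots> \<le> E" unfolding E_def
        using * M gap p1 by (intro divide_left_mono) auto
      finally show ?thesis .
    qed
    have "cmod (contour_integral (linepath p q) f) \<le> E * cmod (q - p)"
      by (rule contour_integral_bound_linepath[OF i1 E]) (use far1 fb seg1 in blast)
    moreover have "cmod (contour_integral (linepath q w) f) \<le> E * cmod (w - q)"
      by (rule contour_integral_bound_linepath[OF i2 E]) (use far2 fb seg2 in blast)
    moreover have "cmod (q - p) \<le> 2 * R" "cmod (w - q) \<le> 2 * R"
      using cmod_le[of "q - p"] cmod_le[of "w - q"] Rpos by (auto simp: p_def q_def w_def)
    ultimately have "cmod (contour_integral (linepath p q) f) \<le> E * (2 * R)"
      "cmod (contour_integral (linepath q w) f) \<le> E * (2 * R)"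
      using E by (meson mult_left_mono order_trans)+
    then show ?thesis unfolding eq E_def[symmetric]
      using norm_triangle_ineq[of "contour_integral (linepath p q) f" "contour_integral (linepath q w) f"] by linarith
  qed
  define L where "L = \<i> * (LINT t|half_line. f (of_real c + of_real t * \<i>)) - (- \<i>) * (LINT t|half_line. f (of_real c + of_real t * (- \<i>)))"
  have "((\<lambda>R. J \<i> R - J (- \<i>) R) \<longlongrightarrow> L) at_top"
    unfolding J_def L_def
    by (intro tendsto_intros half_line_integral_limit) (use int in \<open>simp_all add: f_def\<close>)
  then have "((\<lambda>R. J \<i> R - J (- \<i>) R - 2 * of_real pi * \<i> * F (of_real m)) \<longlongrightarrow> L - 2 * of_real pi * \<i> * F (of_real m)) at_top"
    by (intro tendsto_intros)
  moreover have "((\<lambda>R. J \<i> R - J (- \<i>) R - 2 * of_real pi * \<i> * F (of_real m)) \<longlongrightarrow> 0) at_top"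
  proof (rule Lim_null_comparison)
    show "\<forall>\<^sub>F R in at_top. norm (J \<i> R - J (- \<i>) R - 2 * of_real pi * \<i> * F (of_real m)) \<le> 2 * (4 * M / (R - (m - c))\<^sup>2 * (2 * R))"
      using key by (auto intro: eventually_mono[OF eventually_gt_at_top[of "2 * m"]])
    show "((\<lambda>R. 2 * (4 * M / (R - (m - c))\<^sup>2 * (2 * R))) \<longlongrightarrow> 0) at_top" by real_asymp
  qed
  ultimately have "L - 2 * of_real pi * \<i> * F (of_real m) = 0"
    using tendsto_unique[OF trivial_limit_at_top_linorder] by blast
  then show ?thesis by (simp add: L_def f_def)
qed

section \<open>Laplace inversion on sectors\<close>

text \<open>The bound is on \<open>\<mu> * Q \<mu>\<close> because this quantity is unaffected by
  dilations; the inversion integral inherits a bound that does not depend on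
  \<open>cmod z\<close>.\<close>

definition sectorial :: "(complex \<Rightarrow> complex) \<Rightarrow> real \<Rightarrow> real \<Rightarrow> bool" where
  "sectorial Q \<eta> M \<longleftrightarrow> Q holomorphic_on sector (pi / 2 + \<eta>) \<and>
    (\<forall>\<mu>\<in>sector (pi / 2 + \<eta>). cmod (\<mu> * Q \<mu>) \<le> M)"

lemma sectorial_mono: "sectorial Q \<eta> M \<Longrightarrow> \<eta>' \<le> \<eta> \<Longrightarrow> sectorial Q \<eta>' M"
  unfolding sectorial_def using sector_mono[of "pi / 2 + \<eta>'" "pi / 2 + \<eta>"] holomorphic_on_subset by auto

lemma sectorial_bound: "sectorial Q \<eta> M \<Longrightarrow> \<mu> \<in> sector (pi / 2 + \<eta>) \<Longrightarrow> cmod (Q \<mu>) \<le> M / cmod \<mu>"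
  using sector_nonzero[of \<mu>] by (auto simp: sectorial_def norm_mult field_simps)

lemma sectorial_nonneg: "sectorial Q \<eta> M \<Longrightarrow> 0 < \<eta> \<Longrightarrow> M \<ge> 0"
  using of_real_in_sector[of 1 "pi / 2 + \<eta>"] unfolding sectorial_def
  by (metis add_pos_pos norm_ge_zero order_trans pi_half_gt_zero zero_less_one)

text \<open>The direction of one boundary ray of a wedge around the positive axis. It leans into the
  left half-plane by the angle \<open>\<delta>\<close>, so an exponential decays along it at the
  rate \<open>sin \<delta>\<close>.\<close>

definition edge :: "real \<Rightarrow> real \<Rightarrow> bool" where
  "edge \<delta> \<theta> \<longleftrightarrow> 0 < \<delta> \<and> \<delta> < pi / 2 \<and> (\<theta> = pi / 2 + \<delta> \<or> \<theta> = - (pi / 2 + \<delta>))"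

lemma edge_trig: "edge \<delta> \<theta> \<Longrightarrow> cos \<theta> = - sin \<delta>" "edge \<delta> \<theta> \<Longrightarrow> \<bar>sin \<theta>\<bar> = cos \<delta>"
  "edge \<delta> \<theta> \<Longrightarrow> sin \<delta> > 0" "edge \<delta> \<theta> \<Longrightarrow> cos \<delta> > 0"
proof -
  assume e: "edge \<delta> \<theta>"
  show "cos \<delta> > 0" by (rule cos_gt_zero_pi) (use e in \<open>auto simp: edge_def\<close>)
  moreover have "\<theta> = pi / 2 + \<delta> \<or> \<theta> = - (pi / 2 + \<delta>)" using e by (simp add: edge_def)
  ultimately show "\<bar>sin \<theta>\<bar> = cos \<delta>" "cos \<theta> = - sin \<delta>"
    by (elim disjE; simp add: cos_add_pi_half sin_add_pi_half del: minus_add_distrib)+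
  show "sin \<delta> > 0" by (rule sin_gt_zero) (use e pi_half_less_two in \<open>auto simp: edge_def\<close>)
qed

lemma edge_point:
  assumes e: "edge \<delta> \<theta>" and c: "c > 0" and s: "s \<ge> 0"
  shows "of_real c + of_real s * cis \<theta> \<in> sector (pi / 2 + \<delta>)"
    and "c * cos \<delta> \<le> cmod (of_real c + of_real s * cis \<theta>)"
    and "s * cos \<delta> \<le> cmod (of_real c + of_real s * cis \<theta>)"
proof -
  define p where "p = of_real c + of_real s * cis \<theta>"
  \<comment> \<open>Rotating by \<open>\<psi>\<close> makes the edge vertical: the real part has the
    constant value \<open>c * cos \<delta>\<close> along it, which gives both the sector and the
    distance from 0.\<close>
  define \<psi> where "\<psi> = (if \<theta> = pi / 2 + \<delta> then - \<delta> else \<delta>)"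
  have \<psi>: "\<bar>\<psi>\<bar> = \<delta>" "cos (\<theta> + \<psi>) = 0" "cos \<psi> = cos \<delta>"
    using e by (auto simp: \<psi>_def edge_def)
  have "Re (p * cis \<psi>) = c * cos \<psi> + s * (cos \<theta> * cos \<psi> - sin \<theta> * sin \<psi>)"
    by (simp add: p_def algebra_simps)
  also have "\<dots> = c * cos \<delta>" unfolding cos_add[symmetric] by (simp add: \<psi>)
  finally have re: "Re (p * cis \<psi>) = c * cos \<delta>" .
  show "p \<in> sector (pi / 2 + \<delta>)"
    by (rule halfplane_in_sector[of _ \<psi>]) (use re c edge_trig(4)[OF e] \<psi> e in \<open>auto simp: edge_def\<close>)
  show "c * cos \<delta> \<le> cmod p"
    using complex_Re_le_cmod[of "p * cis \<psi>"] re by (simp add: norm_mult)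
  have "\<bar>Im p\<bar> = s * cos \<delta>" using s edge_trig(2)[OF e] by (simp add: p_def abs_mult)
  then show "s * cos \<delta> \<le> cmod p" using abs_Im_le_cmod[of p] by simp
qed

text \<open>The average of the two lower bounds of \<open>edge_point\<close>, one constant and one
  linear in \<open>s\<close>, arranged as a multiple of \<open>1 + s\<close>.\<close>

lemma edge_point_large:
  assumes e: "edge \<delta> \<theta>" and c: "c > 0" and s: "s \<ge> 0"
  shows "cos \<delta> * min 1 c / 2 * (1 + s) \<le> cmod (of_real c + of_real s * cis \<theta>)"
proof -
  have "cos \<delta> * min 1 c / 2 * (1 + s) = cos \<delta> * (min 1 c / 2) + cos \<delta> * (min 1 c / 2 * s)"
    by (simp add: algebra_simps)
  also have "\<dots> \<le> cos \<delta> * (c / 2) + cos \<delta> * (s / 2)"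
  proof (intro add_mono mult_left_mono)
    show "min 1 c / 2 * s \<le> s / 2" using s c mult_right_mono[of "min 1 c" 1 s] by simp
  qed (use edge_trig(4)[OF e] in auto)
  also have "\<dots> \<le> cmod (of_real c + of_real s * cis \<theta>)"
    using edge_point(2,3)[OF assms] by (simp add: algebra_simps)
  finally show ?thesis .
qed

text \<open>Turns the edge through \<open>c\<close> onto a vertical half-line. The cone in between
  lies to the left of \<open>c\<close>, so it avoids the pole at \<open>m\<close>, and on it the
  decay of \<open>Q\<close> together with that of the Cauchy kernel is quadratic, as
  \<open>ray_rotation\<close> requires.\<close>

lemma edge_cauchy:
  assumes e: "edge \<delta> \<theta>" and Q: "sectorial Q \<delta> M" and c: "0 < c" "c < m"
  defines "f \<equiv> \<lambda>w. Q (of_real c + w) / (of_real m - (of_real c + w))" and "\<epsilon> \<equiv> of_real (sgn \<theta>) * \<i>"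
  shows "integrable half_line (\<lambda>t. f (of_real t * cis \<theta>))"
    and "integrable half_line (\<lambda>t. f (of_real t * \<epsilon>))"
    and "cis \<theta> * (LINT t|half_line. f (of_real t * cis \<theta>)) = \<epsilon> * (LINT t|half_line. f (of_real t * \<epsilon>))"
proof -
  define g where "g = sgn \<theta>"
  have g: "g = 1 \<or> g = -1" using e by (auto simp: g_def edge_def sgn_if)
  have trig: "cos \<theta> = - sin \<delta>" "sin \<theta> = g * cos \<delta>" "sin \<delta> > 0" "cos \<delta> > 0"
    using edge_trig[OF e] e by (auto simp: g_def edge_def sgn_if cos_add_pi_half sin_add_pi_half simp del: minus_add_distrib)
  have cis_\<theta>: "cis \<theta> = Complex (- sin \<delta>) (g * cos \<delta>)" using trig by (simp add: complex_eq_iff)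
  have \<epsilon>: "\<epsilon> = Complex 0 g" by (simp add: \<epsilon>_def g_def complex_eq_iff)
  define K where "K = {of_real a * cis \<theta> + of_real b * \<epsilon> | a b. a \<ge> 0 \<and> b \<ge> (0::real)}"
  have M: "M \<ge> 0" using sectorial_nonneg[OF Q] e by (simp add: edge_def)
  \<comment> \<open>The distance of the vertex \<open>c\<close> from the points \<open>0\<close> and
    \<open>m\<close>. Near the vertex it bounds the denominators from below, farther out
    \<open>cmod w\<close> does; hence the maxima that follow.\<close>
  define k where "k = min c (m - c)"
  have k: "k > 0" "k \<le> c" "k \<le> m - c" using c by (auto simp: k_def)
  have K: "Re w \<le> 0 \<and> of_real c + w \<in> sector (pi / 2 + \<delta>) \<and>
      cos \<delta> * max k (cmod w) \<le> cmod (of_real c + w) \<and> max k (cmod w) \<le> cmod (of_real m - (of_real c + w))"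
    if "w \<in> K" for w
  proof -
    obtain a b where ab: "a \<ge> 0" "b \<ge> 0" "w = of_real a * cis \<theta> + of_real b * \<epsilon>"
      using \<open>w \<in> K\<close> by (auto simp: K_def)
    have Re_w: "Re w = - (a * sin \<delta>)" and Im_w: "Im w = g * (a * cos \<delta> + b)"
      using ab by (auto simp: cis_\<theta> \<epsilon> algebra_simps)
    have Re_le: "Re w \<le> 0" unfolding Re_w using ab(1) trig by simp
    have re: "Re ((of_real c + w) * cis (- g * \<delta>)) = c * cos \<delta> + b * sin \<delta>"
      using g Re_w Im_w by (auto simp: algebra_simps)
    have bs: "b * sin \<delta> \<ge> 0" using ab trig by simp
    have "of_real c + w \<in> sector (pi / 2 + \<delta>)"
      by (rule halfplane_in_sector[of _ "- g * \<delta>"])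
        (use re bs mult_pos_pos[OF c(1) trig(4)] g e in \<open>auto simp: edge_def\<close>)
    moreover have far: "c * cos \<delta> \<le> cmod (of_real c + w)"
      using complex_Re_le_cmod[of "(of_real c + w) * cis (- g * \<delta>)"] re bs by (simp add: norm_mult)
    moreover have "cos \<delta> * cmod w \<le> cmod (of_real c + w)"
    proof -
      have "cmod w \<le> a + b"
        using norm_triangle_ineq[of "of_real a * cis \<theta>" "of_real b * \<epsilon>"] ab g
        by (auto simp: norm_mult \<epsilon>_def g_def[symmetric])
      then have "cos \<delta> * cmod w \<le> cos \<delta> * (a + b)" using trig by (intro mult_left_mono) auto
      also have "\<dots> \<le> a * cos \<delta> + b" using ab mult_right_le_one_le[of b "cos \<delta>"] trig
        by (simp add: algebra_simps mult_left_le_one_le)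
      also have "\<dots> \<le> \<bar>Im (of_real c + w)\<bar>" using Im_w g ab trig by auto
      also have "\<dots> \<le> cmod (of_real c + w)" by (rule abs_Im_le_cmod)
      finally show ?thesis .
    qed
    moreover have "cmod w \<le> cmod (of_real m - (of_real c + w))"
      unfolding cmod_def using c Re_le
      by (intro real_sqrt_le_mono) (auto intro!: power_mono simp: power2_le_iff_abs_le abs_le_square_iff[symmetric])
    moreover have "m - c \<le> cmod (of_real m - (of_real c + w))"
      using complex_Re_le_cmod[of "of_real m - (of_real c + w)"] Re_le by simp
    moreover have "cos \<delta> * k \<le> cmod (of_real c + w)"
      by (rule order_trans[OF _ far]) (use k trig in \<open>simp add: mult.commute\<close>)
    ultimately show ?thesis using Re_le k trig
      by (auto simp: max_def mult.commute)
  qed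
  \<comment> \<open>With \<open>x = max k (cmod w)\<close> the integrand is at most
    \<open>M / (cos \<delta> * x\<^sup>2)\<close>, and \<open>min 1 (k\<^sup>2) * (1 + (cmod
    w)\<^sup>2) \<le> 2 * x\<^sup>2\<close>; this explains the 2 and the minimum.\<close>
  define B where "B = 2 * M / (cos \<delta> * min 1 (k\<^sup>2))"
  have bound: "cmod (f w) \<le> B / (1 + (cmod w)\<^sup>2)" if "w \<in> K" for w
  proof -
    define x where "x = max k (cmod w)"
    have x: "x > 0" using k by (simp add: x_def)
    have x1: "cos \<delta> * x \<le> cmod (of_real c + w)" "x \<le> cmod (of_real m - (of_real c + w))"
      using K[OF that] by (auto simp: x_def)
    have min: "min 1 (k\<^sup>2) * (1 + (cmod w)\<^sup>2) \<le> 2 * x\<^sup>2"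
    proof -
      have "min 1 (k\<^sup>2) * (1 + (cmod w)\<^sup>2) = min 1 (k\<^sup>2) + min 1 (k\<^sup>2) * (cmod w)\<^sup>2" by (simp add: algebra_simps)
      also have "\<dots> \<le> k\<^sup>2 + 1 * (cmod w)\<^sup>2" by (intro add_mono mult_right_mono) auto
      also have "\<dots> \<le> x\<^sup>2 + x\<^sup>2" using k by (intro add_mono) (auto intro!: power_mono simp: x_def)
      finally show ?thesis by simp
    qed
    have "cmod (f w) \<le> M / cmod (of_real c + w) / cmod (of_real m - (of_real c + w))"
      unfolding f_def norm_divide using sectorial_bound[OF Q] K[OF that] by (intro divide_right_mono) auto
    also have "\<dots> \<le> M / (cos \<delta> * x) / x"
      using x1 x M trig by (intro frac_le divide_nonneg_nonneg) (auto intro!: mult_pos_pos)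
    also have "\<dots> = 2 * M / (cos \<delta> * (2 * x\<^sup>2))" by (simp add: power2_eq_square)
    also have "\<dots> \<le> 2 * M / (cos \<delta> * (min 1 (k\<^sup>2) * (1 + (cmod w)\<^sup>2)))"
      using min M k trig x by (intro divide_left_mono mult_left_mono mult_pos_pos) (auto intro!: add_pos_nonneg)
    finally show ?thesis by (simp add: B_def)
  qed
  have sub: "\<delta> \<le> pi / 2" using e by (simp add: edge_def)
  define U where "U = ((+) (of_real c)) -` sector (pi / 2 + \<delta>) \<inter> {w. w \<noteq> of_real (m - c)}"
  have U: "open U"
    unfolding U_def using sub
    by (intro open_Int open_vimage open_sector open_Collect_neq continuous_intros) auto
  have KU: "K \<subseteq> U"
    using K c unfolding U_def by fastforce
  have fU: "f holomorphic_on U"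
  proof -
    have "(Q \<circ> (\<lambda>w. of_real c + w)) holomorphic_on U"
    proof (rule holomorphic_on_compose_gen)
      show "Q holomorphic_on sector (pi / 2 + \<delta>)" using Q by (simp add: sectorial_def)
    qed (auto simp: U_def intro!: holomorphic_intros)
    then have "(\<lambda>w. Q (of_real c + w)) holomorphic_on U" by (simp add: o_def)
    moreover have "(\<lambda>w. of_real m - (of_real c + w)) holomorphic_on U" by (intro holomorphic_intros)
    ultimately show ?thesis
      unfolding f_def by (rule holomorphic_on_divide) (auto simp: U_def algebra_simps)
  qed
  have Kcont: "continuous_on K f"
    by (rule continuous_on_subset[OF holomorphic_on_imp_continuous_on[OF fU] KU])
  have chord: "cos \<delta> \<le> cmod (of_real (1 - s) * cis \<theta> + of_real s * \<epsilon>)" if "0 \<le> s" "s \<le> 1" for s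
  proof -
    have "cos \<delta> = (1 - s) * cos \<delta> + s * cos \<delta>" by (simp add: algebra_simps)
    also have "\<dots> \<le> (1 - s) * cos \<delta> + s * 1" using that by (intro add_mono mult_left_mono) auto
    also have "\<dots> = \<bar>Im (of_real (1 - s) * cis \<theta> + of_real s * \<epsilon>)\<bar>"
    proof -
      have "Im (of_real (1 - s) * cis \<theta> + of_real s * \<epsilon>) = g * ((1 - s) * cos \<delta> + s * 1)"
        by (simp add: cis_\<theta> \<epsilon> algebra_simps)
      moreover have "(1 - s) * cos \<delta> + s * 1 \<ge> 0" using that trig by simp
      moreover have "\<bar>g\<bar> = 1" using g by auto
      ultimately show ?thesis by (simp add: abs_mult)
    qed
    also have "\<dots> \<le> cmod (of_real (1 - s) * cis \<theta> + of_real s * \<epsilon>)" by (rule abs_Im_le_cmod)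
    finally show ?thesis .
  qed
  have n\<epsilon>: "cmod \<epsilon> = 1" using g by (auto simp: \<epsilon>_def g_def[symmetric] norm_mult)
  note rot = ray_rotation[of "cis \<theta>" \<epsilon> "cos \<delta>" f U B, folded K_def, OF _ n\<epsilon> trig(4) chord Kcont fU U _ bound]
  show "integrable half_line (\<lambda>t. f (of_real t * cis \<theta>))" by (rule rot(1)) (use KU in auto)
  show "integrable half_line (\<lambda>t. f (of_real t * \<epsilon>))" by (rule rot(2)) (use KU in auto)
  show "cis \<theta> * (LINT t|half_line. f (of_real t * cis \<theta>)) = \<epsilon> * (LINT t|half_line. f (of_real t * \<epsilon>))"
    by (rule rot(3)) (use KU in auto)
qed

text \<open>Once both edges are turned onto the vertical line through \<open>c\<close>, the formula
  for that line applies. The lower edge is subtracted because the wedge is run through from bottom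
  to top.\<close>

lemma wedge_cauchy:
  assumes \<delta>: "0 < \<delta>" "\<delta> < pi / 2" and Q: "sectorial Q \<delta> M" and c: "0 < c" "c < m"
  defines "J \<equiv> \<lambda>\<theta>. cis \<theta> * (LINT t|half_line. Q (of_real c + of_real t * cis \<theta>) / (of_real m - (of_real c + of_real t * cis \<theta>)))"
  shows "J (pi / 2 + \<delta>) - J (- (pi / 2 + \<delta>)) = 2 * of_real pi * \<i> * Q (of_real m)"
proof -
  have e: "edge \<delta> (pi / 2 + \<delta>)" "edge \<delta> (- (pi / 2 + \<delta>))" using \<delta> by (auto simp: edge_def)
  have sgn: "sgn (pi / 2 + \<delta>) = 1" "sgn (- (pi / 2 + \<delta>)) = - 1"
    using \<delta> pi_gt_zero by (auto simp: sgn_if)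
  note c1 = edge_cauchy[OF e(1) Q c, unfolded sgn] and c2 = edge_cauchy[OF e(2) Q c, unfolded sgn]
  have hp: "{z. Re z > 0} \<subseteq> sector (pi / 2 + \<delta>)"
    using halfplane_in_sector[of _ 0 \<delta>] \<delta> by auto
  have main: "\<i> * (LINT t|half_line. Q (of_real c + of_real t * \<i>) / (of_real m - (of_real c + of_real t * \<i>)))
    - (- \<i>) * (LINT t|half_line. Q (of_real c + of_real t * (- \<i>)) / (of_real m - (of_real c + of_real t * (- \<i>))))
    = 2 * of_real pi * \<i> * Q (of_real m)"
  proof (rule cauchy_vertical_line[OF _ _ c])
    show "Q holomorphic_on {z. Re z > 0}"
      using Q hp unfolding sectorial_def by (blast intro: holomorphic_on_subset)
    show "cmod (Q z) \<le> M / cmod z" if "Re z > 0" for z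
      by (rule sectorial_bound[OF Q]) (use that hp in auto)
  qed (use c1(2) c2(2) in \<open>simp_all\<close>)
  have "of_real 1 * \<i> = \<i>" "of_real (- 1) * \<i> = - \<i>" by auto
  then show ?thesis unfolding J_def c1(3) c2(3) using main by (simp only:)
qed

section \<open>Integrals along the edges of a wedge and their Laplace transforms\<close>

lemma half_line_complex_exp:
  assumes w: "Re w > 0"
  shows "integrable half_line (\<lambda>t. exp (- (w * of_real t)))" "(LINT t|half_line. exp (- (w * of_real t))) = 1 / w"
proof -
  show i: "integrable half_line (\<lambda>t. exp (- (w * of_real t)))"
    by (rule half_line_dominated[OF half_line_exp(1)[OF w]]) auto
  have w0: "w \<noteq> 0" using w by auto
  have int: "integral {0..R} (\<lambda>t. exp (- (w * of_real t))) = (1 - exp (- (w * of_real R))) / w" if "R \<ge> 0" for R :: real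
  proof -
    have "((\<lambda>t. exp (- (w * of_real t))) has_integral (- exp (- (w * of_real R)) / w) - (- exp (- (w * of_real 0)) / w)) {0..R}"
      by (rule fundamental_theorem_of_calculus[OF that])
        (use w0 in \<open>auto intro!: derivative_eq_intros has_vector_derivative_real_field simp: field_simps\<close>)
    then show ?thesis by (simp add: integral_unique diff_divide_distrib)
  qed
  have "((\<lambda>R. exp (- (w * complex_of_real R))) \<longlongrightarrow> 0) at_top"
  proof (rule Lim_null_comparison)
    show "((\<lambda>R. exp (- (Re w * R))) \<longlongrightarrow> 0) at_top" using w by real_asymp
  qed auto
  then have "((\<lambda>R. (1 - exp (- (w * complex_of_real R))) / w) \<longlongrightarrow> (1 - 0) / w) at_top"
    using w0 by (intro tendsto_intros)
  moreover have "((\<lambda>R. (1 - exp (- (w * complex_of_real R))) / w) \<longlongrightarrow> (LINT t|half_line. exp (- (w * of_real t)))) at_top"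
    by (rule Lim_transform_eventually[OF half_line_integral_limit[OF i]])
      (auto intro: eventually_mono[OF eventually_ge_at_top[of 0]] simp: int)
  ultimately show "(LINT t|half_line. exp (- (w * of_real t))) = 1 / w"
    using tendsto_unique[OF trivial_limit_at_top_linorder] by fastforce
qed

text \<open>The contour integral along the ray from \<open>c\<close>; the factor
  \<open>cis \<theta>\<close> is the derivative of its parametrisation.\<close>

definition edge_integral :: "real \<Rightarrow> real \<Rightarrow> (complex \<Rightarrow> complex) \<Rightarrow> complex \<Rightarrow> complex" where
  "edge_integral \<theta> c Q z = (LINT s|half_line. cis \<theta> * exp (z * (of_real c + of_real s * cis \<theta>)) * Q (of_real c + of_real s * cis \<theta>))"

lemma edge_continuous:
  assumes "edge \<delta> \<theta>" "sectorial Q \<delta> M" "c > 0"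
  shows "continuous_on {0<..} (\<lambda>s. Q (of_real c + of_real s * cis \<theta>))"
proof (rule continuous_on_compose2[where g=Q])
  show "continuous_on (sector (pi / 2 + \<delta>)) Q"
    using assms(2) by (auto simp: sectorial_def holomorphic_on_imp_continuous_on)
  show "(\<lambda>s. of_real c + of_real s * cis \<theta>) ` {0<..} \<subseteq> sector (pi / 2 + \<delta>)"
    using edge_point(1)[OF assms(1,3)] by auto
qed (intro continuous_intros)

lemma edge_integral_holomorphic:
  assumes e: "edge \<delta> \<theta>" and Q: "sectorial Q \<delta> M" and c: "c > 0"
  shows "edge_integral \<theta> c Q holomorphic_on {z. Re (z * cis \<theta>) < 0}"
proof -
  define p where "p = (\<lambda>s. complex_of_real c + of_real s * cis \<theta>)"
  have M: "M \<ge> 0" using sectorial_nonneg[OF Q] e by (simp add: edge_def)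
  have "(\<lambda>z. LINT s|half_line. cis \<theta> * exp (z * p s) * Q (p s)) holomorphic_on {z. Re (z * cis \<theta>) < 0}"
  proof (rule holomorphic_integral)
    show "open {z. Re (z * cis \<theta>) < 0}" by (intro open_Collect_less continuous_intros)
    show "(\<lambda>s. cis \<theta> * exp (z * p s) * Q (p s)) \<in> borel_measurable half_line" for z
      unfolding p_def by (intro continuous_half_line_measurable continuous_intros edge_continuous[OF e Q c])
    show "(\<lambda>z. cis \<theta> * exp (z * p s) * Q (p s)) holomorphic_on {z. Re (z * cis \<theta>) < 0}" for s
      by (intro holomorphic_intros)
    fix z assume z: "z \<in> {z. Re (z * cis \<theta>) < 0}"
    \<comment> \<open>Half the rate of decay at \<open>z\<close>, so that a rate of at least
      \<open>r\<close> survives throughout the ball of radius \<open>r\<close>.\<close>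
    define r where "r = - Re (z * cis \<theta>) / 2"
    have r: "r > 0" using z by (simp add: r_def)
    have close: "Re (w * cis \<theta>) < - r \<and> Re w < Re z + r" if "w \<in> ball z r" for w
    proof -
      have "\<bar>Re ((w - z) * cis \<theta>)\<bar> < r" "\<bar>Re (w - z)\<bar> < r"
        using that abs_Re_le_cmod[of "(w - z) * cis \<theta>"] abs_Re_le_cmod[of "w - z"]
        by (auto simp: dist_norm norm_minus_commute norm_mult)
      then have "\<bar>Re (w * cis \<theta>) - Re (z * cis \<theta>)\<bar> < r" "\<bar>Re w - Re z\<bar> < r"
        by (auto simp: left_diff_distrib)
      then show ?thesis by (simp only: r_def) argo
    qed
    define g where "g = (\<lambda>s. exp (c * (Re z + r)) * exp (- (r * s)) * (M / (c * cos \<delta>)))"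
    have "integrable half_line g"
      unfolding g_def using half_line_exp(1)[OF r] by simp
    moreover have "cmod (cis \<theta> * exp (w * p s) * Q (p s)) \<le> g s" if s: "s > 0" and w: "w \<in> ball z r" for s w
    proof -
      have "Re (w * p s) = c * Re w + s * Re (w * cis \<theta>)" by (simp add: p_def algebra_simps)
      also have "\<dots> \<le> c * (Re z + r) + s * (- r)"
        using close[OF w] c s by (intro add_mono mult_left_mono) auto
      finally have 1: "exp (Re (w * p s)) \<le> exp (c * (Re z + r)) * exp (- (r * s))"
        by (simp flip: exp_add add: mult.commute)
      have "cmod (Q (p s)) \<le> M / cmod (p s)"
        unfolding p_def by (rule sectorial_bound[OF Q edge_point(1)[OF e c]]) (use s in auto)
      also have "\<dots> \<le> M / (c * cos \<delta>)"
        using edge_point(2)[OF e c, of s] s M c edge_trig(4)[OF e]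
        by (intro divide_left_mono) (auto simp: p_def intro!: mult_pos_pos intro: less_le_trans[of 0 "c * cos \<delta>"])
      finally show ?thesis using 1 unfolding g_def 
        by (simp only: norm_mult norm_cis norm_exp_eq_Re mult_1) (intro mult_mono; simp)
    qed
    moreover have "ball z r \<subseteq> {z. Re (z * cis \<theta>) < 0}" using close r by fastforce
    ultimately show "\<exists>r g. r > 0 \<and> ball z r \<subseteq> {z. Re (z * cis \<theta>) < 0} \<and> integrable half_line g \<and>
      (\<forall>s\<in>space half_line. \<forall>w\<in>ball z r. cmod (cis \<theta> * exp (w * p s) * Q (p s)) \<le> g s)"
      using r by (intro exI[of _ r] exI[of _ g]) auto
  qed
  then show ?thesis by (simp add: edge_integral_def[abs_def] p_def)
qed

lemma edge_integral_continuous: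
  assumes "edge \<delta> \<theta>" "sectorial Q \<delta> M" "c > 0"
  shows "continuous_on {0<..} (\<lambda>t. edge_integral \<theta> c Q (of_real t))"
  by (rule continuous_on_compose2[OF holomorphic_on_imp_continuous_on[OF edge_integral_holomorphic[OF assms]]])
    (use edge_trig(1,3)[OF assms(1)] in \<open>auto intro!: continuous_intros\<close>)

text \<open>Fubini's theorem: integrating the exponential in \<open>t\<close> first produces the
  Cauchy kernel at \<open>m\<close>. The double integral converges because \<open>m - p s\<close>
  has a real part that grows linearly along the tilted edge, on top of the decay of
  \<open>Q\<close>.\<close>

lemma edge_integral_laplace:
  assumes e: "edge \<delta> \<theta>" and Q: "sectorial Q \<delta> M" and c: "0 < c" "c < m"
  shows "laplace_integrable (\<lambda>t. edge_integral \<theta> c Q (of_real t)) m"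
    and "laplace_integral (\<lambda>t. edge_integral \<theta> c Q (of_real t)) (of_real m) =
      cis \<theta> * (LINT s|half_line. Q (of_real c + of_real s * cis \<theta>) / (of_real m - (of_real c + of_real s * cis \<theta>)))"
proof -
  define p where "p = (\<lambda>s. complex_of_real c + of_real s * cis \<theta>)"
  have M: "M \<ge> 0" using sectorial_nonneg[OF Q] e by (simp add: edge_def)
  note trig = edge_trig[OF e]
  define F where "F = (\<lambda>s t. exp (- ((of_real m - p s) * of_real t)) * (cis \<theta> * Q (p s)))"
  have Re_p: "Re (of_real m - p s) = m - c + s * sin \<delta>" for s using trig by (simp add: p_def)
  have pos: "Re (of_real m - p s) > 0" if "s > 0" for s
    unfolding Re_p using that c trig by (simp add: add_pos_pos)
  have meas_p: "p \<in> borel_measurable half_line" and meas_Q: "(\<lambda>s. Q (p s)) \<in> borel_measurable half_line"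
    unfolding p_def by (intro continuous_half_line_measurable continuous_intros edge_continuous[OF e Q c(1)])+
  have meas: "case_prod F \<in> borel_measurable (half_line \<Otimes>\<^sub>M half_line)"
    unfolding F_def case_prod_beta using meas_p meas_Q by measurable
  have inner: "integrable half_line (F s)" "(LINT t|half_line. cmod (F s t)) = cmod (Q (p s)) / Re (of_real m - p s)"
    "(LINT t|half_line. F s t) = cis \<theta> * (Q (p s) / (of_real m - p s))" if s: "s > 0" for s
    using half_line_complex_exp[OF pos[OF s]] half_line_exp[OF pos[OF s]]
    by (simp_all add: F_def norm_mult)
  have int: "integrable (half_line \<Otimes>\<^sub>M half_line) (case_prod F)"
  proof (rule half_line_pair.Fubini_integrable[OF meas])
    show "AE s in half_line. integrable half_line (\<lambda>t. case_prod F (s, t))"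
      using inner by (intro AE_half_lineI) simp
    \<comment> \<open>The product of the lower bounds for \<open>cmod (p s) / (1 + s)\<close> and
      for \<open>Re (of_real m - p s) / (1 + s)\<close>.\<close>
    define \<kappa> where "\<kappa> = (cos \<delta> * min 1 c / 2) * min (m - c) (sin \<delta>)"
    have \<kappa>: "\<kappa> > 0" unfolding \<kappa>_def using trig c by simp
    have "integrable half_line (\<lambda>s. cmod (Q (p s)) / Re (of_real m - p s))"
    proof (rule half_line_dominated)
      show "integrable half_line (\<lambda>s. M / \<kappa> * (1 / (1 + s\<^sup>2)))"
        by (rule integrable_mult_right[OF half_line_inverse_square])
      show "(\<lambda>s. cmod (Q (p s)) / Re (of_real m - p s)) \<in> borel_measurable half_line"
        using meas_p meas_Q by measurable
      fix s :: real assume s: "s > 0"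
      have 1: "cos \<delta> * min 1 c / 2 * (1 + s) \<le> cmod (p s)"
        using edge_point_large[OF e c(1), of s] s by (simp add: p_def)
      have 2: "min (m - c) (sin \<delta>) * (1 + s) \<le> Re (of_real m - p s)"
      proof -
        have "min (m - c) (sin \<delta>) * (1 + s) = min (m - c) (sin \<delta>) + s * min (m - c) (sin \<delta>)" by (simp add: algebra_simps)
        also have "\<dots> \<le> (m - c) + s * sin \<delta>" using s by (intro add_mono mult_left_mono) auto
        finally show ?thesis unfolding Re_p .
      qed
      have pp: "0 < cos \<delta> * min 1 c / 2 * (1 + s)" "0 < min (m - c) (sin \<delta>) * (1 + s)"
        using trig c s by (auto intro!: mult_pos_pos)
      have "\<kappa> * (1 + s\<^sup>2) \<le> \<kappa> * ((1 + s) * (1 + s))"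
        using \<kappa> s by (intro mult_left_mono) (auto simp: power2_eq_square algebra_simps)
      also have "\<dots> = (cos \<delta> * min 1 c / 2 * (1 + s)) * (min (m - c) (sin \<delta>) * (1 + s))"
        by (simp add: \<kappa>_def)
      also have "\<dots> \<le> cmod (p s) * Re (of_real m - p s)"
        using 1 2 pp by (intro mult_mono) auto
      finally have 3: "\<kappa> * (1 + s\<^sup>2) \<le> cmod (p s) * Re (of_real m - p s)" .
      have "cmod (Q (p s)) \<le> M / cmod (p s)"
        unfolding p_def by (rule sectorial_bound[OF Q edge_point(1)[OF e c(1)]]) (use s in auto)
      then have "cmod (Q (p s)) / Re (of_real m - p s) \<le> M / cmod (p s) / Re (of_real m - p s)"
        using pos[OF s] by (intro divide_right_mono) auto
      also have "\<dots> \<le> M / (\<kappa> * (1 + s\<^sup>2))"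
        unfolding divide_divide_eq_left
        using 3 M \<kappa> pos[OF s] 1 pp by (intro divide_left_mono mult_pos_pos) (auto intro!: add_pos_nonneg)
      finally show "norm (cmod (Q (p s)) / Re (of_real m - p s)) \<le> M / \<kappa> * (1 / (1 + s\<^sup>2))"
        using pos[OF s] by simp
    qed
    then show "integrable half_line (\<lambda>s. LINT t|half_line. norm (case_prod F (s, t)))"
      by (subst Bochner_Integration.integrable_cong[OF refl]) (use inner(2) in auto)
  qed
  have E: "exp (- (of_real m * of_real t)) * edge_integral \<theta> c Q (of_real t) = (LINT s|half_line. F s t)" for t
  proof -
    have *: "exp (- (of_real m * of_real t)) * (cis \<theta> * exp (of_real t * p s) * Q (p s)) = F s t" for s
    proof -
      have "exp (- ((of_real m - p s) * of_real t)) = exp (- (of_real m * of_real t)) * exp (of_real t * p s)"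
        unfolding exp_add[symmetric] by (simp add: algebra_simps)
      then show ?thesis by (simp add: F_def)
    qed
    show ?thesis
      unfolding edge_integral_def *[symmetric] by (simp add: p_def)
  qed
  have i2: "integrable half_line (\<lambda>t. exp (- (of_real m * of_real t)) * edge_integral \<theta> c Q (of_real t))"
    unfolding E by (rule half_line_pair.integrable_snd[OF int])
  show "laplace_integrable (\<lambda>t. edge_integral \<theta> c Q (of_real t)) m"
    unfolding laplace_integrable_def
  proof
    show "(\<lambda>t. edge_integral \<theta> c Q (of_real t)) \<in> borel_measurable half_line"
      by (rule continuous_half_line_measurable[OF edge_integral_continuous[OF e Q c(1)]])
    show "integrable half_line (\<lambda>t. exp (- (m * t)) * cmod (edge_integral \<theta> c Q (of_real t)))"
      using integrable_norm[OF i2] by (simp add: norm_mult)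
  qed
  have "laplace_integral (\<lambda>t. edge_integral \<theta> c Q (of_real t)) (of_real m) = (LINT t|half_line. LINT s|half_line. F s t)"
    unfolding laplace_integral_def E ..
  also have "\<dots> = (LINT s|half_line. LINT t|half_line. F s t)"
    by (rule half_line_pair.Fubini_integral[OF int])
  also have "\<dots> = (LINT s|half_line. cis \<theta> * (Q (p s) / (of_real m - p s)))"
    by (intro Bochner_Integration.integral_cong refl inner(3)) simp
  also have "\<dots> = cis \<theta> * (LINT s|half_line. Q (p s) / (of_real m - p s))"
    by (rule integral_mult_right_zero)
  finally show "laplace_integral (\<lambda>t. edge_integral \<theta> c Q (of_real t)) (of_real m) =
      cis \<theta> * (LINT s|half_line. Q (of_real c + of_real s * cis \<theta>) / (of_real m - (of_real c + of_real s * cis \<theta>)))"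
    by (simp add: p_def)
qed

text \<open>Bromwich's inversion integral with the vertical line bent into the boundary of a wedge;
  the lower edge is traversed towards the vertex, hence the minus sign.\<close>

definition wedge_integral :: "real \<Rightarrow> real \<Rightarrow> (complex \<Rightarrow> complex) \<Rightarrow> complex \<Rightarrow> complex" where
  "wedge_integral \<delta> c Q z =
    (edge_integral (pi / 2 + \<delta>) c Q z - edge_integral (- (pi / 2 + \<delta>)) c Q z) / (2 * of_real pi * \<i>)"

lemma wedge_integral_laplace:
  assumes \<delta>: "0 < \<delta>" "\<delta> < pi / 2" and Q: "sectorial Q \<delta> M" and c: "0 < c" "c < m"
  shows "laplace_integrable (\<lambda>t. wedge_integral \<delta> c Q (of_real t)) m"
    and "laplace_integral (\<lambda>t. wedge_integral \<delta> c Q (of_real t)) (of_real m) = Q (of_real m)"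
    and "continuous_on {0<..} (\<lambda>t. wedge_integral \<delta> c Q (of_real t))"
proof -
  have e: "edge \<delta> (pi / 2 + \<delta>)" "edge \<delta> (- (pi / 2 + \<delta>))" using \<delta> by (auto simp: edge_def)
  define k where "k = 1 / (2 * of_real pi * \<i>)"
  have eq: "wedge_integral \<delta> c Q z = k * (edge_integral (pi / 2 + \<delta>) c Q z + (-1) * edge_integral (- (pi / 2 + \<delta>)) c Q z)" for z
    unfolding wedge_integral_def k_def by (simp add: field_simps)
  note l1 = edge_integral_laplace[OF e(1) Q c] and l2 = edge_integral_laplace[OF e(2) Q c]
  note l2' = laplace_integrable_cmult[OF l2(1), of "-1"]
  show "laplace_integrable (\<lambda>t. wedge_integral \<delta> c Q (of_real t)) m"
    unfolding eq by (rule laplace_integrable_cmult[OF laplace_integrable_add[OF l1(1) l2']])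
  have "laplace_integral (\<lambda>t. wedge_integral \<delta> c Q (of_real t)) (of_real m) =
    k * (laplace_integral (\<lambda>t. edge_integral (pi / 2 + \<delta>) c Q (of_real t)) (of_real m) +
      (-1) * laplace_integral (\<lambda>t. edge_integral (- (pi / 2 + \<delta>)) c Q (of_real t)) (of_real m))"
    unfolding eq laplace_integral_cmult
    by (subst laplace_integral_add[OF l1(1) l2']) (simp_all only: laplace_integral_cmult Re_complex_of_real order_refl)
  also have "\<dots> = k * (2 * of_real pi * \<i> * Q (of_real m))"
    unfolding l1(2) l2(2) wedge_cauchy[OF \<delta> Q c, symmetric] by simp
  also have "\<dots> = Q (of_real m)" by (simp add: k_def)
  finally show "laplace_integral (\<lambda>t. wedge_integral \<delta> c Q (of_real t)) (of_real m) = Q (of_real m)" .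
  show "continuous_on {0<..} (\<lambda>t. wedge_integral \<delta> c Q (of_real t))"
    unfolding wedge_integral_def
    by (intro continuous_intros edge_integral_continuous[OF e(1) Q c(1)] edge_integral_continuous[OF e(2) Q c(1)]) auto
qed

text \<open>No contour is moved: both sides are continuous and have the transform \<open>Q\<close>
  to the right of \<open>c + c'\<close>, so they agree by uniqueness.\<close>

lemma wedge_integral_vertex:
  assumes \<delta>: "0 < \<delta>" "\<delta> < pi / 2" and Q: "sectorial Q \<delta> M" and c: "0 < c" "0 < c'" and t: "t > 0"
  shows "wedge_integral \<delta> c Q (of_real t) = wedge_integral \<delta> c' Q (of_real t)"
proof (rule laplace_unique[of "\<lambda>t. wedge_integral \<delta> c Q (of_real t)" "c + c'"])
  note w = wedge_integral_laplace[OF \<delta> Q]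
  show "laplace_integrable (\<lambda>t. wedge_integral \<delta> c Q (of_real t)) (c + c')"
    "laplace_integrable (\<lambda>t. wedge_integral \<delta> c' Q (of_real t)) (c + c')"
    "continuous_on {0<..} (\<lambda>t. wedge_integral \<delta> c Q (of_real t))"
    "continuous_on {0<..} (\<lambda>t. wedge_integral \<delta> c' Q (of_real t))"
    using c w(1)[of c "c + c'"] w(1)[of c' "c + c'"] w(3)[of c "c + c'"] w(3)[of c' "c + c'"] by auto
  show "laplace_integral (\<lambda>t. wedge_integral \<delta> c Q (of_real t)) (of_real r) =
      laplace_integral (\<lambda>t. wedge_integral \<delta> c' Q (of_real t)) (of_real r)" if "r > c + c'" for r
    using w(2)[of c r] w(2)[of c' r] c that by simp
qed (rule t)

section \<open>The inversion integral in scale-invariant form\<close>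

lemma divide_real_scale: "((1 + of_real s * w) / of_real t :: complex) = of_real (1 / t) + of_real (1 / t * s) * w"
  by (simp add: add_divide_distrib)

text \<open>The factor \<open>1 / z\<close> is the derivative of the substitution that frees the
  exponential from \<open>z\<close>. All dependence on \<open>z\<close> now sits in
  \<open>Q\<close>, where the dilation-invariant bound controls it.\<close>

definition scaled_edge_integral :: "real \<Rightarrow> (complex \<Rightarrow> complex) \<Rightarrow> complex \<Rightarrow> complex" where
  "scaled_edge_integral \<theta> Q z =
    (LINT s|half_line. cis \<theta> * exp (1 + of_real s * cis \<theta>) * (Q ((1 + of_real s * cis \<theta>) / z) / z))"

definition inverse_wedge :: "real \<Rightarrow> (complex \<Rightarrow> complex) \<Rightarrow> complex \<Rightarrow> complex" where
  "inverse_wedge \<delta> Q z =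
    (scaled_edge_integral (pi / 2 + \<delta>) Q z - scaled_edge_integral (- (pi / 2 + \<delta>)) Q z) / (2 * of_real pi * \<i>)"

text \<open>For a positive real \<open>t\<close> the rescaling of the ray leads back to the unscaled
  integral, with a vertex \<open>1 / t\<close> that varies with \<open>t\<close>; this is what makes
  independence of the vertex necessary.\<close>

lemma scaled_edge_integral_real:
  assumes t: "t > 0"
  shows "scaled_edge_integral \<theta> Q (of_real t) = edge_integral \<theta> (1 / t) Q (of_real t)"
proof -
  have "edge_integral \<theta> (1 / t) Q (of_real t) = (1 / t) *\<^sub>R (LINT s|half_line. cis \<theta> *
      exp (of_real t * (of_real (1 / t) + of_real (1 / t * s) * cis \<theta>)) * Q (of_real (1 / t) + of_real (1 / t * s) * cis \<theta>))"
    unfolding edge_integral_def by (rule half_line_scale) (use t in auto)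
  also have "\<dots> = (LINT s|half_line. (1 / t) *\<^sub>R (cis \<theta> *
      exp (of_real t * (of_real (1 / t) + of_real (1 / t * s) * cis \<theta>)) * Q (of_real (1 / t) + of_real (1 / t * s) * cis \<theta>)))"
    by simp
  also have "\<dots> = scaled_edge_integral \<theta> Q (of_real t)"
    unfolding scaled_edge_integral_def divide_real_scale
  proof (rule Bochner_Integration.integral_cong[OF refl])
    fix s
    have "of_real t * (of_real (1 / t) + of_real (1 / t * s) * cis \<theta>) = 1 + of_real s * cis \<theta>"
      using t by (simp add: field_simps)
    then show "(1 / t) *\<^sub>R (cis \<theta> * exp (of_real t * (of_real (1 / t) + of_real (1 / t * s) * cis \<theta>)) * Q (of_real (1 / t) + of_real (1 / t * s) * cis \<theta>))
      = cis \<theta> * exp (1 + of_real s * cis \<theta>) * (Q (of_real (1 / t) + of_real (1 / t * s) * cis \<theta>) / of_real t)"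
      by (simp only: scaleR_conv_of_real) (simp add: of_real_divide)
  qed
  finally show ?thesis by simp
qed

lemma inverse_wedge_real: "t > 0 \<Longrightarrow> inverse_wedge \<delta> Q (of_real t) = wedge_integral \<delta> (1 / t) Q (of_real t)"
  by (simp add: inverse_wedge_def wedge_integral_def scaled_edge_integral_real)

text \<open>The angle budget of the construction: the contour leans by \<open>\<delta>\<close>,
  division by \<open>z\<close> turns it by up to \<open>\<gamma>\<close>, and both together must fit
  into the extra opening \<open>\<eta>\<close> of the domain.\<close>

lemma edge_quotient:
  assumes "edge \<delta> \<theta>" "z \<in> sector \<gamma>" "\<delta> + \<gamma> \<le> \<eta>" "\<eta> \<le> pi / 2" "s \<ge> 0"
  shows "(1 + of_real s * cis \<theta>) / z \<in> sector (pi / 2 + \<eta>)"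
proof -
  have "1 + of_real s * cis \<theta> \<in> sector (pi / 2 + \<delta>)"
    using edge_point(1)[OF assms(1), of 1 s] assms(5) by simp
  from sector_divide[OF this assms(2)]
  have "(1 + of_real s * cis \<theta>) / z \<in> sector (pi / 2 + \<delta> + \<gamma>)" using assms by simp
  then show ?thesis using sector_mono[of "pi / 2 + \<delta> + \<gamma>" "pi / 2 + \<eta>"] assms by auto
qed

text \<open>With \<open>p\<close> for the point on the contour, \<open>Q (p / z) / z\<close> is
  \<open>(p / z) * Q (p / z)\<close> divided by \<open>p\<close>, so \<open>z\<close> cancels. The
  distance of the contour from 0 gives \<open>cos \<delta>\<close>, and the exponential at vertex 1
  gives \<open>exp 1\<close> and the decay.\<close>

lemma scaled_edge_integrand:
  assumes e: "edge \<delta> \<theta>" and s: "s \<ge> 0" and z: "z \<noteq> 0"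
    and B: "cmod ((1 + of_real s * cis \<theta>) / z * Q ((1 + of_real s * cis \<theta>) / z)) \<le> B"
  shows "cmod (cis \<theta> * exp (1 + of_real s * cis \<theta>) * (Q ((1 + of_real s * cis \<theta>) / z) / z))
    \<le> exp 1 * B / cos \<delta> * exp (- (sin \<delta> * s))"
proof -
  define p where "p = 1 + of_real s * cis \<theta>"
  note trig = edge_trig[OF e]
  have p: "cos \<delta> \<le> cmod p" using edge_point(2)[OF e, of 1 s] s by (simp add: p_def)
  have p0: "cmod p > 0" using p trig by linarith
  have B0: "B \<ge> 0" using order_trans[OF norm_ge_zero B] .
  have "cmod (Q (p / z) / z) = cmod (p / z * Q (p / z)) / cmod p"
    using p0 z by (simp add: norm_mult norm_divide field_simps)
  also have "\<dots> \<le> B / cos \<delta>"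
    using p trig B0 B unfolding p_def[symmetric] by (intro frac_le) auto
  finally have 1: "cmod (Q (p / z) / z) \<le> B / cos \<delta>" .
  have 2: "cmod (exp p) = exp 1 * exp (- (sin \<delta> * s))"
    using trig by (simp add: p_def mult.commute flip: exp_add)
  show ?thesis
    unfolding p_def[symmetric] norm_mult norm_cis 2
    using mult_left_mono[OF 1, of "exp 1 * exp (- (sin \<delta> * s))"] by (simp add: norm_divide algebra_simps)
qed

lemma scaled_edge_bound:
  assumes e: "edge \<delta> \<theta>" and z: "z \<noteq> 0"
    and B: "\<And>s. s > 0 \<Longrightarrow> cmod ((1 + of_real s * cis \<theta>) / z * Q ((1 + of_real s * cis \<theta>) / z)) \<le> B"
  shows "cmod (scaled_edge_integral \<theta> Q z) \<le> exp 1 * B / (cos \<delta> * sin \<delta>)"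
proof -
  note trig = edge_trig[OF e]
  have "cmod (scaled_edge_integral \<theta> Q z) \<le> (LINT s|half_line. exp 1 * B / cos \<delta> * exp (- (sin \<delta> * s)))"
    unfolding scaled_edge_integral_def
  proof (rule half_line_norm_le)
    show "integrable half_line (\<lambda>s. exp 1 * B / cos \<delta> * exp (- (sin \<delta> * s)))"
      using half_line_exp(1)[OF trig(3)] by simp
    show "cmod (cis \<theta> * exp (1 + of_real s * cis \<theta>) * (Q ((1 + of_real s * cis \<theta>) / z) / z))
      \<le> exp 1 * B / cos \<delta> * exp (- (sin \<delta> * s))" if "s > 0" for s
      using that z by (intro scaled_edge_integrand[OF e] B) auto
  qed
  also have "\<dots> = exp 1 * B / (cos \<delta> * sin \<delta>)" using half_line_exp(2)[OF trig(3)] by simp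
  finally show ?thesis .
qed

lemma scaled_edge_continuous:
  assumes e: "edge \<delta> \<theta>" and Q: "sectorial Q \<eta> M" and z: "z \<in> sector \<gamma>" "\<delta> + \<gamma> \<le> \<eta>" "\<eta> \<le> pi / 2"
  shows "continuous_on {0<..} (\<lambda>s. cis \<theta> * exp (1 + of_real s * cis \<theta>) * (Q ((1 + of_real s * cis \<theta>) / z) / z))"
proof -
  have z0: "z \<noteq> 0" using z by (auto dest: sector_nonzero)
  have "continuous_on {0<..} (\<lambda>s. Q ((1 + of_real s * cis \<theta>) / z))"
  proof (rule continuous_on_compose2[where g=Q])
    show "continuous_on (sector (pi / 2 + \<eta>)) Q"
      using Q by (auto simp: sectorial_def holomorphic_on_imp_continuous_on)
    show "(\<lambda>s. (1 + of_real s * cis \<theta>) / z) ` {0<..} \<subseteq> sector (pi / 2 + \<eta>)"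
      using edge_quotient[OF e z] by auto
  qed (intro continuous_intros, use z0 in auto)
  then show ?thesis using z0 by (intro continuous_intros) auto
qed

lemma scaled_edge_integrable:
  assumes e: "edge \<delta> \<theta>" and Q: "sectorial Q \<eta> M" and z: "z \<in> sector \<gamma>" "\<delta> + \<gamma> \<le> \<eta>" "\<eta> \<le> pi / 2"
  shows "integrable half_line (\<lambda>s. cis \<theta> * exp (1 + of_real s * cis \<theta>) * (Q ((1 + of_real s * cis \<theta>) / z) / z))"
proof (rule half_line_dominated)
  show "integrable half_line (\<lambda>s. exp 1 * M / cos \<delta> * exp (- (sin \<delta> * s)))"
    using half_line_exp(1)[OF edge_trig(3)[OF e]] by simp
  show "(\<lambda>s. cis \<theta> * exp (1 + of_real s * cis \<theta>) * (Q ((1 + of_real s * cis \<theta>) / z) / z)) \<in> borel_measurable half_line"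
    by (rule continuous_half_line_measurable[OF scaled_edge_continuous[OF assms]])
  show "cmod (cis \<theta> * exp (1 + of_real s * cis \<theta>) * (Q ((1 + of_real s * cis \<theta>) / z) / z))
      \<le> exp 1 * M / cos \<delta> * exp (- (sin \<delta> * s))" if "s > 0" for s
  proof (rule scaled_edge_integrand[OF e])
    show "cmod ((1 + of_real s * cis \<theta>) / z * Q ((1 + of_real s * cis \<theta>) / z)) \<le> M"
      using Q edge_quotient[OF e z, of s] that by (auto simp: sectorial_def)
  qed (use that sector_nonzero[OF z(1)] in auto)
qed

lemma scaled_edge_holomorphic:
  assumes e: "edge \<delta> \<theta>" and Q: "sectorial Q \<eta> M" and z: "\<delta> + \<gamma> \<le> \<eta>" "\<eta> \<le> pi / 2"
  shows "scaled_edge_integral \<theta> Q holomorphic_on sector \<gamma>"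
proof -
  define p where "p = (\<lambda>s. 1 + complex_of_real s * cis \<theta>)"
  have \<gamma>: "\<gamma> \<le> pi" using z e pi_gt_zero by (auto simp: edge_def)
  note op = open_sector[OF \<gamma>]
  have "(\<lambda>z. LINT s|half_line. cis \<theta> * exp (p s) * (Q (p s / z) / z)) holomorphic_on sector \<gamma>"
  proof (rule holomorphic_integral[OF op])
    show "(\<lambda>s. cis \<theta> * exp (p s) * (Q (p s / z) / z)) \<in> borel_measurable half_line" if "z \<in> sector \<gamma>" for z
      unfolding p_def by (rule continuous_half_line_measurable[OF scaled_edge_continuous[OF e Q that z]])
    show "(\<lambda>z. cis \<theta> * exp (p s) * (Q (p s / z) / z)) holomorphic_on sector \<gamma>" if "s \<in> space half_line" for s
    proof -
      have "(Q \<circ> (\<lambda>z. p s / z)) holomorphic_on sector \<gamma>"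
      proof (rule holomorphic_on_compose_gen)
        show "Q holomorphic_on sector (pi / 2 + \<eta>)" using Q by (simp add: sectorial_def)
        show "(\<lambda>z. p s / z) ` sector \<gamma> \<subseteq> sector (pi / 2 + \<eta>)"
          using edge_quotient[OF e _ z, of _ s] that by (auto simp: p_def)
      qed (auto intro!: holomorphic_intros dest: sector_nonzero)
      then have "(\<lambda>z. Q (p s / z)) holomorphic_on sector \<gamma>" by (simp add: o_def)
      then have "(\<lambda>z. Q (p s / z) / z) holomorphic_on sector \<gamma>"
        by (rule holomorphic_on_divide) (auto intro: holomorphic_intros dest: sector_nonzero)
      then show ?thesis by (intro holomorphic_on_mult holomorphic_on_const)
    qed
    fix z0 assume "z0 \<in> sector \<gamma>"
    then obtain r where r: "r > 0" "ball z0 r \<subseteq> sector \<gamma>" using op openE by blast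
    define g where "g = (\<lambda>s. exp 1 * M / cos \<delta> * exp (- (sin \<delta> * s)))"
    have "integrable half_line g"
      unfolding g_def using half_line_exp(1)[OF edge_trig(3)[OF e]] by simp
    moreover have "cmod (cis \<theta> * exp (p s) * (Q (p s / w) / w)) \<le> g s" if "s > 0" "w \<in> ball z0 r" for s w
      unfolding p_def g_def
    proof (rule scaled_edge_integrand[OF e])
      have w: "w \<in> sector \<gamma>" using that r by auto
      then show "w \<noteq> 0" by (rule sector_nonzero)
      show "cmod ((1 + of_real s * cis \<theta>) / w * Q ((1 + of_real s * cis \<theta>) / w)) \<le> M"
        using Q edge_quotient[OF e w z, of s] that by (auto simp: sectorial_def)
    qed (use that in auto)
    ultimately show "\<exists>r g. r > 0 \<and> ball z0 r \<subseteq> sector \<gamma> \<and> integrable half_line g \<and>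
        (\<forall>s\<in>space half_line. \<forall>w\<in>ball z0 r. cmod (cis \<theta> * exp (p s) * (Q (p s / w) / w)) \<le> g s)"
      using r by (intro exI[of _ r] exI[of _ g]) auto
  qed
  then show ?thesis by (simp add: scaled_edge_integral_def[abs_def] p_def)
qed

lemma edges: "0 < \<delta> \<Longrightarrow> \<delta> < pi / 2 \<Longrightarrow> edge \<delta> (pi / 2 + \<delta>) \<and> edge \<delta> (- (pi / 2 + \<delta>))"
  by (auto simp: edge_def)

lemma inverse_wedge_holomorphic:
  assumes "0 < \<delta>" "\<delta> < pi / 2" "sectorial Q \<eta> M" "\<delta> + \<gamma> \<le> \<eta>" "\<eta> \<le> pi / 2"
  shows "inverse_wedge \<delta> Q holomorphic_on sector \<gamma>"
  unfolding inverse_wedge_def[abs_def]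
  using scaled_edge_holomorphic[OF _ assms(3-5), of "pi / 2 + \<delta>"]
    scaled_edge_holomorphic[OF _ assms(3-5), of "- (pi / 2 + \<delta>)"] edges[OF assms(1,2)]
  by (intro holomorphic_on_divide holomorphic_on_diff holomorphic_on_const) auto

text \<open>The bound on \<open>Q\<close> is required only at points with
  \<open>cos \<delta> \<le> cmod \<mu> * cmod z\<close>, the ones the contour visits. For small
  \<open>z\<close> these are far from 0, which is how limits at infinity become initial
  values.\<close>

lemma inverse_wedge_bound:
  assumes \<delta>: "0 < \<delta>" "\<delta> < pi / 2" and z: "z \<in> sector \<gamma>" "\<delta> + \<gamma> \<le> \<eta>" "\<eta> \<le> pi / 2"
    and B: "\<And>\<mu>. \<mu> \<in> sector (pi / 2 + \<eta>) \<Longrightarrow> cos \<delta> \<le> cmod \<mu> * cmod z \<Longrightarrow> cmod (\<mu> * Q \<mu>) \<le> B"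
  shows "cmod (inverse_wedge \<delta> Q z) \<le> exp 1 / (pi * (cos \<delta> * sin \<delta>)) * B"
proof -
  have z0: "z \<noteq> 0" using z(1) by (rule sector_nonzero)
  have *: "cmod (scaled_edge_integral \<theta> Q z) \<le> exp 1 * B / (cos \<delta> * sin \<delta>)" if e: "edge \<delta> \<theta>" for \<theta>
  proof (rule scaled_edge_bound[OF e z0])
    fix s :: real assume s: "s > 0"
    have "cos \<delta> \<le> cmod (1 + of_real s * cis \<theta>)" using edge_point(2)[OF e, of 1 s] s by simp
    then show "cmod ((1 + of_real s * cis \<theta>) / z * Q ((1 + of_real s * cis \<theta>) / z)) \<le> B"
      by (intro B edge_quotient[OF e z]) (use s z0 in \<open>auto simp: norm_divide\<close>)
  qed
  have "cmod (scaled_edge_integral (pi / 2 + \<delta>) Q z - scaled_edge_integral (- (pi / 2 + \<delta>)) Q z)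
      \<le> 2 * (exp 1 * B / (cos \<delta> * sin \<delta>))"
    using *[OF edges[OF \<delta>, THEN conjunct1]] *[OF edges[OF \<delta>, THEN conjunct2]]
      norm_triangle_ineq4[of "scaled_edge_integral (pi / 2 + \<delta>) Q z" "scaled_edge_integral (- (pi / 2 + \<delta>)) Q z"]
    by argo
  then have "cmod (inverse_wedge \<delta> Q z) \<le> 2 * (exp 1 * B / (cos \<delta> * sin \<delta>)) / (2 * pi)"
    unfolding inverse_wedge_def norm_divide
    by (rule order_trans[OF divide_right_mono]) (simp_all add: norm_mult)
  also have "\<dots> = exp 1 / (pi * (cos \<delta> * sin \<delta>)) * B" by (simp add: ac_simps)
  finally show ?thesis .
qed

lemma inverse_wedge_add:
  assumes \<delta>: "0 < \<delta>" "\<delta> < pi / 2" and Q: "sectorial Q1 \<eta> M1" "sectorial Q2 \<eta> M2"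
    and z: "z \<in> sector \<gamma>" "\<delta> + \<gamma> \<le> \<eta>" "\<eta> \<le> pi / 2"
  shows "inverse_wedge \<delta> (\<lambda>\<mu>. Q1 \<mu> + Q2 \<mu>) z = inverse_wedge \<delta> Q1 z + inverse_wedge \<delta> Q2 z"
proof -
  have *: "scaled_edge_integral \<theta> (\<lambda>\<mu>. Q1 \<mu> + Q2 \<mu>) z = scaled_edge_integral \<theta> Q1 z + scaled_edge_integral \<theta> Q2 z"
    if e: "edge \<delta> \<theta>" for \<theta>
    unfolding scaled_edge_integral_def
      Bochner_Integration.integral_add[OF scaled_edge_integrable[OF e Q(1) z] scaled_edge_integrable[OF e Q(2) z], symmetric]
    by (intro Bochner_Integration.integral_cong refl) (simp add: add_divide_distrib[of "Q1 _"] distrib_left)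
  show ?thesis unfolding inverse_wedge_def
    using *[of "pi / 2 + \<delta>"] *[of "- (pi / 2 + \<delta>)"] edges[OF \<delta>]
    by (simp add: add_divide_distrib diff_divide_distrib del: minus_add_distrib)
qed

lemma inverse_wedge_cmult: "inverse_wedge \<delta> (\<lambda>\<mu>. c * Q \<mu>) z = c * inverse_wedge \<delta> Q z"
proof -
  have "scaled_edge_integral \<theta> (\<lambda>\<mu>. c * Q \<mu>) z = c * scaled_edge_integral \<theta> Q z" for \<theta>
    unfolding scaled_edge_integral_def by (subst integral_mult_right_zero[symmetric]) (simp add: mult.left_commute)
  then show ?thesis by (simp add: inverse_wedge_def right_diff_distrib)
qed

text \<open>The vertex \<open>1 / t\<close> in the scaled integral changes with \<open>t\<close>.
  Exchanging it for the fixed vertex \<open>m / 2\<close>, to the left of \<open>m\<close>, makes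
  the computed transform available.\<close>

lemma inverse_wedge_laplace:
  assumes \<delta>: "0 < \<delta>" "\<delta> < pi / 2" and Q: "sectorial Q \<delta> M" and m: "m > 0"
  shows "laplace_integrable (\<lambda>t. inverse_wedge \<delta> Q (of_real t)) m"
    and "laplace_integral (\<lambda>t. inverse_wedge \<delta> Q (of_real t)) (of_real m) = Q (of_real m)"
    and "continuous_on {0<..} (\<lambda>t. inverse_wedge \<delta> Q (of_real t))"
proof -
  have eq: "inverse_wedge \<delta> Q (of_real t) = wedge_integral \<delta> (m / 2) Q (of_real t)" if "t > 0" for t
    unfolding inverse_wedge_real[OF that]
    by (rule wedge_integral_vertex[OF \<delta> Q]) (use that m in auto)
  note w = wedge_integral_laplace[OF \<delta> Q, of "m / 2" m]
  show "laplace_integrable (\<lambda>t. inverse_wedge \<delta> Q (of_real t)) m"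
    using w(1) m eq by (simp cong: laplace_integrable_cong)
  show "laplace_integral (\<lambda>t. inverse_wedge \<delta> Q (of_real t)) (of_real m) = Q (of_real m)"
    using w(2) m eq by (simp cong: laplace_integral_cong)
  show "continuous_on {0<..} (\<lambda>t. inverse_wedge \<delta> Q (of_real t))"
    by (rule continuous_on_eq[OF w(3)]) (use m eq in auto)
qed

lemma sector_identity:
  assumes "f holomorphic_on sector \<theta>" "g holomorphic_on sector \<theta>" "0 < \<theta>" "\<theta> \<le> pi"
    and "\<And>t. t > 0 \<Longrightarrow> f (of_real t) = g (of_real t)" and z: "z \<in> sector \<theta>"
  shows "f z = g z"
proof -
  have "f z - g z = 0"
  proof (rule analytic_continuation[of "\<lambda>z. f z - g z" "sector \<theta>" "of_real ` {0<..}" 1])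
    show "(\<lambda>z. f z - g z) holomorphic_on sector \<theta>" using assms by (intro holomorphic_intros)
    show "of_real ` {0<..} \<subseteq> sector \<theta>" using assms of_real_in_sector by auto
    show "1 \<in> sector \<theta>" using assms of_real_in_sector[of 1 \<theta>] by simp
    show "(1::complex) islimpt of_real ` {0<..}"
      unfolding islimpt_sequential
      by (intro exI[of _ "\<lambda>n. of_real (1 + 1 / (real n + 1))"] conjI allI)
        (auto simp: add_pos_pos field_simps simp del: of_real_add of_real_divide intro!: tendsto_eq_intros
          tendsto_of_real[where a=1, unfolded of_real_1] LIMSEQ_inverse_real_of_nat_add[of 1, unfolded inverse_eq_divide, simplified])
  qed (use assms open_sector connected_sector in auto)
  then show ?thesis by simp
qed

text \<open>On the positive axis both sides have the same transform and are continuous, hence agree;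
  the identity theorem carries this over to the sector.\<close>

lemma inverse_wedge_angle:
  assumes \<delta>: "0 < \<delta>" "0 < \<delta>'" and Q: "sectorial Q \<eta> M" and z: "z \<in> sector \<gamma>" "0 < \<gamma>" "\<delta> + \<gamma> \<le> \<eta>" "\<delta>' + \<gamma> \<le> \<eta>" "\<eta> \<le> pi / 2"
  shows "inverse_wedge \<delta> Q z = inverse_wedge \<delta>' Q z"
proof (rule sector_identity[OF _ _ _ _ _ z(1)])
  have d: "\<delta> < pi / 2" "\<delta>' < pi / 2" using z by auto
  show "inverse_wedge \<delta> Q holomorphic_on sector \<gamma>" "inverse_wedge \<delta>' Q holomorphic_on sector \<gamma>"
    using \<delta> d z by (auto intro!: inverse_wedge_holomorphic[OF _ _ Q])
  fix t :: real assume t: "t > 0"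
  have Q1: "sectorial Q \<delta> M" "sectorial Q \<delta>' M" using z by (auto intro!: sectorial_mono[OF Q])
  note l1 = inverse_wedge_laplace[OF \<delta>(1) d(1) Q1(1)] and l2 = inverse_wedge_laplace[OF \<delta>(2) d(2) Q1(2)]
  show "inverse_wedge \<delta> Q (of_real t) = inverse_wedge \<delta>' Q (of_real t)"
    by (rule laplace_unique[of "\<lambda>t. inverse_wedge \<delta> Q (of_real t)" 1, OF _ _ _ _ _ t])
      (use l1[of 1] l2[of 1] l1(2) l2(2) in auto)
qed (use \<delta> z pi_gt_zero in linarith)+

section \<open>The inverse Laplace transform of a sectorial function\<close>

text \<open>The constants may blow up as \<open>\<gamma>\<close> approaches \<open>\<alpha>\<close>.
  This matches what is known of the transform of \<open>k\<close>, and of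
  \<open>K \<Upsilon>\<close> under condition (vi).\<close>

definition subsectorial :: "(complex \<Rightarrow> complex) \<Rightarrow> real \<Rightarrow> bool" where
  "subsectorial Q \<alpha> \<longleftrightarrow> (\<forall>\<gamma>. 0 < \<gamma> \<and> \<gamma> < \<alpha> \<longrightarrow> (\<exists>M. sectorial Q \<gamma> M))"

text \<open>Substituting \<open>\<mu> = \<nu> / z\<close> in the inversion integral fixes the contour of \<open>\<nu>\<close>: a wedge with vertex
  \<open>1\<close>. Any opening angle that keeps \<open>\<nu> / z\<close> in the domain of \<open>Q\<close> gives the same value.\<close>

definition inverse_laplace :: "real \<Rightarrow> (complex \<Rightarrow> complex) \<Rightarrow> complex \<Rightarrow> complex" where
  "inverse_laplace \<alpha> Q z = inverse_wedge ((\<alpha> - \<bar>Arg z\<bar>) / 2) Q z"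

lemma inverse_laplace_eq:
  assumes \<alpha>: "\<alpha> \<le> pi / 2" and Q: "subsectorial Q \<alpha>" and \<gamma>: "0 < \<gamma>" "\<gamma> < \<alpha>" and z: "z \<in> sector \<gamma>"
  shows "inverse_laplace \<alpha> Q z = inverse_wedge ((\<alpha> - \<gamma>) / 2) Q z"
proof -
  \<comment> \<open>The midpoint leaves room on both sides: \<open>z\<close> is in the sector of
    half-angle \<open>\<gamma>'\<close>, and the larger of the two contour angles plus
    \<open>\<gamma>'\<close> is \<open>(\<alpha> + \<gamma>) / 2\<close>, still below
    \<open>\<alpha>\<close>.\<close>
  define \<gamma>' where "\<gamma>' = (\<bar>Arg z\<bar> + \<gamma>) / 2"
  have a: "\<bar>Arg z\<bar> < \<gamma>" using z by (simp add: sector_def)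
  have \<gamma>': "\<bar>Arg z\<bar> < \<gamma>'" "\<gamma>' < \<gamma>" "0 < \<gamma>'" using a \<gamma> by (auto simp: \<gamma>'_def)
  have zs: "z \<in> sector \<gamma>'" using z \<gamma>' by (simp add: sector_def)
  define \<eta> where "\<eta> = (\<alpha> - \<bar>Arg z\<bar>) / 2 + \<gamma>'"
  have \<eta>: "0 < \<eta>" "\<eta> < \<alpha>" "\<eta> \<le> pi / 2" using a \<gamma> \<alpha> \<gamma>' unfolding \<eta>_def \<gamma>'_def by argo+
  obtain M where M: "sectorial Q \<eta> M" using Q \<eta> by (auto simp: subsectorial_def)
  show ?thesis unfolding inverse_laplace_def
    by (rule inverse_wedge_angle[OF _ _ M zs]) (use a \<gamma> \<gamma>' \<eta> in \<open>unfold \<eta>_def, argo+\<close>)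
qed

lemma inverse_laplace_holomorphic:
  assumes \<alpha>: "\<alpha> \<le> pi / 2" and Q: "subsectorial Q \<alpha>"
  shows "inverse_laplace \<alpha> Q holomorphic_on sector \<alpha>"
proof (rule holomorphic_onI)
  fix z assume z: "z \<in> sector \<alpha>"
  define \<gamma> where "\<gamma> = (\<bar>Arg z\<bar> + \<alpha>) / 2"
  have \<gamma>: "0 < \<gamma>" "\<gamma> < \<alpha>" "\<bar>Arg z\<bar> < \<gamma>" using z by (auto simp: \<gamma>_def sector_def)
  have zs: "z \<in> sector \<gamma>" using z \<gamma> by (simp add: sector_def)
  define \<eta> where "\<eta> = (\<alpha> - \<gamma>) / 2 + \<gamma>"
  have "0 < \<eta>" "\<eta> < \<alpha>" using \<gamma> unfolding \<eta>_def by argo+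
  then obtain M where M: "sectorial Q \<eta> M" using Q unfolding subsectorial_def by blast
  have "inverse_wedge ((\<alpha> - \<gamma>) / 2) Q holomorphic_on sector \<gamma>"
    by (rule inverse_wedge_holomorphic[OF _ _ M]) (use \<gamma> \<alpha> in \<open>unfold \<eta>_def, argo+\<close>)
  then have "inverse_laplace \<alpha> Q holomorphic_on sector \<gamma>"
    using inverse_laplace_eq[OF \<alpha> Q \<gamma>(1,2)] by (simp cong: holomorphic_cong)
  then have "inverse_laplace \<alpha> Q field_differentiable at z"
    using zs open_sector[of \<gamma>] \<gamma> \<alpha> by (intro holomorphic_on_imp_differentiable_at) auto
  then show "inverse_laplace \<alpha> Q field_differentiable at z within sector \<alpha>"
    by (rule field_differentiable_at_within)
qed

text \<open>The constant of the scaled inversion integral at the contour angle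
  \<open>(\<alpha> - \<gamma>) / 2\<close>: \<open>exp 1\<close> from the vertex at 1, the cosine
  from the distance of the contour to 0, the sine from integrating the decaying exponential, and
  \<open>1 / pi\<close> from two edges over \<open>2 * pi\<close>.\<close>

definition inversion_constant :: "real \<Rightarrow> real \<Rightarrow> real" where
  "inversion_constant \<alpha> \<gamma> = exp 1 / (pi * (cos ((\<alpha> - \<gamma>) / 2) * sin ((\<alpha> - \<gamma>) / 2)))"

lemma inversion_constant_pos:
  assumes "0 < \<gamma>" "\<gamma> < \<alpha>" "\<alpha> \<le> pi / 2"
  shows "inversion_constant \<alpha> \<gamma> > 0" "cos ((\<alpha> - \<gamma>) / 2) > 0"
proof -
  have "edge ((\<alpha> - \<gamma>) / 2) (pi / 2 + (\<alpha> - \<gamma>) / 2)" using assms by (intro edges[THEN conjunct1]) auto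
  from edge_trig(3,4)[OF this] show "inversion_constant \<alpha> \<gamma> > 0" "cos ((\<alpha> - \<gamma>) / 2) > 0"
    by (auto simp: inversion_constant_def)
qed

lemma inverse_laplace_bound:
  assumes \<alpha>: "\<alpha> \<le> pi / 2" and Q: "subsectorial Q \<alpha>" and \<gamma>: "0 < \<gamma>" "\<gamma> < \<alpha>" and z: "z \<in> sector \<gamma>"
    and B: "\<And>\<mu>. \<mu> \<in> sector (pi / 2 + (\<alpha> + \<gamma>) / 2) \<Longrightarrow> cos ((\<alpha> - \<gamma>) / 2) \<le> cmod \<mu> * cmod z \<Longrightarrow> cmod (\<mu> * Q \<mu>) \<le> B"
  shows "cmod (inverse_laplace \<alpha> Q z) \<le> inversion_constant \<alpha> \<gamma> * B"
  unfolding inverse_laplace_eq[OF \<alpha> Q \<gamma> z] inversion_constant_def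
proof (rule inverse_wedge_bound[OF _ _ z, where \<eta>="(\<alpha> + \<gamma>) / 2"])
  show "0 < (\<alpha> - \<gamma>) / 2" "(\<alpha> - \<gamma>) / 2 < pi / 2" "(\<alpha> - \<gamma>) / 2 + \<gamma> \<le> (\<alpha> + \<gamma>) / 2" "(\<alpha> + \<gamma>) / 2 \<le> pi / 2"
    using \<gamma> \<alpha> by argo+
qed (rule B)

lemma inverse_laplace_real:
  assumes \<alpha>: "0 < \<alpha>" "\<alpha> \<le> pi / 2" and Q: "subsectorial Q \<alpha>" and m: "m > 0"
  shows "laplace_integrable (\<lambda>t. inverse_laplace \<alpha> Q (of_real t)) m"
    and "laplace_integral (\<lambda>t. inverse_laplace \<alpha> Q (of_real t)) (of_real m) = Q (of_real m)"
    and "continuous_on {0<..} (\<lambda>t. inverse_laplace \<alpha> Q (of_real t))"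
proof -
  obtain M where M: "sectorial Q (\<alpha> / 2) M" using Q \<alpha> by (force simp: subsectorial_def)
  have eq: "inverse_laplace \<alpha> Q (of_real t) = inverse_wedge (\<alpha> / 2) Q (of_real t)" if "t > 0" for t
    using that by (simp add: inverse_laplace_def Arg_of_real)
  note l = inverse_wedge_laplace[OF _ _ M m]
  show "laplace_integrable (\<lambda>t. inverse_laplace \<alpha> Q (of_real t)) m"
    "laplace_integral (\<lambda>t. inverse_laplace \<alpha> Q (of_real t)) (of_real m) = Q (of_real m)"
    using l(1,2) \<alpha> eq by (simp_all cong: laplace_integrable_cong laplace_integral_cong)
  show "continuous_on {0<..} (\<lambda>t. inverse_laplace \<alpha> Q (of_real t))"
    by (rule continuous_on_eq[OF l(3)]) (use \<alpha> eq in auto)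
qed

lemma inverse_laplace_add:
  assumes \<alpha>: "\<alpha> \<le> pi / 2" and Q: "subsectorial Q1 \<alpha>" "subsectorial Q2 \<alpha>" and z: "z \<in> sector \<alpha>"
  shows "inverse_laplace \<alpha> (\<lambda>\<mu>. Q1 \<mu> + Q2 \<mu>) z = inverse_laplace \<alpha> Q1 z + inverse_laplace \<alpha> Q2 z"
proof -
  have a: "\<bar>Arg z\<bar> < \<alpha>" using z by (simp add: sector_def)
  define \<gamma> where "\<gamma> = \<bar>Arg z\<bar> + (\<alpha> - \<bar>Arg z\<bar>) / 4"
  define \<eta> where "\<eta> = (\<alpha> - \<bar>Arg z\<bar>) / 2 + \<gamma>"
  have zs: "z \<in> sector \<gamma>" using z a by (simp add: sector_def \<gamma>_def)
  have \<eta>: "0 < \<eta>" "\<eta> < \<alpha>" using a unfolding \<eta>_def \<gamma>_def by argo+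
  obtain M1 M2 where "sectorial Q1 \<eta> M1" "sectorial Q2 \<eta> M2" using Q \<eta> unfolding subsectorial_def by blast
  then show ?thesis unfolding inverse_laplace_def
    by (rule inverse_wedge_add[OF _ _ _ _ zs, rotated 2]) (use a \<alpha> \<eta> in \<open>unfold \<eta>_def, argo+\<close>)
qed

lemma inverse_laplace_cmult: "inverse_laplace \<alpha> (\<lambda>\<mu>. c * Q \<mu>) z = c * inverse_laplace \<alpha> Q z"
  by (simp add: inverse_laplace_def inverse_wedge_cmult)

lemma subsectorial_add:
  assumes "subsectorial Q1 \<alpha>" "subsectorial Q2 \<alpha>"
  shows "subsectorial (\<lambda>\<mu>. Q1 \<mu> + Q2 \<mu>) \<alpha>"
  unfolding subsectorial_def
proof (intro allI impI)
  fix \<gamma> assume "0 < \<gamma> \<and> \<gamma> < \<alpha>"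
  then obtain M1 M2 where M: "sectorial Q1 \<gamma> M1" "sectorial Q2 \<gamma> M2" using assms unfolding subsectorial_def by blast
  have "cmod (\<mu> * (Q1 \<mu> + Q2 \<mu>)) \<le> M1 + M2" if "\<mu> \<in> sector (pi / 2 + \<gamma>)" for \<mu>
  proof -
    have "cmod (\<mu> * (Q1 \<mu> + Q2 \<mu>)) \<le> cmod (\<mu> * Q1 \<mu>) + cmod (\<mu> * Q2 \<mu>)"
      by (simp add: distrib_left norm_triangle_ineq)
    also have "\<dots> \<le> M1 + M2" using M that by (intro add_mono) (auto simp: sectorial_def)
    finally show ?thesis .
  qed
  then have "sectorial (\<lambda>\<mu>. Q1 \<mu> + Q2 \<mu>) \<gamma> (M1 + M2)"
    using M by (auto simp: sectorial_def intro!: holomorphic_intros)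
  then show "\<exists>M. sectorial (\<lambda>\<mu>. Q1 \<mu> + Q2 \<mu>) \<gamma> M" by blast
qed

lemma subsectorial_inverse: "subsectorial (\<lambda>\<mu>. c / \<mu>) \<alpha>"
  unfolding subsectorial_def sectorial_def
  by (auto intro!: exI[of _ "cmod c"] holomorphic_intros dest: sector_nonzero)

text \<open>Constants have the transform \<open>c / \<mu>\<close>. Subtracting such a term from a
  symbol reduces the initial value of an inverse transform to the case of limit 0.\<close>

lemma inverse_laplace_inverse:
  assumes \<alpha>: "0 < \<alpha>" "\<alpha> \<le> pi / 2" and z: "z \<in> sector \<alpha>"
  shows "inverse_laplace \<alpha> (\<lambda>\<mu>. c / \<mu>) z = c"
proof (rule sector_identity[of _ \<alpha> "\<lambda>_. c", OF inverse_laplace_holomorphic[OF \<alpha>(2) subsectorial_inverse] _ \<alpha>(1) _ _ z])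
  fix t :: real assume t: "t > 0"
  have c: "laplace_integrable (\<lambda>_. c) 1"
    by (rule laplace_integrable_bounded[where K="cmod c" and w=0]) auto
  show "inverse_laplace \<alpha> (\<lambda>\<mu>. c / \<mu>) (of_real t) = c"
  proof (rule laplace_unique[of "\<lambda>t. inverse_laplace \<alpha> (\<lambda>\<mu>. c / \<mu>) (of_real t)" 1 "\<lambda>_. c", OF _ c _ _ _ t])
    fix r :: real assume r: "r > 1"
    have "laplace_integral (\<lambda>_. c) (of_real r) = c / of_real r"
      using half_line_complex_exp(2)[of "of_real r"] r by (simp add: laplace_integral_def)
    then show "laplace_integral (\<lambda>t. inverse_laplace \<alpha> (\<lambda>\<mu>. c / \<mu>) (of_real t)) (of_real r) = laplace_integral (\<lambda>_. c) (of_real r)"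
      using inverse_laplace_real(2)[OF \<alpha> subsectorial_inverse, of r] r by simp
  qed (use inverse_laplace_real[OF \<alpha> subsectorial_inverse, of 1 c] in auto)
qed (use \<alpha> pi_gt_zero in \<open>auto\<close>)

section \<open>Uniform radial limits\<close>

text \<open>After rescaling by \<open>cmod z\<close> a sequence of counterexamples is a normal family whose limit vanishes
  on the positive reals.\<close>

lemma uniform_sectorial_limit:
  fixes F :: "'i \<Rightarrow> complex \<Rightarrow> complex"
  assumes \<theta>: "0 < \<theta>" "\<theta> < \<theta>'" "\<theta>' \<le> pi"
    and hol: "\<And>i. i \<in> I \<Longrightarrow> F i holomorphic_on sector \<theta>'"
    and bd: "\<And>i z. i \<in> I \<Longrightarrow> z \<in> sector \<theta>' \<Longrightarrow> cmod (F i z) \<le> M"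
    and lim: "\<And>e. e > 0 \<Longrightarrow> \<exists>R. \<forall>i\<in>I. \<forall>r\<ge>R. cmod (F i (of_real r)) \<le> e"
    and e: "e > 0"
  shows "\<exists>R>0. \<forall>i\<in>I. \<forall>z\<in>sector \<theta>. cmod z \<ge> R \<longrightarrow> cmod (F i z) \<le> e"
proof (rule ccontr)
  assume "\<not> ?thesis"
  then have "\<forall>n::nat. \<exists>i z. i \<in> I \<and> z \<in> sector \<theta> \<and> cmod z \<ge> real n + 1 \<and> cmod (F i z) > e"
    by (auto simp: not_le) (metis add.commute of_nat_0_less_iff of_nat_Suc zero_less_Suc)
  then obtain i z where iz: "\<And>n. i n \<in> I" "\<And>n. z n \<in> sector \<theta>" "\<And>n. cmod (z n) \<ge> real n + 1" "\<And>n. cmod (F (i n) (z n)) > e"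
    by metis
  define h where "h = (\<lambda>n w. F (i n) (of_real (cmod (z n)) * w))"
  have zp: "cmod (z n) > 0" for n using iz(3)[of n] by linarith
  define H where "H = {f. f holomorphic_on sector \<theta>' \<and> (\<forall>w\<in>sector \<theta>'. cmod (f w) \<le> M)}"
  have hH: "range h \<subseteq> H"
  proof -
    have "h n holomorphic_on sector \<theta>'" for n
    proof -
      have "(F (i n) \<circ> (\<lambda>w. of_real (cmod (z n)) * w)) holomorphic_on sector \<theta>'"
        by (rule holomorphic_on_compose_gen[OF _ hol[OF iz(1)]]) (auto intro!: holomorphic_intros sector_scale zp)
      then show ?thesis by (simp add: h_def o_def)
    qed
    moreover have "cmod (h n w) \<le> M" if "w \<in> sector \<theta>'" for n w
      unfolding h_def by (intro bd iz sector_scale that zp)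
    ultimately show ?thesis by (auto simp: H_def)
  qed
  obtain g r where g: "g holomorphic_on sector \<theta>'" and r: "strict_mono (r :: nat \<Rightarrow> nat)"
    and pt: "\<And>x. x \<in> sector \<theta>' \<Longrightarrow> (\<lambda>n. h (r n) x) \<longlonglongrightarrow> g x"
    and unif: "\<And>K. compact K \<Longrightarrow> K \<subseteq> sector \<theta>' \<Longrightarrow> uniform_limit K (h \<circ> r) g sequentially"
  proof (rule Montel[of "sector \<theta>'" H h])
    show "open (sector \<theta>')" using \<theta> by (intro open_sector) auto
    show "\<exists>B. \<forall>f\<in>H. \<forall>w\<in>K. cmod (f w) \<le> B" if "compact K" "K \<subseteq> sector \<theta>'" for K
      using that by (intro exI[of _ M]) (auto simp: H_def)
  qed (use hH in \<open>auto simp: H_def\<close>)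
  have "g (of_real t) = 0" if t: "t > 0" for t
  proof -
    have "(\<lambda>n. h (r n) (of_real t)) \<longlonglongrightarrow> 0"
    proof (rule tendstoI)
      fix d :: real assume "d > 0"
      then obtain R where R: "\<And>i s. i \<in> I \<Longrightarrow> s \<ge> R \<Longrightarrow> cmod (F i (of_real s)) \<le> d / 2"
        using lim[of "d / 2"] by auto
      have "\<forall>\<^sub>F n in sequentially. real n \<ge> R / t" 
        using filterlim_real_sequentially by (simp add: filterlim_at_top)
      then show "\<forall>\<^sub>F n in sequentially. dist (h (r n) (of_real t)) 0 < d"
      proof eventually_elim
        case (elim n)
        have "real n \<le> real (r n)" using seq_suble[OF r, of n] by simp
        then have "cmod (z (r n)) \<ge> R / t" using elim iz(3)[of "r n"] by linarith
        then have "cmod (z (r n)) * t \<ge> R" using t by (simp add: field_simps)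
        then have "cmod (F (i (r n)) (of_real (cmod (z (r n)) * t))) \<le> d / 2" using R iz by blast
        then show ?case using \<open>d > 0\<close> by (simp add: h_def)
      qed
    qed
    moreover have "(\<lambda>n. h (r n) (of_real t)) \<longlonglongrightarrow> g (of_real t)"
      by (rule pt) (use t \<theta> in \<open>auto intro: of_real_in_sector\<close>)
    ultimately show ?thesis using LIMSEQ_unique by blast
  qed
  then have g0: "g w = 0" if "w \<in> sector \<theta>'" for w
    using sector_identity[of g \<theta>' "\<lambda>_. 0" w] g \<theta> that by auto
  \<comment> \<open>After rescaling, every \<open>z n\<close> lies on this compact arc, where
    convergence to the zero limit is uniform; that contradicts values larger than
    \<open>e\<close>.\<close>
  define K where "K = cis ` {- \<theta>..\<theta>}"
  have "compact K" unfolding K_def by (intro compact_continuous_image continuous_intros) auto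
  moreover have "K \<subseteq> sector \<theta>'"
    using sector_polarI[of 1 _ \<theta>'] \<theta> by (auto simp: K_def)
  ultimately have "uniform_limit K (h \<circ> r) g sequentially" by (rule unif)
  from uniform_limitD[OF this e] obtain n where n: "\<forall>w\<in>K. dist ((h \<circ> r) n w) (g w) < e"
    by (auto simp: eventually_sequentially)
  define w where "w = cis (Arg (z (r n)))"
  have "w \<in> K" using iz(2)[of "r n"] unfolding w_def K_def
    by (intro imageI) (auto simp: sector_def abs_less_iff)
  moreover have "w \<in> sector \<theta>'" using \<open>w \<in> K\<close> \<open>K \<subseteq> _\<close> by auto
  ultimately have "cmod (h (r n) w) < e" using n g0 by auto
  moreover have "of_real (cmod (z (r n))) * w = z (r n)"
    using rcis_cmod_Arg[of "z (r n)"] by (simp add: rcis_def w_def)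
  ultimately show False using iz(4)[of "r n"] by (simp add: h_def)
qed

section \<open>Analytic extension of a Laplace transform\<close>

text \<open>For half-angles up to \<open>pi / 2\<close> a sector is the intersection of two
  half-planes, and is therefore closed under nonnegative combinations that do not vanish.\<close>

lemma sector_iff_halfplanes:
  assumes "0 < \<gamma>" "\<gamma> \<le> pi / 2"
  shows "z \<in> sector \<gamma> \<longleftrightarrow> Re (z * cis (pi / 2 - \<gamma>)) > 0 \<and> Re (z * cis (- (pi / 2 - \<gamma>))) > 0"
proof -
  define \<phi> where "\<phi> = Arg z"
  define \<psi> where "\<psi> = pi / 2 - \<gamma>"
  have \<psi>: "0 \<le> \<psi>" "\<psi> < pi / 2" using assms by (auto simp: \<psi>_def)
  have z: "z = of_real (cmod z) * cis \<phi>" using rcis_cmod_Arg[of z] by (simp add: rcis_def \<phi>_def)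
  have re: "Re (z * cis x) = cmod z * cos (\<phi> + x)" for x
    by (subst z) (simp add: mult.assoc cis_mult)
  have bd: "- pi < \<phi>" "\<phi> \<le> pi" using Arg_bounded[of z] by (auto simp: \<phi>_def)
  have neg: "cos x \<le> 0" if "pi / 2 \<le> x" "x \<le> 3 * pi / 2" for x
  proof -
    have "0 \<le> cos (x - pi)" by (rule cos_ge_zero) (use that in auto)
    then show ?thesis by (simp add: cos_diff)
  qed
  show ?thesis
  proof
    assume "z \<in> sector \<gamma>"
    then have c: "cmod z > 0" "\<bar>\<phi>\<bar> < \<gamma>" by (auto simp: sector_def \<phi>_def)
    have "cos (\<phi> + \<psi>) > 0" "cos (\<phi> + - \<psi>) > 0"
      by (rule cos_gt_zero_pi; use c \<psi> \<psi>_def in argo)+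
    then show "Re (z * cis (pi / 2 - \<gamma>)) > 0 \<and> Re (z * cis (- (pi / 2 - \<gamma>))) > 0"
      unfolding re \<psi>_def[symmetric] using c by auto
  next
    assume R: "Re (z * cis (pi / 2 - \<gamma>)) > 0 \<and> Re (z * cis (- (pi / 2 - \<gamma>))) > 0"
    then have c: "cos (\<phi> + \<psi>) > 0" "cos (\<phi> - \<psi>) > 0" and "z \<noteq> 0"
      unfolding re \<psi>_def[symmetric] by (auto simp: zero_less_mult_iff)
    have "\<phi> < \<gamma>"
    proof (rule ccontr)
      assume "\<not> \<phi> < \<gamma>"
      then have "cos (\<phi> + \<psi>) \<le> 0" using \<psi> bd by (intro neg) (auto simp: \<psi>_def)
      then show False using c by simp
    qed
    moreover have "- \<gamma> < \<phi>"
    proof (rule ccontr)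
      assume "\<not> - \<gamma> < \<phi>"
      then have "cos (- (\<phi> - \<psi>)) \<le> 0" using \<psi> bd by (intro neg) (auto simp: \<psi>_def)
      then show False using c by (metis cos_minus not_le)
    qed
    ultimately show "z \<in> sector \<gamma>" using \<open>z \<noteq> 0\<close> by (simp add: sector_def \<phi>_def)
  qed
qed

lemma sector_cone:
  assumes \<gamma>: "0 < \<gamma>" "\<gamma> \<le> pi / 2" and u: "u \<in> sector \<gamma>" and v: "v \<in> sector \<gamma>"
    and ab: "a \<ge> 0" "b \<ge> 0" "a + b > (0::real)"
  shows "of_real a * u + of_real b * v \<in> sector \<gamma>"
proof -
  have pos: "a * x + b * y > 0" if "x > 0" "y > 0" for x y
    using ab that by (cases "a = 0") (auto intro: add_pos_nonneg)
  have re: "Re ((of_real a * u + of_real b * v) * w) = a * Re (u * w) + b * Re (v * w)" for w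
    by (simp add: algebra_simps)
  show ?thesis using u v unfolding sector_iff_halfplanes[OF \<gamma>] re by (blast intro: pos)
qed

lemma zero_in_closure_sector:
  assumes "\<gamma> > 0"
  shows "0 \<in> closure (sector \<gamma>)"
proof -
  have "(\<lambda>n. complex_of_real (1 / real (Suc n))) \<longlonglongrightarrow> of_real 0"
    by (intro tendsto_of_real LIMSEQ_Suc lim_1_over_n[where 'a=real])
  moreover have "complex_of_real (1 / real (Suc n)) \<in> sector \<gamma>" for n
    by (rule of_real_in_sector) (use assms in auto)
  ultimately show ?thesis unfolding closure_sequential
    by (intro exI[of _ "\<lambda>n. complex_of_real (1 / real (Suc n))"]) simp
qed

text \<open>Converts exponential decay into the quadratic decay that \<open>ray_rotation\<close>
  expects. The constant comes from \<open>exp y \<ge> 1\<close> and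
  \<open>exp y \<ge> y\<^sup>2 / 2\<close> at \<open>y = \<epsilon> * x\<close>.\<close>

lemma exp_times_square_le:
  fixes x \<epsilon> :: real
  assumes "\<epsilon> > 0" "x \<ge> 0"
  shows "exp (- (\<epsilon> * x)) \<le> (1 + 2 / \<epsilon>\<^sup>2) / (1 + x\<^sup>2)"
proof -
  have y: "\<epsilon> * x \<ge> 0" using assms by simp
  have "1 + \<epsilon> * x + (\<epsilon> * x)\<^sup>2 / 2 \<le> exp (\<epsilon> * x)" by (rule exp_lower_Taylor_quadratic[OF y])
  then have "(\<epsilon> * x)\<^sup>2 / 2 \<le> exp (\<epsilon> * x)" "1 \<le> exp (\<epsilon> * x)" using y zero_le_power2[of "\<epsilon> * x"] by argo+
  then have "x\<^sup>2 \<le> 2 / \<epsilon>\<^sup>2 * exp (\<epsilon> * x)" "1 \<le> exp (\<epsilon> * x)"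
    using assms by (auto simp: power_mult_distrib field_simps)
  then have "1 + x\<^sup>2 \<le> exp (\<epsilon> * x) + 2 / \<epsilon>\<^sup>2 * exp (\<epsilon> * x)" by (intro add_mono)
  then have "1 + x\<^sup>2 \<le> (1 + 2 / \<epsilon>\<^sup>2) * exp (\<epsilon> * x)" by (simp add: distrib_right)
  moreover have "1 + x\<^sup>2 > 0" by (simp add: add_pos_nonneg)
  ultimately show ?thesis by (simp add: exp_minus field_simps)
qed

text \<open>Integrating along the ray of direction \<open>\<theta>\<close> gives a function
  \<open>rl \<theta>\<close>, holomorphic where \<open>Re (\<mu> * cis \<theta>) > 0\<close>.
  Rotation of rays makes any two of them agree where both converge, and for
  \<open>\<bar>\<theta>\<bar> < \<alpha>\<close> these half-planes cover the larger sector.\<close>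

lemma laplace_extension:
  fixes g :: "complex \<Rightarrow> complex"
  assumes \<alpha>: "0 < \<alpha>" "\<alpha> \<le> pi / 2" and hol: "g holomorphic_on sector \<alpha>"
    and cont: "\<And>\<gamma>. 0 < \<gamma> \<Longrightarrow> \<gamma> < \<alpha> \<Longrightarrow> continuous_on (closure (sector \<gamma>)) g"
    and bd: "\<And>\<gamma>. 0 < \<gamma> \<Longrightarrow> \<gamma> < \<alpha> \<Longrightarrow> \<exists>M. \<forall>z\<in>sector \<gamma>. cmod (g z) \<le> M"
  obtains K where "subsectorial K \<alpha>" "\<And>\<mu>. Re \<mu> > 0 \<Longrightarrow> K \<mu> = laplace_integral (\<lambda>t. g (of_real t)) \<mu>"
    "((\<lambda>r. of_real r * K (of_real r)) \<longlongrightarrow> g 0) at_top"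
proof -
  define rl where "rl = (\<lambda>\<theta> \<mu>. cis \<theta> * laplace_integral (\<lambda>t. g (of_real t * cis \<theta>)) (\<mu> * cis \<theta>))"
  have ray: "of_real t * cis \<theta> \<in> sector \<gamma>" if "t > 0" "\<bar>\<theta>\<bar> < \<gamma>" "\<gamma> < \<alpha>" for t \<theta> \<gamma>
    by (rule sector_polarI) (use that \<alpha> in auto)
  have gray: "continuous_on {0<..} (\<lambda>t. g (of_real t * cis \<theta>))" if "\<bar>\<theta>\<bar> < \<alpha>" for \<theta>
  proof (rule continuous_on_compose2[where g=g])
    show "continuous_on (sector \<alpha>) g" by (rule holomorphic_on_imp_continuous_on[OF hol])
    show "(\<lambda>t. of_real t * cis \<theta>) ` {0<..} \<subseteq> sector \<alpha>"
      using sector_polarI[of _ \<theta> \<alpha>] that \<alpha> by auto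
  qed (intro continuous_intros)
  have li: "laplace_integrable (\<lambda>t. g (of_real t * cis \<theta>)) \<sigma>" if "\<bar>\<theta>\<bar> < \<alpha>" "\<sigma> > 0" for \<theta> \<sigma>
  proof -
    define \<gamma> where "\<gamma> = (\<bar>\<theta>\<bar> + \<alpha>) / 2"
    have \<gamma>: "\<bar>\<theta>\<bar> < \<gamma>" "\<gamma> < \<alpha>" "0 < \<gamma>" using that unfolding \<gamma>_def by argo+
    obtain M where M: "\<And>z. z \<in> sector \<gamma> \<Longrightarrow> cmod (g z) \<le> M" using bd[OF \<gamma>(3,2)] by blast
    show ?thesis
    proof (rule laplace_integrable_bounded[where w=0 and K=M])
      show "cmod (g (of_real t * cis \<theta>)) \<le> M * exp (0 * t)" if "t > 0" for t
        using M[OF ray[OF that \<gamma>(1,2)]] by simp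
    qed (use that gray in \<open>auto intro: continuous_half_line_measurable\<close>)
  qed
  have rl_hol: "rl \<theta> field_differentiable at \<mu>" if "\<bar>\<theta>\<bar> < \<alpha>" "Re (\<mu> * cis \<theta>) > 0" for \<theta> \<mu>
  proof -
    define \<sigma> where "\<sigma> = Re (\<mu> * cis \<theta>) / 2"
    have \<sigma>: "\<sigma> > 0" "Re (\<mu> * cis \<theta>) > \<sigma>" using that by (auto simp: \<sigma>_def)
    define U where "U = {\<mu>. Re (\<mu> * cis \<theta>) > \<sigma>}"
    have "(laplace_integral (\<lambda>t. g (of_real t * cis \<theta>)) \<circ> (\<lambda>\<mu>. \<mu> * cis \<theta>)) holomorphic_on U"
      by (rule holomorphic_on_compose_gen[OF _ laplace_integral_holomorphic[OF li[OF that(1) \<sigma>(1)]]])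
        (auto simp: U_def intro!: holomorphic_intros)
    then have "rl \<theta> holomorphic_on U" unfolding rl_def by (auto simp: o_def intro!: holomorphic_intros)
    moreover have "open U" unfolding U_def by (intro open_Collect_less continuous_intros)
    ultimately show ?thesis using \<sigma> by (auto simp: U_def intro: holomorphic_on_imp_differentiable_at)
  qed
  have rl_eq: "rl \<theta>1 \<mu> = rl \<theta>2 \<mu>"
    if \<theta>: "\<bar>\<theta>1\<bar> < \<alpha>" "\<bar>\<theta>2\<bar> < \<alpha>" and \<mu>: "Re (\<mu> * cis \<theta>1) > 0" "Re (\<mu> * cis \<theta>2) > 0" for \<theta>1 \<theta>2 \<mu>
  proof -
    define \<gamma> where "\<gamma> = (max \<bar>\<theta>1\<bar> \<bar>\<theta>2\<bar> + \<alpha>) / 2"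
    have mx: "\<bar>\<theta>1\<bar> \<le> max \<bar>\<theta>1\<bar> \<bar>\<theta>2\<bar>" "\<bar>\<theta>2\<bar> \<le> max \<bar>\<theta>1\<bar> \<bar>\<theta>2\<bar>" "max \<bar>\<theta>1\<bar> \<bar>\<theta>2\<bar> < \<alpha>" using \<theta> by auto
    have \<gamma>: "\<bar>\<theta>1\<bar> < \<gamma>" "\<bar>\<theta>2\<bar> < \<gamma>" "\<gamma> < \<alpha>" "0 < \<gamma>" "\<gamma> \<le> pi / 2"
      using mx \<alpha> unfolding \<gamma>_def by argo+
    obtain M where M: "\<And>z. z \<in> sector \<gamma> \<Longrightarrow> cmod (g z) \<le> M" using bd[OF \<gamma>(4,3)] by blast
    \<comment> \<open>The cone between the rays contains the origin, which is not in the open sector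
      where \<open>M\<close> is a bound.\<close>
    define M' where "M' = max M (cmod (g 0))"
    define f where "f = (\<lambda>z. exp (- (\<mu> * z)) * g z)"
    define K where "K = {of_real a * cis \<theta>1 + of_real b * cis \<theta>2 | a b. a \<ge> 0 \<and> b \<ge> (0::real)}"
    define \<epsilon> where "\<epsilon> = min (Re (\<mu> * cis \<theta>1)) (Re (\<mu> * cis \<theta>2))"
    have \<epsilon>: "\<epsilon> > 0" using \<mu> by (simp add: \<epsilon>_def)
    have s12: "cis \<theta>1 \<in> sector \<gamma>" "cis \<theta>2 \<in> sector \<gamma>" using ray[of 1 _ \<gamma>] \<gamma> by auto
    have Kz: "(z = 0 \<or> z \<in> sector \<gamma>) \<and> Re (\<mu> * z) \<ge> \<epsilon> * cmod z" if "z \<in> K" for z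
    proof -
      obtain a b where ab: "a \<ge> 0" "b \<ge> 0" "z = of_real a * cis \<theta>1 + of_real b * cis \<theta>2"
        using \<open>z \<in> K\<close> by (auto simp: K_def)
      have "cmod z \<le> a + b"
        using norm_triangle_ineq[of "of_real a * cis \<theta>1" "of_real b * cis \<theta>2"] ab by (simp add: norm_mult)
      then have "\<epsilon> * cmod z \<le> \<epsilon> * (a + b)" using \<epsilon> by simp
      also have "\<dots> = a * \<epsilon> + b * \<epsilon>" by (simp add: algebra_simps)
      also have "\<dots> \<le> a * Re (\<mu> * cis \<theta>1) + b * Re (\<mu> * cis \<theta>2)"
        using ab by (intro add_mono mult_left_mono) (auto simp: \<epsilon>_def)
      also have "\<dots> = Re (\<mu> * z)" unfolding ab(3) by (simp add: algebra_simps)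
      finally have 1: "\<epsilon> * cmod z \<le> Re (\<mu> * z)" .
      show ?thesis
      proof (cases "a + b > 0")
        case True
        then show ?thesis using sector_cone[OF \<gamma>(4,5) s12 ab(1,2)] 1 by (simp add: ab(3))
      next
        case False
        then have "a = 0" "b = 0" using ab by linarith+
        then show ?thesis using ab(3) by simp
      qed
    qed
    have Ksub: "K \<subseteq> closure (sector \<gamma>)"
      using Kz zero_in_closure_sector[OF \<gamma>(4)] closure_subset[of "sector \<gamma>"] by auto
    have fc: "continuous_on K f"
      unfolding f_def by (intro continuous_intros continuous_on_subset[OF cont[OF \<gamma>(4,3)] Ksub])
    have fh: "f holomorphic_on sector \<alpha>" unfolding f_def by (intro holomorphic_intros hol)
    have M0: "M' \<ge> 0" by (simp add: M'_def le_max_iff_disj)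
    have fb: "cmod (f z) \<le> (M' * (1 + 2 / \<epsilon>\<^sup>2)) / (1 + (cmod z)\<^sup>2)" if "z \<in> K" for z
    proof -
      have "cmod (g z) \<le> M'" using Kz[OF that] M by (auto simp: M'_def le_max_iff_disj)
      moreover have "cmod (exp (- (\<mu> * z))) \<le> exp (- (\<epsilon> * cmod z))" using Kz[OF that] by simp
      ultimately have "cmod (f z) \<le> exp (- (\<epsilon> * cmod z)) * M'"
        unfolding f_def norm_mult by (intro mult_mono) auto
      also have "\<dots> \<le> (1 + 2 / \<epsilon>\<^sup>2) / (1 + (cmod z)\<^sup>2) * M'"
        by (intro mult_right_mono exp_times_square_le \<epsilon> M0) auto
      finally show ?thesis by (simp add: ac_simps)
    qed
    define d where "d = min (cos \<theta>1) (cos \<theta>2)"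
    have "cos \<theta>1 > 0" "cos \<theta>2 > 0" by (rule cos_gt_zero_pi; use \<gamma> in argo)+
    then have d: "d > 0" by (simp add: d_def)
    have chord: "d \<le> cmod (of_real (1 - s) * cis \<theta>1 + of_real s * cis \<theta>2)" if "0 \<le> s" "s \<le> 1" for s
    proof -
      have "d = (1 - s) * d + s * d" by (simp add: algebra_simps)
      also have "\<dots> \<le> (1 - s) * cos \<theta>1 + s * cos \<theta>2"
        using that by (intro add_mono mult_left_mono) (auto simp: d_def)
      also have "\<dots> = Re (of_real (1 - s) * cis \<theta>1 + of_real s * cis \<theta>2)" by simp
      also have "\<dots> \<le> cmod (of_real (1 - s) * cis \<theta>1 + of_real s * cis \<theta>2)" by (rule complex_Re_le_cmod)
      finally show ?thesis .
    qed
    have "cis \<theta>1 * (LINT t|half_line. f (of_real t * cis \<theta>1)) = cis \<theta>2 * (LINT t|half_line. f (of_real t * cis \<theta>2))"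
      by (rule ray_rotation(3)[of "cis \<theta>1" "cis \<theta>2" d f "sector \<alpha>", folded K_def, OF _ _ d chord fc fh _ _ fb])
        (use \<alpha> open_sector[of \<alpha>] Kz sector_mono[of \<gamma> \<alpha>] \<gamma> in auto)
    then show ?thesis
      unfolding rl_def laplace_integral_def f_def by (simp add: ac_simps)
  qed
  define ok where "ok = (\<lambda>\<mu> \<theta>. \<bar>\<theta>\<bar> < \<alpha> \<and> Re (\<mu> * cis \<theta>) > 0)"
  \<comment> \<open>Any admissible direction gives the same value by \<open>rl_eq\<close>, so
    locally the choice may be replaced by one fixed direction.\<close>
  define K where "K = (\<lambda>\<mu>. rl (SOME \<theta>. ok \<mu> \<theta>) \<mu>)"
  have K: "K \<mu> = rl \<theta> \<mu>" if "ok \<mu> \<theta>" for \<mu> \<theta>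
  proof -
    have "ok \<mu> (SOME \<theta>. ok \<mu> \<theta>)" using that by (rule someI)
    then show ?thesis using that rl_eq unfolding K_def ok_def by blast
  qed
  have K_real: "K \<mu> = laplace_integral (\<lambda>t. g (of_real t)) \<mu>" if "Re \<mu> > 0" for \<mu>
    using K[of \<mu> 0] that \<alpha> by (simp add: ok_def rl_def)
  have "subsectorial K \<alpha>"
    unfolding subsectorial_def
  proof (intro allI impI)
    fix \<gamma> assume \<gamma>: "0 < \<gamma> \<and> \<gamma> < \<alpha>"
    define \<gamma>' where "\<gamma>' = (\<gamma> + \<alpha>) / 2"
    define \<gamma>'' where "\<gamma>'' = (\<gamma>' + \<alpha>) / 2"
    have g1: "\<gamma> < \<gamma>'" "\<gamma>' < \<gamma>''" "\<gamma>'' < \<alpha>" "0 < \<gamma>'" "0 < \<gamma>''" using \<gamma> unfolding \<gamma>''_def \<gamma>'_def by argo+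
    obtain M where M: "\<And>z. z \<in> sector \<gamma>'' \<Longrightarrow> cmod (g z) \<le> M" using bd[OF g1(5,3)] by blast
    \<comment> \<open>Turning \<open>\<mu>\<close> by \<open>\<gamma>'\<close> towards the positive
      axis leaves an argument of modulus at most \<open>pi / 2 + \<gamma> - \<gamma>'\<close>, or at
      most \<open>\<gamma>'\<close> if the axis is crossed. Both are below \<open>pi / 2\<close>, so
      the real part is comparable with the modulus.\<close>
    define \<beta> where "\<beta> = max \<gamma>' (pi / 2 - (\<gamma>' - \<gamma>))"
    define \<kappa> where "\<kappa> = cos \<beta>"
    have "\<gamma>' < pi / 2" "pi / 2 - (\<gamma>' - \<gamma>) < pi / 2" using g1 \<alpha> by argo+
    then have \<beta>: "0 < \<beta>" "\<beta> < pi / 2" using g1 unfolding \<beta>_def by (auto simp: less_max_iff_disj simp del: less_divide_eq_numeral1)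
    have \<kappa>: "\<kappa> > 0" unfolding \<kappa>_def by (rule cos_gt_zero_pi) (use \<beta> in auto)
    have choose: "\<exists>\<theta>. \<bar>\<theta>\<bar> = \<gamma>' \<and> Re (\<mu> * cis \<theta>) \<ge> \<kappa> * cmod \<mu>" if \<mu>: "\<mu> \<in> sector (pi / 2 + \<gamma>)" for \<mu>
    proof -
      define \<phi> where "\<phi> = Arg \<mu>"
      have \<phi>: "\<bar>\<phi>\<bar> < pi / 2 + \<gamma>" using \<mu> by (simp add: sector_def \<phi>_def)
      define \<theta> where "\<theta> = (if \<phi> \<ge> 0 then - \<gamma>' else \<gamma>')"
      have "\<bar>\<phi> + \<theta>\<bar> \<le> \<beta>" using \<phi> g1 by (auto simp: \<theta>_def \<beta>_def abs_if split: if_splits)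
      then have "cos \<bar>\<phi> + \<theta>\<bar> \<ge> \<kappa>" unfolding \<kappa>_def by (intro cos_monotone_0_pi_le) (use \<beta> in auto)
      then have c: "cos (\<phi> + \<theta>) \<ge> \<kappa>" by simp
      have "\<mu> * cis \<theta> = of_real (cmod \<mu>) * cis (\<phi> + \<theta>)"
        using rcis_cmod_Arg[of \<mu>] by (metis \<phi>_def cis_mult mult.assoc rcis_def)
      then have "Re (\<mu> * cis \<theta>) = cmod \<mu> * cos (\<phi> + \<theta>)" by simp
      also have "\<dots> \<ge> cmod \<mu> * \<kappa>" using c by (intro mult_left_mono) auto
      finally have "Re (\<mu> * cis \<theta>) \<ge> \<kappa> * cmod \<mu>" by (simp add: mult.commute)
      moreover have "\<bar>\<theta>\<bar> = \<gamma>'" using g1 by (simp add: \<theta>_def)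
      ultimately show ?thesis by blast
    qed
    have M0: "M \<ge> 0" using order_trans[OF norm_ge_zero M[of 1]] of_real_in_sector[of 1 \<gamma>''] g1 by auto
    have "K holomorphic_on sector (pi / 2 + \<gamma>)"
    proof (rule holomorphic_onI)
      fix \<mu> assume \<mu>: "\<mu> \<in> sector (pi / 2 + \<gamma>)"
      obtain \<theta> where \<theta>: "\<bar>\<theta>\<bar> = \<gamma>'" "Re (\<mu> * cis \<theta>) \<ge> \<kappa> * cmod \<mu>" using choose[OF \<mu>] by blast
      have pos: "Re (\<mu> * cis \<theta>) > 0"
        using \<theta>(2) mult_pos_pos[OF \<kappa>, of "cmod \<mu>"] sector_nonzero[OF \<mu>] by simp
      have \<theta>\<alpha>: "\<bar>\<theta>\<bar> < \<alpha>" using \<theta> g1 by simp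
      define U where "U = {\<nu>. Re (\<nu> * cis \<theta>) > 0}"
      have U: "open U" "\<mu> \<in> U" using pos by (auto simp: U_def intro!: open_Collect_less continuous_intros)
      have "rl \<theta> holomorphic_on U"
        using rl_hol[OF \<theta>\<alpha>] by (auto simp: U_def holomorphic_on_def intro: field_differentiable_at_within)
      then have "K holomorphic_on U"
        by (rule holomorphic_transform) (use \<theta>\<alpha> in \<open>auto simp: U_def ok_def intro!: K[symmetric]\<close>)
      then have "K field_differentiable at \<mu>" using U by (rule holomorphic_on_imp_differentiable_at)
      then show "K field_differentiable at \<mu> within sector (pi / 2 + \<gamma>)" by (rule field_differentiable_at_within)
    qed
    moreover have "cmod (\<mu> * K \<mu>) \<le> M / \<kappa>" if \<mu>: "\<mu> \<in> sector (pi / 2 + \<gamma>)" for \<mu>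
    proof -
      obtain \<theta> where \<theta>: "\<bar>\<theta>\<bar> = \<gamma>'" "Re (\<mu> * cis \<theta>) \<ge> \<kappa> * cmod \<mu>" using choose[OF \<mu>] by blast
      have \<mu>0: "cmod \<mu> > 0" using sector_nonzero[OF \<mu>] by simp
      have pos0: "\<kappa> * cmod \<mu> > 0" using \<kappa> \<mu>0 by simp
      then have pos: "Re (\<mu> * cis \<theta>) > 0" using \<theta>(2) by linarith
      have "K \<mu> = rl \<theta> \<mu>" by (rule K) (use \<theta> g1 pos in \<open>simp add: ok_def\<close>)
      also have "cmod \<dots> = cmod (laplace_integral (\<lambda>t. g (of_real t * cis \<theta>)) (\<mu> * cis \<theta>))"
        by (simp add: rl_def norm_mult)
      also have "\<dots> \<le> (LINT t|half_line. M * exp (- (Re (\<mu> * cis \<theta>) * t)))"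
        unfolding laplace_integral_def
      proof (rule half_line_norm_le)
        show "integrable half_line (\<lambda>t. M * exp (- (Re (\<mu> * cis \<theta>) * t)))"
          by (rule integrable_mult_right[OF half_line_exp(1)[OF pos]])
        fix t :: real assume "t > 0"
        then have "cmod (g (of_real t * cis \<theta>)) \<le> M" by (intro M ray) (use \<theta> g1 in auto)
        then show "cmod (exp (- (\<mu> * cis \<theta> * of_real t)) * g (of_real t * cis \<theta>)) \<le> M * exp (- (Re (\<mu> * cis \<theta>) * t))"
          unfolding norm_mult cmod_exp_mult_real by (simp only: mult.commute[of M] mult_left_mono exp_ge_zero)
      qed
      also have "\<dots> = M / Re (\<mu> * cis \<theta>)" using half_line_exp(2)[OF pos] by simp
      also have "\<dots> \<le> M / (\<kappa> * cmod \<mu>)" using M0 \<theta>(2) pos pos0 by (intro divide_left_mono) auto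
      finally have "cmod \<mu> * cmod (K \<mu>) \<le> cmod \<mu> * (M / (\<kappa> * cmod \<mu>))" by (intro mult_left_mono) auto
      also have "\<dots> = M / \<kappa>" using \<mu>0 by simp
      finally show ?thesis by (simp add: norm_mult)
    qed
    ultimately show "\<exists>M. sectorial K \<gamma> M" unfolding sectorial_def by blast
  qed
  moreover have "((\<lambda>r. of_real r * K (of_real r)) \<longlongrightarrow> g 0) at_top"
  proof -
    define \<gamma> where "\<gamma> = \<alpha> / 2"
    have \<gamma>: "0 < \<gamma>" "\<gamma> < \<alpha>" using \<alpha> by (auto simp: \<gamma>_def)
    obtain M where M: "\<And>z. z \<in> sector \<gamma> \<Longrightarrow> cmod (g z) \<le> M" using bd[OF \<gamma>] by blast
    have g0: "continuous_on {0..} (\<lambda>t. g (of_real t))"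
    proof (rule continuous_on_compose2[OF cont[OF \<gamma>]])
      show "complex_of_real ` {0..} \<subseteq> closure (sector \<gamma>)"
      proof
        fix z assume "z \<in> complex_of_real ` {0..}"
        then obtain t where t: "t \<ge> 0" "z = of_real t" by auto
        show "z \<in> closure (sector \<gamma>)"
          using zero_in_closure_sector[OF \<gamma>(1)] of_real_in_sector[OF _ \<gamma>(1), of t] closure_subset[of "sector \<gamma>"] t
          by (cases "t = 0") auto
      qed
    qed (intro continuous_intros)
    \<comment> \<open>Substituting \<open>s = r * t\<close> shows \<open>r * K r\<close> as the mean
      of \<open>g (s / r)\<close> with weight \<open>exp (- s)\<close>. The denominator
      \<open>max 1 r\<close> equals \<open>r\<close> in the end and makes measurability hold for
      every \<open>r\<close>, as dominated convergence demands.\<close>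
    have "((\<lambda>r. LINT s|half_line. exp (- complex_of_real s) * g (of_real (s / r))) \<longlongrightarrow> (LINT s|half_line. exp (- complex_of_real s) * g (of_real 0))) at_top"
    proof (rule Lim_transform_eventually)
      show "((\<lambda>r. LINT s|half_line. exp (- complex_of_real s) * g (of_real (s / max 1 r))) \<longlongrightarrow> (LINT s|half_line. exp (- complex_of_real s) * g (of_real 0))) at_top"
      proof (rule integral_dominated_convergence_at_top)
        show "integrable half_line (\<lambda>s. M * exp (- (1 * s)))"
          by (rule integrable_mult_right[OF half_line_exp(1)]) simp
        show "(\<lambda>s. exp (- complex_of_real s) * g (of_real 0)) \<in> borel_measurable half_line"
          by (intro continuous_half_line_measurable continuous_intros)
        show "(\<lambda>s. exp (- complex_of_real s) * g (of_real (s / max 1 r))) \<in> borel_measurable half_line" for r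
          by (intro continuous_half_line_measurable continuous_intros continuous_on_compose2[OF g0]) auto
        show "AE s in half_line. ((\<lambda>r. exp (- complex_of_real s) * g (of_real (s / max 1 r))) \<longlongrightarrow> exp (- complex_of_real s) * g (of_real 0)) at_top"
        proof (rule AE_half_lineI)
          fix s :: real assume s: "s > 0"
          have "filterlim (\<lambda>r. s / max 1 r) (at 0 within {0..}) at_top"
            unfolding filterlim_at
          proof
            show "\<forall>\<^sub>F r in at_top. s / max 1 r \<in> {0..} \<and> s / max 1 r \<noteq> 0" using s by (intro always_eventually) auto
            have "((\<lambda>r. s / r) \<longlongrightarrow> 0) at_top" by real_asymp
            then show "((\<lambda>r. s / max 1 r) \<longlongrightarrow> 0) at_top"
              by (rule Lim_transform_eventually) (auto intro: eventually_mono[OF eventually_ge_at_top[of 1]])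
          qed
          moreover have "((\<lambda>t. g (of_real t)) \<longlongrightarrow> g (of_real 0)) (at 0 within {0..})"
            using bspec[OF g0[unfolded continuous_on_def], of 0] by simp
          ultimately have "((\<lambda>r. g (of_real (s / max 1 r))) \<longlongrightarrow> g (of_real 0)) at_top"
            by (rule filterlim_compose[rotated])
          then show "((\<lambda>r. exp (- complex_of_real s) * g (of_real (s / max 1 r))) \<longlongrightarrow> exp (- complex_of_real s) * g (of_real 0)) at_top"
            by (rule tendsto_mult_left)
        qed
        show "\<forall>\<^sub>F r in at_top. AE s in half_line. cmod (exp (- complex_of_real s) * g (of_real (s / max 1 r))) \<le> M * exp (- (1 * s))"
        proof (rule always_eventually, rule allI, rule AE_half_lineI)
          fix r s :: real assume "s > 0"
          then have "cmod (g (of_real (s / max 1 r))) \<le> M" by (intro M of_real_in_sector \<gamma>) auto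
          then show "cmod (exp (- complex_of_real s) * g (of_real (s / max 1 r))) \<le> M * exp (- (1 * s))"
            by (simp add: norm_mult mult.commute)
        qed
      qed
    qed (auto intro: eventually_mono[OF eventually_ge_at_top[of 1]])
    moreover have "(LINT s|half_line. exp (- complex_of_real s) * g (of_real 0)) = g 0"
      using half_line_complex_exp(2)[of 1] by simp
    moreover have "\<forall>\<^sub>F r in at_top. (LINT s|half_line. exp (- complex_of_real s) * g (of_real (s / r))) = of_real r * K (of_real r)"
      using eventually_gt_at_top[of 0]
    proof eventually_elim
      case (elim r)
      have "laplace_integral (\<lambda>t. g (of_real t)) (of_real r) = (1 / r) *\<^sub>R (LINT s|half_line. exp (- (of_real r * of_real (1 / r * s))) * g (of_real (1 / r * s)))"
        unfolding laplace_integral_def by (rule half_line_scale) (use elim in simp)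
      then show ?case using K_real[of "of_real r"] elim by (simp add: scaleR_conv_of_real)
    qed
    ultimately show ?thesis using Lim_transform_eventually by fastforce
  qed
  ultimately show ?thesis using K_real by (intro that) auto
qed

section \<open>The truncated transform of a locally integrable function\<close>

text \<open>Local integrability yields only Lebesgue measurability, while Fubini's theorem for Borel
  products needs a Borel kernel. The value 0 on the negative axis lets convolutions be written as
  integrals over the whole half-line.\<close>

lemma locally_integrable_borel_version:
  assumes a: "locally_integrable a"
  obtains b N where "b \<in> borel_measurable borel" "\<And>t. t \<le> 0 \<Longrightarrow> b t = 0" "negligible N"
    "\<And>t. t > 0 \<Longrightarrow> t \<notin> N \<Longrightarrow> b t = a t"
proof -
  define f where "f = (\<lambda>n::nat. \<lambda>t. indicator {0..real n} t *\<^sub>R a t)"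
  have fm: "f n \<in> borel_measurable lebesgue" for n
    using a unfolding locally_integrable_def set_integrable_def f_def by (auto intro: borel_measurable_integrable)
  have "(\<lambda>t. indicator {0..} t *\<^sub>R a t) \<in> borel_measurable lebesgue"
  proof (rule borel_measurable_LIMSEQ_metric[OF fm])
    fix t :: real
    have "\<forall>\<^sub>F n in sequentially. f n t = indicator {0..} t *\<^sub>R a t"
      using eventually_ge_at_top[of "nat \<lceil>t\<rceil>"]
    proof eventually_elim
      case (elim n)
      then have "t \<le> real n" by linarith
      then show ?case by (auto simp: f_def indicator_def)
    qed
    then show "(\<lambda>n. f n t) \<longlonglongrightarrow> indicator {0..} t *\<^sub>R a t" by (rule tendsto_eventually)
  qed
  then have m: "(\<lambda>t. Re (indicator {0..} t *\<^sub>R a t)) \<in> borel_measurable (completion lborel)"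
    "(\<lambda>t. Im (indicator {0..} t *\<^sub>R a t)) \<in> borel_measurable (completion lborel)"
    by (intro borel_measurable_continuous_on[where f=Re] borel_measurable_continuous_on[where f=Im]
        continuous_intros; simp)+
  obtain u where u: "u \<in> borel_measurable lborel" "AE t in lborel. Re (indicator {0..} t *\<^sub>R a t) = u t"
    using completion_ex_borel_measurable_real[OF m(1)] by blast
  obtain v where v: "v \<in> borel_measurable lborel" "AE t in lborel. Im (indicator {0..} t *\<^sub>R a t) = v t"
    using completion_ex_borel_measurable_real[OF m(2)] by blast
  have [measurable]: "u \<in> borel_measurable borel" "v \<in> borel_measurable borel" using u v by auto
  define b where "b = (\<lambda>t. indicator {0<..} t *\<^sub>R (complex_of_real (u t) + \<i> * complex_of_real (v t)))"
  have "AE t in lborel. t > 0 \<longrightarrow> b t = a t"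
    using u(2) v(2) by eventually_elim (auto simp: b_def complex_eq_iff)
  then obtain N where N: "N \<in> null_sets lborel" "{t \<in> space lborel. \<not> (t > 0 \<longrightarrow> b t = a t)} \<subseteq> N"
    by (auto elim!: AE_E simp: null_sets_def)
  show ?thesis
  proof
    show "b \<in> borel_measurable borel" unfolding b_def by measurable
    show "negligible N" using N(1) by (simp add: negligible_iff_null_sets null_sets_completionI)
    show "b t = a t" if "t > 0" "t \<notin> N" for t using N(2) that by auto
  qed (auto simp: b_def)
qed

text \<open>The second mean value theorem leaves an integral over \<open>{0..c}\<close>, at most
  \<open>B\<close>, and one over \<open>{c..b}\<close>, a difference of two such and so at most
  \<open>2 * B\<close>; hence the factor 3.\<close>

lemma bounded_antimono_integral:
  fixes f h :: "real \<Rightarrow> real"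
  assumes f: "\<And>b. b \<ge> 0 \<Longrightarrow> f integrable_on {0..b}" and B: "\<And>b. b \<ge> 0 \<Longrightarrow> \<bar>integral {0..b} f\<bar> \<le> B"
    and h: "\<And>x y. 0 \<le> x \<Longrightarrow> x \<le> y \<Longrightarrow> h y \<le> h x" "\<And>x. x \<ge> 0 \<Longrightarrow> 0 \<le> h x" and b: "b \<ge> 0"
  shows "(\<lambda>x. h x * f x) integrable_on {0..b}" "\<bar>integral {0..b} (\<lambda>x. h x * f x)\<bar> \<le> 3 * h 0 * B"
proof -
  obtain c where c: "c \<in> {0..b}"
    and hi: "((\<lambda>x. - h x * f x) has_integral (- h 0 * integral {0..c} f + - h b * integral {c..b} f)) {0..b}"
    by (rule second_mean_value_theorem_full[OF f[OF b] b, of "\<lambda>x. - h x"]) (use h in auto)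
  have hi': "((\<lambda>x. h x * f x) has_integral (h 0 * integral {0..c} f + h b * integral {c..b} f)) {0..b}"
    using has_integral_neg[OF hi] by (simp add: add.commute)
  then show "(\<lambda>x. h x * f x) integrable_on {0..b}" by blast
  have "integral {0..c} f + integral {c..b} f = integral {0..b} f"
    by (rule Henstock_Kurzweil_Integration.integral_combine) (use c f[OF b] in auto)
  then have 1: "\<bar>integral {c..b} f\<bar> \<le> 2 * B" using B[of c] B[of b] c b by auto
  have B0: "B \<ge> 0" using B[of 0] by simp
  have "\<bar>h 0 * integral {0..c} f + h b * integral {c..b} f\<bar> \<le> h 0 * B + h 0 * (2 * B)"
  proof (rule order_trans[OF abs_triangle_ineq add_mono])
    show "\<bar>h 0 * integral {0..c} f\<bar> \<le> h 0 * B"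
      using B[of c] c h(2)[of 0] by (simp add: abs_mult mult_left_mono)
    show "\<bar>h b * integral {c..b} f\<bar> \<le> h 0 * (2 * B)"
      unfolding abs_mult using 1 h(1)[of 0 b] h(2)[of b] h(2)[of 0] b by (intro mult_mono) auto
  qed
  then show "\<bar>integral {0..b} (\<lambda>x. h x * f x)\<bar> \<le> 3 * h 0 * B"
    using integral_unique[OF hi'] by (simp add: algebra_simps)
qed

text \<open>The offset \<open>1 + \<bar>y\<bar> / \<epsilon>\<close> is chosen so that the loss from
  damping, \<open>\<epsilon>\<close> times the bracket, outweighs the slope of the cosine, which is
  at most \<open>\<bar>y\<bar>\<close>.\<close>

lemma damped_cosine_antimono:
  fixes \<epsilon> y \<phi> :: real
  assumes \<epsilon>: "\<epsilon> > 0" and x: "x \<le> x'"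
  shows "exp (- (\<epsilon> * x')) * (cos (y * x' + \<phi>) + (1 + \<bar>y\<bar> / \<epsilon>)) \<le> exp (- (\<epsilon> * x)) * (cos (y * x + \<phi>) + (1 + \<bar>y\<bar> / \<epsilon>))"
proof (rule DERIV_nonpos_imp_nonincreasing[OF x])
  fix t
  let ?D = "exp (- (\<epsilon> * t)) * (- \<epsilon> * (cos (y * t + \<phi>) + (1 + \<bar>y\<bar> / \<epsilon>)) - y * sin (y * t + \<phi>))"
  have "((\<lambda>x. exp (- (\<epsilon> * x)) * (cos (y * x + \<phi>) + (1 + \<bar>y\<bar> / \<epsilon>))) has_real_derivative ?D) (at t)"
    by (auto intro!: derivative_eq_intros simp: algebra_simps)
  moreover have "?D \<le> 0"
  proof (rule mult_nonneg_nonpos)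
    have "- y * sin (y * t + \<phi>) \<le> \<bar>y\<bar> * 1"
      by (rule order_trans[OF abs_ge_self]) (simp add: abs_mult mult_left_le)
    moreover have "\<epsilon> * cos (y * t + \<phi>) \<ge> \<epsilon> * (-1)" using \<epsilon> by (intro mult_left_mono) auto
    ultimately show "- \<epsilon> * (cos (y * t + \<phi>) + (1 + \<bar>y\<bar> / \<epsilon>)) - y * sin (y * t + \<phi>) \<le> 0"
      using \<epsilon> by (simp add: algebra_simps)
  qed simp
  ultimately show "\<exists>D. ((\<lambda>x. exp (- (\<epsilon> * x)) * (cos (y * x + \<phi>) + (1 + \<bar>y\<bar> / \<epsilon>))) has_real_derivative D) (at t) \<and> D \<le> 0"
    by blast
qed

text \<open>The oscillating weight is not monotone, but it is the difference of two nonnegative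
  decreasing weights, each covered by the mean value estimate.\<close>

lemma bounded_damped_cosine_integral:
  fixes f :: "real \<Rightarrow> real"
  assumes f: "\<And>b. b \<ge> 0 \<Longrightarrow> f integrable_on {0..b}" and B: "\<And>b. b \<ge> 0 \<Longrightarrow> \<bar>integral {0..b} f\<bar> \<le> B"
    and \<epsilon>: "\<epsilon> > 0"
  shows "\<exists>B'. \<forall>b\<ge>0. (\<lambda>x. exp (- (\<epsilon> * x)) * cos (y * x + \<phi>) * f x) integrable_on {0..b} \<and>
    \<bar>integral {0..b} (\<lambda>x. exp (- (\<epsilon> * x)) * cos (y * x + \<phi>) * f x)\<bar> \<le> B'"
proof -
  define C where "C = 1 + \<bar>y\<bar> / \<epsilon>"
  define h where "h = (\<lambda>x. exp (- (\<epsilon> * x)) * (cos (y * x + \<phi>) + C))"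
  define k where "k = (\<lambda>x. exp (- (\<epsilon> * x)) * C)"
  have C: "C \<ge> 1" using \<epsilon> by (simp add: C_def)
  have hk: "h x' \<le> h x" "k x' \<le> k x" if "x \<le> x'" for x x'
  proof -
    show "h x' \<le> h x" using damped_cosine_antimono[OF \<epsilon> that, of y \<phi>] by (simp add: h_def C_def)
    show "k x' \<le> k x" unfolding k_def by (rule mult_right_mono) (use \<epsilon> that C in auto)
  qed
  have pos: "0 \<le> h x" "0 \<le> k x" for x
  proof -
    have "cos (y * x + \<phi>) + C \<ge> 0" using C cos_ge_minus_one[of "y * x + \<phi>"] by linarith
    then show "0 \<le> h x" "0 \<le> k x" using C by (auto simp: h_def k_def)
  qed
  have eq: "exp (- (\<epsilon> * x)) * cos (y * x + \<phi>) * f x = h x * f x - k x * f x" for x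
    by (simp add: h_def k_def algebra_simps)
  show ?thesis
  proof (intro exI allI impI)
    fix b :: real assume b: "b \<ge> 0"
    note i1 = bounded_antimono_integral[OF f B, of h b, OF _ _ hk(1) pos(1) b]
    note i2 = bounded_antimono_integral[OF f B, of k b, OF _ _ hk(2) pos(2) b]
    show "(\<lambda>x. exp (- (\<epsilon> * x)) * cos (y * x + \<phi>) * f x) integrable_on {0..b} \<and>
      \<bar>integral {0..b} (\<lambda>x. exp (- (\<epsilon> * x)) * cos (y * x + \<phi>) * f x)\<bar> \<le> 3 * h 0 * B + 3 * k 0 * B"
      unfolding eq using i1 i2
      by (auto intro: integrable_diff simp: Henstock_Kurzweil_Integration.integral_diff)
  qed
qed

text \<open>Existence of the transform at \<open>z\<close> is conditional convergence, possibly off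
  the real axis. It bounds the partial integrals of the real and imaginary parts, and moving right
  to \<open>\<sigma>\<close> supplies the damping with which these recombine into integrals of
  \<open>p\<close> against a real exponential.\<close>

lemma laplace_exists_abs_bounded:
  fixes p :: "real \<Rightarrow> real"
  assumes p: "\<And>b. b \<ge> 0 \<Longrightarrow> p absolutely_integrable_on {0..b}"
    and z: "laplace_exists (\<lambda>t. of_real (p t)) z" and \<sigma>: "\<sigma> > Re z"
  shows "\<exists>B. \<forall>b\<ge>0. integral {0..b} (\<lambda>t. exp (- (\<sigma> * t)) * p t) \<le> B"
proof -
  define F where "F = (\<lambda>t. exp (- z * of_real t) * complex_of_real (p t))"
  have Fi: "F integrable_on {0..b}" if "b \<ge> 0" for b
  proof -
    have "(\<lambda>t. exp (- z * of_real t)) \<in> borel_measurable (lebesgue_on {0..b})"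
      by (intro continuous_imp_measurable_on_sets_lebesgue continuous_intros) auto
    moreover have "bounded ((\<lambda>t. exp (- z * of_real t)) ` {0..b})"
      by (intro compact_imp_bounded compact_continuous_image continuous_intros) auto
    moreover have "(\<lambda>t. complex_of_real (p t)) absolutely_integrable_on {0..b}"
      using absolutely_integrable_linear[OF p[OF that] bounded_linear_of_real[where 'a=complex]] by (simp add: o_def)
    ultimately have "(\<lambda>t. exp (- z * of_real t) * complex_of_real (p t)) absolutely_integrable_on {0..b}"
      by (intro absolutely_integrable_bounded_measurable_product[OF bilinear_times]) auto
    then show ?thesis unfolding F_def by (rule set_lebesgue_integral_eq_integral(1))
  qed
  define G where "G = (\<lambda>b. integral {0..b} F)"
  obtain L where L: "(G \<longlongrightarrow> L) at_top"
    using z unfolding laplace_exists_def truncated_laplace_def F_def G_def by auto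
  obtain b0 where b0: "\<And>b. b \<ge> b0 \<Longrightarrow> dist (G b) L < 1"
    using tendstoD[OF L, of 1] by (auto simp: eventually_at_top_linorder)
  have "continuous_on {0..max 0 b0} G"
    unfolding G_def by (rule indefinite_integral_continuous_1) (use Fi in auto)
  then have "bounded (G ` {0..max 0 b0})" by (intro compact_imp_bounded compact_continuous_image) auto
  then obtain B1 where B1: "\<And>b. b \<in> {0..max 0 b0} \<Longrightarrow> cmod (G b) \<le> B1" unfolding bounded_iff by blast
  define B where "B = max B1 (cmod L + 1)"
  have GB: "cmod (G b) \<le> B" if "b \<ge> 0" for b
  proof (cases "b \<le> max 0 b0")
    case True then show ?thesis using B1[of b] that by (auto simp: B_def)
  next
    case False
    then have "dist (G b) L < 1" using b0[of b] by auto
    then have "cmod (G b) \<le> cmod L + 1" using norm_triangle_ineq2[of "G b" L] by (simp add: dist_norm)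
    then show ?thesis by (simp add: B_def)
  qed
  define c s where "c = (\<lambda>t. Re (F t))" and "s = (\<lambda>t. - Im (F t))"
  have ci: "c integrable_on {0..b}" "s integrable_on {0..b}" "\<bar>integral {0..b} c\<bar> \<le> B" "\<bar>integral {0..b} s\<bar> \<le> B"
    if b: "b \<ge> 0" for b
  proof -
    have F1: "(F has_integral G b) {0..b}" unfolding G_def by (rule integrable_integral[OF Fi[OF b]])
    have "(c has_integral Re (G b)) {0..b}"
      unfolding c_def using has_integral_linear[OF F1 bounded_linear_Re] by (simp add: o_def)
    moreover have "((\<lambda>t. Im (F t)) has_integral Im (G b)) {0..b}"
      using has_integral_linear[OF F1 bounded_linear_Im] by (simp add: o_def)
    then have "(s has_integral - Im (G b)) {0..b}" unfolding s_def by (rule has_integral_neg)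
    ultimately show "c integrable_on {0..b}" "s integrable_on {0..b}" "\<bar>integral {0..b} c\<bar> \<le> B" "\<bar>integral {0..b} s\<bar> \<le> B"
      using GB[OF b] abs_Re_le_cmod[of "G b"] abs_Im_le_cmod[of "G b"] by (auto simp: integral_unique)
  qed
  define \<epsilon> y where "\<epsilon> = \<sigma> - Re z" and "y = Im z"
  have \<epsilon>: "\<epsilon> > 0" using \<sigma> by (simp add: \<epsilon>_def)
  obtain Bc where Bc: "\<And>b. b \<ge> 0 \<Longrightarrow> (\<lambda>x. exp (- (\<epsilon> * x)) * cos (y * x + 0) * c x) integrable_on {0..b} \<and>
    \<bar>integral {0..b} (\<lambda>x. exp (- (\<epsilon> * x)) * cos (y * x + 0) * c x)\<bar> \<le> Bc"
    using bounded_damped_cosine_integral[OF ci(1,3) \<epsilon>, of y 0] by blast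
  obtain Bs where Bs: "\<And>b. b \<ge> 0 \<Longrightarrow> (\<lambda>x. exp (- (\<epsilon> * x)) * cos (y * x + (- pi / 2)) * s x) integrable_on {0..b} \<and>
    \<bar>integral {0..b} (\<lambda>x. exp (- (\<epsilon> * x)) * cos (y * x + (- pi / 2)) * s x)\<bar> \<le> Bs"
    using bounded_damped_cosine_integral[OF ci(2,4) \<epsilon>, of y "- pi / 2"] by blast
  have cs: "cos (x + (- pi / 2)) = sin x" for x :: real by (simp add: cos_diff)
  \<comment> \<open>Multiplying the parts \<open>c\<close> and \<open>s\<close> once more by cosine
    and sine removes the oscillation, as the squares add up to 1; the phase \<open>- pi / 2\<close>
    obtains the sine from the cosine estimate.\<close>
  have eq: "exp (- (\<sigma> * t)) * p t = exp (- (\<epsilon> * t)) * cos (y * t + 0) * c t + exp (- (\<epsilon> * t)) * cos (y * t + (- pi / 2)) * s t" for t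
  proof -
    have Fc: "c t = exp (- (Re z * t)) * cos (y * t) * p t" "s t = exp (- (Re z * t)) * sin (y * t) * p t"
      by (auto simp: c_def s_def F_def y_def Re_exp Im_exp)
    have "exp (- (\<epsilon> * t)) * cos (y * t + 0) * c t + exp (- (\<epsilon> * t)) * cos (y * t + (- pi / 2)) * s t
      = (exp (- (\<epsilon> * t)) * exp (- (Re z * t))) * ((cos (y * t))\<^sup>2 + (sin (y * t))\<^sup>2) * p t"
      unfolding cs Fc by (simp add: power2_eq_square algebra_simps del: sin_cos_squared_add sin_cos_squared_add2 sin_cos_squared_add3)
    also have "\<dots> = exp (- (\<sigma> * t)) * p t" by (simp add: \<epsilon>_def algebra_simps flip: exp_add)
    finally show ?thesis by simp
  qed
  show ?thesis
  proof (intro exI allI impI)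
    fix b :: real assume "b \<ge> 0"
    then show "integral {0..b} (\<lambda>t. exp (- (\<sigma> * t)) * p t) \<le> Bc + Bs"
      unfolding eq using Bc[of b] Bs[of b]
      by (subst Henstock_Kurzweil_Integration.integral_add) auto
  qed
qed

text \<open>For nonnegative functions bounded partial integrals already give integrability, by
  monotone convergence along the intervals \<open>{0..n}\<close>.\<close>

lemma half_line_integrable_of_bounded:
  fixes f :: "real \<Rightarrow> real"
  assumes f: "f \<in> borel_measurable borel" "\<And>t. 0 \<le> f t" and B: "\<And>b. b \<ge> 0 \<Longrightarrow> (f has_integral I b) {0..b} \<and> I b \<le> B"
  shows "integrable half_line f"
  unfolding half_line_set_integrable(1) set_integrable_def
proof (rule integrableI_bounded)
  show "(\<lambda>x. indicator {0..} x *\<^sub>R f x) \<in> borel_measurable lborel"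
    by (intro borel_measurable_scaleR borel_measurable_indicator) (use f(1) in auto)
  have "(\<integral>\<^sup>+ t. ennreal (norm (indicator {0..} t *\<^sub>R f t)) \<partial>lborel) = (\<integral>\<^sup>+ t. (SUP n::nat. ennreal (f t) * indicator {0..real n} t) \<partial>lborel)"
  proof (rule nn_integral_cong)
    fix t
    have mono: "ennreal (f t) * indicator {0..real n} t \<le> ennreal (f t) * indicator {0..} t" for n
      by (auto simp: indicator_def)
    have "(SUP n::nat. ennreal (f t) * indicator {0..real n} t) = ennreal (f t) * indicator {0..} t"
    proof (rule antisym)
      show "(SUP n::nat. ennreal (f t) * indicator {0..real n} t) \<le> ennreal (f t) * indicator {0..} t"
        by (intro SUP_least mono)
      have "t \<le> real (nat \<lceil>t\<rceil>)" by linarith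
      then have "ennreal (f t) * indicator {0..} t \<le> ennreal (f t) * indicator {0..real (nat \<lceil>t\<rceil>)} t"
        by (auto simp: indicator_def)
      also have "\<dots> \<le> (SUP n::nat. ennreal (f t) * indicator {0..real n} t)" by (rule SUP_upper) simp
      finally show "ennreal (f t) * indicator {0..} t \<le> (SUP n::nat. ennreal (f t) * indicator {0..real n} t)" .
    qed
    then show "ennreal (norm (indicator {0..} t *\<^sub>R f t)) = (SUP n::nat. ennreal (f t) * indicator {0..real n} t)"
      using f(2)[of t] by (auto simp: indicator_def)
  qed
  also have "\<dots> = (SUP n::nat. \<integral>\<^sup>+ t. ennreal (f t) * indicator {0..real n} t \<partial>lborel)"
  proof (rule nn_integral_monotone_convergence_SUP)
    show "incseq (\<lambda>n::nat. \<lambda>t. ennreal (f t) * indicator {0..real n} t)"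
      by (auto simp: incseq_def le_fun_def indicator_def)
    show "(\<lambda>t. ennreal (f t) * indicator {0..real n} t) \<in> borel_measurable lborel" for n :: nat
      by (intro borel_measurable_times_ennreal borel_measurable_indicator measurable_compose[OF f(1) measurable_ennreal, simplified]) (use f(1) in auto)
  qed
  also have "\<dots> \<le> ennreal B"
  proof (rule SUP_least)
    fix n :: nat
    have "((\<lambda>t. indicator {0..real n} t * f t) has_integral I (real n)) UNIV"
      using B[of "real n"] has_integral_restrict_UNIV[of "{0..real n}" f "I (real n)"]
      by (simp add: indicator_def of_bool_def if_distrib[of "\<lambda>x. x * _"] cong: if_cong)
    then have "(\<integral>\<^sup>+ t. ennreal (indicator {0..real n} t * f t) \<partial>lborel) = ennreal (I (real n))"
      using f by (intro nn_integral_has_integral_lborel borel_measurable_times borel_measurable_indicator) auto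
    moreover have "(\<integral>\<^sup>+ t. ennreal (f t) * indicator {0..real n} t \<partial>lborel) = (\<integral>\<^sup>+ t. ennreal (indicator {0..real n} t * f t) \<partial>lborel)"
      by (intro nn_integral_cong) (auto simp: indicator_def)
    ultimately show "(\<integral>\<^sup>+ t. ennreal (f t) * indicator {0..real n} t \<partial>lborel) \<le> ennreal B"
      using B[of "real n"] by (simp add: ennreal_leI)
  qed
  finally show "(\<integral>\<^sup>+ t. ennreal (norm (indicator {0..} t *\<^sub>R f t)) \<partial>lborel) < \<infinity>"
    by (rule order.strict_trans1) simp
qed

lemma laplace_eq_laplace_integral:
  assumes f: "laplace_integrable f \<sigma>" and N: "negligible N" and eq: "\<And>t. t > 0 \<Longrightarrow> t \<notin> N \<Longrightarrow> f t = g t" and \<mu>: "Re \<mu> \<ge> \<sigma>"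
  shows "laplace g \<mu> = laplace_integral f \<mu>"
proof -
  have tr: "truncated_laplace g \<mu> b = integral {0..b} (\<lambda>t. exp (- (\<mu> * of_real t)) * f t)" for b
    unfolding truncated_laplace_def
    by (rule integral_spike[of "insert 0 N"]) (use N eq in \<open>auto simp: negligible_insert\<close>)
  have "(truncated_laplace g \<mu> \<longlongrightarrow> laplace_integral f \<mu>) at_top"
    unfolding laplace_integral_def tr[abs_def]
    by (rule half_line_integral_limit[OF laplace_integrableD[OF f \<mu>]])
  then show ?thesis unfolding laplace_def by (intro tendsto_Lim) auto
qed

text \<open>For the nonnegative function \<open>cmod (a t)\<close> the bounded partial integrals
  amount to absolute convergence to the right of \<open>\<omega>\<close>. If the transform vanished
  at all reals beyond some \<open>\<sigma>\<close>, uniqueness would force \<open>a\<close> to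
  vanish almost everywhere.\<close>

lemma locally_integrable_kernel:
  assumes a: "locally_integrable a" and abs: "laplace_abscissa (\<lambda>t. of_real (cmod (a t))) \<le> ereal \<omega>"
    and nz: "\<not> (AE t in lebesgue_on {0..}. a t = 0)"
  obtains b N where "b \<in> borel_measurable borel" "\<And>t. t \<le> 0 \<Longrightarrow> b t = 0" "negligible N"
    "\<And>t. t > 0 \<Longrightarrow> t \<notin> N \<Longrightarrow> b t = a t"
    "\<And>\<sigma>. \<sigma> > \<omega> \<Longrightarrow> laplace_integrable b \<sigma>"
    "\<And>\<mu>. Re \<mu> > \<omega> \<Longrightarrow> laplace a \<mu> = laplace_integral b \<mu>"
    "\<And>\<sigma>. \<sigma> > \<omega> \<Longrightarrow> \<exists>r>\<sigma>. laplace_integral b (of_real r) \<noteq> 0"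
proof -
  obtain b N where b: "b \<in> borel_measurable borel" "\<And>t. t \<le> 0 \<Longrightarrow> b t = 0" and N: "negligible N"
    "\<And>t. t > 0 \<Longrightarrow> t \<notin> N \<Longrightarrow> b t = a t"
    using locally_integrable_borel_version[OF a] by blast
  have [measurable]: "b \<in> borel_measurable borel" by (rule b)
  have aloc: "(\<lambda>t. cmod (a t)) absolutely_integrable_on {0..T}" if "T \<ge> 0" for T
    using a that unfolding locally_integrable_def by (intro absolutely_integrable_norm[unfolded o_def]) auto
  have li: "laplace_integrable b \<sigma>" if \<sigma>: "\<sigma> > \<omega>" for \<sigma>
  proof -
    have "laplace_abscissa (\<lambda>t. of_real (cmod (a t))) < ereal \<sigma>" using abs \<sigma> by (metis ereal_less_eq(3) ereal_less(2) less_ereal.simps(1) order.strict_trans1)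
    then obtain z where z: "laplace_exists (\<lambda>t. of_real (cmod (a t))) z" "Re z < \<sigma>"
      unfolding laplace_abscissa_def by (auto simp: INF_less_iff)
    obtain B where B: "\<And>T. T \<ge> 0 \<Longrightarrow> integral {0..T} (\<lambda>t. exp (- (\<sigma> * t)) * cmod (a t)) \<le> B"
      using laplace_exists_abs_bounded[OF aloc z] by blast
    have "integrable half_line (\<lambda>t. exp (- (\<sigma> * t)) * cmod (b t))"
    proof (rule half_line_integrable_of_bounded[where I="\<lambda>T. integral {0..T} (\<lambda>t. exp (- (\<sigma> * t)) * cmod (a t))" and B=B])
      show "(\<lambda>t. exp (- (\<sigma> * t)) * cmod (b t)) \<in> borel_measurable borel" by measurable
      fix T :: real assume T: "T \<ge> 0"
      have "(\<lambda>t. exp (- (\<sigma> * t)) * cmod (a t)) absolutely_integrable_on {0..T}"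
        by (intro absolutely_integrable_bounded_measurable_product[OF bilinear_times] aloc T
            continuous_imp_measurable_on_sets_lebesgue compact_imp_bounded compact_continuous_image continuous_intros) auto
      then have "((\<lambda>t. exp (- (\<sigma> * t)) * cmod (a t)) has_integral integral {0..T} (\<lambda>t. exp (- (\<sigma> * t)) * cmod (a t))) {0..T}"
        by (intro integrable_integral set_lebesgue_integral_eq_integral(1))
      then have "((\<lambda>t. exp (- (\<sigma> * t)) * cmod (b t)) has_integral integral {0..T} (\<lambda>t. exp (- (\<sigma> * t)) * cmod (a t))) {0..T}"
        by (rule has_integral_spike[of "insert 0 N", rotated 2]) (use N in \<open>auto simp: negligible_insert\<close>)
      then show "((\<lambda>t. exp (- (\<sigma> * t)) * cmod (b t)) has_integral integral {0..T} (\<lambda>t. exp (- (\<sigma> * t)) * cmod (a t))) {0..T} \<and>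
        integral {0..T} (\<lambda>t. exp (- (\<sigma> * t)) * cmod (a t)) \<le> B" using B[OF T] by simp
    qed simp
    then show ?thesis unfolding laplace_integrable_def using b(1) by (simp add: borel_measurable_half_line)
  qed
  show ?thesis
  proof (rule that[OF b N li])
    show "laplace a \<mu> = laplace_integral b \<mu>" if "Re \<mu> > \<omega>" for \<mu>
      by (rule laplace_eq_laplace_integral[OF li[of "Re \<mu>"] N]) (use that in auto)
    show "\<exists>r>\<sigma>. laplace_integral b (of_real r) \<noteq> 0" if \<sigma>: "\<sigma> > \<omega>" for \<sigma>
    proof (rule ccontr)
      assume "\<not> ?thesis"
      then have "AE t in half_line. b t = 0" by (intro laplace_unique_AE[OF li[OF \<sigma>]]) auto
      then have "AE t in lborel. t > 0 \<longrightarrow> b t = 0" by (simp add: AE_half_line_iff)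
      then have "AE t in lebesgue. t > 0 \<longrightarrow> b t = 0" by (rule AE_completion)
      moreover have "AE t in lebesgue. t \<notin> insert 0 N"
        using N(1) by (intro AE_not_in) (simp add: negligible_iff_null_sets[symmetric] negligible_insert)
      ultimately have "AE t in lebesgue. t \<in> {0..} \<longrightarrow> a t = 0"
        by eventually_elim (use N(2) in \<open>auto simp: less_le\<close>)
      then have "AE t in lebesgue_on {0..}. a t = 0" by (subst AE_restrict_space_iff) auto
      then show False using nz by simp
    qed
  qed
qed

section \<open>Convolution\<close>

text \<open>Written without an upper limit: for a kernel that vanishes on the nonpositive axis the
  integrand stops at \<open>s = t\<close> by itself.\<close>

definition convolution :: "(real \<Rightarrow> complex) \<Rightarrow> (real \<Rightarrow> complex) \<Rightarrow> real \<Rightarrow> complex" where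
  "convolution b f t = (LINT s|half_line. b (t - s) * f s)"

lemma half_line_translate:
  fixes h :: "real \<Rightarrow> 'b::{banach, second_countable_topology}"
  assumes h: "\<And>t. t \<le> 0 \<Longrightarrow> h t = 0" and s: "s \<ge> 0"
  shows "integrable half_line (\<lambda>t. h (t - s)) \<longleftrightarrow> integrable half_line h"
    and "(LINT t|half_line. h (t - s)) = (LINT t|half_line. h t)"
proof -
  have 1: "(\<lambda>t. indicator {0<..} t *\<^sub>R h (t - s)) = (\<lambda>t. h (- s + 1 * t))"
    and 2: "(\<lambda>t. indicator {0<..} t *\<^sub>R h t) = h"
    using h s by (auto simp: fun_eq_iff indicator_def)
  show "integrable half_line (\<lambda>t. h (t - s)) \<longleftrightarrow> integrable half_line h"
    unfolding half_line_integrable_iff set_integrable_def 1 2 by (rule lborel_integrable_real_affine_iff) simp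
  show "(LINT t|half_line. h (t - s)) = (LINT t|half_line. h t)"
    unfolding half_line_integral set_lebesgue_integral_def 1 2
    using lborel_integral_real_affine[of 1 h "- s"] by simp
qed

text \<open>Distributing the exponential over the two factors turns the double integral into one of
  \<open>h (t - s)\<close>, and because \<open>h\<close> vanishes on the nonpositive axis,
  translating it by \<open>s\<close> preserves its integral over the half-line.\<close>

lemma convolution_laplace:
  assumes b: "b \<in> borel_measurable borel" "\<And>t. t \<le> 0 \<Longrightarrow> b t = 0" "laplace_integrable b \<sigma>" and f: "laplace_integrable f \<sigma>"
  shows "laplace_integrable (convolution b f) \<sigma>"
    and "laplace_integral (convolution b f) (of_real \<sigma>) = laplace_integral b (of_real \<sigma>) * laplace_integral f (of_real \<sigma>)"
proof -
  have [measurable]: "b \<in> borel_measurable borel" "f \<in> borel_measurable half_line"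
    using b f laplace_integrable_measurable by auto
  define h where "h = (\<lambda>u. exp (- (of_real \<sigma> * of_real u)) * b u)"
  define F where "F = (\<lambda>s t. (exp (- (of_real \<sigma> * of_real s)) * f s) * h (t - s))"
  have h0: "h u = 0" if "u \<le> 0" for u using b(2)[OF that] by (simp add: h_def)
  have [measurable]: "h \<in> borel_measurable borel" unfolding h_def by measurable
  have meas: "case_prod F \<in> borel_measurable (half_line \<Otimes>\<^sub>M half_line)"
    unfolding F_def case_prod_beta by measurable
  have hi: "integrable half_line h" unfolding h_def by (rule laplace_integrableD[OF b(3)]) simp
  have fi: "integrable half_line (\<lambda>s. exp (- (of_real \<sigma> * of_real s)) * f s)" by (rule laplace_integrableD[OF f]) simp
  have int: "integrable (half_line \<Otimes>\<^sub>M half_line) (case_prod F)"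
  proof (rule half_line_pair.Fubini_integrable[OF meas])
    show "AE s in half_line. integrable half_line (\<lambda>t. case_prod F (s, t))"
      using half_line_translate(1)[of h] h0 hi by (intro AE_half_lineI) (simp add: F_def)
    have "(LINT t|half_line. cmod (F s t)) = cmod (exp (- (of_real \<sigma> * of_real s)) * f s) * (LINT t|half_line. cmod (h t))"
      if "s > 0" for s
      using half_line_translate(2)[of "\<lambda>u. cmod (h u)" s] h0 that by (simp add: F_def norm_mult)
    moreover have "integrable half_line (\<lambda>s. cmod (exp (- (of_real \<sigma> * of_real s)) * f s) * (LINT t|half_line. cmod (h t)))"
      by (intro integrable_mult_left integrable_norm fi)
    ultimately show "integrable half_line (\<lambda>s. LINT t|half_line. norm (case_prod F (s, t)))"
      by (subst Bochner_Integration.integrable_cong[OF refl]) auto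
  qed
  have E: "exp (- (of_real \<sigma> * of_real t)) * convolution b f t = (LINT s|half_line. F s t)" for t
  proof -
    have "exp (- (of_real \<sigma> * of_real t)) * (b (t - s) * f s) = F s t" for s
    proof -
      have "exp (- (complex_of_real \<sigma> * of_real t)) = exp (- (of_real \<sigma> * of_real s)) * exp (- (of_real \<sigma> * of_real (t - s)))"
        unfolding exp_add[symmetric] by (simp add: algebra_simps)
      then show ?thesis by (simp add: F_def h_def)
    qed
    then show ?thesis unfolding convolution_def by (simp flip: integral_mult_right_zero)
  qed
  have i2: "integrable half_line (\<lambda>t. exp (- (of_real \<sigma> * of_real t)) * convolution b f t)"
    unfolding E by (rule half_line_pair.integrable_snd[OF int])
  have "(\<lambda>t. exp (of_real \<sigma> * of_real t) * (exp (- (of_real \<sigma> * of_real t)) * convolution b f t)) \<in> borel_measurable half_line"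
    by (intro borel_measurable_times borel_measurable_integrable[OF i2] continuous_half_line_measurable continuous_intros)
  moreover have "exp (of_real \<sigma> * of_real t) * (exp (- (of_real \<sigma> * of_real t)) * convolution b f t) = convolution b f t" for t
    by (simp flip: exp_add mult.assoc)
  ultimately have "convolution b f \<in> borel_measurable half_line" by simp
  then show "laplace_integrable (convolution b f) \<sigma>"
    unfolding laplace_integrable_def using integrable_norm[OF i2] by (simp add: norm_mult)
  have "laplace_integral (convolution b f) (of_real \<sigma>) = (LINT t|half_line. LINT s|half_line. F s t)"
    unfolding laplace_integral_def E ..
  also have "\<dots> = (LINT s|half_line. LINT t|half_line. F s t)"
    by (rule half_line_pair.Fubini_integral[OF int])
  also have "\<dots> = (LINT s|half_line. (exp (- (of_real \<sigma> * of_real s)) * f s) * (LINT t|half_line. h t))"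
    using half_line_translate(2)[of h] h0
    by (intro Bochner_Integration.integral_cong refl) (simp add: F_def)
  finally show "laplace_integral (convolution b f) (of_real \<sigma>) = laplace_integral b (of_real \<sigma>) * laplace_integral f (of_real \<sigma>)"
    by (simp add: laplace_integral_def h_def mult.commute)
qed

text \<open>The kernel may be discontinuous, so the dependence on \<open>t\<close> is moved to the
  other factor by reflecting the variable. That factor, extended by zero, can jump only at the
  single point \<open>u = t0\<close>.\<close>

lemma convolution_continuous:
  assumes b: "b \<in> borel_measurable borel" "\<And>t. t \<le> 0 \<Longrightarrow> b t = 0" "laplace_integrable b \<sigma>" and f: "continuous_on {0..} f"
  shows "continuous_on {0<..} (convolution b f)"
proof -
  have [measurable]: "b \<in> borel_measurable borel" by (rule b)
  define f0 where "f0 = (\<lambda>x. indicator {0<..} x *\<^sub>R f x)"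
  have f0m: "f0 \<in> borel_measurable borel"
  proof -
    have "continuous_on {0<..} f" by (rule continuous_on_subset[OF f]) auto
    then show ?thesis unfolding f0_def by (rule borel_measurable_continuous_on_indicator[rotated]) auto
  qed
  have f0c: "(\<lambda>u. f0 (c - u)) \<in> borel_measurable borel" for c
    by (rule measurable_compose[OF _ f0m]) simp
  have conv: "convolution b f t = (LINT u|lborel. b u * f0 (t - u))" for t
  proof -
    have "convolution b f t = (LINT s|lborel. b (t - s) * f0 s)"
      unfolding convolution_def half_line_integral set_lebesgue_integral_def
      by (intro Bochner_Integration.integral_cong) (auto simp: f0_def indicator_def)
    also have "\<dots> = (LINT u|lborel. b u * f0 (t - u))"
      by (subst lborel_integral_real_affine[of "-1" _ t]) auto
    finally show ?thesis .
  qed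
  show ?thesis
    unfolding continuous_on_sequentially
  proof (intro allI ballI impI)
    fix X :: "nat \<Rightarrow> real" and t0 :: real assume t0: "t0 \<in> {0<..}" and X: "(\<forall>n. X n \<in> {0<..}) \<and> X \<longlonglongrightarrow> t0"
    obtain T where T: "\<And>n. \<bar>X n\<bar> \<le> T" using X convergent_imp_Bseq[of X] unfolding convergent_def Bseq_def by auto
    have "bounded (f ` {0..T})"
      by (intro compact_imp_bounded compact_continuous_image continuous_on_subset[OF f]) auto
    then obtain B where B: "\<And>x. x \<in> {0..T} \<Longrightarrow> cmod (f x) \<le> B" unfolding bounded_iff by blast
    have T0: "T \<ge> 0" using T[of 0] by linarith
    have B0: "B \<ge> 0" using order_trans[OF norm_ge_zero B[of 0]] T0 by auto
    \<comment> \<open>The constant \<open>exp (\<bar>\<sigma>\<bar> * T)\<close> compensates for the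
      exponential weight on \<open>u \<le> T\<close>, the only range where the integrands differ
      from 0.\<close>
    define w where "w = (\<lambda>u. exp (\<bar>\<sigma>\<bar> * T) * B * (indicator {0<..} u *\<^sub>R (exp (- (\<sigma> * u)) * cmod (b u))))"
    have wi: "integrable lborel w"
      unfolding w_def using b(3) by (intro integrable_mult_right) (simp add: laplace_integrable_def half_line_integrable_iff set_integrable_def)
    have "(\<lambda>n. LINT u|lborel. b u * f0 (X n - u)) \<longlonglongrightarrow> (LINT u|lborel. b u * f0 (t0 - u))"
    proof (rule integral_dominated_convergence[OF _ _ wi])
      show "(\<lambda>u. b u * f0 (t0 - u)) \<in> borel_measurable lborel" "(\<lambda>u. b u * f0 (X n - u)) \<in> borel_measurable lborel" for n
        using b(1) f0c by (auto intro!: borel_measurable_times)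
      have "AE u in lborel. u \<noteq> t0" by (rule AE_lborel_singleton)
      then show "AE u in lborel. (\<lambda>n. b u * f0 (X n - u)) \<longlonglongrightarrow> b u * f0 (t0 - u)"
      proof eventually_elim
        case (elim u)
        have lim: "(\<lambda>n. X n - u) \<longlonglongrightarrow> t0 - u" using X by (intro tendsto_intros) auto
        have "(\<lambda>n. f0 (X n - u)) \<longlonglongrightarrow> f0 (t0 - u)"
        proof (cases "u < t0")
          case True
          have "\<forall>\<^sub>F n in sequentially. X n - u > 0"
            by (rule order_tendstoD(1)[OF lim]) (use True in simp)
          then have ev: "\<forall>\<^sub>F n in sequentially. f (X n - u) = f0 (X n - u)"
            by eventually_elim (simp add: f0_def)
          have "isCont f (t0 - u)"
            using f True by (intro continuous_on_interior[of "{0..}"]) auto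
          then have "(\<lambda>n. f (X n - u)) \<longlonglongrightarrow> f (t0 - u)" using lim by (rule isCont_tendsto_compose)
          then show ?thesis using True ev by (simp add: f0_def Lim_transform_eventually)
        next
          case False
          then have "t0 - u < 0" using elim by simp
          then have "\<forall>\<^sub>F n in sequentially. X n - u < 0" by (rule order_tendstoD(2)[OF lim])
          then have "\<forall>\<^sub>F n in sequentially. f0 (X n - u) = f0 (t0 - u)"
            by eventually_elim (use False in \<open>auto simp: f0_def\<close>)
          then show ?thesis by (rule tendsto_eventually)
        qed
        then show ?case by (rule tendsto_mult_left)
      qed
      show "AE u in lborel. cmod (b u * f0 (X n - u)) \<le> w u" for n
      proof (rule AE_I2)
        fix u
        show "cmod (b u * f0 (X n - u)) \<le> w u"
        proof (cases "u > 0 \<and> u < X n")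
          case True
          then have u: "u > 0" "u \<le> T" using T[of n] by auto
          have "cmod (f0 (X n - u)) \<le> B" using True T[of n] B[of "X n - u"] by (auto simp: f0_def)
          moreover have "1 \<le> exp (\<bar>\<sigma>\<bar> * T) * exp (- (\<sigma> * u))"
          proof -
            have "\<sigma> * u \<le> \<bar>\<sigma>\<bar> * u" using u by (intro mult_right_mono) auto
            also have "\<dots> \<le> \<bar>\<sigma>\<bar> * T" using u by (intro mult_left_mono) auto
            finally show ?thesis by (simp flip: exp_add)
          qed
          ultimately have "cmod (b u) * cmod (f0 (X n - u)) \<le> (cmod (b u) * (exp (\<bar>\<sigma>\<bar> * T) * exp (- (\<sigma> * u)))) * B"
            using mult_left_mono[of 1 "exp (\<bar>\<sigma>\<bar> * T) * exp (- (\<sigma> * u))" "cmod (b u)"]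
            by (intro mult_mono) auto
          then show ?thesis using u by (simp add: w_def norm_mult ac_simps)
        next
          case False
          have "w u \<ge> 0" using B0 by (simp add: w_def indicator_def)
          moreover have "b u * f0 (X n - u) = 0" using False b(2)[of u] by (auto simp: f0_def indicator_def not_less)
          ultimately show ?thesis by (metis norm_zero)
        qed
      qed
    qed
    then show "(convolution b f \<circ> X) \<longlonglongrightarrow> convolution b f t0" by (simp add: o_def conv)
  qed
qed

section \<open>Weak integrals in sequentially complete spaces\<close>

lemma tendsto_cseminorm: "(f \<longlongrightarrow> l) F \<Longrightarrow> cseminorm p \<Longrightarrow> ((\<lambda>x. p (f x - l)) \<longlongrightarrow> 0) F"
  by (simp add: tendsto_cseminorm_iff)

lemma dual_continuous_on:
  fixes f :: "'b::topological_space \<Rightarrow> 'a::locally_convex"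
  assumes "\<phi> \<in> dual" "continuous_on S f"
  shows "continuous_on S (\<lambda>x. \<phi> (f x))"
  using assms by (auto simp: continuous_on_def intro: tendsto_dual)

lemma cseminorm_continuous_on:
  fixes f :: "'b::topological_space \<Rightarrow> 'a::locally_convex"
  assumes "cseminorm p" "continuous_on S f"
  shows "continuous_on S (\<lambda>x. p (f x))"
  by (rule continuous_on_compose2[of UNIV p]) (use assms in \<open>auto simp: cseminorm_def\<close>)

text \<open>Heine's theorem is applied to the scalar function \<open>p (f x - f y)\<close> on the
  square, and its values are compared with the zeros on the diagonal.\<close>

lemma uniformly_continuous_cseminorm:
  fixes f :: "real \<Rightarrow> 'a::locally_convex"
  assumes f: "continuous_on {a..b} f" and p: "cseminorm p" and e: "e > 0"
  obtains d where "d > 0" "\<And>x y. x \<in> {a..b} \<Longrightarrow> y \<in> {a..b} \<Longrightarrow> \<bar>x - y\<bar> < d \<Longrightarrow> p (f x - f y) < e"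
proof -
  note sp = cseminorm_seminorm[OF p]
  define P where "P = (\<lambda>u. p (f (fst u) - f (snd u)))"
  have cf: "continuous_on ({a..b} \<times> {a..b}) (\<lambda>v. f (fst v))" "continuous_on ({a..b} \<times> {a..b}) (\<lambda>v. f (snd v))"
    by (rule continuous_on_compose2[OF f], auto intro!: continuous_intros)+
  have "continuous_on ({a..b} \<times> {a..b}) P"
    unfolding continuous_on_def
  proof
    fix u assume u: "u \<in> {a..b} \<times> {a..b}"
    have 1: "((\<lambda>v. f (fst v)) \<longlongrightarrow> f (fst u)) (at u within {a..b} \<times> {a..b})"
      "((\<lambda>v. f (snd v)) \<longlongrightarrow> f (snd u)) (at u within {a..b} \<times> {a..b})"
      using cf u unfolding continuous_on_def by blast+
    have "((\<lambda>v. p (f (fst v) - f (fst u)) + p (f (snd v) - f (snd u))) \<longlongrightarrow> 0 + 0) (at u within {a..b} \<times> {a..b})"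
      by (rule tendsto_add[OF tendsto_cseminorm[OF 1(1) p] tendsto_cseminorm[OF 1(2) p]])
    then have "((\<lambda>v. p (f (fst v) - f (fst u)) + p (f (snd v) - f (snd u))) \<longlongrightarrow> 0) (at u within {a..b} \<times> {a..b})" by simp
    then have "((\<lambda>v. P v - P u) \<longlongrightarrow> 0) (at u within {a..b} \<times> {a..b})"
    proof (rule Lim_null_comparison[rotated])
      have "\<bar>P v - P u\<bar> \<le> p (f (fst v) - f (fst u)) + p (f (snd v) - f (snd u))" for v
      proof -
        have "\<bar>P v - P u\<bar> \<le> p ((f (fst v) - f (snd v)) - (f (fst u) - f (snd u)))"
          unfolding P_def by (rule seminorm_abs_diff[OF sp])
        also have "\<dots> = p ((f (fst v) - f (fst u)) - (f (snd v) - f (snd u)))" by (simp add: algebra_simps)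
        also have "\<dots> \<le> p (f (fst v) - f (fst u)) + p (f (snd v) - f (snd u))" by (rule seminorm_diff[OF sp])
        finally show ?thesis .
      qed
      then show "\<forall>\<^sub>F v in at u within {a..b} \<times> {a..b}. norm (P v - P u) \<le> p (f (fst v) - f (fst u)) + p (f (snd v) - f (snd u))"
        by (intro always_eventually) simp
    qed
    then show "(P \<longlongrightarrow> P u) (at u within {a..b} \<times> {a..b})" by (simp add: LIM_zero_iff)
  qed
  then have "uniformly_continuous_on ({a..b} \<times> {a..b}) P"
    by (rule compact_uniformly_continuous) (intro compact_Times compact_Icc)
  then obtain d where d: "d > 0" "\<And>u v. u \<in> {a..b} \<times> {a..b} \<Longrightarrow> v \<in> {a..b} \<times> {a..b} \<Longrightarrow> dist v u < d \<Longrightarrow> dist (P v) (P u) < e"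
    using e unfolding uniformly_continuous_on_def by blast
  show ?thesis
  proof (rule that[OF d(1)])
    fix x y assume xy: "x \<in> {a..b}" "y \<in> {a..b}" "\<bar>x - y\<bar> < d"
    have "dist (P (x, y)) (P (x, x)) < e"
      using xy by (intro d(2)) (auto simp: dist_Pair_Pair dist_real_def abs_minus_commute)
    then show "p (f x - f y) < e"
      using seminorm_0[OF sp] seminorm_nonneg[OF sp, of "f x - f y"] by (simp add: P_def dist_real_def)
  qed
qed

text \<open>Left Riemann sums approach the scalar integrals at a rate that is the same for all
  functionals in a polar. They are thus a Cauchy sequence, and testing its limit with a functional
  gives the integral.\<close>

lemma weak_integral_interval:
  fixes f :: "real \<Rightarrow> 'a::sequentially_complete_lcs"
  assumes f: "continuous_on {a..b} f" and ab: "a \<le> b"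
  shows "\<exists>v. \<forall>\<phi>\<in>dual. \<phi> v = integral {a..b} (\<lambda>t. \<phi> (f t))"
proof -
  define h where "h = (\<lambda>n::nat. (b - a) / (real n + 1))"
  define v where "v = (\<lambda>n. \<Sum>j<n + 1. h n *\<^sub>R f (a + real j * h n))"
  have h0: "h n \<ge> 0" for n using ab by (simp add: h_def)
  have hb: "a + real m * h n \<le> b" if "m \<le> n + 1" for m n
  proof -
    have "real m * h n \<le> (real n + 1) * h n" using that h0 by (intro mult_right_mono) auto
    then show ?thesis by (simp add: h_def)
  qed
  have hlim: "h \<longlonglongrightarrow> 0" unfolding h_def by real_asymp
  have est: "\<exists>N. \<forall>n\<ge>N. \<forall>\<phi>\<in>polar p. cmod (\<phi> (v n) - integral {a..b} (\<lambda>t. \<phi> (f t))) \<le> (b - a) * e"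
    if p: "cseminorm p" and e: "e > 0" for p e
  proof -
    obtain d where d: "d > 0" "\<And>x y. x \<in> {a..b} \<Longrightarrow> y \<in> {a..b} \<Longrightarrow> \<bar>x - y\<bar> < d \<Longrightarrow> p (f x - f y) < e"
      using uniformly_continuous_cseminorm[OF f p e] by blast
    obtain N where N: "\<And>n. n \<ge> N \<Longrightarrow> h n < d"
      using order_tendstoD(2)[OF hlim d(1)] by (auto simp: eventually_sequentially)
    have "cmod (\<phi> (v n) - integral {a..b} (\<lambda>t. \<phi> (f t))) \<le> (b - a) * e" if n: "n \<ge> N" and \<phi>: "\<phi> \<in> polar p" for n \<phi>
    proof -
      note f\<phi> = polar_functional[OF \<phi>]
      have cont: "continuous_on {a..b} (\<lambda>t. \<phi> (f t))" by (rule dual_continuous_on[OF dualI[OF p \<phi>] f])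
      have int: "(\<lambda>t. \<phi> (f t)) integrable_on {x..y}" if "a \<le> x" "y \<le> b" for x y
        by (rule integrable_continuous_interval) (rule continuous_on_subset[OF cont], use that in auto)
      define T where "T = (\<lambda>m. a + real m * h n)"
      have "cmod ((\<Sum>j<m. of_real (h n) * \<phi> (f (T j))) - integral {a..T m} (\<lambda>t. \<phi> (f t))) \<le> real m * h n * e"
        if "m \<le> n + 1" for m using that
      proof (induction m)
        case (Suc m)
        define I where "I = integral {T m..T (Suc m)} (\<lambda>t. \<phi> (f t))"
        have T1: "a \<le> T m" "T m \<le> T (Suc m)" "T (Suc m) \<le> b" "T (Suc m) - T m = h n"
          using h0[of n] hb[OF Suc.prems] by (auto simp: T_def algebra_simps)
        have comb: "integral {a..T (Suc m)} (\<lambda>t. \<phi> (f t)) = integral {a..T m} (\<lambda>t. \<phi> (f t)) + I"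
          unfolding I_def by (rule Henstock_Kurzweil_Integration.integral_combine[symmetric]) (use T1 int[of a] in auto)
        have const: "((\<lambda>t. \<phi> (f (T m))) has_integral (T (Suc m) - T m) *\<^sub>R \<phi> (f (T m))) {T m..T (Suc m)}"
          using has_integral_const_real[of "\<phi> (f (T m))" "T m" "T (Suc m)"] T1(2) by simp
        have "((\<lambda>t. \<phi> (f (T m)) - \<phi> (f t)) has_integral (T (Suc m) - T m) *\<^sub>R \<phi> (f (T m)) - I) {T m..T (Suc m)}"
          unfolding I_def by (rule has_integral_diff[OF const integrable_integral[OF int]]) (use T1 in auto)
        then have "cmod ((T (Suc m) - T m) *\<^sub>R \<phi> (f (T m)) - I) \<le> e * measure lborel {T m..T (Suc m)}"
        proof (rule has_integral_bound_real[rotated 2, where S="{}"])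
          show "0 \<le> e" using e by simp
          fix t assume "t \<in> {T m..T (Suc m)} - {}"
          then have t: "t \<in> {T m..T (Suc m)}" by simp
          have "p (f (T m) - f t) < e"
            by (rule d(2)) (use t T1 N[OF n] in auto)
          then show "cmod (\<phi> (f (T m)) - \<phi> (f t)) \<le> e"
            using polar_bound[OF \<phi>, of "f (T m) - f t"] by (simp add: functional_diff[OF f\<phi>])
        qed simp
        then have 1: "cmod (of_real (h n) * \<phi> (f (T m)) - I) \<le> h n * e"
          using T1 by (simp add: scaleR_conv_of_real mult.commute)
        have "cmod ((\<Sum>j<Suc m. of_real (h n) * \<phi> (f (T j))) - integral {a..T (Suc m)} (\<lambda>t. \<phi> (f t)))
          = cmod (((\<Sum>j<m. of_real (h n) * \<phi> (f (T j))) - integral {a..T m} (\<lambda>t. \<phi> (f t))) + (of_real (h n) * \<phi> (f (T m)) - I))"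
          unfolding comb by (simp add: algebra_simps)
        also have "\<dots> \<le> real m * h n * e + h n * e"
          using Suc 1 by (intro order_trans[OF norm_triangle_ineq add_mono]) auto
        finally show ?case by (simp add: algebra_simps)
      qed (simp add: T_def)
      from this[of "n + 1"] show ?thesis
        by (simp add: v_def functional_sum[OF f\<phi>] functional_scaleR[OF f\<phi>] T_def h_def add.commute del: sum.lessThan_Suc)
    qed
    then show ?thesis by blast
  qed
  have "\<exists>l. v \<longlonglongrightarrow> l"
  proof (rule Cauchy_cseminorm_convergent)
    fix p :: "'a \<Rightarrow> real" and e :: real assume p: "cseminorm p" and e: "e > 0"
    define e' where "e' = e / (4 * (b - a + 1))"
    have e': "e' > 0" using e ab by (simp add: e'_def)
    have "(b - a + 1) * e' = e / 4" unfolding e'_def using ab by (simp add: divide_simps)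
    then have e'2: "2 * ((b - a) * e') < e" using e e' by (simp add: distrib_right)
    obtain N where N: "\<And>n \<phi>. n \<ge> N \<Longrightarrow> \<phi> \<in> polar p \<Longrightarrow> cmod (\<phi> (v n) - integral {a..b} (\<lambda>t. \<phi> (f t))) \<le> (b - a) * e'"
      using est[OF p e'] by blast
    have "p (v m - v n) < e" if "m \<ge> N" "n \<ge> N" for m n
    proof -
      have "p (v m - v n) \<le> 2 * ((b - a) * e')"
      proof (rule seminorm_le_polar[OF cseminorm_seminorm[OF p]])
        fix \<phi> assume \<phi>: "\<phi> \<in> polar p"
        let ?I = "integral {a..b} (\<lambda>t. \<phi> (f t))"
        have "\<phi> (v m - v n) = (\<phi> (v m) - ?I) - (\<phi> (v n) - ?I)" by (simp add: functional_diff[OF polar_functional[OF \<phi>]])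
        then show "cmod (\<phi> (v m - v n)) \<le> 2 * ((b - a) * e')"
          using norm_triangle_ineq4[of "\<phi> (v m) - ?I" "\<phi> (v n) - ?I"] N[OF that(1) \<phi>] N[OF that(2) \<phi>] by simp
      qed
      then show ?thesis using e'2 by simp
    qed
    then show "\<exists>N. \<forall>m\<ge>N. \<forall>n\<ge>N. p (v m - v n) < e" by blast
  qed
  then obtain l where l: "v \<longlonglongrightarrow> l" by blast
  show ?thesis
  proof (intro exI ballI)
    fix \<phi> :: "'a \<Rightarrow> complex" assume \<phi>: "\<phi> \<in> dual"
    then obtain p where p: "cseminorm p" "\<phi> \<in> polar p" by (auto simp: dual_def)
    have "(\<lambda>n. \<phi> (v n)) \<longlonglongrightarrow> integral {a..b} (\<lambda>t. \<phi> (f t))"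
    proof (rule LIMSEQ_I)
      fix e :: real assume e: "e > 0"
      define e' where "e' = e / (2 * (b - a + 1))"
      have e': "e' > 0" using e ab by (simp add: e'_def)
      have "(b - a + 1) * e' = e / 2" unfolding e'_def using ab by (simp add: divide_simps)
      then have "(b - a) * e' < e" using e e' by (simp add: distrib_right)
      with est[OF p(1) e'] p(2)
      show "\<exists>N. \<forall>n\<ge>N. norm (\<phi> (v n) - integral {a..b} (\<lambda>t. \<phi> (f t))) < e" by (meson le_less_trans)
    qed
    then show "\<phi> l = integral {a..b} (\<lambda>t. \<phi> (f t))"
      using tendsto_dual[OF \<phi> l] LIMSEQ_unique by blast
  qed
qed

text \<open>The integrals over \<open>{0..n}\<close> converge because their errors are at most the
  tail of a dominating function that depends on the seminorm but not on the functional.\<close>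

lemma weak_integral_half_line:
  fixes f :: "real \<Rightarrow> 'a::sequentially_complete_lcs"
  assumes f: "continuous_on {0..} f"
    and dom: "\<And>p. cseminorm p \<Longrightarrow> \<exists>g. integrable half_line g \<and> (\<forall>s>0. p (f s) \<le> g s)"
  shows "\<exists>v. \<forall>\<phi>\<in>dual. \<phi> v = (LINT s|half_line. \<phi> (f s))"
proof -
  have "\<forall>n::nat. \<exists>v. \<forall>\<phi>\<in>dual. \<phi> v = integral {0..real n} (\<lambda>t. \<phi> (f t))"
    by (intro allI weak_integral_interval continuous_on_subset[OF f]) auto
  then obtain v where v: "\<And>n \<phi>. \<phi> \<in> dual \<Longrightarrow> \<phi> (v n) = integral {0..real n} (\<lambda>t. \<phi> (f t))" by metis
  have est: "\<exists>\<tau>. \<tau> \<longlonglongrightarrow> 0 \<and> (\<forall>n. \<forall>\<phi>\<in>polar p. cmod (\<phi> (v n) - (LINT s|half_line. \<phi> (f s))) \<le> \<tau> n)"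
    if p: "cseminorm p" for p
  proof -
    obtain g where g: "integrable half_line g" "\<And>s. s > 0 \<Longrightarrow> p (f s) \<le> g s" using dom[OF p] by blast
    have gm: "g \<in> borel_measurable half_line" using g(1) by simp
    have im: "(\<lambda>s. indicator {real n<..} s :: real) \<in> borel_measurable half_line" for n
      by (rule borel_measurable_half_line) simp
    define \<tau> where "\<tau> = (\<lambda>n. LINT s|half_line. indicator {real n<..} s * g s)"
    have g0: "g s \<ge> 0" if "s > 0" for s
      using g(2)[OF that] seminorm_nonneg[OF cseminorm_seminorm[OF p], of "f s"] by linarith
    have ti: "integrable half_line (\<lambda>s. indicator {real n<..} s * g s)" for n
      by (rule half_line_dominated[OF g(1)]) (use im gm g0 in \<open>auto simp: indicator_def intro!: borel_measurable_times\<close>)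
    have "\<tau> \<longlonglongrightarrow> (LINT s|half_line. 0)"
      unfolding \<tau>_def
    proof (rule integral_dominated_convergence[OF _ _ g(1)])
      show "(\<lambda>s. indicator {real n<..} s * g s) \<in> borel_measurable half_line" for n
        using im gm by (intro borel_measurable_times)
      show "AE s in half_line. (\<lambda>n. indicator {real n<..} s * g s) \<longlonglongrightarrow> 0"
      proof (intro AE_I2 tendsto_eventually)
        fix s
        show "\<forall>\<^sub>F n in sequentially. indicator {real n<..} s * g s = 0"
          using eventually_ge_at_top[of "nat \<lceil>s\<rceil>"]
        proof eventually_elim
          case (elim n)
          then have "s \<le> real n" by linarith
          then show ?case by simp
        qed
      qed
      show "AE s in half_line. norm (indicator {real n<..} s * g s) \<le> g s" for n
        using g0 by (intro AE_half_lineI) (auto simp: indicator_def)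
    qed simp
    moreover have "cmod (\<phi> (v n) - (LINT s|half_line. \<phi> (f s))) \<le> \<tau> n" if \<phi>: "\<phi> \<in> polar p" for n \<phi>
    proof -
      have "continuous_on {0..} (\<lambda>s. \<phi> (f s))" by (rule dual_continuous_on[OF dualI[OF p \<phi>] f])
      then have m: "(\<lambda>s. \<phi> (f s)) \<in> borel_measurable half_line"
        by (intro continuous_half_line_measurable) (rule continuous_on_subset, auto)
      have i: "integrable half_line (\<lambda>s. \<phi> (f s))"
        by (rule half_line_dominated[OF g(1) m]) (use polar_bound[OF \<phi>] g(2) order_trans in blast)
      then have si: "set_integrable lborel {0..} (\<lambda>s. \<phi> (f s))" by (simp add: half_line_set_integrable)
      have si2: "set_integrable lborel {0..real n} (\<lambda>s. \<phi> (f s))" by (rule set_integrable_subset[OF si]) auto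
      have "\<phi> (v n) - (LINT s|half_line. \<phi> (f s)) = (LINT s:{0..real n}|lborel. \<phi> (f s)) - (LINT s:{0..}|lborel. \<phi> (f s))"
        using v[OF dualI[OF p \<phi>]] set_borel_integral_eq_integral(2)[OF si2] by (simp add: half_line_set_integrable)
      also have "\<dots> = (LINT s|lborel. indicator {0..real n} s *\<^sub>R \<phi> (f s) - indicator {0..} s *\<^sub>R \<phi> (f s))"
        using si si2 by (simp add: set_lebesgue_integral_def set_integrable_def)
      also have "\<dots> = (LINT s|half_line. - (indicator {real n<..} s *\<^sub>R \<phi> (f s)))"
        unfolding half_line_integral set_lebesgue_integral_def
        by (intro Bochner_Integration.integral_cong) (auto simp: indicator_def)
      also have "cmod \<dots> \<le> \<tau> n"
        unfolding \<tau>_def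
        by (rule half_line_norm_le[OF ti])
          (use polar_bound[OF \<phi>] g(2) order_trans in \<open>auto simp: indicator_def intro: order_trans\<close>)
      finally show ?thesis .
    qed
    ultimately show ?thesis by auto
  qed
  have "\<exists>l. v \<longlonglongrightarrow> l"
  proof (rule Cauchy_cseminorm_convergent)
    fix p :: "'a \<Rightarrow> real" and e :: real assume p: "cseminorm p" and e: "e > 0"
    obtain \<tau> where \<tau>: "\<tau> \<longlonglongrightarrow> 0" "\<And>n \<phi>. \<phi> \<in> polar p \<Longrightarrow> cmod (\<phi> (v n) - (LINT s|half_line. \<phi> (f s))) \<le> \<tau> n"
      using est[OF p] by blast
    obtain N where N: "\<And>n. n \<ge> N \<Longrightarrow> \<tau> n < e / 2"
      using order_tendstoD(2)[OF \<tau>(1), of "e / 2"] e by (auto simp: eventually_sequentially)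
    have "p (v m - v n) < e" if "m \<ge> N" "n \<ge> N" for m n
    proof -
      have "p (v m - v n) \<le> \<tau> m + \<tau> n"
      proof (rule seminorm_le_polar[OF cseminorm_seminorm[OF p]])
        fix \<phi> assume \<phi>: "\<phi> \<in> polar p"
        let ?I = "LINT s|half_line. \<phi> (f s)"
        have "\<phi> (v m - v n) = (\<phi> (v m) - ?I) - (\<phi> (v n) - ?I)" by (simp add: functional_diff[OF polar_functional[OF \<phi>]])
        then show "cmod (\<phi> (v m - v n)) \<le> \<tau> m + \<tau> n"
          using norm_triangle_ineq4[of "\<phi> (v m) - ?I" "\<phi> (v n) - ?I"] \<tau>(2)[OF \<phi>, of m] \<tau>(2)[OF \<phi>, of n] by simp
      qed
      then show ?thesis using N[OF that(1)] N[OF that(2)] by linarith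
    qed
    then show "\<exists>N. \<forall>m\<ge>N. \<forall>n\<ge>N. p (v m - v n) < e" by blast
  qed
  then obtain l where l: "v \<longlonglongrightarrow> l" by blast
  show ?thesis
  proof (intro exI ballI)
    fix \<phi> :: "'a \<Rightarrow> complex" assume \<phi>: "\<phi> \<in> dual"
    then obtain p where p: "cseminorm p" "\<phi> \<in> polar p" by (auto simp: dual_def)
    obtain \<tau> where \<tau>: "\<tau> \<longlonglongrightarrow> 0" "\<And>n \<phi>. \<phi> \<in> polar p \<Longrightarrow> cmod (\<phi> (v n) - (LINT s|half_line. \<phi> (f s))) \<le> \<tau> n"
      using est[OF p(1)] by blast
    have "(\<lambda>n. \<phi> (v n) - (LINT s|half_line. \<phi> (f s))) \<longlonglongrightarrow> 0"
      by (rule Lim_null_comparison[OF _ \<tau>(1)]) (use \<tau>(2)[OF p(2)] in simp)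
    then have "(\<lambda>n. \<phi> (v n)) \<longlonglongrightarrow> (LINT s|half_line. \<phi> (f s))" by (simp add: LIM_zero_iff)
    then show "\<phi> l = (LINT s|half_line. \<phi> (f s))"
      using tendsto_dual[OF \<phi> l] LIMSEQ_unique by blast
  qed
qed

section \<open>Vector-valued analytic functions\<close>

lemma vector_analytic_dual:
  assumes f: "vector_analytic_on f S" and S: "open S" and \<phi>: "\<phi> \<in> dual"
  shows "(\<lambda>z. \<phi> (f z)) holomorphic_on S"
proof (rule holomorphic_onI)
  fix z assume z: "z \<in> S"
  obtain d where d: "((\<lambda>w. inverse (w - z) *\<^sub>C (f w - f z)) \<longlongrightarrow> d) (at z within S)"
    using f z by (auto simp: vector_analytic_on_def)
  have "((\<lambda>w. \<phi> (inverse (w - z) *\<^sub>C (f w - f z))) \<longlongrightarrow> \<phi> d) (at z within S)" by (rule tendsto_dual[OF \<phi> d])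
  then have "((\<lambda>z. \<phi> (f z)) has_field_derivative \<phi> d) (at z within S)"
    unfolding has_field_derivative_iff
    by (simp add: functional_scale[OF dual_functional[OF \<phi>]] functional_diff[OF dual_functional[OF \<phi>]] divide_inverse mult.commute)
  then show "(\<lambda>z. \<phi> (f z)) field_differentiable at z within S" by (auto simp: field_differentiable_def)
qed

lemma vector_analytic_continuous:
  assumes f: "vector_analytic_on f S"
  shows "continuous_on S f"
  unfolding continuous_on_def
proof
  fix z assume z: "z \<in> S"
  obtain d where d: "((\<lambda>w. inverse (w - z) *\<^sub>C (f w - f z)) \<longlongrightarrow> d) (at z within S)"
    using f z by (auto simp: vector_analytic_on_def)
  have "((\<lambda>w. w - z) \<longlongrightarrow> z - z) (at z within S)" by (intro tendsto_intros)
  from tendsto_scaleC[OF this d]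
  have "((\<lambda>w. (w - z) *\<^sub>C inverse (w - z) *\<^sub>C (f w - f z)) \<longlongrightarrow> 0) (at z within S)" by simp
  then have "((\<lambda>w. (w - z) *\<^sub>C inverse (w - z) *\<^sub>C (f w - f z) + f z) \<longlongrightarrow> 0 + f z) (at z within S)"
    by (rule tendsto_add_lcs[OF _ tendsto_const])
  moreover have "(w - z) *\<^sub>C inverse (w - z) *\<^sub>C (f w - f z) + f z = f w" for w
    by (cases "w = z") (auto simp: scaleC_scaleC)
  ultimately show "(f \<longlongrightarrow> f z) (at z within S)" by simp
qed

text \<open>Local boundedness makes the quadratic Taylor remainder uniform over each polar.
  Difference quotients therefore form a Cauchy sequence, and the same uniform estimate upgrades its
  limit to a limit over all increments.\<close>

lemma weakly_analytic_imp_analytic: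
  fixes F :: "complex \<Rightarrow> 'a::sequentially_complete_lcs"
  assumes S: "open S" and hol: "\<And>\<phi>. \<phi> \<in> dual \<Longrightarrow> (\<lambda>z. \<phi> (F z)) holomorphic_on S"
    and bd: "\<And>z p. z \<in> S \<Longrightarrow> cseminorm p \<Longrightarrow> \<exists>r>0. \<exists>B. \<forall>w\<in>ball z r. p (F w) \<le> B"
  shows "vector_analytic_on F S"
  unfolding vector_analytic_on_def
proof
  fix z assume z: "z \<in> S"
  obtain r0 where r0: "r0 > 0" "ball z r0 \<subseteq> S" using S z openE by blast
  define D where "D = (\<lambda>h. inverse h *\<^sub>C (F (z + h) - F z))"
  have est: "\<exists>r>0. \<exists>K\<ge>0. \<forall>\<phi>\<in>polar p. \<forall>h. h \<noteq> 0 \<and> cmod h < r \<longrightarrow> cmod (\<phi> (D h) - deriv (\<lambda>z. \<phi> (F z)) z) \<le> K * cmod h"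
    if p: "cseminorm p" for p
  proof -
    obtain r1 B where r1: "r1 > 0" "\<And>w. w \<in> ball z r1 \<Longrightarrow> p (F w) \<le> B" using bd[OF z p] by blast
    define r where "r = min r0 r1"
    have r: "r > 0" "ball z r \<subseteq> S" "\<And>w. w \<in> ball z r \<Longrightarrow> p (F w) \<le> B" using r0 r1 by (auto simp: r_def)
    have B: "B \<ge> 0" using r(3)[of z] r(1) seminorm_nonneg[OF cseminorm_seminorm[OF p], of "F z"] by simp
    have "cmod (\<phi> (D h) - deriv (\<lambda>z. \<phi> (F z)) z) \<le> 32 * B / r\<^sup>2 * cmod h"
      if \<phi>: "\<phi> \<in> polar p" and h: "h \<noteq> 0" "cmod h < r / 2" for \<phi> h
    proof -
      note f\<phi> = polar_functional[OF \<phi>]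
      have *: "cmod (\<phi> (F (z + h)) - \<phi> (F z) - h * deriv (\<lambda>z. \<phi> (F z)) z) \<le> 32 * B / r\<^sup>2 * (cmod h)\<^sup>2"
      proof (rule holomorphic_remainder_bound[OF _ _ r(1) h(2)])
        show "(\<lambda>z. \<phi> (F z)) holomorphic_on ball z r"
          by (rule holomorphic_on_subset[OF hol[OF dualI[OF p \<phi>]] r(2)])
        show "cmod (\<phi> (F w)) \<le> B" if "w \<in> ball z r" for w
          using polar_bound[OF \<phi>, of "F w"] r(3)[OF that] by simp
      qed
      have "\<phi> (D h) - deriv (\<lambda>z. \<phi> (F z)) z = (\<phi> (F (z + h)) - \<phi> (F z) - h * deriv (\<lambda>z. \<phi> (F z)) z) / h"
        using h by (simp add: D_def functional_scale[OF f\<phi>] functional_diff[OF f\<phi>] field_simps)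
      then have "cmod (\<phi> (D h) - deriv (\<lambda>z. \<phi> (F z)) z) = cmod (\<phi> (F (z + h)) - \<phi> (F z) - h * deriv (\<lambda>z. \<phi> (F z)) z) / cmod h"
        by (simp add: norm_divide)
      also have "\<dots> \<le> 32 * B / r\<^sup>2 * (cmod h)\<^sup>2 / cmod h" using * by (intro divide_right_mono) auto
      also have "\<dots> = 32 * B / r\<^sup>2 * cmod h" using h by (simp add: power2_eq_square)
      finally show ?thesis .
    qed
    then show ?thesis using r(1) B by (intro exI[of _ "r / 2"] conjI exI[of _ "32 * B / r\<^sup>2"]) auto
  qed
  \<comment> \<open>The limit has to be found along a sequence, since completeness is only
    sequential.\<close>
  define H where "H = (\<lambda>n::nat. complex_of_real (1 / (real n + 1)))"
  have H0: "H n \<noteq> 0" for n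
    unfolding H_def of_real_eq_0_iff by simp
  have Hlim: "(\<lambda>n. cmod (H n)) \<longlonglongrightarrow> 0"
    unfolding H_def norm_of_real by real_asymp
  have "\<exists>d. (\<lambda>n. D (H n)) \<longlonglongrightarrow> d"
  proof (rule Cauchy_cseminorm_convergent)
    fix p :: "'a \<Rightarrow> real" and e :: real assume p: "cseminorm p" and e: "e > 0"
    obtain r K where r: "r > 0" "K \<ge> 0"
      "\<And>\<phi> h. \<phi> \<in> polar p \<Longrightarrow> h \<noteq> 0 \<Longrightarrow> cmod h < r \<Longrightarrow> cmod (\<phi> (D h) - deriv (\<lambda>z. \<phi> (F z)) z) \<le> K * cmod h"
      using est[OF p] by blast
    define \<eta> where "\<eta> = min r (e / (2 * (K + 1)))"
    have \<eta>: "\<eta> > 0" using r e by (simp add: \<eta>_def)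
    obtain N where N: "\<And>n. n \<ge> N \<Longrightarrow> cmod (H n) < \<eta>"
      using order_tendstoD(2)[OF Hlim \<eta>] by (auto simp: eventually_sequentially)
    have Ke: "K * cmod (H n) < e / 2" if "n \<ge> N" for n
    proof -
      have "K * cmod (H n) \<le> K * (e / (2 * (K + 1)))" using N[OF that] r by (intro mult_left_mono) (auto simp: \<eta>_def)
      also have "\<dots> < e / 2" using r e by (simp add: field_simps)
      finally show ?thesis .
    qed
    have "p (D (H m) - D (H n)) < e" if mn: "m \<ge> N" "n \<ge> N" for m n
    proof -
      have "p (D (H m) - D (H n)) \<le> K * cmod (H m) + K * cmod (H n)"
      proof (rule seminorm_le_polar[OF cseminorm_seminorm[OF p]])
        fix \<phi> assume \<phi>: "\<phi> \<in> polar p"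
        let ?d = "deriv (\<lambda>z. \<phi> (F z)) z"
        have "\<phi> (D (H m) - D (H n)) = (\<phi> (D (H m)) - ?d) - (\<phi> (D (H n)) - ?d)"
          by (simp add: functional_diff[OF polar_functional[OF \<phi>]])
        then show "cmod (\<phi> (D (H m) - D (H n))) \<le> K * cmod (H m) + K * cmod (H n)"
          using norm_triangle_ineq4[of "\<phi> (D (H m)) - ?d" "\<phi> (D (H n)) - ?d"]
            r(3)[OF \<phi> H0, of m] r(3)[OF \<phi> H0, of n] N[OF mn(1)] N[OF mn(2)] by (auto simp: \<eta>_def)
      qed
      then show ?thesis using Ke[OF mn(1)] Ke[OF mn(2)] by linarith
    qed
    then show "\<exists>N. \<forall>m\<ge>N. \<forall>n\<ge>N. p (D (H m) - D (H n)) < e" by blast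
  qed
  then obtain d where d: "(\<lambda>n. D (H n)) \<longlonglongrightarrow> d" by blast
  have "((\<lambda>w. inverse (w - z) *\<^sub>C (F w - F z)) \<longlongrightarrow> d) (at z)"
    unfolding tendsto_cseminorm_iff
  proof (intro allI impI)
    fix p :: "'a \<Rightarrow> real" assume p: "cseminorm p"
    note sp = cseminorm_seminorm[OF p]
    obtain r K where r: "r > 0" "K \<ge> 0"
      "\<And>\<phi> h. \<phi> \<in> polar p \<Longrightarrow> h \<noteq> 0 \<Longrightarrow> cmod h < r \<Longrightarrow> cmod (\<phi> (D h) - deriv (\<lambda>z. \<phi> (F z)) z) \<le> K * cmod h"
      using est[OF p] by blast
    have \<phi>d: "\<phi> d = deriv (\<lambda>z. \<phi> (F z)) z" if \<phi>: "\<phi> \<in> polar p" for \<phi>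
    proof -
      have "(\<lambda>n. \<phi> (D (H n)) - deriv (\<lambda>z. \<phi> (F z)) z) \<longlonglongrightarrow> 0"
      proof (rule Lim_null_comparison)
        show "(\<lambda>n. K * cmod (H n)) \<longlonglongrightarrow> 0" using tendsto_mult_left[OF Hlim, of K] by simp
        show "\<forall>\<^sub>F n in sequentially. norm (\<phi> (D (H n)) - deriv (\<lambda>z. \<phi> (F z)) z) \<le> K * cmod (H n)"
          using order_tendstoD(2)[OF Hlim r(1)] by eventually_elim (rule r(3)[OF \<phi> H0])
      qed
      then have "(\<lambda>n. \<phi> (D (H n))) \<longlonglongrightarrow> deriv (\<lambda>z. \<phi> (F z)) z" by (simp add: LIM_zero_iff)
      then show ?thesis using tendsto_dual[OF dualI[OF p \<phi>] d] LIMSEQ_unique by blast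
    qed
    show "((\<lambda>w. p (inverse (w - z) *\<^sub>C (F w - F z) - d)) \<longlongrightarrow> 0) (at z)"
    proof (rule Lim_null_comparison)
      have "((\<lambda>w. K * cmod (w - z)) \<longlongrightarrow> K * cmod (z - z)) (at z)" by (intro tendsto_intros)
      then show "((\<lambda>w. K * cmod (w - z)) \<longlongrightarrow> 0) (at z)" by simp
      show "\<forall>\<^sub>F w in at z. norm (p (inverse (w - z) *\<^sub>C (F w - F z) - d)) \<le> K * cmod (w - z)"
        unfolding eventually_at
      proof (intro exI[of _ r] conjI ballI impI r(1))
        fix w assume w: "w \<noteq> z \<and> dist w z < r"
        have "p (D (w - z) - d) \<le> K * cmod (w - z)"
        proof (rule seminorm_le_polar[OF sp])
          fix \<phi> assume \<phi>: "\<phi> \<in> polar p"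
          show "cmod (\<phi> (D (w - z) - d)) \<le> K * cmod (w - z)"
            using r(3)[OF \<phi>, of "w - z"] w
            by (simp add: functional_diff[OF polar_functional[OF \<phi>]] \<phi>d[OF \<phi>] dist_norm)
        qed
        then show "norm (p (inverse (w - z) *\<^sub>C (F w - F z) - d)) \<le> K * cmod (w - z)"
          using seminorm_nonneg[OF sp] by (simp add: D_def)
      qed
    qed
  qed
  then show "\<exists>d. ((\<lambda>w. inverse (w - z) *\<^sub>C (F w - F z)) \<longlongrightarrow> d) (at z within S)"
    using tendsto_within_subset[OF _ subset_UNIV] by blast
qed

section \<open>Strong convolution integrals\<close>

lemma borel_measurable_lebesgue_on: "g \<in> borel_measurable borel \<Longrightarrow> g \<in> borel_measurable (lebesgue_on S)"
  by (intro measurable_restrict_space1 measurable_completion) simp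

lemma integral_lebesgue_on_borel:
  fixes g :: "real \<Rightarrow> 'b::{banach, second_countable_topology}"
  assumes "g \<in> borel_measurable borel"
  shows "integrable (lebesgue_on {0..t}) g \<longleftrightarrow> integrable lborel (\<lambda>s. indicator {0..t} s *\<^sub>R g s)"
    and "integral\<^sup>L (lebesgue_on {0..t}) g = (LINT s|lborel. indicator {0..t} s *\<^sub>R g s)"
proof -
  have m: "(\<lambda>s. indicator {0..t} s *\<^sub>R g s) \<in> borel_measurable lborel" using assms by simp
  show "integrable (lebesgue_on {0..t}) g \<longleftrightarrow> integrable lborel (\<lambda>s. indicator {0..t} s *\<^sub>R g s)"
    by (subst integrable_restrict_space) (auto simp: integrable_completion[OF m])
  show "integral\<^sup>L (lebesgue_on {0..t}) g = (LINT s|lborel. indicator {0..t} s *\<^sub>R g s)"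
    by (subst integral_restrict_space) (auto simp: integral_completion[OF m])
qed

lemma negligible_reflect_translate:
  assumes "negligible (N :: real set)"
  shows "negligible ((\<lambda>s. t - s) ` N)"
proof -
  have "negligible (uminus ` N)"
    by (rule negligible_differentiable_image_negligible[OF _ assms]) (auto simp: differentiable_on_def)
  then have "negligible ((+) t ` uminus ` N)" by (rule negligible_translation)
  then show ?thesis by (simp add: image_image)
qed

lemma kernel_integrable:
  assumes b: "b \<in> borel_measurable borel" "\<And>t. t \<le> 0 \<Longrightarrow> b t = 0" "laplace_integrable b \<sigma>" and t: "t \<ge> 0"
  shows "integrable (lebesgue_on {0..t}) (\<lambda>s. b (t - s))"
proof -
  have bm: "(\<lambda>s. b (t - s)) \<in> borel_measurable borel" by (rule measurable_compose[OF _ b(1)]) simp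
  have "integrable half_line (\<lambda>u. indicator {..t} u *\<^sub>R b u)"
  proof (rule half_line_dominated)
    show "integrable half_line (\<lambda>u. exp (\<bar>\<sigma>\<bar> * t) * (exp (- (\<sigma> * u)) * cmod (b u)))"
      using b(3) by (intro integrable_mult_right) (simp add: laplace_integrable_def)
    show "(\<lambda>u. indicator {..t} u *\<^sub>R b u) \<in> borel_measurable half_line"
      using b(1) by (intro borel_measurable_half_line) simp
    fix u :: real assume u: "u > 0"
    show "cmod (indicator {..t} u *\<^sub>R b u) \<le> exp (\<bar>\<sigma>\<bar> * t) * (exp (- (\<sigma> * u)) * cmod (b u))"
    proof (cases "u \<le> t")
      case True
      have "\<sigma> * u \<le> \<bar>\<sigma>\<bar> * u" using u by (intro mult_right_mono) auto
      also have "\<dots> \<le> \<bar>\<sigma>\<bar> * t" using True by (intro mult_left_mono) auto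
      finally have "1 \<le> exp (\<bar>\<sigma>\<bar> * t) * exp (- (\<sigma> * u))" by (simp flip: exp_add)
      from mult_right_mono[OF this, of "cmod (b u)"] show ?thesis using True by (simp add: mult.assoc)
    qed simp
  qed
  then have "integrable lborel (\<lambda>u. indicator {0<..} u *\<^sub>R indicator {..t} u *\<^sub>R b u)"
    by (simp add: half_line_integrable_iff set_integrable_def)
  then have "integrable lborel (\<lambda>s. indicator {0<..} (t + (-1) * s) *\<^sub>R indicator {..t} (t + (-1) * s) *\<^sub>R b (t + (-1) * s))"
    by (rule lborel_integrable_real_affine) simp
  also have "(\<lambda>s. indicator {0<..} (t + (-1) * s) *\<^sub>R indicator {..t} (t + (-1) * s) *\<^sub>R b (t + (-1) * s))
    = (\<lambda>s. indicator {0..t} s *\<^sub>R b (t - s))"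
  proof
    fix s show "indicator {0<..} (t + (-1) * s) *\<^sub>R indicator {..t} (t + (-1) * s) *\<^sub>R b (t + (-1) * s)
        = indicator {0..t} s *\<^sub>R b (t - s)"
      using b(2)[of "t - s"] by (cases "s < t") (auto simp: indicator_def)
  qed
  finally show ?thesis by (simp add: integral_lebesgue_on_borel(1)[OF bm])
qed

text \<open>The kernel and the continuous factor are approximated separately: the kernel by simple
  functions converging in mean, \<open>f\<close> by its values at grid points. Their products are
  simple, converge pointwise, and work for every seminorm at once, as the strong integral
  demands.\<close>

lemma strong_convolution_integral:
  fixes f :: "real \<Rightarrow> 'a::sequentially_complete_lcs"
  assumes b: "b \<in> borel_measurable borel" "\<And>t. t \<le> 0 \<Longrightarrow> b t = 0" "laplace_integrable b \<sigma>"
    and N: "negligible N" "\<And>t. t > 0 \<Longrightarrow> t \<notin> N \<Longrightarrow> b t = a t"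
    and f: "continuous_on {0..} f" and t: "t \<ge> 0"
  shows "\<exists>v. has_strong_integral (lebesgue_on {0..t}) (\<lambda>s. a (t - s) *\<^sub>C f s) v \<and>
    (\<forall>\<phi>\<in>dual. \<phi> v = convolution b (\<lambda>s. \<phi> (f s)) t)"
proof -
  define M where "M = lebesgue_on {0..t}"
  define c where "c = (\<lambda>s. b (t - s))"
  have sM: "space M = {0..t}" by (simp add: M_def)
  have eM: "emeasure M A \<noteq> \<infinity>" if "A \<subseteq> {0..t}" "A \<in> sets M" for A
  proof -
    have "emeasure M A \<le> emeasure M {0..t}" using that by (intro emeasure_mono) (auto simp: M_def sets_restrict_space)
    also have "\<dots> = ennreal t" using t by (simp add: M_def emeasure_restrict_space)
    finally show ?thesis by (auto simp: top_unique)
  qed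
  have cm: "c \<in> borel_measurable borel" unfolding c_def by (rule measurable_compose[OF _ b(1)]) simp
  have cM: "c \<in> borel_measurable M" unfolding M_def by (rule borel_measurable_lebesgue_on[OF cm])
  have ci: "integrable M c" unfolding M_def c_def by (rule kernel_integrable[OF b t])
  have ac: "AE s in M. a (t - s) = c s"
  proof -
    have "negligible (insert t ((\<lambda>s. t - s) ` N))"
      using negligible_reflect_translate[OF N(1)] by (simp add: negligible_insert)
    then have "AE s in lebesgue. s \<notin> insert t ((\<lambda>s. t - s) ` N)"
      by (intro AE_not_in) (simp add: negligible_iff_null_sets)
    then have "AE s in lebesgue. s \<in> {0..t} \<longrightarrow> a (t - s) = c s"
    proof eventually_elim
      case (elim s)
      have "t - s \<notin> N"
      proof
        assume "t - s \<in> N"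
        then have "t - (t - s) \<in> (\<lambda>s. t - s) ` N" by (rule imageI)
        then show False using elim by simp
      qed
      then show ?case using elim N(2)[of "t - s"] by (auto simp: c_def)
    qed
    then show ?thesis unfolding M_def by (subst AE_restrict_space_iff) auto
  qed
  obtain \<alpha> where \<alpha>: "\<And>i. simple_function M (\<alpha> i)" "\<And>s. s \<in> space M \<Longrightarrow> (\<lambda>i. \<alpha> i s) \<longlonglongrightarrow> c s"
    "\<And>i s. s \<in> space M \<Longrightarrow> cmod (\<alpha> i s) \<le> 2 * cmod (c s)"
    using borel_measurable_implies_sequence_metric[OF cM, of 0] by (simp add: dist_norm) blast
  have \<alpha>m: "\<alpha> i \<in> borel_measurable M" for i by (rule borel_measurable_simple_function[OF \<alpha>(1)])
  have \<alpha>i: "integrable M (\<alpha> i)" for i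
    by (rule Bochner_Integration.integrable_bound[of M "\<lambda>s. 2 * c s"]) (use ci \<alpha>m \<alpha>(3) in \<open>auto simp: norm_mult\<close>)
  define I where "I = (\<lambda>i. LINT s|M. cmod (c s - \<alpha> i s))"
  define J where "J = (LINT s|M. cmod (c s))"
  have Ilim: "I \<longlonglongrightarrow> 0"
  proof -
    have "I \<longlonglongrightarrow> (LINT s|M. 0)"
      unfolding I_def
    proof (rule integral_dominated_convergence)
      show "integrable M (\<lambda>s. 3 * cmod (c s))" using ci by simp
      show "AE s in M. (\<lambda>i. cmod (c s - \<alpha> i s)) \<longlonglongrightarrow> 0"
      proof (rule AE_I2)
        fix s assume "s \<in> space M"
        then have "(\<lambda>i. c s - \<alpha> i s) \<longlonglongrightarrow> c s - c s" by (intro tendsto_intros \<alpha>(2))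
        then show "(\<lambda>i. cmod (c s - \<alpha> i s)) \<longlonglongrightarrow> 0" by (simp add: tendsto_norm_zero_iff)
      qed
      show "AE s in M. norm (cmod (c s - \<alpha> i s)) \<le> 3 * cmod (c s)" for i
      proof (rule AE_I2)
        fix s assume "s \<in> space M"
        then show "norm (cmod (c s - \<alpha> i s)) \<le> 3 * cmod (c s)"
          using norm_triangle_ineq4[of "c s" "\<alpha> i s"] \<alpha>(3)[of s i] by simp
      qed
    qed (use cM \<alpha>m in measurable)
    then show ?thesis by simp
  qed
  have I0: "I i \<ge> 0" and J0: "J \<ge> 0" for i unfolding I_def J_def by (rule Bochner_Integration.integral_nonneg; simp)+
  \<comment> \<open>Rounds \<open>s\<close> down to a multiple of \<open>1 / (i + 1)\<close>;
    rounding down keeps the point inside \<open>{0..t}\<close>.\<close>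
  define g where "g = (\<lambda>i::nat. \<lambda>s. real_of_int \<lfloor>s * (real i + 1)\<rfloor> / (real i + 1))"
  have gs: "0 \<le> g i s \<and> g i s \<le> s \<and> s - g i s \<le> 1 / (real i + 1)" if "s \<ge> 0" for i s
  proof -
    define P where "P = real i + 1"
    define F where "F = real_of_int \<lfloor>s * P\<rfloor>"
    have P: "P > 0" by (simp add: P_def)
    have F: "F \<le> s * P" "s * P - F \<le> 1" unfolding F_def by linarith+
    have F0: "0 \<le> F" using that P by (simp add: F_def)
    have "s - F / P = (s * P - F) / P" using P by (simp add: diff_divide_distrib)
    also have "\<dots> \<le> 1 / P" using F(2) P by (intro divide_right_mono) auto
    finally have "s - F / P \<le> 1 / P" .
    moreover have "F / P \<le> s" using F(1) P by (simp add: divide_le_eq)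
    moreover have "0 \<le> F / P" using F0 P by simp
    ultimately show ?thesis by (simp add: g_def F_def P_def)
  qed
  have g_in: "g i s \<in> {0..t}" if "s \<in> {0..t}" for i s using gs[of s i] that by auto
  have g_simple: "simple_function M (g i)" for i
  proof (rule simple_function_borel_measurable)
    have "mono (g i)"
      unfolding g_def by (intro monoI divide_right_mono of_int_le_iff[THEN iffD2] floor_mono mult_right_mono) auto
    then show "g i \<in> borel_measurable M"
      unfolding M_def by (intro borel_measurable_lebesgue_on borel_measurable_mono)
    have "g i ` space M \<subseteq> (\<lambda>n. real_of_int n / (real i + 1)) ` {0..\<lfloor>t * (real i + 1)\<rfloor>}"
    proof
      fix y assume "y \<in> g i ` space M"
      then obtain s where s: "s \<in> {0..t}" "y = g i s" by (auto simp: sM)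
      have "\<lfloor>s * (real i + 1)\<rfloor> \<in> {0..\<lfloor>t * (real i + 1)\<rfloor>}"
        using s by (auto intro!: floor_mono mult_right_mono)
      then show "y \<in> (\<lambda>n. real_of_int n / (real i + 1)) ` {0..\<lfloor>t * (real i + 1)\<rfloor>}" by (auto simp: s(2) g_def)
    qed
    then show "finite (g i ` space M)" by (rule finite_subset) auto
  qed
  define S where "S = (\<lambda>i s. \<alpha> i s *\<^sub>C f (g i s))"
  have S_simple: "simple_function M (S i)" for i
    unfolding S_def by (rule simple_function_compose2[OF \<alpha>(1) simple_function_compose1[OF g_simple]])
  have S_int: "Bochner_Integration.simple_bochner_integrable M (S i)" for i
  proof (rule simple_bochner_integrable.intros[OF S_simple])
    have "{y \<in> space M. S i y \<noteq> 0} = S i -` (- {0}) \<inter> space M" by auto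
    then have "{y \<in> space M. S i y \<noteq> 0} \<in> sets M" using simple_functionD(2)[OF S_simple, of i "- {0}"] by simp
    then show "emeasure M {y \<in> space M. S i y \<noteq> 0} \<noteq> \<infinity>" by (intro eM) (auto simp: sM)
  qed
  have f0: "continuous_on {0..t} f" by (rule continuous_on_subset[OF f]) auto
  have modulus: "\<exists>K w. K \<ge> 0 \<and> w \<longlonglongrightarrow> 0 \<and> (\<forall>s\<in>{0..t}. \<forall>i. p (f (g i s)) \<le> K \<and> p (f s - f (g i s)) \<le> w i)"
    if p: "cseminorm p" for p
  proof -
    note sp = cseminorm_seminorm[OF p]
    have "bounded ((\<lambda>s. p (f s)) ` {0..t})"
      by (intro compact_imp_bounded compact_continuous_image cseminorm_continuous_on[OF p f0] compact_Icc)
    then obtain K where K': "\<forall>x\<in>(\<lambda>s. p (f s)) ` {0..t}. norm x \<le> K" unfolding bounded_iff by blast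
    have K: "p (f s) \<le> K" if "s \<in> {0..t}" for s
      using bspec[OF K' imageI[OF that]] by (simp add: abs_le_iff)
    have K0: "K \<ge> 0" by (rule order_trans[OF seminorm_nonneg[OF sp] K[of 0]]) (use t in simp)
    \<comment> \<open>The worst change of \<open>f\<close> under rounding; it tends to 0 by uniform
      continuity.\<close>
    define w where "w = (\<lambda>i. SUP s\<in>{0..t}. p (f s - f (g i s)))"
    have bdd: "bdd_above ((\<lambda>s. p (f s - f (g i s))) ` {0..t})" for i
      by (rule bdd_aboveI2[of _ _ "K + K"])
        (rule order_trans[OF seminorm_diff[OF sp] add_mono[OF K K[OF g_in]]])
    have wle: "p (f s - f (g i s)) \<le> w i" if "s \<in> {0..t}" for s i
      unfolding w_def by (rule cSUP_upper[OF that bdd])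
    have w0: "w i \<ge> 0" for i by (rule order_trans[OF seminorm_nonneg[OF sp] wle[of 0]]) (use t in simp)
    have "w \<longlonglongrightarrow> 0"
    proof (rule LIMSEQ_I)
      fix e :: real assume e: "e > 0"
      obtain d where d: "d > 0" "\<And>x y. x \<in> {0..t} \<Longrightarrow> y \<in> {0..t} \<Longrightarrow> \<bar>x - y\<bar> < d \<Longrightarrow> p (f x - f y) < e / 2"
        using uniformly_continuous_cseminorm[OF f0 p, of "e / 2"] e by auto
      have "(\<lambda>i. 1 / (real i + 1)) \<longlonglongrightarrow> 0" by real_asymp
      then obtain n where n: "\<And>i. i \<ge> n \<Longrightarrow> 1 / (real i + 1) < d"
        using order_tendstoD(2)[of "\<lambda>i. 1 / (real i + 1)" 0 sequentially d] d(1) by (auto simp: eventually_sequentially)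
      have "w i \<le> e / 2" if "i \<ge> n" for i
        unfolding w_def
      proof (rule cSUP_least)
        fix s assume s: "s \<in> {0..t}"
        have "\<bar>s - g i s\<bar> < d" using gs[of s i] n[OF that] s by auto
        then show "p (f s - f (g i s)) \<le> e / 2" using d(2)[OF s g_in[OF s]] by (simp add: less_imp_le)
      qed (use t in auto)
      then have "norm (w i - 0) < e" if "i \<ge> n" for i using w0[of i] e that by fastforce
      then show "\<exists>no. \<forall>n\<ge>no. norm (w n - 0) < e" by blast
    qed
    then show ?thesis using K0 K g_in wle by blast
  qed
  \<comment> \<open>The error splits into that of the kernel, times a bound for \<open>f\<close>,
    and that of \<open>f\<close>, times the modulus of the kernel. Both have integrals that tend to
    0.\<close>
  have pw: "p (c s *\<^sub>C f s - S i s) \<le> cmod (c s - \<alpha> i s) * K + cmod (c s) * W"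
    if "seminorm p" "p (f (g i s)) \<le> K" "p (f s - f (g i s)) \<le> W" for p i s K W
  proof -
    have "c s *\<^sub>C f s - S i s = (c s - \<alpha> i s) *\<^sub>C f (g i s) + c s *\<^sub>C (f s - f (g i s))"
      by (simp add: S_def scaleC_diff_right scaleC_diff_left)
    then have "p (c s *\<^sub>C f s - S i s) \<le> cmod (c s - \<alpha> i s) * p (f (g i s)) + cmod (c s) * p (f s - f (g i s))"
      using seminorm_add[OF that(1), of "(c s - \<alpha> i s) *\<^sub>C f (g i s)" "c s *\<^sub>C (f s - f (g i s))"]
      by (simp add: seminorm_scale[OF that(1)])
    also have "\<dots> \<le> cmod (c s - \<alpha> i s) * K + cmod (c s) * W"
      using that by (intro add_mono mult_left_mono) auto
    finally show ?thesis .
  qed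
  have bi: "integrable M (\<lambda>s. cmod (c s - \<alpha> i s) * K + cmod (c s) * W)"
    "(LINT s|M. cmod (c s - \<alpha> i s) * K + cmod (c s) * W) = I i * K + J * W" for i K W
    using ci \<alpha>i by (auto simp: I_def J_def)
  \<comment> \<open>The vectors \<open>V i\<close> approach these scalar integrals uniformly over
    each polar, which shows convergence and identifies the limit.\<close>
  define L where "L = (\<lambda>\<phi>. LINT s|M. c s * \<phi> (f s))"
  define V where "V = (\<lambda>i. Bochner_Integration.simple_bochner_integral M (S i))"
  have est: "cmod (\<phi> (V i) - L \<phi>) \<le> I i * K + J * w i"
    if p: "cseminorm p" and \<phi>: "\<phi> \<in> polar p" and Kw: "K \<ge> 0" "\<forall>s\<in>{0..t}. \<forall>i. p (f (g i s)) \<le> K \<and> p (f s - f (g i s)) \<le> w i"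
    for p \<phi> K w i
  proof -
    note f\<phi> = polar_functional[OF \<phi>]
    have lin: "linear \<phi>"
      by (rule linearI) (auto simp: functional_add[OF f\<phi>] functional_scaleR[OF f\<phi>] scaleR_conv_of_real)
    have sb: "Bochner_Integration.simple_bochner_integrable M (\<lambda>s. \<phi> (S i s))"
      using simple_bochner_integrable_compose2[of "\<lambda>x y. \<phi> x" M "S i" "S i", OF _ S_int S_int] functional_0[OF f\<phi>] by simp
    have "\<phi> (V i) = Bochner_Integration.simple_bochner_integral M (\<lambda>s. \<phi> (S i s))"
      unfolding V_def by (rule simple_bochner_integral_linear[OF lin S_int, symmetric])
    also have "\<dots> = (LINT s|M. \<phi> (S i s))" by (rule simple_bochner_integrable_eq_integral[OF sb])
    finally have V: "\<phi> (V i) = (LINT s|M. \<phi> (S i s))" .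
    have Si: "integrable M (\<lambda>s. \<phi> (S i s))"
      using has_bochner_integral_simple_bochner_integrable[OF sb] by (auto simp: has_bochner_integral_iff)
    have \<phi>c: "continuous_on {0..t} (\<lambda>s. \<phi> (f s))" by (rule dual_continuous_on[OF dualI[OF p \<phi>] f0])
    have \<phi>m: "(\<lambda>s. \<phi> (f s)) \<in> borel_measurable M"
      unfolding M_def by (rule continuous_imp_measurable_on_sets_lebesgue[OF \<phi>c]) auto
    have le: "cmod (\<phi> (S i s) - c s * \<phi> (f s)) \<le> cmod (c s - \<alpha> i s) * K + cmod (c s) * w i" if "s \<in> space M" for s
    proof -
      have "\<phi> (S i s) - c s * \<phi> (f s) = - \<phi> (c s *\<^sub>C f s - S i s)"
        by (simp add: functional_diff[OF f\<phi>] functional_scale[OF f\<phi>])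
      then have "cmod (\<phi> (S i s) - c s * \<phi> (f s)) \<le> p (c s *\<^sub>C f s - S i s)" using polar_bound[OF \<phi>] by simp
      also have "\<dots> \<le> cmod (c s - \<alpha> i s) * K + cmod (c s) * w i"
        using Kw that by (intro pw[OF cseminorm_seminorm[OF p]]) (auto simp: sM)
      finally show ?thesis .
    qed
    have di: "integrable M (\<lambda>s. \<phi> (S i s) - c s * \<phi> (f s))"
      by (rule Bochner_Integration.integrable_bound[OF bi(1)[of i K "w i"]])
        (use Si cM \<phi>m le in \<open>auto intro!: AE_I2 borel_measurable_diff borel_measurable_times order_trans[OF _ abs_ge_self]\<close>)
    have Li: "integrable M (\<lambda>s. c s * \<phi> (f s))"
      using Bochner_Integration.integrable_diff[OF Si di] by simp
    have "\<phi> (V i) - L \<phi> = (LINT s|M. \<phi> (S i s) - c s * \<phi> (f s))" unfolding V L_def using Si Li by simp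
    also have "cmod \<dots> \<le> (LINT s|M. cmod (c s - \<alpha> i s) * K + cmod (c s) * w i)"
      by (rule order_trans[OF integral_norm_bound integral_mono]) (use di bi(1) le in auto)
    finally show ?thesis by (simp add: bi(2))
  qed
  have lim0: "(\<lambda>i. I i * K + J * w i) \<longlonglongrightarrow> 0" if "w \<longlonglongrightarrow> 0" for K w
    by (rule tendsto_eq_intros Ilim that | simp)+
  have "\<exists>v. V \<longlonglongrightarrow> v"
  proof (rule Cauchy_cseminorm_convergent)
    fix p :: "'a \<Rightarrow> real" and e :: real assume p: "cseminorm p" and e: "e > 0"
    obtain K w where Kw: "K \<ge> 0" "w \<longlonglongrightarrow> 0" "\<forall>s\<in>{0..t}. \<forall>i. p (f (g i s)) \<le> K \<and> p (f s - f (g i s)) \<le> w i"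
      using modulus[OF p] by blast
    obtain n where n: "\<And>i. i \<ge> n \<Longrightarrow> I i * K + J * w i < e / 2"
      using order_tendstoD(2)[OF lim0[OF Kw(2)], of "e / 2" K] e by (auto simp: eventually_sequentially)
    have "p (V i - V j) < e" if ij: "i \<ge> n" "j \<ge> n" for i j
    proof -
      have "p (V i - V j) \<le> (I i * K + J * w i) + (I j * K + J * w j)"
      proof (rule seminorm_le_polar[OF cseminorm_seminorm[OF p]])
        fix \<phi> assume \<phi>: "\<phi> \<in> polar p"
        have "\<phi> (V i - V j) = (\<phi> (V i) - L \<phi>) - (\<phi> (V j) - L \<phi>)" by (simp add: functional_diff[OF polar_functional[OF \<phi>]])
        then show "cmod (\<phi> (V i - V j)) \<le> (I i * K + J * w i) + (I j * K + J * w j)"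
          using norm_triangle_ineq4[of "\<phi> (V i) - L \<phi>" "\<phi> (V j) - L \<phi>"]
            est[OF p \<phi> Kw(1,3), of i] est[OF p \<phi> Kw(1,3), of j] by simp
      qed
      then show ?thesis using n[OF ij(1)] n[OF ij(2)] by linarith
    qed
    then show "\<exists>N. \<forall>m\<ge>N. \<forall>n\<ge>N. p (V m - V n) < e" by blast
  qed
  then obtain v where v: "V \<longlonglongrightarrow> v" by blast
  have "\<phi> v = convolution b (\<lambda>s. \<phi> (f s)) t" if \<phi>: "\<phi> \<in> dual" for \<phi>
  proof -
    obtain p where p: "cseminorm p" "\<phi> \<in> polar p" using \<phi> by (auto simp: dual_def)
    obtain K w where Kw: "K \<ge> 0" "w \<longlonglongrightarrow> 0" "\<forall>s\<in>{0..t}. \<forall>i. p (f (g i s)) \<le> K \<and> p (f s - f (g i s)) \<le> w i"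
      using modulus[OF p(1)] by blast
    have "(\<lambda>i. \<phi> (V i) - L \<phi>) \<longlonglongrightarrow> 0"
      by (rule Lim_null_comparison[OF _ lim0[OF Kw(2), of K]]) (use est[OF p Kw(1,3)] in simp)
    then have "(\<lambda>i. \<phi> (V i)) \<longlonglongrightarrow> L \<phi>" by (simp add: LIM_zero_iff)
    then have "\<phi> v = L \<phi>" using tendsto_dual[OF \<phi> v] LIMSEQ_unique by blast
    also have "L \<phi> = (LINT s|M. indicator {0..t} s *\<^sub>R (c s * \<phi> (f s)))"
      unfolding L_def by (intro Bochner_Integration.integral_cong) (auto simp: sM)
    also have "\<dots> = (LINT s|lborel. indicator {0..t} s *\<^sub>R indicator {0..t} s *\<^sub>R (c s * \<phi> (f s)))"
      unfolding M_def
    proof (rule integral_lebesgue_on_borel(2))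
      have "(\<lambda>s. indicator {0..t} s *\<^sub>R \<phi> (f s)) \<in> borel_measurable borel"
        by (rule borel_measurable_continuous_on_indicator[OF _ dual_continuous_on[OF \<phi> f0]]) auto
      then have "(\<lambda>s. c s * (indicator {0..t} s *\<^sub>R \<phi> (f s))) \<in> borel_measurable borel"
        using cm by (intro borel_measurable_times)
      then show "(\<lambda>s. indicator {0..t} s *\<^sub>R (c s * \<phi> (f s))) \<in> borel_measurable borel" by simp
    qed
    also have "\<dots> = (LINT s:{0..}|lborel. c s * \<phi> (f s))"
      unfolding set_lebesgue_integral_def
      by (intro Bochner_Integration.integral_cong) (use b(2)[of "t - _"] in \<open>auto simp: indicator_def c_def\<close>)
    also have "\<dots> = convolution b (\<lambda>s. \<phi> (f s)) t"
      by (simp add: convolution_def half_line_set_integrable(2) c_def)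
    finally show ?thesis .
  qed
  moreover have "has_strong_integral M (\<lambda>s. a (t - s) *\<^sub>C f s) v"
    unfolding has_strong_integral_def
  proof (intro exI[of _ S] conjI allI impI S_int)
    show "AE s in M. (\<lambda>i. S i s) \<longlonglongrightarrow> a (t - s) *\<^sub>C f s"
      using ac AE_space
    proof eventually_elim
      case (elim s)
      then have s: "s \<in> {0..t}" by (simp add: sM)
      have "(\<lambda>i. f (g i s)) \<longlonglongrightarrow> f s"
        unfolding tendsto_cseminorm_iff
      proof (intro allI impI)
        fix p :: "'a \<Rightarrow> real" assume p: "cseminorm p"
        obtain K w where Kw: "w \<longlonglongrightarrow> 0" "\<forall>s\<in>{0..t}. \<forall>i. p (f (g i s)) \<le> K \<and> p (f s - f (g i s)) \<le> w i"
          using modulus[OF p] by blast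
        show "(\<lambda>i. p (f (g i s) - f s)) \<longlonglongrightarrow> 0"
          by (rule tendsto_0_dominated[OF Kw(1)])
            (use Kw(2) s seminorm_nonneg[OF cseminorm_seminorm[OF p]] seminorm_commute[OF cseminorm_seminorm[OF p]] in auto)
      qed
      then have "(\<lambda>i. \<alpha> i s *\<^sub>C f (g i s)) \<longlonglongrightarrow> c s *\<^sub>C f s"
        by (intro tendsto_scaleC \<alpha>(2)) (use s in \<open>auto simp: sM\<close>)
      then show ?case using elim by (simp add: S_def)
    qed
    show "(\<lambda>i. Bochner_Integration.simple_bochner_integral M (S i)) \<longlonglongrightarrow> v" using v by (simp add: V_def)
    fix p :: "'a \<Rightarrow> real" assume "seminorm p \<and> continuous_on UNIV p"
    then have p: "cseminorm p" by (simp add: cseminorm_def)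
    obtain K w where Kw: "K \<ge> 0" "w \<longlonglongrightarrow> 0" "\<forall>s\<in>{0..t}. \<forall>i. p (f (g i s)) \<le> K \<and> p (f s - f (g i s)) \<le> w i"
      using modulus[OF p] by blast
    have le: "(\<integral>\<^sup>+ s. ennreal (p (a (t - s) *\<^sub>C f s - S i s)) \<partial>M) \<le> ennreal (I i * K + J * w i)" for i
    proof -
      have "(\<integral>\<^sup>+ s. ennreal (p (a (t - s) *\<^sub>C f s - S i s)) \<partial>M) = (\<integral>\<^sup>+ s. ennreal (p (c s *\<^sub>C f s - S i s)) \<partial>M)"
        by (rule nn_integral_cong_AE) (use ac in \<open>eventually_elim, simp\<close>)
      also have "\<dots> \<le> (\<integral>\<^sup>+ s. ennreal (cmod (c s - \<alpha> i s) * K + cmod (c s) * w i) \<partial>M)"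
        using Kw by (intro nn_integral_mono ennreal_leI pw[OF cseminorm_seminorm[OF p]]) (auto simp: sM)
      also have "\<dots> = ennreal (I i * K + J * w i)"
      proof (subst nn_integral_eq_integral[OF bi(1)])
        have "w i \<ge> 0" using Kw(3) t seminorm_nonneg[OF cseminorm_seminorm[OF p], of "f 0 - f (g i 0)"]
          by (meson atLeastAtMost_iff order_refl order_trans)
        then show "AE s in M. 0 \<le> cmod (c s - \<alpha> i s) * K + cmod (c s) * w i" using Kw(1) by (intro AE_I2) simp
      qed (simp add: bi(2))
      finally show ?thesis .
    qed
    have "(\<lambda>i. ennreal (I i * K + J * w i)) \<longlonglongrightarrow> 0"
      using tendsto_ennrealI[OF lim0[OF Kw(2)]] by simp
    then show "(\<lambda>i. \<integral>\<^sup>+ s. ennreal (p (a (t - s) *\<^sub>C f s - S i s)) \<partial>M) \<longlonglongrightarrow> 0"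
      by (rule tendsto_sandwich[OF always_eventually always_eventually tendsto_const, rotated 2]) (use le in auto)
  qed
  ultimately show ?thesis unfolding M_def by blast
qed

section \<open>Inverse Laplace transforms of operator families\<close>

lemma inverse_laplace_cong:
  assumes \<alpha>: "0 < \<alpha>" "\<alpha> \<le> pi / 2" and z: "z \<in> sector \<alpha>" and eq: "\<And>\<mu>. \<mu> \<in> sector (pi / 2 + \<alpha>) \<Longrightarrow> P \<mu> = P' \<mu>"
  shows "inverse_laplace \<alpha> P z = inverse_laplace \<alpha> P' z"
proof -
  define \<delta> where "\<delta> = (\<alpha> - \<bar>Arg z\<bar>) / 2"
  have z': "z \<noteq> 0" "\<bar>Arg z\<bar> < \<alpha>" using z by (auto simp: sector_def)
  have \<delta>: "0 < \<delta>" "\<delta> < pi / 2" using z' \<alpha> by (auto simp: \<delta>_def)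
  have zg: "z \<in> sector (\<bar>Arg z\<bar> + \<delta>)" using z' \<delta> by (auto simp: sector_def)
  have "scaled_edge_integral \<theta> P z = scaled_edge_integral \<theta> P' z" if e: "edge \<delta> \<theta>" for \<theta>
    unfolding scaled_edge_integral_def
  proof (rule Bochner_Integration.integral_cong[OF refl])
    fix s assume "s \<in> space half_line"
    then have "(1 + of_real s * cis \<theta>) / z \<in> sector (pi / 2 + \<alpha>)"
      by (intro edge_quotient[OF e zg]) (use \<alpha> in \<open>auto simp: \<delta>_def field_simps\<close>)
    then show "cis \<theta> * exp (1 + of_real s * cis \<theta>) * (P ((1 + of_real s * cis \<theta>) / z) / z) =
      cis \<theta> * exp (1 + of_real s * cis \<theta>) * (P' ((1 + of_real s * cis \<theta>) / z) / z)" by (simp add: eq)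
  qed
  then show ?thesis
    unfolding inverse_laplace_def inverse_wedge_def \<delta>_def[symmetric] using edges[OF \<delta>] by simp
qed

text \<open>The operator form of \<open>subsectorial\<close>: one seminorm \<open>q\<close> serves
  the whole smaller sector, so \<open>\<mu> * Q \<mu>\<close> is equicontinuous there and scalar
  bounds hold uniformly over polars.\<close>

locale sectorial_family =
  fixes \<alpha> :: real and Q :: "complex \<Rightarrow> 'a::{sequentially_complete_lcs, t2_space} \<Rightarrow> 'a"
  assumes angle: "0 < \<alpha>" "\<alpha> \<le> pi / 2"
    and symbol_add: "\<And>\<mu> x y. \<mu> \<in> sector (pi / 2 + \<alpha>) \<Longrightarrow> Q \<mu> (x + y) = Q \<mu> x + Q \<mu> y"
    and symbol_scale: "\<And>\<mu> c x. \<mu> \<in> sector (pi / 2 + \<alpha>) \<Longrightarrow> Q \<mu> (c *\<^sub>C x) = c *\<^sub>C Q \<mu> x"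
    and symbol_analytic: "\<And>x. vector_analytic_on (\<lambda>\<mu>. Q \<mu> x) (sector (pi / 2 + \<alpha>))"
    and symbol_bound: "\<And>\<gamma> p. 0 < \<gamma> \<Longrightarrow> \<gamma> < \<alpha> \<Longrightarrow> cseminorm p \<Longrightarrow>
      \<exists>q. cseminorm q \<and> (\<forall>\<mu>\<in>sector (pi / 2 + \<gamma>). \<forall>x. cmod \<mu> * p (Q \<mu> x) \<le> q x)"
begin

lemma symbol_holomorphic: "\<phi> \<in> dual \<Longrightarrow> (\<lambda>\<mu>. \<phi> (Q \<mu> x)) holomorphic_on sector (pi / 2 + \<alpha>)"
  by (rule vector_analytic_dual[OF symbol_analytic open_sector]) (use angle in auto)

lemma symbol_sectorial:
  assumes "0 < \<gamma>" "\<gamma> < \<alpha>" "\<phi> \<in> dual"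
  shows "\<exists>M. sectorial (\<lambda>\<mu>. \<phi> (Q \<mu> x)) \<gamma> M"
proof -
  obtain p where p: "cseminorm p" "\<phi> \<in> polar p" using assms(3) by (auto simp: dual_def)
  obtain q where q: "\<And>\<mu> x. \<mu> \<in> sector (pi / 2 + \<gamma>) \<Longrightarrow> cmod \<mu> * p (Q \<mu> x) \<le> q x"
    using symbol_bound[OF assms(1,2) p(1)] by blast
  have "cmod (\<mu> * \<phi> (Q \<mu> x)) \<le> q x" if "\<mu> \<in> sector (pi / 2 + \<gamma>)" for \<mu>
    using order_trans[OF mult_left_mono[OF polar_bound[OF p(2)] norm_ge_zero] q[OF that]] by (simp add: norm_mult)
  moreover have "sector (pi / 2 + \<gamma>) \<subseteq> sector (pi / 2 + \<alpha>)" using assms by (intro sector_mono) simp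
  ultimately show ?thesis
    unfolding sectorial_def using holomorphic_on_subset[OF symbol_holomorphic[OF assms(3)]] by blast
qed

lemma symbol_subsectorial: "\<phi> \<in> dual \<Longrightarrow> subsectorial (\<lambda>\<mu>. \<phi> (Q \<mu> x)) \<alpha>"
  using symbol_sectorial by (auto simp: subsectorial_def)

lemma symbol_edge_integral:
  assumes e: "edge \<delta> \<theta>" and z: "z \<in> sector \<gamma>" and \<gamma>: "0 < \<gamma>" "\<delta> + \<gamma> < \<alpha>"
  shows "\<exists>v. \<forall>\<phi>\<in>dual. \<phi> v = scaled_edge_integral \<theta> (\<lambda>\<mu>. \<phi> (Q \<mu> x)) z"
proof -
  have \<delta>: "0 < \<delta>" using e by (simp add: edge_def)
  define m where "m = (\<lambda>s::real. (1 + of_real s * cis \<theta>) / z)"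
  define c where "c = (\<lambda>s::real. cis \<theta> * exp (1 + of_real s * cis \<theta>) / z)"
  define f where "f = (\<lambda>s. c s *\<^sub>C Q (m s) x)"
  have z0: "z \<noteq> 0" using z by (rule sector_nonzero)
  have m: "m s \<in> sector (pi / 2 + (\<delta> + \<gamma>))" if "s \<ge> 0" for s
    unfolding m_def by (rule edge_quotient[OF e z order_refl _ that]) (use \<gamma> angle in simp)
  have sub: "sector (pi / 2 + (\<delta> + \<gamma>)) \<subseteq> sector (pi / 2 + \<alpha>)" using \<gamma> by (intro sector_mono) simp
  have "continuous_on {0..} f"
    unfolding continuous_on_def f_def
  proof (intro ballI tendsto_scaleC)
    fix s :: real assume s: "s \<in> {0..}"
    have "continuous_on {0..} c" "continuous_on {0..} m" unfolding c_def m_def by (intro continuous_intros; simp add: z0)+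
    then show "(c \<longlongrightarrow> c s) (at s within {0..})" using s by (simp add: continuous_on_def)
    have "continuous_on {0..} (\<lambda>s. Q (m s) x)"
      by (rule continuous_on_compose2[OF vector_analytic_continuous[OF symbol_analytic] \<open>continuous_on {0..} m\<close>]) (use m sub in auto)
    then show "((\<lambda>s. Q (m s) x) \<longlongrightarrow> Q (m s) x) (at s within {0..})" using s by (simp add: continuous_on_def)
  qed
  moreover have "\<exists>g. integrable half_line g \<and> (\<forall>s>0. p (f s) \<le> g s)" if p: "cseminorm p" for p
  proof -
    note sp = cseminorm_seminorm[OF p]
    obtain q where q: "\<And>\<mu> x. \<mu> \<in> sector (pi / 2 + (\<delta> + \<gamma>)) \<Longrightarrow> cmod \<mu> * p (Q \<mu> x) \<le> q x"
      using symbol_bound[of "\<delta> + \<gamma>", OF _ _ p] \<delta> \<gamma> by auto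
    have "p (f s) \<le> exp 1 * q x / cos \<delta> * exp (- (sin \<delta> * s))" if s: "s > 0" for s
    proof -
      \<comment> \<open>The scalar estimate of the integrand speaks only of absolute values, so it
        may be applied with the function \<open>p (Q \<mu> x)\<close> in the role of the
        symbol.\<close>
      have "p (f s) = cmod (cis \<theta> * exp (1 + of_real s * cis \<theta>) * (of_real (p (Q (m s) x)) / z))"
        using seminorm_nonneg[OF sp] by (simp add: f_def c_def seminorm_scale[OF sp] norm_mult norm_divide)
      also have "\<dots> \<le> exp 1 * q x / cos \<delta> * exp (- (sin \<delta> * s))"
        unfolding m_def
        by (rule scaled_edge_integrand[OF e _ z0, of s "\<lambda>\<mu>. of_real (p (Q \<mu> x))"])
          (use s q[OF m, of s x] seminorm_nonneg[OF sp] in \<open>auto simp: m_def norm_mult norm_divide abs_of_nonneg\<close>)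
      finally show ?thesis .
    qed
    moreover have "integrable half_line (\<lambda>s. exp 1 * q x / cos \<delta> * exp (- (sin \<delta> * s)))"
      using edge_trig(3)[OF e] by (intro integrable_mult_right half_line_exp(1))
    ultimately show ?thesis by blast
  qed
  ultimately obtain v where "\<And>\<phi>. \<phi> \<in> dual \<Longrightarrow> \<phi> v = (LINT s|half_line. \<phi> (f s))"
    using weak_integral_half_line[of f] by blast
  then have "\<phi> v = scaled_edge_integral \<theta> (\<lambda>\<mu>. \<phi> (Q \<mu> x)) z" if "\<phi> \<in> dual" for \<phi>
    using that by (simp add: scaled_edge_integral_def f_def c_def m_def functional_scale[OF dual_functional])
  then show ?thesis by blast
qed

lemma weak_inverse_exists:
  assumes z: "z \<in> sector \<alpha>"
  shows "\<exists>v. \<forall>\<phi>\<in>dual. \<phi> v = inverse_laplace \<alpha> (\<lambda>\<mu>. \<phi> (Q \<mu> x)) z"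
proof -
  define \<delta> where "\<delta> = (\<alpha> - \<bar>Arg z\<bar>) / 2"
  have z': "z \<noteq> 0" "\<bar>Arg z\<bar> < \<alpha>" using z by (auto simp: sector_def)
  have \<delta>: "0 < \<delta>" "\<delta> < pi / 2" using z' angle by (auto simp: \<delta>_def)
  have zg: "z \<in> sector (\<bar>Arg z\<bar> + \<delta> / 2)" "0 < \<bar>Arg z\<bar> + \<delta> / 2" using z' \<delta> by (auto simp: sector_def)
  have "\<delta> + (\<bar>Arg z\<bar> + \<delta> / 2) < \<alpha>" using z'(2) by (simp add: \<delta>_def field_simps)
  note * = symbol_edge_integral[OF _ zg this]
  obtain v where v: "\<And>\<phi>. \<phi> \<in> dual \<Longrightarrow> \<phi> v = scaled_edge_integral (pi / 2 + \<delta>) (\<lambda>\<mu>. \<phi> (Q \<mu> x)) z"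
    using *[OF conjunct1[OF edges[OF \<delta>]]] by blast
  obtain w where w: "\<And>\<phi>. \<phi> \<in> dual \<Longrightarrow> \<phi> w = scaled_edge_integral (- (pi / 2 + \<delta>)) (\<lambda>\<mu>. \<phi> (Q \<mu> x)) z"
    using *[OF conjunct2[OF edges[OF \<delta>]]] by blast
  have "\<phi> ((1 / (2 * of_real pi * \<i>)) *\<^sub>C (v - w)) = inverse_laplace \<alpha> (\<lambda>\<mu>. \<phi> (Q \<mu> x)) z" if "\<phi> \<in> dual" for \<phi>
    unfolding inverse_laplace_def inverse_wedge_def \<delta>_def[symmetric]
    using v[OF that] w[OF that]
    by (simp add: functional_scale[OF dual_functional[OF that]] functional_diff[OF dual_functional[OF that]])
  then show ?thesis by blast
qed

text \<open>The vector exists by \<open>weak_inverse_exists\<close> for \<open>z\<close> in the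
  sector and is unique because functionals separate points of the Hausdorff space; linearity in
  \<open>x\<close> therefore comes from the scalar transforms.\<close>

definition inverse_family :: "complex \<Rightarrow> 'a \<Rightarrow> 'a" where
  "inverse_family z x = (SOME v. \<forall>\<phi>\<in>dual. \<phi> v = inverse_laplace \<alpha> (\<lambda>\<mu>. \<phi> (Q \<mu> x)) z)"

lemma inverse_family_dual:
  assumes "z \<in> sector \<alpha>" "\<phi> \<in> dual"
  shows "\<phi> (inverse_family z x) = inverse_laplace \<alpha> (\<lambda>\<mu>. \<phi> (Q \<mu> x)) z"
  using someI_ex[OF weak_inverse_exists[OF assms(1)], of x] assms(2) by (simp add: inverse_family_def)

lemma inverse_family_add:
  assumes z: "z \<in> sector \<alpha>"
  shows "inverse_family z (x + y) = inverse_family z x + inverse_family z y"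
proof (rule dual_separates)
  fix \<phi> :: "'a \<Rightarrow> complex" assume \<phi>: "\<phi> \<in> dual"
  have "\<phi> (inverse_family z (x + y)) = inverse_laplace \<alpha> (\<lambda>\<mu>. \<phi> (Q \<mu> x) + \<phi> (Q \<mu> y)) z"
    unfolding inverse_family_dual[OF z \<phi>]
    by (rule inverse_laplace_cong[OF angle z]) (simp add: symbol_add functional_add[OF dual_functional[OF \<phi>]])
  also have "\<dots> = \<phi> (inverse_family z x) + \<phi> (inverse_family z y)"
    unfolding inverse_family_dual[OF z \<phi>]
    by (rule inverse_laplace_add[OF angle(2) symbol_subsectorial[OF \<phi>] symbol_subsectorial[OF \<phi>] z])
  finally show "\<phi> (inverse_family z (x + y)) = \<phi> (inverse_family z x + inverse_family z y)"
    by (simp add: functional_add[OF dual_functional[OF \<phi>]])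
qed

lemma inverse_family_scale:
  assumes z: "z \<in> sector \<alpha>"
  shows "inverse_family z (c *\<^sub>C x) = c *\<^sub>C inverse_family z x"
proof (rule dual_separates)
  fix \<phi> :: "'a \<Rightarrow> complex" assume \<phi>: "\<phi> \<in> dual"
  have "\<phi> (inverse_family z (c *\<^sub>C x)) = inverse_laplace \<alpha> (\<lambda>\<mu>. c * \<phi> (Q \<mu> x)) z"
    unfolding inverse_family_dual[OF z \<phi>]
    by (rule inverse_laplace_cong[OF angle z]) (simp add: symbol_scale functional_scale[OF dual_functional[OF \<phi>]])
  then show "\<phi> (inverse_family z (c *\<^sub>C x)) = \<phi> (c *\<^sub>C inverse_family z x)"
    by (simp add: inverse_laplace_cmult inverse_family_dual[OF z \<phi>] functional_scale[OF dual_functional[OF \<phi>]])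
qed

lemma inverse_family_bound:
  assumes \<gamma>: "0 < \<gamma>" "\<gamma> < \<alpha>" and p: "cseminorm p"
  shows "\<exists>q. cseminorm q \<and> (\<forall>z\<in>sector \<gamma>. \<forall>x. p (inverse_family z x) \<le> q x)"
proof -
  obtain q where q: "cseminorm q" "\<And>\<mu> x. \<mu> \<in> sector (pi / 2 + (\<alpha> + \<gamma>) / 2) \<Longrightarrow> cmod \<mu> * p (Q \<mu> x) \<le> q x"
    using symbol_bound[of "(\<alpha> + \<gamma>) / 2", OF _ _ p] \<gamma> by auto
  have "p (inverse_family z x) \<le> inversion_constant \<alpha> \<gamma> * q x" if z: "z \<in> sector \<gamma>" for z x
  proof (rule seminorm_le_polar[OF cseminorm_seminorm[OF p]])
    fix \<phi> assume \<phi>: "\<phi> \<in> polar p"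
    note d = dualI[OF p \<phi>]
    have z\<alpha>: "z \<in> sector \<alpha>" using z sector_mono[of \<gamma> \<alpha>] \<gamma> by auto
    have "cmod (\<mu> * \<phi> (Q \<mu> x)) \<le> q x" if "\<mu> \<in> sector (pi / 2 + (\<alpha> + \<gamma>) / 2)" for \<mu>
      using order_trans[OF mult_left_mono[OF polar_bound[OF \<phi>] norm_ge_zero] q(2)[OF that]] by (simp add: norm_mult)
    then show "cmod (\<phi> (inverse_family z x)) \<le> inversion_constant \<alpha> \<gamma> * q x"
      unfolding inverse_family_dual[OF z\<alpha> d]
      by (intro inverse_laplace_bound[OF angle(2) symbol_subsectorial[OF d] \<gamma> z])
  qed
  moreover have "cseminorm (\<lambda>x. inversion_constant \<alpha> \<gamma> * q x)"
    using inversion_constant_pos(1)[OF \<gamma> angle(2)] by (intro cseminorm_scaled[OF q(1)]) simp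
  ultimately show ?thesis by blast
qed

lemma in_smaller_sector:
  assumes "z \<in> sector \<alpha>"
  obtains \<gamma> where "0 < \<gamma>" "\<gamma> < \<alpha>" "z \<in> sector \<gamma>"
  using assms by (intro that[of "(\<alpha> + \<bar>Arg z\<bar>) / 2"]) (auto simp: sector_def)

lemma inverse_family_operator:
  assumes z: "z \<in> sector \<alpha>"
  shows "inverse_family z \<in> continuous_operators"
proof (rule operatorI[OF inverse_family_add[OF z] inverse_family_scale[OF z]])
  fix p :: "'a \<Rightarrow> real" assume p: "cseminorm p"
  obtain \<gamma> where "0 < \<gamma>" "\<gamma> < \<alpha>" "z \<in> sector \<gamma>" using in_smaller_sector[OF z] .
  then show "\<exists>q. cseminorm q \<and> (\<forall>x. p (inverse_family z x) \<le> q x)"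
    using inverse_family_bound[OF _ _ p, of \<gamma>] by blast
qed

lemma inverse_family_analytic: "vector_analytic_on (\<lambda>z. inverse_family z x) (sector \<alpha>)"
proof (rule weakly_analytic_imp_analytic)
  show "open (sector \<alpha>)" using angle by (intro open_sector) simp
  show "(\<lambda>z. \<phi> (inverse_family z x)) holomorphic_on sector \<alpha>" if \<phi>: "\<phi> \<in> dual" for \<phi>
    using inverse_laplace_holomorphic[OF angle(2) symbol_subsectorial[OF \<phi>], of x]
    by (rule holomorphic_transform) (simp add: inverse_family_dual[OF _ \<phi>])
  fix z and p :: "'a \<Rightarrow> real" assume z: "z \<in> sector \<alpha>" and p: "cseminorm p"
  obtain \<gamma> where \<gamma>: "0 < \<gamma>" "\<gamma> < \<alpha>" "z \<in> sector \<gamma>" using in_smaller_sector[OF z] .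
  have "open (sector \<gamma>)" using \<gamma> angle by (intro open_sector) simp
  then obtain r where "r > 0" "ball z r \<subseteq> sector \<gamma>" using \<gamma>(3) open_contains_ball by blast
  then show "\<exists>r>0. \<exists>B. \<forall>w\<in>ball z r. p (inverse_family w x) \<le> B"
    using inverse_family_bound[OF \<gamma>(1,2) p] by blast
qed

lemma inverse_family_laplace:
  assumes \<phi>: "\<phi> \<in> dual" and m: "m > 0"
  shows "laplace_integrable (\<lambda>t. \<phi> (inverse_family (of_real t) x)) m"
    and "laplace_integral (\<lambda>t. \<phi> (inverse_family (of_real t) x)) (of_real m) = \<phi> (Q (of_real m) x)"
proof -
  have eq: "\<phi> (inverse_family (of_real t) x) = inverse_laplace \<alpha> (\<lambda>\<mu>. \<phi> (Q \<mu> x)) (of_real t)" if "t > 0" for t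
    by (rule inverse_family_dual[OF of_real_in_sector[OF that angle(1)] \<phi>])
  show "laplace_integrable (\<lambda>t. \<phi> (inverse_family (of_real t) x)) m"
    using inverse_laplace_real(1)[OF angle symbol_subsectorial[OF \<phi>] m, of x] laplace_integrable_cong[OF eq] by simp
  show "laplace_integral (\<lambda>t. \<phi> (inverse_family (of_real t) x)) (of_real m) = \<phi> (Q (of_real m) x)"
    using inverse_laplace_real(2)[OF angle symbol_subsectorial[OF \<phi>] m, of x] laplace_integral_cong[OF eq] by simp
qed

text \<open>Subtracting \<open>l\<close> changes the symbol to \<open>Q \<mu> x - l / \<mu>\<close>,
  and \<open>\<mu>\<close> times it tends to 0 along the positive axis. The uniform radial limit
  extends this to a sector and to all functionals of a polar, and the inversion bound then concerns
  only points far from 0.\<close>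

lemma inverse_family_initial_value:
  assumes lim: "((\<lambda>r::real. of_real r *\<^sub>C Q (of_real r) x) \<longlongrightarrow> l) at_top" and \<gamma>: "0 < \<gamma>" "\<gamma> < \<alpha>"
  shows "((\<lambda>z. inverse_family z x) \<longlongrightarrow> l) (at 0 within sector \<gamma>)"
proof (rule tendsto_cseminormI)
  fix p :: "'a \<Rightarrow> real" and e :: real assume p: "cseminorm p" and e: "e > 0"
  note sp = cseminorm_seminorm[OF p]
  define c where "c = inversion_constant \<alpha> \<gamma>"
  define d where "d = cos ((\<alpha> - \<gamma>) / 2)"
  have cd: "c > 0" "d > 0" using inversion_constant_pos[OF \<gamma> angle(2)] by (auto simp: c_def d_def)
  define \<gamma>' where "\<gamma>' = (\<alpha> + \<gamma>) / 2"
  define \<gamma>'' where "\<gamma>'' = (\<alpha> + \<gamma>') / 2"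
  have \<gamma>': "0 < \<gamma>'" "\<gamma>' < \<gamma>''" "\<gamma>'' < \<alpha>" using \<gamma> by (auto simp: \<gamma>'_def \<gamma>''_def)
  define F where "F = (\<lambda>\<phi> \<mu>. \<mu> * \<phi> (Q \<mu> x) - \<phi> l)"
  obtain q where q: "\<And>\<mu> x. \<mu> \<in> sector (pi / 2 + \<gamma>'') \<Longrightarrow> cmod \<mu> * p (Q \<mu> x) \<le> q x"
    using symbol_bound[of \<gamma>'', OF _ _ p] \<gamma>' by auto
  have "\<exists>R>0. \<forall>\<phi>\<in>polar p. \<forall>\<mu>\<in>sector (pi / 2 + \<gamma>'). cmod \<mu> \<ge> R \<longrightarrow> cmod (F \<phi> \<mu>) \<le> e / c"
  proof (rule uniform_sectorial_limit)
    show "0 < pi / 2 + \<gamma>'" "pi / 2 + \<gamma>' < pi / 2 + \<gamma>''" "pi / 2 + \<gamma>'' \<le> pi" "e / c > 0" using \<gamma>' angle e cd by auto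
    fix \<phi> assume \<phi>: "\<phi> \<in> polar p"
    have "sector (pi / 2 + \<gamma>'') \<subseteq> sector (pi / 2 + \<alpha>)" using \<gamma>' by (intro sector_mono) simp
    then show "F \<phi> holomorphic_on sector (pi / 2 + \<gamma>'')"
      unfolding F_def by (intro holomorphic_intros holomorphic_on_subset[OF symbol_holomorphic[OF dualI[OF p \<phi>]]])
    fix \<mu> assume \<mu>: "\<mu> \<in> sector (pi / 2 + \<gamma>'')"
    have "cmod (F \<phi> \<mu>) \<le> cmod (\<mu> * \<phi> (Q \<mu> x)) + cmod (\<phi> l)" unfolding F_def by (rule norm_triangle_ineq4)
    also have "\<dots> \<le> q x + p l"
      using order_trans[OF mult_left_mono[OF polar_bound[OF \<phi>] norm_ge_zero] q[OF \<mu>]] polar_bound[OF \<phi>, of l]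
      by (simp add: norm_mult add_mono)
    finally show "cmod (F \<phi> \<mu>) \<le> q x + p l" .
  next
    fix e' :: real assume e': "e' > 0"
    have "((\<lambda>r::real. p (of_real r *\<^sub>C Q (of_real r) x - l)) \<longlongrightarrow> 0) at_top" by (rule tendsto_cseminorm[OF lim p])
    from order_tendstoD(2)[OF this e'] obtain R where R: "\<And>r. r \<ge> R \<Longrightarrow> p (of_real r *\<^sub>C Q (of_real r) x - l) < e'"
      by (auto simp: eventually_at_top_linorder)
    have "cmod (F \<phi> (of_real r)) \<le> e'" if \<phi>: "\<phi> \<in> polar p" and "r \<ge> R" for \<phi> r
    proof -
      have "F \<phi> (of_real r) = \<phi> (of_real r *\<^sub>C Q (of_real r) x - l)"
        by (simp add: F_def functional_diff[OF polar_functional[OF \<phi>]] functional_scale[OF polar_functional[OF \<phi>]])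
      then show ?thesis using polar_bound[OF \<phi>, of "of_real r *\<^sub>C Q (of_real r) x - l"] R[OF that(2)] by simp
    qed
    then show "\<exists>R. \<forall>\<phi>\<in>polar p. \<forall>r\<ge>R. cmod (F \<phi> (of_real r)) \<le> e'" by blast
  qed
  then obtain R where R: "R > 0" "\<And>\<phi> \<mu>. \<phi> \<in> polar p \<Longrightarrow> \<mu> \<in> sector (pi / 2 + \<gamma>') \<Longrightarrow> cmod \<mu> \<ge> R \<Longrightarrow> cmod (F \<phi> \<mu>) \<le> e / c"
    by blast
  \<comment> \<open>For \<open>cmod z < d / R\<close> all points of the contour belonging to
    \<open>z\<close> have modulus at least \<open>R\<close>, where \<open>F\<close> is at most
    \<open>e / c\<close>; the constant \<open>c\<close> of the inversion bound then cancels.\<close>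
  have est: "p (inverse_family z x - l) \<le> e" if z: "z \<in> sector \<gamma>" and zR: "cmod z < d / R" for z
  proof (rule seminorm_le_polar[OF sp])
    fix \<phi> assume \<phi>: "\<phi> \<in> polar p"
    note du = dualI[OF p \<phi>]
    have z\<alpha>: "z \<in> sector \<alpha>" using z sector_mono[of \<gamma> \<alpha>] \<gamma> by auto
    have z0: "cmod z > 0" using sector_nonzero[OF z] by simp
    let ?P = "\<lambda>\<mu>. \<phi> (Q \<mu> x) + (- \<phi> l) / \<mu>"
    have "\<phi> (inverse_family z x - l) = inverse_laplace \<alpha> (\<lambda>\<mu>. \<phi> (Q \<mu> x)) z + inverse_laplace \<alpha> (\<lambda>\<mu>. (- \<phi> l) / \<mu>) z"
      unfolding inverse_laplace_inverse[OF angle z\<alpha>] functional_diff[OF polar_functional[OF \<phi>]] inverse_family_dual[OF z\<alpha> du] by simp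
    also have "\<dots> = inverse_laplace \<alpha> ?P z"
      by (rule inverse_laplace_add[OF angle(2) symbol_subsectorial[OF du] subsectorial_inverse z\<alpha>, symmetric])
    also have "cmod \<dots> \<le> c * (e / c)"
      unfolding c_def
    proof (rule inverse_laplace_bound[OF angle(2) subsectorial_add[OF symbol_subsectorial[OF du] subsectorial_inverse] \<gamma> z])
      fix \<mu> assume \<mu>: "\<mu> \<in> sector (pi / 2 + (\<alpha> + \<gamma>) / 2)" and le: "cos ((\<alpha> - \<gamma>) / 2) \<le> cmod \<mu> * cmod z"
      have "R * cmod z < d" using zR R(1) by (simp add: field_simps)
      then have "R * cmod z \<le> cmod \<mu> * cmod z" using le by (simp add: d_def)
      then have "R \<le> cmod \<mu>" using z0 by simp
      then have "cmod (F \<phi> \<mu>) \<le> e / c" using R(2)[OF \<phi>, of \<mu>] \<mu> by (simp add: \<gamma>'_def)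
      moreover have "\<mu> * ?P \<mu> = F \<phi> \<mu>" using sector_nonzero[OF \<mu>] by (simp add: F_def field_simps)
      ultimately show "cmod (\<mu> * ?P \<mu>) \<le> e / inversion_constant \<alpha> \<gamma>" by (simp add: c_def)
    qed
    finally show "cmod (\<phi> (inverse_family z x - l)) \<le> e" using cd by simp
  qed
  show "\<forall>\<^sub>F z in at 0 within sector \<gamma>. p (inverse_family z x - l) \<le> e"
    unfolding eventually_at using cd R(1) est by (intro exI[of _ "d / R"]) auto
qed

end

section \<open>Resolvent families by Laplace inversion\<close>

text \<open>The zeros of the nontrivial holomorphic transform of \<open>b\<close> are isolated, so
  immediately to the right of any of them the transform of \<open>h\<close> vanishes, and continuity
  covers the zero itself.\<close>

lemma laplace_zero_extend:
  assumes h: "laplace_integrable h \<sigma>" and b: "laplace_integrable b \<sigma>"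
    and nz: "\<exists>r>\<sigma>. laplace_integral b (of_real r) \<noteq> 0"
    and zero: "\<And>r. r > \<sigma> \<Longrightarrow> laplace_integral b (of_real r) \<noteq> 0 \<Longrightarrow> laplace_integral h (of_real r) = 0"
    and r: "r > \<sigma>"
  shows "laplace_integral h (of_real r) = 0"
proof (cases "laplace_integral b (of_real r) = 0")
  case False
  then show ?thesis using zero r by blast
next
  case True
  obtain r0 where r0: "r0 > \<sigma>" "laplace_integral b (of_real r0) \<noteq> 0" using nz by blast
  let ?H = "{\<mu>. Re \<mu> > \<sigma>}"
  have H: "open ?H" "connected ?H" by (auto simp: open_halfspace_Re_gt intro: convex_connected convex_halfspace_Re_gt)
  obtain \<rho> where \<rho>: "\<rho> > 0" "\<And>z. z \<in> ball (of_real r) \<rho> - {of_real r} \<Longrightarrow> laplace_integral b z \<noteq> 0"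
    using isolated_zeros[OF laplace_integral_holomorphic[OF b] H _ True _ r0(2)] r r0(1)
    by (metis Re_complex_of_real mem_Collect_eq)
  have "continuous_on ?H (laplace_integral h)"
    by (rule holomorphic_on_imp_continuous_on[OF laplace_integral_holomorphic[OF h]])
  then have "isCont (laplace_integral h) (of_real r)" using H(1) r by (simp add: continuous_on_eq_continuous_at)
  then have "((\<lambda>x. laplace_integral h (of_real x)) \<longlongrightarrow> laplace_integral h (of_real r)) (at_right r)"
    by (rule isCont_tendsto_compose) (intro tendsto_intros)
  moreover have "((\<lambda>x. laplace_integral h (of_real x)) \<longlongrightarrow> 0) (at_right r)"
  proof (rule tendsto_eventually)
    have "laplace_integral h (of_real x) = 0" if "r < x" "x < r + \<rho>" for x
      using that r by (intro zero \<rho>(2)) (auto simp: dist_of_real dist_real_def)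
    then show "\<forall>\<^sub>F x in at_right r. laplace_integral h (of_real x) = 0"
      using \<rho>(1) by (intro eventually_at_rightI[of r "r + \<rho>"]) auto
  qed
  ultimately show ?thesis using tendsto_unique trivial_limit_at_right_real by blast
qed

text \<open>If a value of the pair left the closed graph, a separating pair of functionals would
  combine \<open>f\<close> and \<open>g\<close> into a scalar function that is not 0 there. Its
  transform, however, vanishes wherever the pair of transforms lies in \<open>A\<close>.\<close>

lemma laplace_in_graph:
  fixes f g :: "real \<Rightarrow> 'a::locally_convex"
  assumes A: "mlo A" "closed A" and b: "laplace_integrable b \<sigma>" "\<exists>r>\<sigma>. laplace_integral b (of_real r) \<noteq> 0"
    and f: "\<And>\<phi>. \<phi> \<in> dual \<Longrightarrow> laplace_integrable (\<lambda>t. \<phi> (f t)) \<sigma>" "\<And>\<phi>. \<phi> \<in> dual \<Longrightarrow> continuous_on {0<..} (\<lambda>t. \<phi> (f t))"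
    and g: "\<And>\<phi>. \<phi> \<in> dual \<Longrightarrow> laplace_integrable (\<lambda>t. \<phi> (g t)) \<sigma>" "\<And>\<phi>. \<phi> \<in> dual \<Longrightarrow> continuous_on {0<..} (\<lambda>t. \<phi> (g t))"
    and eq: "\<And>r. r > \<sigma> \<Longrightarrow> laplace_integral b (of_real r) \<noteq> 0 \<Longrightarrow> \<exists>u v. (u, v) \<in> A \<and>
      (\<forall>\<phi>\<in>dual. laplace_integral (\<lambda>t. \<phi> (f t)) (of_real r) = \<phi> u \<and> laplace_integral (\<lambda>t. \<phi> (g t)) (of_real r) = \<phi> v)"
    and t: "t > 0"
  shows "(f t, g t) \<in> A"
proof (rule ccontr)
  assume "(f t, g t) \<notin> A"
  then obtain \<phi> \<psi> where \<phi>: "\<phi> \<in> dual" and \<psi>: "\<psi> \<in> dual" and van: "\<And>x y. (x, y) \<in> A \<Longrightarrow> \<phi> x + \<psi> y = 0" and ne: "\<phi> (f t) + \<psi> (g t) \<noteq> 0"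
    using closed_graph_separation[OF A] by blast
  let ?h = "\<lambda>t. \<phi> (f t) + \<psi> (g t)"
  have h: "laplace_integrable ?h \<sigma>" by (rule laplace_integrable_add[OF f(1)[OF \<phi>] g(1)[OF \<psi>]])
  have "laplace_integral ?h (of_real r) = 0" if r: "r > \<sigma>" "laplace_integral b (of_real r) \<noteq> 0" for r
  proof -
    obtain u v where uv: "(u, v) \<in> A" "\<And>\<phi>. \<phi> \<in> dual \<Longrightarrow> laplace_integral (\<lambda>t. \<phi> (f t)) (of_real r) = \<phi> u"
      "\<And>\<phi>. \<phi> \<in> dual \<Longrightarrow> laplace_integral (\<lambda>t. \<phi> (g t)) (of_real r) = \<phi> v"
      using eq[OF r] by blast
    have "laplace_integral ?h (of_real r) = \<phi> u + \<psi> v"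
      using laplace_integral_add[OF f(1)[OF \<phi>] g(1)[OF \<psi>], of "of_real r"] r(1) uv(2)[OF \<phi>] uv(3)[OF \<psi>] by simp
    then show ?thesis using van[OF uv(1)] by simp
  qed
  then have "laplace_integral ?h (of_real r) = 0" if "r > \<sigma>" for r
    by (rule laplace_zero_extend[OF h b _ that])
  then have "AE t in half_line. ?h t = 0" by (rule laplace_unique_AE[OF h])
  then have "?h t = 0" by (intro AE_zero_continuous[OF _ _ t] continuous_intros f(2)[OF \<phi>] g(2)[OF \<psi>])
  then show False using ne by simp
qed

lemma operator_scaled:
  assumes "T \<in> continuous_operators"
  shows "(\<lambda>x. c *\<^sub>C T x) \<in> continuous_operators"
proof (rule operatorI)
  fix p :: "'a \<Rightarrow> real" assume p: "cseminorm p"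
  have "cseminorm (\<lambda>x. cmod c * p (T x))" by (rule cseminorm_scaled[OF operator_seminorm[OF assms p] norm_ge_zero])
  then show "\<exists>q. cseminorm q \<and> (\<forall>x. p (c *\<^sub>C T x) \<le> q x)"
    by (intro exI[of _ "\<lambda>x. cmod c * p (T x)"]) (simp add: seminorm_scale[OF cseminorm_seminorm[OF p]])
qed (simp_all add: operator_add[OF assms] operator_scale[OF assms] scaleC_add_right scaleC_scaleC mult.commute)

lemma operator_difference:
  assumes "T \<in> continuous_operators" "U \<in> continuous_operators"
  shows "(\<lambda>x. T x - U x) \<in> continuous_operators"
proof (rule operatorI)
  fix p :: "'a \<Rightarrow> real" assume p: "cseminorm p"
  have "cseminorm (\<lambda>x. p (T x) + p (U x))" by (rule cseminorm_add[OF operator_seminorm[OF assms(1) p] operator_seminorm[OF assms(2) p]])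
  then show "\<exists>q. cseminorm q \<and> (\<forall>x. p (T x - U x) \<le> q x)"
    by (intro exI[of _ "\<lambda>x. p (T x) + p (U x)"]) (simp add: seminorm_diff[OF cseminorm_seminorm[OF p]])
qed (simp_all add: operator_add[OF assms(1)] operator_add[OF assms(2)] operator_scale[OF assms(1)] operator_scale[OF assms(2)] scaleC_diff_right)

lemma mlo_add: "mlo A \<Longrightarrow> (x, u) \<in> A \<Longrightarrow> (y, v) \<in> A \<Longrightarrow> (x + y, u + v) \<in> A"
  and mlo_scale: "mlo A \<Longrightarrow> (x, u) \<in> A \<Longrightarrow> (c *\<^sub>C x, c *\<^sub>C u) \<in> A"
  unfolding mlo_def by blast+

lemma mlo_diff: "mlo A \<Longrightarrow> (x, u) \<in> A \<Longrightarrow> (y, v) \<in> A \<Longrightarrow> (x - y, u - v) \<in> A"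
  using mlo_add[of A x u "- y" "- v"] mlo_scale[of A y v "-1"] by (simp add: scaleC_minus_one)

lemma mlo_converse:
  fixes A :: "('a::complex_vector \<times> 'a) set"
  assumes A: "mlo A"
  shows "mlo (A\<inverse>)"
proof -
  note m = vector_space_scaleC[folded module_iff_vector_space, where ?'a = 'a]
  have "0 \<in> Domain A" using A module.subspace_0[OF m] unfolding mlo_def by blast
  then obtain y where "(0, y) \<in> A" by blast
  from mlo_scale[OF A this, of 0] have "(0, 0) \<in> A" by simp
  then have "module.subspace (*\<^sub>C) (Range A)"
    unfolding module.subspace_def[OF m] using mlo_add[OF A] mlo_scale[OF A] by blast
  then show ?thesis using mlo_add[OF A] mlo_scale[OF A] unfolding mlo_def by auto
qed

lemma commutes_with_mlo_iff: "commutes_with_mlo T A \<longleftrightarrow> (\<forall>(x, y)\<in>A. (T x, T y) \<in> A)"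
  by (auto simp: commutes_with_mlo_def graph_of_def relcomp_unfold subset_iff)

text \<open>The relations hold only where the kernel transform is nonzero, which is a set of reals
  reaching infinity but perhaps not a neighbourhood of it. Restricting the filter to this set keeps
  it nontrivial, and a closed set keeps its limits.\<close>

lemma tendsto_in_closed_graph:
  fixes A :: "('a::topological_space \<times> 'a) set"
  assumes A: "closed A" and f: "(f \<longlongrightarrow> x) at_top" "(g \<longlongrightarrow> y) at_top"
    and ev: "\<And>r. r > \<sigma> \<Longrightarrow> P r \<Longrightarrow> (f r, g r) \<in> A" and P: "\<And>s. s > \<sigma> \<Longrightarrow> \<exists>r>s. P (r::real)"
  shows "(x, y) \<in> A"
proof -
  define F where "F = inf at_top (principal {r. r > \<sigma> \<and> P r})"
  have "F \<noteq> bot"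
  proof -
    have "\<exists>\<^sub>F r in at_top. r > \<sigma> \<and> P r"
      unfolding frequently_def eventually_at_top_linorder
    proof (rule notI)
      assume "\<exists>n. \<forall>r\<ge>n. \<not> (\<sigma> < r \<and> P r)"
      then obtain n where n: "\<And>r. r \<ge> n \<Longrightarrow> \<not> (\<sigma> < r \<and> P r)" by blast
      obtain r where r: "r > max n (\<sigma> + 1)" "P r" using P[of "max n (\<sigma> + 1)"] by (meson less_add_one less_max_iff_disj)
      then have "n \<le> r" "\<sigma> < r" by linarith+
      then show False using n[of r] r(2) by blast
    qed
    then show ?thesis
      by (simp add: F_def frequently_def eventually_inf_principal trivial_limit_def)
  qed
  moreover have "((\<lambda>r. (f r, g r)) \<longlongrightarrow> (x, y)) F"
    unfolding F_def by (intro tendsto_Pair tendsto_mono[OF inf_le1] f)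
  moreover have "\<forall>\<^sub>F r in F. (f r, g r) \<in> A"
    unfolding F_def eventually_inf_principal by (intro always_eventually) (use ev in auto)
  ultimately show ?thesis using Lim_in_closed_set[OF A, of "\<lambda>r. (f r, g r)" F "(x, y)"] by blast
qed

text \<open>Here \<open>K\<close> is the transform of \<open>k\<close> shifted by \<open>\<omega>\<close>, \<open>b\<close> is a Borel version of \<open>a\<close>, and \<open>S\<^sub>0\<close> is the value
  at \<open>0\<close> of the inverse transform of \<open>K \<Upsilon>\<close>.\<close>

locale resolvent_inversion =
  sectorial_family \<alpha> "\<lambda>\<mu> x. K \<mu> *\<^sub>C \<Upsilon> (of_real \<omega> + \<mu>) x"
  for \<alpha> \<omega> :: real and K :: "complex \<Rightarrow> complex" and \<Upsilon> :: "complex \<Rightarrow> 'a::{sequentially_complete_lcs, t2_space} \<Rightarrow> 'a" +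
  fixes A :: "('a \<times> 'a) set" and C S\<^sub>0 :: "'a \<Rightarrow> 'a" and a b k :: "real \<Rightarrow> complex" and N :: "real set"
  assumes A_mlo: "mlo A" and A_closed: "closed A" and C_op: "C \<in> continuous_operators" and CA: "commutes_with_mlo C A"
    and b: "b \<in> borel_measurable borel" "\<And>t. t \<le> 0 \<Longrightarrow> b t = 0" "\<And>\<sigma>. \<sigma> > \<omega> \<Longrightarrow> laplace_integrable b \<sigma>"
    and b_nonzero: "\<And>\<sigma>. \<sigma> > \<omega> \<Longrightarrow> \<exists>r>\<sigma>. laplace_integral b (of_real r) \<noteq> 0"
    and N: "negligible N" "\<And>t. t > 0 \<Longrightarrow> t \<notin> N \<Longrightarrow> b t = a t"
    and k_cont: "continuous_on {0..} k" and k_int: "\<And>\<sigma>. \<sigma> > \<omega> \<Longrightarrow> laplace_integrable k \<sigma>"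
    and k_laplace: "\<And>r. r > \<omega> \<Longrightarrow> laplace_integral k (of_real r) = K (of_real r - of_real \<omega>)"
    and K_limit: "((\<lambda>r. (of_real r - of_real \<omega>) * K (of_real r - of_real \<omega>)) \<longlongrightarrow> k 0) at_top"
    and resolvent: "\<And>r x. r > \<omega> \<Longrightarrow> laplace_integral b (of_real r) \<noteq> 0 \<Longrightarrow>
      (\<Upsilon> (of_real r) x, laplace_integral b (of_real r) *\<^sub>C (\<Upsilon> (of_real r) x - C x)) \<in> A"
    and resolvent_C: "\<And>r x. r > \<omega> \<Longrightarrow> \<Upsilon> (of_real r) (C x) = C (\<Upsilon> (of_real r) x)"
    and resolvent_left: "\<And>r x y. r > \<omega> \<Longrightarrow> (x, y) \<in> A \<Longrightarrow>
      laplace_integral b (of_real r) *\<^sub>C \<Upsilon> (of_real r) x - \<Upsilon> (of_real r) y = laplace_integral b (of_real r) *\<^sub>C C x"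
    and S0_op: "S\<^sub>0 \<in> continuous_operators"
    and S0_limit: "\<And>x. ((\<lambda>r. ((of_real r - of_real \<omega>) * K (of_real r - of_real \<omega>)) *\<^sub>C \<Upsilon> (of_real r) x) \<longlongrightarrow> S\<^sub>0 x) at_top"
begin

abbreviation weight :: "real \<Rightarrow> complex" where
  "weight r \<equiv> (of_real r - of_real \<omega>) * K (of_real r - of_real \<omega>)"

definition \<kappa> :: "real \<Rightarrow> complex" where "\<kappa> r = K (of_real r - of_real \<omega>)"

text \<open>The exponential undoes the shift by \<open>\<omega>\<close>, so that the transform of
  \<open>T\<close> is that of \<open>k\<close> times \<open>\<Upsilon>\<close>. The value at 0 is
  set by hand to the limit.\<close>

definition T :: "real \<Rightarrow> 'a \<Rightarrow> 'a" where
  "T t x = (if t = 0 then S\<^sub>0 x else exp (of_real \<omega> * of_real t) *\<^sub>C inverse_family (of_real t) x)"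

definition R :: "real \<Rightarrow> 'a \<Rightarrow> 'a" where
  "R t x = k t *\<^sub>C C x - T t x"

lemma inverse_family_limit:
  assumes "0 < \<gamma>" "\<gamma> < \<alpha>"
  shows "((\<lambda>z. inverse_family z x) \<longlongrightarrow> S\<^sub>0 x) (at 0 within sector \<gamma>)"
proof (rule inverse_family_initial_value[OF _ assms])
  have "filterlim (\<lambda>r. r + \<omega>) at_top at_top" by real_asymp
  from filterlim_compose[OF S0_limit[of x] this]
  show "((\<lambda>r. of_real r *\<^sub>C K (of_real r) *\<^sub>C \<Upsilon> (of_real \<omega> + of_real r) x) \<longlongrightarrow> S\<^sub>0 x) at_top"
    by (simp add: scaleC_scaleC add.commute)
qed

lemma T_continuous: "continuous_on {0..} (\<lambda>t. T t x)"
  unfolding continuous_on_def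
proof
  fix t :: real assume t: "t \<in> {0..}"
  define \<gamma> where "\<gamma> = \<alpha> / 2"
  have \<gamma>: "0 < \<gamma>" "\<gamma> < \<alpha>" using angle by (auto simp: \<gamma>_def)
  show "((\<lambda>t. T t x) \<longlongrightarrow> T t x) (at t within {0..})"
  proof (cases "t = 0")
    case True
    have "filterlim complex_of_real (at 0 within sector \<gamma>) (at 0 within {0..})"
      unfolding filterlim_at
    proof
      show "\<forall>\<^sub>F s in at 0 within {0..}. complex_of_real s \<in> sector \<gamma> \<and> complex_of_real s \<noteq> 0"
        unfolding eventually_at by (intro exI[of _ 1]) (auto intro!: of_real_in_sector \<gamma>(1))
      show "(complex_of_real \<longlongrightarrow> 0) (at 0 within {0..})" using tendsto_of_real[OF tendsto_ident_at, of 0 "{0..}"] by simp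
    qed
    from filterlim_compose[OF inverse_family_limit[OF \<gamma>, of x] this]
    have 1: "((\<lambda>s. inverse_family (of_real s) x) \<longlongrightarrow> S\<^sub>0 x) (at 0 within {0..})" .
    have "((\<lambda>s. exp (of_real \<omega> * complex_of_real s)) \<longlongrightarrow> exp (of_real \<omega> * of_real 0)) (at 0 within {0..})" by (intro tendsto_intros)
    from tendsto_scaleC[OF this 1]
    have "((\<lambda>s. exp (of_real \<omega> * of_real s) *\<^sub>C inverse_family (of_real s) x) \<longlongrightarrow> S\<^sub>0 x) (at 0 within {0..})" by simp
    then have "((\<lambda>t. T t x) \<longlongrightarrow> S\<^sub>0 x) (at 0 within {0..})"
      by (rule Lim_transform_eventually) (auto simp: eventually_at T_def intro!: exI[of _ 1])
    then show ?thesis using True by (simp add: T_def)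
  next
    case False
    then have t: "t > 0" using t by simp
    have "((\<lambda>z. inverse_family z x) \<longlongrightarrow> inverse_family (of_real t) x) (at (of_real t) within sector \<alpha>)"
      using vector_analytic_continuous[OF inverse_family_analytic, of x] of_real_in_sector[OF t angle(1)]
      by (auto simp: continuous_on_def)
    then have "((\<lambda>z. inverse_family z x) \<longlongrightarrow> inverse_family (of_real t) x) (nhds (of_real t))"
      using at_within_open[OF of_real_in_sector[OF t angle(1)] open_sector] angle
      by (simp add: tendsto_nhds_iff)
    from filterlim_compose[OF this tendsto_of_real[OF tendsto_ident_at]]
    have 1: "((\<lambda>s. inverse_family (of_real s) x) \<longlongrightarrow> inverse_family (of_real t) x) (at t within {0..})" .
    have "((\<lambda>s. exp (of_real \<omega> * complex_of_real s)) \<longlongrightarrow> exp (of_real \<omega> * of_real t)) (at t within {0..})" by (intro tendsto_intros)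
    from tendsto_scaleC[OF this 1]
    have "((\<lambda>s. T s x) \<longlongrightarrow> exp (of_real \<omega> * of_real t) *\<^sub>C inverse_family (of_real t) x) (at t within {0..})"
    proof (rule Lim_transform_eventually)
      show "\<forall>\<^sub>F s in at t within {0..}. exp (of_real \<omega> * of_real s) *\<^sub>C inverse_family (of_real s) x = T s x"
        unfolding eventually_at using t by (intro exI[of _ t]) (auto simp: T_def dist_real_def)
    qed
    then show ?thesis using t by (simp add: T_def)
  qed
qed

lemma T_operator: "t \<ge> 0 \<Longrightarrow> T t \<in> continuous_operators"
  unfolding T_def[abs_def]
  by (cases "t = 0") (simp_all add: S0_op operator_scaled inverse_family_operator of_real_in_sector angle)

lemma T_laplace:
  assumes \<phi>: "\<phi> \<in> dual" and r: "r > \<omega>"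
  shows "laplace_integrable (\<lambda>t. \<phi> (T t x)) r"
    and "laplace_integral (\<lambda>t. \<phi> (T t x)) (of_real r) = \<phi> (\<kappa> r *\<^sub>C \<Upsilon> (of_real r) x)"
proof -
  let ?f = "\<lambda>t. \<phi> (inverse_family (of_real t) x)"
  have eq: "\<phi> (T t x) = exp (of_real \<omega> * of_real t) * ?f t" if "t > 0" for t
    using that by (simp add: T_def functional_scale[OF dual_functional[OF \<phi>]])
  have i: "laplace_integrable ?f (r - \<omega>)" by (rule inverse_family_laplace(1)[OF \<phi>]) (use r in simp)
  have "laplace_integrable (\<lambda>t. exp (of_real \<omega> * of_real t) * ?f t) r"
  proof (rule laplace_integrableI)
    show "(\<lambda>t. exp (of_real \<omega> * of_real t) * ?f t) \<in> borel_measurable half_line"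
      using laplace_integrable_measurable[OF i] measurable_exp_half_line[of "- of_real \<omega>"]
      by (intro borel_measurable_times) auto
    show "integrable half_line (\<lambda>t. exp (- ((r - \<omega>) * t)) * cmod (?f t))" using i by (simp add: laplace_integrable_def)
    show "exp (- (r * t)) * cmod (exp (of_real \<omega> * of_real t) * ?f t) \<le> exp (- ((r - \<omega>) * t)) * cmod (?f t)" for t
      using cmod_exp_mult_real[of "- of_real \<omega>" t]
      by (simp add: norm_mult mult.assoc[symmetric] exp_add[symmetric] algebra_simps)
  qed
  then show "laplace_integrable (\<lambda>t. \<phi> (T t x)) r" using laplace_integrable_cong[OF eq] by simp
  have "laplace_integral (\<lambda>t. \<phi> (T t x)) (of_real r) = laplace_integral ?f (of_real (r - \<omega>))"
    using laplace_integral_cong[OF eq] by (simp add: laplace_integral_shift)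
  also have "\<dots> = \<phi> (\<kappa> r *\<^sub>C \<Upsilon> (of_real r) x)"
    by (subst inverse_family_laplace(2)[OF \<phi>]) (use r in \<open>simp_all add: \<kappa>_def\<close>)
  finally show "laplace_integral (\<lambda>t. \<phi> (T t x)) (of_real r) = \<phi> (\<kappa> r *\<^sub>C \<Upsilon> (of_real r) x)" .
qed

lemma T_dual_continuous: "\<phi> \<in> dual \<Longrightarrow> continuous_on {0..} (\<lambda>t. \<phi> (T t x))"
  by (rule dual_continuous_on[OF _ T_continuous])

lemma R_continuous: "continuous_on {0..} (\<lambda>t. R t x)"
  unfolding continuous_on_def R_def
  using k_cont T_continuous[of x] by (auto simp: continuous_on_def intro!: tendsto_diff_lcs tendsto_scaleC tendsto_const)

lemma R_operator: "t \<ge> 0 \<Longrightarrow> R t \<in> continuous_operators"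
  unfolding R_def[abs_def] by (intro operator_difference operator_scaled C_op T_operator)

lemma R_laplace:
  assumes \<phi>: "\<phi> \<in> dual" and r: "r > \<omega>"
  shows "laplace_integrable (\<lambda>t. \<phi> (R t x)) r"
    and "laplace_integral (\<lambda>t. \<phi> (R t x)) (of_real r) = \<phi> (\<kappa> r *\<^sub>C (C x - \<Upsilon> (of_real r) x))"
proof -
  note f\<phi> = dual_functional[OF \<phi>]
  have eq: "(\<lambda>t. \<phi> (R t x)) = (\<lambda>t. \<phi> (C x) * k t + (- 1) * \<phi> (T t x))"
    by (auto simp: R_def functional_diff[OF f\<phi>] functional_scale[OF f\<phi>])
  have 1: "laplace_integrable (\<lambda>t. \<phi> (C x) * k t) r" by (rule laplace_integrable_cmult[OF k_int[OF r]])
  have 2: "laplace_integrable (\<lambda>t. (- 1) * \<phi> (T t x)) r" by (rule laplace_integrable_cmult[OF T_laplace(1)[OF \<phi> r]])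
  show "laplace_integrable (\<lambda>t. \<phi> (R t x)) r" unfolding eq by (rule laplace_integrable_add[OF 1 2])
  have "laplace_integral (\<lambda>t. \<phi> (R t x)) (of_real r) = \<phi> (C x) * \<kappa> r + (- 1) * \<phi> (\<kappa> r *\<^sub>C \<Upsilon> (of_real r) x)"
    unfolding eq laplace_integral_add[OF 1 2, of "of_real r", simplified Re_complex_of_real, OF order_refl]
      laplace_integral_cmult T_laplace(2)[OF \<phi> r] k_laplace[OF r] \<kappa>_def ..
  then show "laplace_integral (\<lambda>t. \<phi> (R t x)) (of_real r) = \<phi> (\<kappa> r *\<^sub>C (C x - \<Upsilon> (of_real r) x))"
    by (simp add: functional_diff[OF f\<phi>] functional_scale[OF f\<phi>] algebra_simps)
qed

lemma resolvent_commutes: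
  assumes "(y, x) \<in> A" and r: "r > \<omega>" "laplace_integral b (of_real r) \<noteq> 0"
  shows "(\<Upsilon> (of_real r) y, \<Upsilon> (of_real r) x) \<in> A"
proof -
  have "\<Upsilon> (of_real r) x = laplace_integral b (of_real r) *\<^sub>C (\<Upsilon> (of_real r) y - C y)"
    using resolvent_left[OF r(1) assms(1)] by (simp add: scaleC_diff_right algebra_simps)
  then show ?thesis using resolvent[OF r, of y] by simp
qed

lemma S0_commutes:
  assumes "(y, x) \<in> A"
  shows "(S\<^sub>0 y, S\<^sub>0 x) \<in> A"
  by (rule tendsto_in_closed_graph[OF A_closed S0_limit S0_limit mlo_scale[OF A_mlo resolvent_commutes[OF assms]] b_nonzero])

lemma S0_C: "S\<^sub>0 (C x) = C (S\<^sub>0 x)"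
proof -
  have "((\<lambda>r. C (weight r *\<^sub>C \<Upsilon> (of_real r) x)) \<longlongrightarrow> C (S\<^sub>0 x)) at_top"
    by (rule operator_tendsto[OF C_op S0_limit])
  then have "((\<lambda>r. weight r *\<^sub>C \<Upsilon> (of_real r) (C x)) \<longlongrightarrow> C (S\<^sub>0 x)) at_top"
  proof (rule Lim_transform_eventually)
    show "\<forall>\<^sub>F r in at_top. C (weight r *\<^sub>C \<Upsilon> (of_real r) x)
        = weight r *\<^sub>C \<Upsilon> (of_real r) (C x)"
      using eventually_gt_at_top[of \<omega>] by eventually_elim (simp add: resolvent_C operator_scale[OF C_op])
  qed
  then show ?thesis using tendsto_unique[OF _ S0_limit] by simp
qed

text \<open>The transform of the kernel tends to 0 at infinity while the weighted bracket converges.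
  This yields both facts about \<open>S\<^sub>0\<close> needed at \<open>t = 0\<close>.\<close>

lemma kernel_transform_limit:
  "((\<lambda>r. laplace_integral b (of_real r) *\<^sub>C (weight r *\<^sub>C (\<Upsilon> (of_real r) x - C x))) \<longlongrightarrow> 0) at_top"
proof -
  have 1: "((\<lambda>r. laplace_integral b (of_real r)) \<longlongrightarrow> 0) at_top"
    by (rule laplace_integral_at_top[OF b(3)[of "\<omega> + 1"]]) simp
  have "((\<lambda>r. weight r *\<^sub>C \<Upsilon> (of_real r) x
      - weight r *\<^sub>C C x) \<longlongrightarrow> S\<^sub>0 x - k 0 *\<^sub>C C x) at_top"
    by (rule tendsto_diff_lcs[OF S0_limit tendsto_scaleC[OF K_limit tendsto_const]])
  from tendsto_scaleC[OF 1 this] show ?thesis by (simp add: scaleC_diff_right)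
qed

text \<open>The inclusion for the integral at \<open>t = 0\<close>, where the integral is 0. It is
  the limit of the scaled resolvent relation in the closed graph.\<close>

lemma S0_kernel: "(S\<^sub>0 x, 0) \<in> A"
proof (rule tendsto_in_closed_graph[OF A_closed S0_limit kernel_transform_limit _ b_nonzero])
  fix r :: real assume "r > \<omega>" "laplace_integral b (of_real r) \<noteq> 0"
  from mlo_scale[OF A_mlo resolvent[OF this], of "(of_real r - of_real \<omega>) * K (of_real r - of_real \<omega>)"]
  show "(weight r *\<^sub>C \<Upsilon> (of_real r) x,
      laplace_integral b (of_real r) *\<^sub>C (weight r *\<^sub>C (\<Upsilon> (of_real r) x - C x))) \<in> A"
    by (simp add: scaleC_scaleC mult.commute)
qed

text \<open>The integral equation at \<open>t = 0\<close>. On the range the left resolvent identity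
  expresses \<open>\<Upsilon> x\<close> through the kernel transform times a bracket in
  \<open>y\<close>, and so tends to 0 after weighting.\<close>

lemma S0_range:
  assumes "(y, x) \<in> A"
  shows "S\<^sub>0 x = 0"
proof -
  have "((\<lambda>r. weight r *\<^sub>C \<Upsilon> (of_real r) x) \<longlongrightarrow> 0) at_top"
  proof (rule Lim_transform_eventually[OF kernel_transform_limit[of y]])
    show "\<forall>\<^sub>F r in at_top. laplace_integral b (of_real r) *\<^sub>C (weight r *\<^sub>C (\<Upsilon> (of_real r) y - C y))
        = weight r *\<^sub>C \<Upsilon> (of_real r) x"
      using eventually_gt_at_top[of \<omega>]
    proof eventually_elim
      case (elim r)
      have "\<Upsilon> (of_real r) x = laplace_integral b (of_real r) *\<^sub>C (\<Upsilon> (of_real r) y - C y)"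
        using resolvent_left[OF elim assms] by (simp add: scaleC_diff_right algebra_simps)
      then show ?case by (simp add: scaleC_scaleC mult.commute)
    qed
  qed
  then show ?thesis using tendsto_unique[OF _ S0_limit] by simp
qed

lemma continuous_on_positive: "continuous_on {0..} f \<Longrightarrow> continuous_on {0<..} (f :: real \<Rightarrow> complex)"
  by (rule continuous_on_subset) auto

lemma T_commutes:
  assumes yx: "(y, x) \<in> A" and t: "t \<ge> 0"
  shows "(T t y, T t x) \<in> A"
proof (cases "t = 0")
  case True
  then show ?thesis using S0_commutes[OF yx] by (simp add: T_def)
next
  case False
  define \<sigma> where "\<sigma> = \<omega> + 1"
  have \<sigma>: "\<sigma> > \<omega>" by (simp add: \<sigma>_def)
  show ?thesis
  proof (rule laplace_in_graph[OF A_mlo A_closed b(3)[OF \<sigma>] b_nonzero[OF \<sigma>] T_laplace(1)[OF _ \<sigma>]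
        continuous_on_positive[OF T_dual_continuous] T_laplace(1)[OF _ \<sigma>] continuous_on_positive[OF T_dual_continuous]])
    fix r assume r: "r > \<sigma>" "laplace_integral b (of_real r) \<noteq> 0"
    then have r': "r > \<omega>" using \<sigma> by simp
    show "\<exists>u v. (u, v) \<in> A \<and> (\<forall>\<phi>\<in>dual. laplace_integral (\<lambda>t. \<phi> (T t y)) (of_real r) = \<phi> u \<and>
        laplace_integral (\<lambda>t. \<phi> (T t x)) (of_real r) = \<phi> v)"
      using mlo_scale[OF A_mlo resolvent_commutes[OF yx r' r(2)], of "\<kappa> r"] T_laplace(2)[OF _ r'] by blast
  qed (use t False in auto)
qed

lemma T_C:
  assumes "t \<ge> 0"
  shows "T t (C x) = C (T t x)"
proof (cases "t = 0")
  case True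
  then show ?thesis by (simp add: T_def S0_C)
next
  case False
  show ?thesis
  proof (rule dual_separates)
    fix \<phi> :: "'a \<Rightarrow> complex" assume \<phi>: "\<phi> \<in> dual"
    have \<psi>: "(\<lambda>x. \<phi> (C x)) \<in> dual" by (rule operator_dual[OF C_op \<phi>])
    have \<sigma>: "\<omega> + 1 > \<omega>" by simp
    show "\<phi> (T t (C x)) = \<phi> (C (T t x))"
    proof (rule laplace_unique[OF T_laplace(1)[OF \<phi> \<sigma>] T_laplace(1)[OF \<psi> \<sigma>] continuous_on_positive[OF T_dual_continuous[OF \<phi>]]
          continuous_on_positive[OF T_dual_continuous[OF \<psi>]]])
      fix r assume "r > \<omega> + 1"
      then have r: "r > \<omega>" by simp
      show "laplace_integral (\<lambda>t. \<phi> (T t (C x))) (of_real r) = laplace_integral (\<lambda>t. \<phi> (C (T t x))) (of_real r)"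
        unfolding T_laplace(2)[OF \<phi> r] T_laplace(2)[OF \<psi> r] by (simp add: resolvent_C[OF r] operator_scale[OF C_op])
    qed (use assms False in simp)
  qed
qed

lemma convolution_R:
  "t \<ge> 0 \<Longrightarrow> \<exists>v. has_strong_integral (lebesgue_on {0..t}) (\<lambda>s. a (t - s) *\<^sub>C R s x) v \<and>
    (\<forall>\<phi>\<in>dual. \<phi> v = convolution b (\<lambda>s. \<phi> (R s x)) t)"
  using strong_convolution_integral[OF b(1,2) b(3)[of "\<omega> + 1"] N R_continuous] by simp

lemma convolution_R_laplace:
  assumes \<phi>: "\<phi> \<in> dual"
  shows "r > \<omega> \<Longrightarrow> laplace_integrable (convolution b (\<lambda>s. \<phi> (R s x))) r"
    and "r > \<omega> \<Longrightarrow> laplace_integral (convolution b (\<lambda>s. \<phi> (R s x))) (of_real r)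
      = \<phi> (laplace_integral b (of_real r) *\<^sub>C \<kappa> r *\<^sub>C (C x - \<Upsilon> (of_real r) x))"
    and "continuous_on {0<..} (convolution b (\<lambda>s. \<phi> (R s x)))"
  using convolution_laplace[OF b(1,2) b(3) R_laplace(1)[OF \<phi>]] R_laplace(2)[OF \<phi>, of r x]
    convolution_continuous[OF b(1,2) b(3)[of "\<omega> + 1"] dual_continuous_on[OF \<phi> R_continuous]]
  by (simp_all add: functional_scale[OF dual_functional[OF \<phi>]])

lemma convolution_0: "convolution b f 0 = 0"
proof -
  have "convolution b f 0 = (LINT s|half_line. 0)"
    unfolding convolution_def by (rule Bochner_Integration.integral_cong) (simp_all add: b(2))
  then show ?thesis by simp
qed

text \<open>The value \<open>- T t x\<close> is \<open>R t x - k t *\<^sub>C C x\<close>. In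
  transforms the claim says that the kernel times \<open>C y - \<Upsilon> y\<close> equals
  \<open>- \<Upsilon> x\<close>, which is the left resolvent identity.\<close>

lemma R_integral_equation:
  assumes yx: "(y, x) \<in> A" and t: "t \<ge> 0"
  shows "has_strong_integral (lebesgue_on {0..t}) (\<lambda>s. a (t - s) *\<^sub>C R s y) (- T t x)"
proof -
  obtain v where v: "has_strong_integral (lebesgue_on {0..t}) (\<lambda>s. a (t - s) *\<^sub>C R s y) v"
    "\<And>\<phi>. \<phi> \<in> dual \<Longrightarrow> \<phi> v = convolution b (\<lambda>s. \<phi> (R s y)) t"
    using convolution_R[OF t, of y] by blast
  have "v = - T t x"
  proof (rule dual_separates)
    fix \<phi> :: "'a \<Rightarrow> complex" assume \<phi>: "\<phi> \<in> dual"
    note f\<phi> = dual_functional[OF \<phi>]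
    show "\<phi> v = \<phi> (- T t x)"
    proof (cases "t = 0")
      case True
      then show ?thesis using v(2)[OF \<phi>] S0_range[OF yx] by (simp add: convolution_0 T_def functional_0[OF f\<phi>])
    next
      case False
      have \<sigma>: "\<omega> + 1 > \<omega>" by simp
      have "convolution b (\<lambda>s. \<phi> (R s y)) t = (- 1) * \<phi> (T t x)"
      proof (rule laplace_unique[OF convolution_R_laplace(1)[OF \<phi> \<sigma>] laplace_integrable_cmult[OF T_laplace(1)[OF \<phi> \<sigma>]]
            convolution_R_laplace(3)[OF \<phi>]])
        show "continuous_on {0<..} (\<lambda>t. (- 1) * \<phi> (T t x))"
          by (intro continuous_intros continuous_on_positive[OF T_dual_continuous[OF \<phi>]])
        fix r assume "r > \<omega> + 1"
        then have r: "r > \<omega>" by simp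
        have "\<Upsilon> (of_real r) x = - (laplace_integral b (of_real r) *\<^sub>C (C y - \<Upsilon> (of_real r) y))"
          using resolvent_left[OF r yx] by (simp add: scaleC_diff_right algebra_simps)
        then show "laplace_integral (convolution b (\<lambda>s. \<phi> (R s y))) (of_real r) = laplace_integral (\<lambda>t. (- 1) * \<phi> (T t x)) (of_real r)"
          unfolding convolution_R_laplace(2)[OF \<phi> r] laplace_integral_cmult T_laplace(2)[OF \<phi> r]
          by (simp add: functional_scale[OF f\<phi>] functional_minus[OF f\<phi>])
      qed (use t False in simp)
      then show ?thesis using v(2)[OF \<phi>] by (simp add: functional_minus[OF f\<phi>])
    qed
  qed
  then show ?thesis using v(1) by simp
qed

text \<open>In transforms the pair becomes a multiple of \<open>\<Upsilon> x\<close> and of the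
  kernel times \<open>\<Upsilon> x - C x\<close>, which the resolvent relation places in
  \<open>A\<close>. Read in \<open>A\<inverse>\<close>, with \<open>- T t x\<close> as the second
  component, this is the inclusion asserted for \<open>R\<close>.\<close>

lemma R_integral_in_graph:
  assumes t: "t \<ge> 0"
  shows "\<exists>v. has_strong_integral (lebesgue_on {0..t}) (\<lambda>s. a (t - s) *\<^sub>C R s x) v \<and> (- T t x, v) \<in> A"
proof -
  \<comment> \<open>Transforms concern functions of \<open>t\<close>, so the integrals for the
    single times are first collected into one function.\<close>
  have "\<forall>t. \<exists>v. t \<ge> 0 \<longrightarrow> has_strong_integral (lebesgue_on {0..t}) (\<lambda>s. a (t - s) *\<^sub>C R s x) v \<and>
      (\<forall>\<phi>\<in>dual. \<phi> v = convolution b (\<lambda>s. \<phi> (R s x)) t)" (is "\<forall>t. \<exists>v. ?P t v")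
    unfolding ex_simps by (intro allI impI convolution_R)
  from choice[OF this] obtain v where v: "\<And>t. t \<ge> 0 \<Longrightarrow> has_strong_integral (lebesgue_on {0..t}) (\<lambda>s. a (t - s) *\<^sub>C R s x) (v t)"
    "\<And>t \<phi>. t \<ge> 0 \<Longrightarrow> \<phi> \<in> dual \<Longrightarrow> \<phi> (v t) = convolution b (\<lambda>s. \<phi> (R s x)) t"
    by blast
  have "(- T t x, v t) \<in> A"
  proof (cases "t = 0")
    case True
    have "v 0 = 0" by (rule dual_separates) (simp add: v(2) convolution_0 functional_0[OF dual_functional])
    then show ?thesis using True mlo_scale[OF A_mlo S0_kernel, of "-1"] by (simp add: T_def scaleC_minus_one)
  next
    case False
    have \<sigma>: "\<omega> + 1 > \<omega>" by simp
    have eq: "convolution b (\<lambda>s. \<phi> (R s x)) t = \<phi> (v t)" if "\<phi> \<in> dual" "t > 0" for \<phi> t using v(2)[of t \<phi>] that by simp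
    have mT: "\<phi> (- T t x) = (- 1) * \<phi> (T t x)" if "\<phi> \<in> dual" for \<phi> t by (simp add: functional_minus[OF dual_functional[OF that]])
    show ?thesis
    proof (rule laplace_in_graph[OF A_mlo A_closed b(3)[OF \<sigma>] b_nonzero[OF \<sigma>]])
      fix \<phi> :: "'a \<Rightarrow> complex" assume \<phi>: "\<phi> \<in> dual"
      show "laplace_integrable (\<lambda>t. \<phi> (- T t x)) (\<omega> + 1)"
        unfolding mT[OF \<phi>] by (rule laplace_integrable_cmult[OF T_laplace(1)[OF \<phi> \<sigma>]])
      show "continuous_on {0<..} (\<lambda>t. \<phi> (- T t x))"
        unfolding mT[OF \<phi>] by (intro continuous_intros continuous_on_positive[OF T_dual_continuous[OF \<phi>]])
      show "laplace_integrable (\<lambda>t. \<phi> (v t)) (\<omega> + 1)"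
        by (subst laplace_integrable_cong[where g = "convolution b (\<lambda>s. \<phi> (R s x))"])
          (simp_all add: eq[OF \<phi>] convolution_R_laplace(1)[OF \<phi> \<sigma>])
      show "continuous_on {0<..} (\<lambda>t. \<phi> (v t))"
        using convolution_R_laplace(3)[OF \<phi>, of x] by (rule continuous_on_eq) (simp add: eq[OF \<phi>])
    next
      fix r assume r: "r > \<omega> + 1" "laplace_integral b (of_real r) \<noteq> 0"
      then have r': "r > \<omega>" by simp
      let ?u = "(- \<kappa> r) *\<^sub>C \<Upsilon> (of_real r) x"
      let ?v = "(- \<kappa> r) *\<^sub>C laplace_integral b (of_real r) *\<^sub>C (\<Upsilon> (of_real r) x - C x)"
      have "(?u, ?v) \<in> A" by (rule mlo_scale[OF A_mlo resolvent[OF r' r(2)]])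
      moreover have "laplace_integral (\<lambda>t. \<phi> (- T t x)) (of_real r) = \<phi> ?u \<and> laplace_integral (\<lambda>t. \<phi> (v t)) (of_real r) = \<phi> ?v"
        if \<phi>: "\<phi> \<in> dual" for \<phi>
      proof
        show "laplace_integral (\<lambda>t. \<phi> (- T t x)) (of_real r) = \<phi> ?u"
          unfolding mT[OF \<phi>] laplace_integral_cmult T_laplace(2)[OF \<phi> r'] by (simp add: functional_scale[OF dual_functional[OF \<phi>]])
        have "laplace_integral (\<lambda>t. \<phi> (v t)) (of_real r) = laplace_integral (convolution b (\<lambda>s. \<phi> (R s x))) (of_real r)"
          by (rule laplace_integral_cong) (simp add: eq[OF \<phi>])
        then show "laplace_integral (\<lambda>t. \<phi> (v t)) (of_real r) = \<phi> ?v"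
          unfolding convolution_R_laplace(2)[OF \<phi> r']
          by (simp add: functional_scale[OF dual_functional[OF \<phi>]] functional_diff[OF dual_functional[OF \<phi>]] algebra_simps)
      qed
      ultimately show "\<exists>u v'. (u, v') \<in> A \<and> (\<forall>\<phi>\<in>dual. laplace_integral (\<lambda>t. \<phi> (- T t x)) (of_real r) = \<phi> u \<and>
          laplace_integral (\<lambda>t. \<phi> (v t)) (of_real r) = \<phi> v')" by blast
    qed (use t False in auto)
  qed
  then show ?thesis using v(1)[OF t] by blast
qed

text \<open>On the positive axis this is \<open>T_commutes\<close> up to a scalar factor. For a
  separating pair of functionals the scalar expression is holomorphic in \<open>z\<close> and
  vanishes on the axis, hence on the sector.\<close>

lemma inverse_family_commutes:
  assumes yx: "(y, x) \<in> A" and z: "z \<in> sector \<alpha>"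
  shows "(inverse_family z y, inverse_family z x) \<in> A"
proof (rule ccontr)
  assume "(inverse_family z y, inverse_family z x) \<notin> A"
  then obtain \<phi> \<psi> where \<phi>: "\<phi> \<in> dual" and \<psi>: "\<psi> \<in> dual" and van: "\<And>x y. (x, y) \<in> A \<Longrightarrow> \<phi> x + \<psi> y = 0"
    and ne: "\<phi> (inverse_family z y) + \<psi> (inverse_family z x) \<noteq> 0"
    using closed_graph_separation[OF A_mlo A_closed] by blast
  have op: "open (sector \<alpha>)" using angle by (intro open_sector) simp
  have "\<phi> (inverse_family z y) + \<psi> (inverse_family z x) = 0"
  proof (rule sector_identity[where g = "\<lambda>_. 0", OF _ _ angle(1) _ _ z])
    show "(\<lambda>z. \<phi> (inverse_family z y) + \<psi> (inverse_family z x)) holomorphic_on sector \<alpha>"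
      by (intro holomorphic_intros vector_analytic_dual[OF inverse_family_analytic op] \<phi> \<psi>)
    fix t :: real assume t: "t > 0"
    have "(exp (- (of_real \<omega> * of_real t)) *\<^sub>C T t y, exp (- (of_real \<omega> * of_real t)) *\<^sub>C T t x) \<in> A"
      by (rule mlo_scale[OF A_mlo T_commutes[OF yx]]) (use t in simp)
    then have "(inverse_family (of_real t) y, inverse_family (of_real t) x) \<in> A"
      using t by (simp add: T_def scaleC_scaleC exp_minus_inverse mult.commute[of "exp (- _)"])
    then show "\<phi> (inverse_family (of_real t) y) + \<psi> (inverse_family (of_real t) x) = 0" by (rule van)
  qed (use angle in auto)
  then show False using ne by simp
qed

lemma resolvent_family: "resolvent_family_with_subgenerator a k C (A\<inverse>) R"
  unfolding resolvent_family_with_subgenerator_def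
proof (intro conjI allI impI ballI)
  show "mlo (A\<inverse>)" by (rule mlo_converse[OF A_mlo])
  show "C \<in> continuous_operators" by (rule C_op)
  show "commutes_with_mlo C (A\<inverse>)" using CA by (auto simp: commutes_with_mlo_iff)
  show "continuous_on {0..} (\<lambda>t. R t x)" for x by (rule R_continuous)
  fix t :: real assume t: "0 \<le> t"
  show "R t \<in> continuous_operators" by (rule R_operator[OF t])
  show "R t \<circ> C = C \<circ> R t"
    by (auto simp: R_def fun_eq_iff T_C[OF t] operator_diff[OF C_op] operator_scale[OF C_op])
  have "(R t y, R t x) \<in> A" if yx: "(y, x) \<in> A" for x y
  proof -
    have "(C y, C x) \<in> A" using CA yx by (auto simp: commutes_with_mlo_iff)
    then show ?thesis unfolding R_def by (intro mlo_diff[OF A_mlo] mlo_scale[OF A_mlo] T_commutes[OF yx t])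
  qed
  then show "commutes_with_mlo (R t) (A\<inverse>)" by (auto simp: commutes_with_mlo_iff)
  fix w assume "w \<in> A\<inverse>"
  then show "case w of (x, y) \<Rightarrow> has_strong_integral (lebesgue_on {0..t}) (\<lambda>s. a (t - s) *\<^sub>C R s y) (R t x - k t *\<^sub>C C x)"
    using R_integral_equation[OF _ t] by (auto simp: R_def)
qed

end

section \<open>Extension of the resolvent family to the sector\<close>

context resolvent_inversion
begin

lemma analytic_resolvent_family:
  fixes kk :: "complex \<Rightarrow> complex"
  assumes \<omega>: "\<omega> \<ge> 0" and hol: "kk holomorphic_on sector \<alpha>"
    and cont: "\<And>\<gamma>. 0 < \<gamma> \<Longrightarrow> \<gamma> < \<alpha> \<Longrightarrow> continuous_on (closure (sector \<gamma>)) kk"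
    and bd: "\<And>\<gamma>. 0 < \<gamma> \<Longrightarrow> \<gamma> < \<alpha> \<Longrightarrow> \<exists>M. \<forall>z\<in>sector \<gamma>. cmod (exp (- (of_real \<omega> * z)) * kk z) \<le> M"
    and kk: "\<And>t. t \<ge> 0 \<Longrightarrow> kk (of_real t) = k t"
  defines "RR \<equiv> \<lambda>z x. kk z *\<^sub>C C x - exp (of_real \<omega> * z) *\<^sub>C inverse_family z x"
  shows "exponentially_equicontinuous_analytic_family \<alpha> R RR"
    and "z \<in> sector \<alpha> \<Longrightarrow> commutes_with_mlo (RR z) (A\<inverse>)"
    and "0 < \<gamma> \<Longrightarrow> \<gamma> < \<alpha> \<Longrightarrow> equicontinuous ((\<lambda>z x. exp (- (of_real \<omega> * z)) *\<^sub>C RR z x) ` sector \<gamma>)"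
proof -
  have op: "open (sector \<alpha>)" using angle by (intro open_sector) simp
  have sub: "sector \<gamma> \<subseteq> sector \<alpha>" if "\<gamma> < \<alpha>" for \<gamma> using that by (intro sector_mono) simp
  have RR_op: "RR z \<in> continuous_operators" if "z \<in> sector \<alpha>" for z
    unfolding RR_def by (intro operator_difference operator_scaled C_op inverse_family_operator that)
  have bound: "\<exists>q. cseminorm q \<and> (\<forall>z\<in>sector \<gamma>. \<forall>x. p (exp (- (of_real \<omega> * z)) *\<^sub>C RR z x) \<le> q x)"
    if \<gamma>: "0 < \<gamma>" "\<gamma> < \<alpha>" and p: "cseminorm p" for \<gamma> p
  proof -
    note sp = cseminorm_seminorm[OF p]
    obtain M where M: "\<And>z. z \<in> sector \<gamma> \<Longrightarrow> cmod (exp (- (of_real \<omega> * z)) * kk z) \<le> M" using bd[OF \<gamma>] by blast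
    obtain q where q: "cseminorm q" "\<And>z x. z \<in> sector \<gamma> \<Longrightarrow> p (inverse_family z x) \<le> q x"
      using inverse_family_bound[OF \<gamma> p] by blast
    have "p (exp (- (of_real \<omega> * z)) *\<^sub>C RR z x) \<le> \<bar>M\<bar> * p (C x) + q x" if z: "z \<in> sector \<gamma>" for z x
    proof -
      have "exp (- (of_real \<omega> * z)) *\<^sub>C RR z x = (exp (- (of_real \<omega> * z)) * kk z) *\<^sub>C C x - inverse_family z x"
        by (simp add: RR_def scaleC_diff_right scaleC_scaleC exp_minus_inverse mult.commute[of "exp (- _)" "exp _"])
      then have "p (exp (- (of_real \<omega> * z)) *\<^sub>C RR z x) \<le> cmod (exp (- (of_real \<omega> * z)) * kk z) * p (C x) + p (inverse_family z x)"
        using seminorm_diff[OF sp] by (simp only: seminorm_scale[OF sp, symmetric])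
      also have "\<dots> \<le> \<bar>M\<bar> * p (C x) + q x"
        using M[OF z] q(2)[OF z] seminorm_nonneg[OF sp] by (intro add_mono mult_right_mono) auto
      finally show ?thesis .
    qed
    moreover have "cseminorm (\<lambda>x. \<bar>M\<bar> * p (C x) + q x)"
      by (rule cseminorm_add[OF cseminorm_scaled[OF operator_seminorm[OF C_op p] abs_ge_zero] q(1)])
    ultimately show ?thesis by blast
  qed
  show equi: "equicontinuous ((\<lambda>z x. exp (- (of_real \<omega> * z)) *\<^sub>C RR z x) ` sector \<gamma>)" if \<gamma>: "0 < \<gamma>" "\<gamma> < \<alpha>" for \<gamma>
    by (subst equicontinuous_iff)
      (use bound[OF \<gamma>] operator_scale[OF RR_op] sub[OF \<gamma>(2)] in \<open>auto simp: scaleC_scaleC mult.commute\<close>)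
  \<comment> \<open>The factors with \<open>z\<close> and with \<open>Re z\<close> have the same
    modulus for real \<open>\<omega>\<close>, so seminorms do not distinguish them.\<close>
  have equi_Re: "equicontinuous ((\<lambda>z x. exp (- (of_real \<omega> * of_real (Re z))) *\<^sub>C RR z x) ` sector \<gamma>)"
    if \<gamma>: "0 < \<gamma>" "\<gamma> < \<alpha>" for \<gamma>
  proof (subst equicontinuous_iff)
    have eq: "p (exp (- (of_real \<omega> * of_real (Re z))) *\<^sub>C RR z x) = p (exp (- (of_real \<omega> * z)) *\<^sub>C RR z x)"
      if "cseminorm p" for p z x
      by (simp add: seminorm_scale[OF cseminorm_seminorm[OF that]])
    show "\<forall>p. cseminorm p \<longrightarrow> (\<exists>q. cseminorm q \<and>
        (\<forall>T\<in>(\<lambda>z x. exp (- (of_real \<omega> * of_real (Re z))) *\<^sub>C RR z x) ` sector \<gamma>. \<forall>x. p (T x) \<le> q x))"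
      using bound[OF \<gamma>] by (simp add: eq)
  qed (use operator_scale[OF RR_op] sub[OF \<gamma>(2)] in \<open>auto simp: scaleC_scaleC mult.commute\<close>)
  have "vector_analytic_on (\<lambda>z. RR z x) (sector \<alpha>)" for x
  proof (rule weakly_analytic_imp_analytic[OF op])
    fix \<phi> :: "'a \<Rightarrow> complex" assume \<phi>: "\<phi> \<in> dual"
    have "(\<lambda>z. kk z * \<phi> (C x) - exp (of_real \<omega> * z) * \<phi> (inverse_family z x)) holomorphic_on sector \<alpha>"
      by (intro holomorphic_intros hol vector_analytic_dual[OF inverse_family_analytic op \<phi>])
    then show "(\<lambda>z. \<phi> (RR z x)) holomorphic_on sector \<alpha>"
      by (simp add: RR_def functional_diff[OF dual_functional[OF \<phi>]] functional_scale[OF dual_functional[OF \<phi>]])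
  next
    fix z and p :: "'a \<Rightarrow> real" assume z: "z \<in> sector \<alpha>" and p: "cseminorm p"
    note sp = cseminorm_seminorm[OF p]
    obtain \<gamma> where \<gamma>: "0 < \<gamma>" "\<gamma> < \<alpha>" "z \<in> sector \<gamma>" using in_smaller_sector[OF z] .
    obtain q where q: "\<And>z x. z \<in> sector \<gamma> \<Longrightarrow> p (exp (- (of_real \<omega> * z)) *\<^sub>C RR z x) \<le> q x"
      using bound[OF \<gamma>(1,2) p] by blast
    have "open (sector \<gamma>)" using \<gamma> angle by (intro open_sector) simp
    then obtain r where r: "r > 0" "ball z r \<subseteq> sector \<gamma>" using \<gamma>(3) open_contains_ball by blast
    \<comment> \<open>Equicontinuity was shown for the damped family; on a ball the damping is
      undone at the cost of a constant, where \<open>\<omega> \<ge> 0\<close> makes the exponential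
      monotone in the real part.\<close>
    have "p (RR w x) \<le> exp (\<omega> * (Re z + r)) * q x" if w: "w \<in> ball z r" for w
    proof -
      have "\<bar>Re (w - z)\<bar> < r" using w abs_Re_le_cmod[of "w - z"] by (simp add: dist_norm norm_minus_commute)
      then have "Re w \<le> Re z + r" by simp
      then have le: "exp (\<omega> * Re w) \<le> exp (\<omega> * (Re z + r))" using \<omega> by (simp add: mult_left_mono)
      have "RR w x = exp (of_real \<omega> * w) *\<^sub>C exp (- (of_real \<omega> * w)) *\<^sub>C RR w x"
        by (simp add: scaleC_scaleC exp_minus_inverse)
      then have "p (RR w x) = exp (\<omega> * Re w) * p (exp (- (of_real \<omega> * w)) *\<^sub>C RR w x)"
        by (metis Re_complex_of_real norm_exp_eq_Re seminorm_scale[OF sp] times_complex.sel(1) Im_complex_of_real mult_zero_left diff_zero)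
      also have "\<dots> \<le> exp (\<omega> * (Re z + r)) * q x"
        by (rule mult_mono[OF le q]) (use w r seminorm_nonneg[OF sp] in auto)
      finally show ?thesis .
    qed
    then show "\<exists>r>0. \<exists>B. \<forall>w\<in>ball z r. p (RR w x) \<le> B" using r(1) by blast
  qed
  moreover have "((\<lambda>z. RR z x) \<longlongrightarrow> R 0 x) (at 0 within sector \<gamma>)" if \<gamma>: "0 < \<gamma>" "\<gamma> < \<alpha>" for \<gamma> x
  proof -
    have "(kk \<longlongrightarrow> kk 0) (at 0 within closure (sector \<gamma>))"
      using cont[OF \<gamma>] zero_in_closure_sector[OF \<gamma>(1)] by (auto simp: continuous_on_def)
    then have "(kk \<longlongrightarrow> kk 0) (at 0 within sector \<gamma>)" by (rule tendsto_within_subset) (rule closure_subset)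
    then have 1: "(kk \<longlongrightarrow> k 0) (at 0 within sector \<gamma>)" using kk[of 0] by simp
    have "((\<lambda>z. exp (of_real \<omega> * z)) \<longlongrightarrow> exp (of_real \<omega> * 0)) (at 0 within sector \<gamma>)" by (intro tendsto_intros)
    then have 2: "((\<lambda>z. exp (of_real \<omega> * z)) \<longlongrightarrow> 1) (at 0 within sector \<gamma>)" by simp
    from tendsto_diff_lcs[OF tendsto_scaleC[OF 1 tendsto_const] tendsto_scaleC[OF 2 inverse_family_limit[OF \<gamma>, of x]], of "C x"]
    show ?thesis by (simp add: RR_def R_def T_def)
  qed
  moreover have "RR (of_real t) = R t" if "t > 0" for t
    using that by (auto simp: fun_eq_iff RR_def R_def T_def kk)
  ultimately have "analytic_family \<alpha> R RR" unfolding analytic_family_def using RR_op by auto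
  then show "exponentially_equicontinuous_analytic_family \<alpha> R RR"
    unfolding exponentially_equicontinuous_analytic_family_def using \<omega> equi_Re by auto
  assume z: "z \<in> sector \<alpha>"
  have "(RR z y, RR z x) \<in> A" if yx: "(y, x) \<in> A" for x y
  proof -
    have "(C y, C x) \<in> A" using CA yx by (auto simp: commutes_with_mlo_iff)
    then show ?thesis
      unfolding RR_def by (intro mlo_diff[OF A_mlo] mlo_scale[OF A_mlo] inverse_family_commutes[OF yx z])
  qed
  then show "commutes_with_mlo (RR z) (A\<inverse>)" by (auto simp: commutes_with_mlo_iff)
qed

end

section \<open>Passage between the shifted sector and the sector at 0, and assembly\<close>

lemma mem_shifted_sector: "\<mu> \<in> shifted_sector \<omega> \<theta> \<longleftrightarrow> \<mu> - of_real \<omega> \<in> sector \<theta>"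
proof -
  have "\<mu> = of_real \<omega> + (\<mu> - of_real \<omega>)" by simp
  then show ?thesis unfolding shifted_sector_def by (metis (no_types, lifting) add_diff_cancel_left' image_iff)
qed

lemma subsectorial_holomorphic:
  assumes Q: "subsectorial Q \<alpha>" and \<alpha>: "0 < \<alpha>" "\<alpha> \<le> pi / 2"
  shows "Q holomorphic_on sector (pi / 2 + \<alpha>)"
proof -
  have op: "open (sector (pi / 2 + \<gamma>))" if "\<gamma> \<le> \<alpha>" for \<gamma> using that \<alpha> by (intro open_sector) simp
  have "Q field_differentiable at z" if z: "z \<in> sector (pi / 2 + \<alpha>)" for z
  proof -
    \<comment> \<open>The midpoint between the excess of the argument over \<open>pi / 2\<close> and
      \<open>\<alpha>\<close>; the maximum keeps \<open>\<gamma>\<close> positive when that excess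
      is negative.\<close>
    define \<gamma> where "\<gamma> = max (\<alpha> / 2) ((\<alpha> + (\<bar>Arg z\<bar> - pi / 2)) / 2)"
    have "\<gamma> < \<alpha>" "0 < \<gamma>" "z \<in> sector (pi / 2 + \<gamma>)" using z \<alpha> by (auto simp: \<gamma>_def sector_def max_def field_simps)
    then show ?thesis
      using Q op[of \<gamma>] unfolding subsectorial_def sectorial_def
      by (meson holomorphic_on_imp_differentiable_at less_imp_le)
  qed
  then show ?thesis using op[of \<alpha>] by (auto simp: holomorphic_on_def field_differentiable_at_within)
qed

lemma vector_analytic_scaled:
  fixes F :: "complex \<Rightarrow> 'a::sequentially_complete_lcs"
  assumes S: "open S" and f: "f holomorphic_on S" and F: "vector_analytic_on F S"
  shows "vector_analytic_on (\<lambda>z. f z *\<^sub>C F z) S"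
proof (rule weakly_analytic_imp_analytic[OF S])
  fix \<phi> :: "'a \<Rightarrow> complex" assume \<phi>: "\<phi> \<in> dual"
  show "(\<lambda>z. \<phi> (f z *\<^sub>C F z)) holomorphic_on S"
    unfolding functional_scale[OF dual_functional[OF \<phi>]]
    by (intro holomorphic_intros f vector_analytic_dual[OF F S \<phi>])
next
  fix z and p :: "'a \<Rightarrow> real" assume z: "z \<in> S" and p: "cseminorm p"
  note sp = cseminorm_seminorm[OF p]
  obtain r where r: "r > 0" "cball z r \<subseteq> S" using S z open_contains_cball by blast
  have "continuous_on (cball z r) (\<lambda>w. cmod (f w) * p (F w))"
    using r(2) holomorphic_on_imp_continuous_on[OF f] cseminorm_continuous_on[OF p vector_analytic_continuous[OF F]]
    by (intro continuous_intros) (auto intro: continuous_on_subset)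
  then have "bounded ((\<lambda>w. cmod (f w) * p (F w)) ` cball z r)"
    by (intro compact_imp_bounded compact_continuous_image compact_cball)
  then obtain B where B: "\<forall>y\<in>(\<lambda>w. cmod (f w) * p (F w)) ` cball z r. norm y \<le> B" unfolding bounded_iff by blast
  have "p (f w *\<^sub>C F w) \<le> B" if "w \<in> ball z r" for w
    using bspec[OF B imageI[of w]] that by (simp add: seminorm_scale[OF sp] abs_le_iff)
  then show "\<exists>r>0. \<exists>B. \<forall>w\<in>ball z r. p (f w *\<^sub>C F w) \<le> B" using r(1) by blast
qed

lemma vector_analytic_translate:
  assumes "vector_analytic_on F (shifted_sector \<omega> \<theta>)"
  shows "vector_analytic_on (\<lambda>\<mu>. F (of_real \<omega> + \<mu>)) (sector \<theta>)"
  unfolding vector_analytic_on_def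
proof
  fix z assume z: "z \<in> sector \<theta>"
  then have "of_real \<omega> + z \<in> shifted_sector \<omega> \<theta>" by (simp add: mem_shifted_sector)
  then obtain d where d: "((\<lambda>w. inverse (w - (of_real \<omega> + z)) *\<^sub>C (F w - F (of_real \<omega> + z))) \<longlongrightarrow> d)
      (at (of_real \<omega> + z) within shifted_sector \<omega> \<theta>)"
    using assms unfolding vector_analytic_on_def by blast
  have "filterlim (\<lambda>w. of_real \<omega> + w) (at (of_real \<omega> + z) within shifted_sector \<omega> \<theta>) (at z within sector \<theta>)"
    unfolding filterlim_at
  proof
    show "\<forall>\<^sub>F w in at z within sector \<theta>. of_real \<omega> + w \<in> shifted_sector \<omega> \<theta> \<and> of_real \<omega> + w \<noteq> of_real \<omega> + z"
      by (auto simp: eventually_at mem_shifted_sector intro!: exI[of _ 1])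
    show "((\<lambda>w. of_real \<omega> + w) \<longlongrightarrow> of_real \<omega> + z) (at z within sector \<theta>)" by (intro tendsto_intros)
  qed
  from filterlim_compose[OF d this]
  show "\<exists>d. ((\<lambda>w. inverse (w - z) *\<^sub>C (F (of_real \<omega> + w) - F (of_real \<omega> + z))) \<longlongrightarrow> d) (at z within sector \<theta>)" by auto
qed

text \<open>An equicontinuous family that tends to 0 on a dense set tends to 0 everywhere: the
  difference from a nearby point of the set is small for all \<open>r\<close> at once.\<close>

lemma dense_range_limit:
  fixes U :: "real \<Rightarrow> 'a::locally_convex \<Rightarrow> 'a"
  assumes dense: "closure D = UNIV" and D: "\<And>x. x \<in> D \<Longrightarrow> ((\<lambda>r. U r x) \<longlongrightarrow> 0) at_top"
    and add: "\<And>r x y. r > \<omega> \<Longrightarrow> U r (x + y) = U r x + U r y"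
    and bound: "\<And>p. cseminorm p \<Longrightarrow> \<exists>q. cseminorm q \<and> (\<forall>r>\<omega>. \<forall>x. p (U r x) \<le> q x)"
  shows "((\<lambda>r. U r x) \<longlongrightarrow> 0) at_top"
proof (rule tendsto_cseminormI)
  fix p :: "'a \<Rightarrow> real" and e :: real assume p: "cseminorm p" and e: "e > 0"
  note sp = cseminorm_seminorm[OF p]
  obtain q where q: "cseminorm q" "\<And>r x. r > \<omega> \<Longrightarrow> p (U r x) \<le> q x" using bound[OF p] by blast
  have "x \<in> closure D" using dense by simp
  moreover have "open {y. q (y - x) < e / 2}" "x \<in> {y. q (y - x) < e / 2}"
    by (rule open_cseminorm_ball[OF q(1)]) (use e seminorm_0[OF cseminorm_seminorm[OF q(1)]] in simp)
  ultimately obtain y where y: "y \<in> D" "q (y - x) < e / 2" unfolding closure_iff_nhds_not_empty by blast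
  have "((\<lambda>r. p (U r y - 0)) \<longlongrightarrow> 0) at_top" by (rule tendsto_cseminorm[OF D[OF y(1)] p])
  from order_tendstoD(2)[OF this, of "e / 2"] e have "\<forall>\<^sub>F r in at_top. p (U r y) < e / 2" by simp
  then show "\<forall>\<^sub>F r in at_top. p (U r x - 0) \<le> e"
    using eventually_gt_at_top[of \<omega>]
  proof eventually_elim
    case (elim r)
    have "p (U r x) \<le> p (U r y) + p (U r (x - y))"
      using seminorm_add[OF sp, of "U r y" "U r (x - y)"] add[OF elim(2), of y "x - y"] by simp
    also have "p (U r (x - y)) \<le> q (x - y)" by (rule q(2)[OF elim(2)])
    also have "q (x - y) = q (y - x)" by (rule seminorm_commute[OF cseminorm_seminorm[OF q(1)]])
    finally show ?case using y(2) elim(1) by simp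
  qed
qed

text \<open>Translates condition (vi) from the shifted sector into the seminorm form of the locale;
  the factor \<open>\<mu> - \<omega>\<close> becomes the \<open>\<mu>\<close> that the bound
  requires.\<close>

lemma sectorial_family_scaled:
  fixes \<Upsilon> :: "complex \<Rightarrow> 'a::{sequentially_complete_lcs, t2_space} \<Rightarrow> 'a"
  assumes \<alpha>: "0 < \<alpha>" "\<alpha> \<le> pi / 2" and K: "subsectorial K \<alpha>"
    and op: "\<And>\<mu>. \<mu> \<in> shifted_sector \<omega> (pi / 2 + \<alpha>) \<Longrightarrow> \<Upsilon> \<mu> \<in> continuous_operators"
    and analytic: "\<And>x. vector_analytic_on (\<lambda>\<mu>. \<Upsilon> \<mu> x) (shifted_sector \<omega> (pi / 2 + \<alpha>))"
    and equi: "\<And>\<gamma>. 0 < \<gamma> \<Longrightarrow> \<gamma> < \<alpha> \<Longrightarrow> equicontinuous ((\<lambda>\<mu> x. ((\<mu> - of_real \<omega>) * K (\<mu> - of_real \<omega>)) *\<^sub>C \<Upsilon> \<mu> x) `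
          shifted_sector \<omega> (pi / 2 + \<gamma>))"
  shows "sectorial_family \<alpha> (\<lambda>\<mu> x. K \<mu> *\<^sub>C \<Upsilon> (of_real \<omega> + \<mu>) x)"
proof
  have \<Upsilon>: "\<Upsilon> (of_real \<omega> + \<mu>) \<in> continuous_operators" if "\<mu> \<in> sector (pi / 2 + \<alpha>)" for \<mu>
    using that by (intro op) (simp add: mem_shifted_sector)
  show "0 < \<alpha>" "\<alpha> \<le> pi / 2" by (fact \<alpha>)+
  show "K \<mu> *\<^sub>C \<Upsilon> (of_real \<omega> + \<mu>) (x + y) = K \<mu> *\<^sub>C \<Upsilon> (of_real \<omega> + \<mu>) x + K \<mu> *\<^sub>C \<Upsilon> (of_real \<omega> + \<mu>) y"
    if "\<mu> \<in> sector (pi / 2 + \<alpha>)" for \<mu> x y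
    by (simp add: operator_add[OF \<Upsilon>[OF that]] scaleC_add_right)
  show "K \<mu> *\<^sub>C \<Upsilon> (of_real \<omega> + \<mu>) (c *\<^sub>C x) = c *\<^sub>C K \<mu> *\<^sub>C \<Upsilon> (of_real \<omega> + \<mu>) x"
    if "\<mu> \<in> sector (pi / 2 + \<alpha>)" for \<mu> c x
    by (simp add: operator_scale[OF \<Upsilon>[OF that]] scaleC_scaleC mult.commute)
  show "vector_analytic_on (\<lambda>\<mu>. K \<mu> *\<^sub>C \<Upsilon> (of_real \<omega> + \<mu>) x) (sector (pi / 2 + \<alpha>))" for x
    by (rule vector_analytic_scaled[OF open_sector subsectorial_holomorphic[OF K \<alpha>] vector_analytic_translate[OF analytic]])
      (use \<alpha> in simp)
  fix \<gamma> and p :: "'a \<Rightarrow> real" assume \<gamma>: "0 < \<gamma>" "\<gamma> < \<alpha>" and p: "cseminorm p"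
  have scale: "T (c *\<^sub>C x) = c *\<^sub>C T x"
    if T: "T \<in> (\<lambda>\<mu> x. ((\<mu> - of_real \<omega>) * K (\<mu> - of_real \<omega>)) *\<^sub>C \<Upsilon> \<mu> x) ` shifted_sector \<omega> (pi / 2 + \<gamma>)" for T c x
  proof -
    obtain \<mu> where \<mu>: "\<mu> \<in> shifted_sector \<omega> (pi / 2 + \<gamma>)" "T = (\<lambda>x. ((\<mu> - of_real \<omega>) * K (\<mu> - of_real \<omega>)) *\<^sub>C \<Upsilon> \<mu> x)"
      using T by blast
    have "\<mu> \<in> shifted_sector \<omega> (pi / 2 + \<alpha>)"
      using \<mu>(1) \<gamma>(2) sector_mono[of "pi / 2 + \<gamma>" "pi / 2 + \<alpha>"] by (auto simp: mem_shifted_sector)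
    then show ?thesis by (simp add: \<mu>(2) operator_scale[OF op] scaleC_scaleC mult_ac)
  qed
  let ?F = "(\<lambda>\<mu> x. ((\<mu> - of_real \<omega>) * K (\<mu> - of_real \<omega>)) *\<^sub>C \<Upsilon> \<mu> x) ` shifted_sector \<omega> (pi / 2 + \<gamma>)"
  have "\<forall>p. cseminorm p \<longrightarrow> (\<exists>q. cseminorm q \<and> (\<forall>T\<in>?F. \<forall>x. p (T x) \<le> q x))"
    by (rule iffD1[OF equicontinuous_iff equi[OF \<gamma>]]) (rule scale)
  then obtain q where q0: "cseminorm q" and F: "\<forall>T\<in>?F. \<forall>x. p (T x) \<le> q x" using p by blast
  have q: "p (((\<mu> - of_real \<omega>) * K (\<mu> - of_real \<omega>)) *\<^sub>C \<Upsilon> \<mu> x) \<le> q x"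
    if "\<mu> \<in> shifted_sector \<omega> (pi / 2 + \<gamma>)" for \<mu> x
    using bspec[OF F imageI[OF that]] by blast
  have "cmod \<mu> * p (K \<mu> *\<^sub>C \<Upsilon> (of_real \<omega> + \<mu>) x) \<le> q x" if "\<mu> \<in> sector (pi / 2 + \<gamma>)" for \<mu> x
    using q[of "of_real \<omega> + \<mu>" x] that
    by (simp add: mem_shifted_sector seminorm_scale[OF cseminorm_seminorm[OF p]] norm_mult mult.assoc)
  then show "\<exists>q. cseminorm q \<and> (\<forall>\<mu>\<in>sector (pi / 2 + \<gamma>). \<forall>x. cmod \<mu> * p (K \<mu> *\<^sub>C \<Upsilon> (of_real \<omega> + \<mu>) x) \<le> q x)"
    using q0 by blast
qed

theorem proposition2p3:
  fixes A :: "('a::{sequentially_complete_lcs, t2_space} \<times> 'a) set"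
    and C D' :: "'a \<Rightarrow> 'a"
    and k a :: "real \<Rightarrow> complex"
    and \<alpha> \<omega> :: real
    and \<Upsilon> :: "complex \<Rightarrow> 'a \<Rightarrow> 'a"
  assumes k_cont: "continuous_on {0..} k" and k_nonzero: "\<exists>t\<ge>0. k t \<noteq> 0"
    and a_loc: "locally_integrable a" and a_nonzero: "\<not> (AE t in lebesgue_on {0..}. a t = 0)"
    and A_mlo: "mlo A" and A_closed: "closed A"
    and C_op: "C \<in> continuous_operators" and CA: "commutes_with_mlo C A"
    and alpha: "0 < \<alpha>" "\<alpha> \<le> pi / 2"
    and abs_k: "laplace_abscissa k < \<infinity>"
    and abs_a: "laplace_abscissa (\<lambda>t. of_real (cmod (a t))) < \<infinity>"
    and omega: "ereal \<omega> \<ge>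
      max 0 (max (laplace_abscissa k) (laplace_abscissa (\<lambda>t. of_real (cmod (a t)))))"
    and range_C: "\<And>\<mu>. Re \<mu> > \<omega> \<Longrightarrow> laplace a \<mu> \<noteq> 0 \<Longrightarrow>
      range C \<subseteq> Range (scalar_minus (laplace a \<mu>) A)"
    and Upsilon_op: "\<And>\<mu>. \<mu> \<in> shifted_sector \<omega> (pi / 2 + \<alpha>) \<Longrightarrow> \<Upsilon> \<mu> \<in> continuous_operators"
    and D_op: "D' \<in> continuous_operators"
    and Upsilon_analytic:
      "\<And>x. vector_analytic_on (\<lambda>\<mu>. \<Upsilon> \<mu> x) (shifted_sector \<omega> (pi / 2 + \<alpha>))"
    and i: "\<exists>kk :: complex \<Rightarrow> complex. kk analytic_on sector \<alpha> \<and>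
      (\<forall>\<gamma>\<in>{0<..<\<alpha>}. continuous_on (closure (sector \<gamma>)) kk) \<and>
      (\<forall>\<gamma>\<in>{0<..<\<alpha>}. bdd_above ((\<lambda>z. cmod (exp (- (of_real \<omega> * z)) * kk z)) ` sector \<gamma>)) \<and>
      (\<forall>t\<ge>0. kk (of_real t) = k t)"
    and ii: "\<And>\<mu> x. Re \<mu> > \<omega> \<Longrightarrow> laplace a \<mu> \<noteq> 0 \<Longrightarrow>
      \<Upsilon> \<mu> x \<in> (*\<^sub>C) (laplace a \<mu>) ` ((scalar_minus (laplace a \<mu>) A)\<inverse> `` {C x})"
    and iii: "\<And>\<mu> x. Re \<mu> > \<omega> \<Longrightarrow> \<Upsilon> \<mu> (C x) = C (\<Upsilon> \<mu> x)"
    and iv: "\<And>\<mu> x y. Re \<mu> > \<omega> \<Longrightarrow> (x, y) \<in> A \<Longrightarrow>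
      laplace a \<mu> *\<^sub>C \<Upsilon> \<mu> x - \<Upsilon> \<mu> y = laplace a \<mu> *\<^sub>C C x"
    and v: "\<And>x. closure (Range A) \<noteq> UNIV \<Longrightarrow>
      ((\<lambda>r::real. \<Upsilon> (of_real r) x) \<longlongrightarrow> D' x) at_top"
  shows "\<exists>khat :: complex \<Rightarrow> complex.
    khat analytic_on shifted_sector \<omega> (pi / 2 + \<alpha>) \<and>
    (\<forall>\<mu>. Re \<mu> > \<omega> \<longrightarrow> khat \<mu> = laplace k \<mu>) \<and>
    (\<forall>\<gamma>\<in>{0<..<\<alpha>}.
      bdd_above ((\<lambda>\<mu>. cmod ((\<mu> - of_real \<omega>) * khat \<mu>)) ` shifted_sector \<omega> (pi / 2 + \<gamma>))) \<and>
    ((\<lambda>r::real. of_real r * khat (of_real r)) \<longlongrightarrow> k 0) at_top \<and>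
    ((\<forall>\<gamma>\<in>{0<..<\<alpha>}.
        equicontinuous ((\<lambda>\<mu> x. ((\<mu> - of_real \<omega>) * khat \<mu>) *\<^sub>C \<Upsilon> \<mu> x) `
          shifted_sector \<omega> (pi / 2 + \<gamma>))) \<longrightarrow>
      (\<exists>R RR. resolvent_family_with_subgenerator a k C (A\<inverse>) R \<and>
        exponentially_equicontinuous_analytic_family \<alpha> R RR \<and>
        (\<forall>z\<in>sector \<alpha>. commutes_with_mlo (RR z) (A\<inverse>)) \<and>
        (\<forall>\<gamma>\<in>{0<..<\<alpha>}.
          equicontinuous ((\<lambda>z x. exp (- (of_real \<omega> * z)) *\<^sub>C RR z x) ` sector \<gamma>)) \<and>
        (\<forall>t\<ge>0. \<forall>x. \<exists>v.
          has_strong_integral (lebesgue_on {0..t}) (\<lambda>s. a (t - s) *\<^sub>C R s x) v \<and>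
          (v, R t x - k t *\<^sub>C C x) \<in> A\<inverse>)))"
proof -
  have "ereal 0 \<le> ereal \<omega>" and a_le: "laplace_abscissa (\<lambda>t. of_real (cmod (a t))) \<le> ereal \<omega>"
    using omega by (simp_all add: zero_ereal_def)
  then have \<omega>: "\<omega> \<ge> 0" by simp
  obtain kk :: "complex \<Rightarrow> complex" where kk: "kk analytic_on sector \<alpha>"
    "\<And>\<gamma>. 0 < \<gamma> \<Longrightarrow> \<gamma> < \<alpha> \<Longrightarrow> continuous_on (closure (sector \<gamma>)) kk"
    "\<And>\<gamma>. 0 < \<gamma> \<Longrightarrow> \<gamma> < \<alpha> \<Longrightarrow> bdd_above ((\<lambda>z. cmod (exp (- (of_real \<omega> * z)) * kk z)) ` sector \<gamma>)"
    "\<And>t. t \<ge> 0 \<Longrightarrow> kk (of_real t) = k t"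
    using i by (auto simp: Ball_def)
  have kk_hol: "kk holomorphic_on sector \<alpha>" by (rule analytic_imp_holomorphic[OF kk(1)])
  have kk_bd: "\<exists>M. \<forall>z\<in>sector \<gamma>. cmod (exp (- (of_real \<omega> * z)) * kk z) \<le> M" if "0 < \<gamma>" "\<gamma> < \<alpha>" for \<gamma>
    using kk(3)[OF that] unfolding bdd_above_def by blast
  obtain b N where b: "b \<in> borel_measurable borel" "\<And>t. t \<le> 0 \<Longrightarrow> b t = 0" "negligible N"
    "\<And>t. t > 0 \<Longrightarrow> t \<notin> N \<Longrightarrow> b t = a t" "\<And>\<sigma>. \<sigma> > \<omega> \<Longrightarrow> laplace_integrable b \<sigma>"
    "\<And>\<mu>. Re \<mu> > \<omega> \<Longrightarrow> laplace a \<mu> = laplace_integral b \<mu>"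
    "\<And>\<sigma>. \<sigma> > \<omega> \<Longrightarrow> \<exists>r>\<sigma>. laplace_integral b (of_real r) \<noteq> 0"
    using locally_integrable_kernel[OF a_loc a_le a_nonzero] by blast
  define g where "g = (\<lambda>z. exp (- (of_real \<omega> * z)) * kk z)"
  obtain K where K: "subsectorial K \<alpha>" "\<And>\<mu>. Re \<mu> > 0 \<Longrightarrow> K \<mu> = laplace_integral (\<lambda>t. g (of_real t)) \<mu>"
    "((\<lambda>r. of_real r * K (of_real r)) \<longlongrightarrow> g 0) at_top"
  proof (rule laplace_extension[OF alpha, of g])
    show "g holomorphic_on sector \<alpha>" unfolding g_def by (intro holomorphic_intros kk_hol)
    show "continuous_on (closure (sector \<gamma>)) g" if "0 < \<gamma>" "\<gamma> < \<alpha>" for \<gamma>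
      unfolding g_def by (intro continuous_intros kk(2) that)
    show "\<exists>M. \<forall>z\<in>sector \<gamma>. cmod (g z) \<le> M" if "0 < \<gamma>" "\<gamma> < \<alpha>" for \<gamma> unfolding g_def by (rule kk_bd[OF that])
  qed blast
  have g0: "g 0 = k 0" using kk(4)[of 0] by (simp add: g_def)
  have k_int: "laplace_integrable k \<sigma>" if "\<sigma> > \<omega>" for \<sigma>
  proof -
    \<comment> \<open>Any smaller sector contains the positive axis, so its bound controls the
      growth of \<open>k\<close> itself.\<close>
    obtain M where M: "\<And>z. z \<in> sector (\<alpha> / 2) \<Longrightarrow> cmod (exp (- (of_real \<omega> * z)) * kk z) \<le> M" using kk_bd[of "\<alpha> / 2"] alpha by auto
    show ?thesis
    proof (rule laplace_integrable_bounded[OF _ _ that])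
      show "k \<in> borel_measurable half_line"
        by (rule continuous_half_line_measurable[OF continuous_on_subset[OF k_cont]]) auto
      fix t :: real assume t: "t > 0"
      have "exp (- (\<omega> * t)) * cmod (k t) \<le> M"
        using M[OF of_real_in_sector[OF t]] alpha t by (simp add: norm_mult kk(4))
      from mult_right_mono[OF this, of "exp (\<omega> * t)"]
      show "cmod (k t) \<le> M * exp (\<omega> * t)" by (simp add: exp_minus field_simps)
    qed
  qed
  have k_laplace: "laplace_integral k \<mu> = K (\<mu> - of_real \<omega>)" if "Re \<mu> > \<omega>" for \<mu>
  proof -
    have "laplace_integral k \<mu> = laplace_integral (\<lambda>t. exp (of_real \<omega> * of_real t) * g (of_real t)) \<mu>"
      by (rule laplace_integral_cong) (simp add: g_def kk(4) mult.assoc[symmetric] exp_minus_inverse)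
    also have "\<dots> = K (\<mu> - of_real \<omega>)" using K(2)[of "\<mu> - of_real \<omega>"] that by (simp add: laplace_integral_shift)
    finally show ?thesis .
  qed
  have K_limit: "((\<lambda>r. (of_real r - of_real \<omega>) * K (of_real r - of_real \<omega>)) \<longlongrightarrow> k 0) at_top"
  proof -
    have "filterlim (\<lambda>r. r - \<omega>) at_top at_top" by real_asymp
    from filterlim_compose[OF K(3) this] show ?thesis by (simp add: g0)
  qed
  define khat where "khat = (\<lambda>\<mu>. K (\<mu> - of_real \<omega>))"
  have khat_ana: "khat analytic_on shifted_sector \<omega> (pi / 2 + \<alpha>)"
  proof -
    have "K analytic_on sector (pi / 2 + \<alpha>)"
      using subsectorial_holomorphic[OF K(1) alpha] open_sector[of "pi / 2 + \<alpha>"] alpha by (simp add: analytic_on_open)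
    moreover have "(\<lambda>\<mu>. \<mu> - of_real \<omega>) ` shifted_sector \<omega> (pi / 2 + \<alpha>) \<subseteq> sector (pi / 2 + \<alpha>)"
      by (auto simp: mem_shifted_sector)
    ultimately have "(K \<circ> (\<lambda>\<mu>. \<mu> - of_real \<omega>)) analytic_on shifted_sector \<omega> (pi / 2 + \<alpha>)"
      by (intro analytic_on_compose analytic_intros) (rule analytic_on_subset)
    then show ?thesis by (simp add: khat_def o_def)
  qed
  have khat_ext: "khat \<mu> = laplace k \<mu>" if "Re \<mu> > \<omega>" for \<mu>
    using laplace_eq_laplace_integral[OF k_int[OF that], of "{}" k \<mu>] k_laplace[OF that] by (simp add: khat_def)
  have khat_bdd: "bdd_above ((\<lambda>\<mu>. cmod ((\<mu> - of_real \<omega>) * khat \<mu>)) ` shifted_sector \<omega> (pi / 2 + \<gamma>))"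
    if \<gamma>: "\<gamma> \<in> {0<..<\<alpha>}" for \<gamma>
  proof -
    obtain M where "\<And>\<mu>. \<mu> \<in> sector (pi / 2 + \<gamma>) \<Longrightarrow> cmod (\<mu> * K \<mu>) \<le> M"
      using K(1) \<gamma> unfolding subsectorial_def sectorial_def by (meson greaterThanLessThan_iff)
    then show ?thesis by (intro bdd_aboveI2[of _ _ M]) (simp add: khat_def mem_shifted_sector)
  qed
  have khat_lim: "((\<lambda>r::real. of_real r * khat (of_real r)) \<longlongrightarrow> k 0) at_top"
  proof -
    \<comment> \<open>The known limit carries the factor \<open>r - \<omega>\<close>; the quotient
      exchanges it for \<open>r\<close>.\<close>
    have "((\<lambda>r. r / (r - \<omega>)) \<longlongrightarrow> 1) at_top" by real_asymp
    from tendsto_mult[OF tendsto_of_real[OF this, where ?'a = complex] K_limit]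
    have "((\<lambda>r. of_real (r / (r - \<omega>)) * ((of_real r - of_real \<omega>) * K (of_real r - of_real \<omega>))) \<longlongrightarrow> k 0) at_top" by simp
    then show ?thesis
    proof (rule Lim_transform_eventually)
      show "\<forall>\<^sub>F r in at_top. of_real (r / (r - \<omega>)) * ((of_real r - of_real \<omega>) * K (of_real r - of_real \<omega>)) = of_real r * khat (of_real r)"
        using eventually_gt_at_top[of \<omega>]
      proof eventually_elim
        case (elim r)
        then have "complex_of_real r - of_real \<omega> \<noteq> 0" by (simp flip: of_real_diff)
        then show ?case by (simp add: khat_def)
      qed
    qed
  qed
  have khat_fam: "\<exists>R RR. resolvent_family_with_subgenerator a k C (A\<inverse>) R \<and>
        exponentially_equicontinuous_analytic_family \<alpha> R RR \<and>
        (\<forall>z\<in>sector \<alpha>. commutes_with_mlo (RR z) (A\<inverse>)) \<and>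
        (\<forall>\<gamma>\<in>{0<..<\<alpha>}.
          equicontinuous ((\<lambda>z x. exp (- (of_real \<omega> * z)) *\<^sub>C RR z x) ` sector \<gamma>)) \<and>
        (\<forall>t\<ge>0. \<forall>x. \<exists>v.
          has_strong_integral (lebesgue_on {0..t}) (\<lambda>s. a (t - s) *\<^sub>C R s x) v \<and>
          (v, R t x - k t *\<^sub>C C x) \<in> A\<inverse>)"
    if vi: "\<forall>\<gamma>\<in>{0<..<\<alpha>}. equicontinuous ((\<lambda>\<mu> x. ((\<mu> - of_real \<omega>) * khat \<mu>) *\<^sub>C \<Upsilon> \<mu> x) ` shifted_sector \<omega> (pi / 2 + \<gamma>))"
  proof -
    have fam: "sectorial_family \<alpha> (\<lambda>\<mu> x. K \<mu> *\<^sub>C \<Upsilon> (of_real \<omega> + \<mu>) x)"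
      by (rule sectorial_family_scaled[OF alpha K(1) Upsilon_op Upsilon_analytic]) (use vi in \<open>auto simp: khat_def\<close>)
    have real_sector: "of_real r \<in> shifted_sector \<omega> (pi / 2 + \<alpha>)" if "r > \<omega>" for r
      unfolding mem_shifted_sector of_real_diff[symmetric] using that alpha by (intro of_real_in_sector) auto
    have left: "laplace_integral b (of_real r) *\<^sub>C \<Upsilon> (of_real r) x - \<Upsilon> (of_real r) y = laplace_integral b (of_real r) *\<^sub>C C x"
      if "r > \<omega>" "(x, y) \<in> A" for r x y
      using iv[of "of_real r" x y] b(6)[of "of_real r"] that by simp
    \<comment> \<open>If the range is not dense, hypothesis (v) and the limit of the weight give
      \<open>k 0\<close> times \<open>D'\<close>. In the dense case no limit of
      \<open>\<Upsilon>\<close> is assumed, and the weighted limit turns out to be 0.\<close>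
    define S0 where "S0 = (if closure (Range A) = UNIV then (\<lambda>x. 0) else (\<lambda>x. k 0 *\<^sub>C D' x))"
    have zero_op: "(\<lambda>x::'a. 0) \<in> continuous_operators"
      using operator_scaled[OF C_op, of 0] by simp
    have S0_op: "S0 \<in> continuous_operators" unfolding S0_def using operator_scaled[OF D_op] zero_op by simp
    define U where "U = (\<lambda>r x. ((of_real r - of_real \<omega>) * K (of_real r - of_real \<omega>)) *\<^sub>C \<Upsilon> (of_real r) x)"
    have U_bound: "\<exists>q. cseminorm q \<and> (\<forall>r>\<omega>. \<forall>x. p (U r x) \<le> q x)" if p: "cseminorm p" for p
    proof -
      obtain q where q: "cseminorm q" "\<And>\<mu> x. \<mu> \<in> sector (pi / 2 + \<alpha> / 2) \<Longrightarrow> cmod \<mu> * p (K \<mu> *\<^sub>C \<Upsilon> (of_real \<omega> + \<mu>) x) \<le> q x"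
        using sectorial_family.symbol_bound[OF fam _ _ p, of "\<alpha> / 2"] alpha by auto
      have "p (U r x) \<le> q x" if r: "r > \<omega>" for r x
      proof -
        have "complex_of_real r - of_real \<omega> \<in> sector (pi / 2 + \<alpha> / 2)"
          unfolding of_real_diff[symmetric] using r alpha by (intro of_real_in_sector) auto
        from q(2)[OF this, of x] show ?thesis
          by (simp add: U_def seminorm_scale[OF cseminorm_seminorm[OF p]] norm_mult mult.assoc)
      qed
      then show ?thesis using q(1) by blast
    qed
    have U_limit: "((\<lambda>r. U r x) \<longlongrightarrow> S0 x) at_top" for x
    proof (cases "closure (Range A) = UNIV")
      case False
      then show ?thesis unfolding U_def S0_def using tendsto_scaleC[OF K_limit v] by simp
    next
      case True
      have range: "((\<lambda>r. U r x) \<longlongrightarrow> 0) at_top" if x: "x \<in> Range A" for x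
      proof -
        obtain y where yx: "(y, x) \<in> A" using x by blast
        show ?thesis
        proof (rule tendsto_cseminormI)
          fix p :: "'a \<Rightarrow> real" and e :: real assume p: "cseminorm p" and e: "e > 0"
          note sp = cseminorm_seminorm[OF p]
          obtain q where q: "\<And>r x. r > \<omega> \<Longrightarrow> p (U r x) \<le> q x" using U_bound[OF p] by blast
          let ?\<kappa> = "\<lambda>r. (of_real r - of_real \<omega>) * K (of_real r - of_real \<omega>)"
          have lim_b: "((\<lambda>r. laplace_integral b (of_real r)) \<longlongrightarrow> 0) at_top"
            by (rule laplace_integral_at_top[OF b(5)[of "\<omega> + 1"]]) simp
          have "((\<lambda>r. cmod (laplace_integral b (of_real r)) * (q y + cmod (?\<kappa> r) * p (C y))) \<longlongrightarrow> cmod 0 * (q y + cmod (k 0) * p (C y))) at_top"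
            by (intro tendsto_intros lim_b K_limit)
          then have "\<forall>\<^sub>F r in at_top. cmod (laplace_integral b (of_real r)) * (q y + cmod (?\<kappa> r) * p (C y)) < e"
            using order_tendstoD(2)[of _ 0 at_top e] e by simp
          then show "\<forall>\<^sub>F r in at_top. p (U r x - 0) \<le> e"
            using eventually_gt_at_top[of \<omega>]
          proof eventually_elim
            case (elim r)
            \<comment> \<open>On the range hypothesis (iv) extracts a factor that tends to 0; the
              remaining bracket in \<open>y\<close> stays bounded after weighting, by equicontinuity
              and the limit of the weight.\<close>
            have "\<Upsilon> (of_real r) x = laplace_integral b (of_real r) *\<^sub>C (\<Upsilon> (of_real r) y - C y)"
              using left[OF elim(2) yx] by (simp add: scaleC_diff_right algebra_simps)
            then have "U r x = laplace_integral b (of_real r) *\<^sub>C (U r y - ?\<kappa> r *\<^sub>C C y)"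
              by (simp add: U_def scaleC_diff_right scaleC_scaleC mult_ac)
            then have "p (U r x) = cmod (laplace_integral b (of_real r)) * p (U r y - ?\<kappa> r *\<^sub>C C y)"
              by (simp add: seminorm_scale[OF sp])
            also have "\<dots> \<le> cmod (laplace_integral b (of_real r)) * (q y + cmod (?\<kappa> r) * p (C y))"
              using seminorm_diff[OF sp, of "U r y" "?\<kappa> r *\<^sub>C C y"] q[OF elim(2), of y]
              by (intro mult_left_mono) (auto simp: seminorm_scale[OF sp])
            finally show ?case using elim(1) by simp
          qed
        qed
      qed
      have add: "U r (x + y) = U r x + U r y" if r: "r > \<omega>" for r x y
        by (simp add: U_def operator_add[OF Upsilon_op[OF real_sector[OF r]]] scaleC_add_right)
      have "((\<lambda>r. U r x) \<longlongrightarrow> 0) at_top" by (rule dense_range_limit[OF True]) (fact range add U_bound)+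
      then show ?thesis using True by (simp add: S0_def)
    qed
    interpret resolvent_inversion \<alpha> \<omega> K \<Upsilon> A C S0 a b k N
    proof (intro resolvent_inversion.intro fam resolvent_inversion_axioms.intro)
      fix r :: real and x :: 'a assume r: "r > \<omega>" and nz: "laplace_integral b (of_real r) \<noteq> 0"
      have ab: "laplace a (of_real r) = laplace_integral b (of_real r)" by (rule b(6)) (use r in simp)
      \<comment> \<open>Hypothesis (ii) provides \<open>u\<close> with \<open>\<Upsilon> x\<close>
        equal to the kernel transform times \<open>u\<close>. The corresponding \<open>y\<close> in
        \<open>A u\<close> is then \<open>\<Upsilon> x - C x\<close>, and scaling the pair by the
        kernel transform gives the resolvent relation.\<close>
      obtain u where u: "\<Upsilon> (of_real r) x = laplace a (of_real r) *\<^sub>C u" "(u, C x) \<in> scalar_minus (laplace a (of_real r)) A"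
        using ii[of "of_real r" x] r nz ab by auto
      obtain y where y: "C x = laplace a (of_real r) *\<^sub>C u - y" "(u, y) \<in> A" using u(2) unfolding scalar_minus_def by blast
      have "(laplace a (of_real r) *\<^sub>C u, laplace a (of_real r) *\<^sub>C y) \<in> A" by (rule mlo_scale[OF A_mlo y(2)])
      moreover have "y = \<Upsilon> (of_real r) x - C x" by (simp add: u(1) y(1))
      ultimately show "(\<Upsilon> (of_real r) x, laplace_integral b (of_real r) *\<^sub>C (\<Upsilon> (of_real r) x - C x)) \<in> A"
        by (simp add: u(1) ab)
    next
      show "laplace_integral k (of_real r) = K (of_real r - of_real \<omega>)" if "r > \<omega>" for r using k_laplace[of "of_real r"] that by simp
      show "\<Upsilon> (of_real r) (C x) = C (\<Upsilon> (of_real r) x)" if "r > \<omega>" for r x using iii[of "of_real r" x] that by simp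
      show "((\<lambda>r. ((of_real r - of_real \<omega>) * K (of_real r - of_real \<omega>)) *\<^sub>C \<Upsilon> (of_real r) x) \<longlongrightarrow> S0 x) at_top" for x
        using U_limit[of x] by (simp add: U_def)
    qed (fact A_mlo A_closed C_op CA b(1-5) b(7) k_cont k_int K_limit left S0_op)+
    define RR where "RR = (\<lambda>z x. kk z *\<^sub>C C x - exp (of_real \<omega> * z) *\<^sub>C inverse_family z x)"
    note RR = analytic_resolvent_family[where kk = kk]
    show ?thesis
    proof (intro exI[of _ R] exI[of _ RR] conjI ballI allI impI)
      show "resolvent_family_with_subgenerator a k C (A\<inverse>) R" by (rule resolvent_family)
      show "exponentially_equicontinuous_analytic_family \<alpha> R RR"
        unfolding RR_def by (rule RR(1)[OF \<omega> kk_hol]) (fact kk(2) kk_bd kk(4))+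
      show "commutes_with_mlo (RR z) (A\<inverse>)" if "z \<in> sector \<alpha>" for z
        unfolding RR_def by (rule RR(2)[OF \<omega> kk_hol]) (fact kk(2) kk_bd kk(4) that)+
      show "equicontinuous ((\<lambda>z x. exp (- (of_real \<omega> * z)) *\<^sub>C RR z x) ` sector \<gamma>)" if "\<gamma> \<in> {0<..<\<alpha>}" for \<gamma>
        unfolding RR_def
      proof (rule RR(3)[OF \<omega> kk_hol])
        show "0 < \<gamma>" "\<gamma> < \<alpha>" using that by auto
      qed (fact kk(2) kk_bd kk(4))+
      show "\<exists>v. has_strong_integral (lebesgue_on {0..t}) (\<lambda>s. a (t - s) *\<^sub>C R s x) v \<and> (v, R t x - k t *\<^sub>C C x) \<in> A\<inverse>"
        if "t \<ge> 0" for t x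
        using R_integral_in_graph[OF that, of x] by (simp add: R_def)
    qed
  qed
  show ?thesis
    by (intro exI[of _ khat] conjI ballI allI impI)
      (rule khat_ana | (rule khat_ext khat_bdd khat_fam, assumption) | rule khat_lim)+
qed

end
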